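(* Assume the standing setup, the heat-kernel assumptions (H1)–(H2), that $\lambda_1>0$, and that $\int_E\widehat\phi(x)\beta(x)l(x)\,m(dx)<\infty$, where $l(x):=\sum_{k\ge2}k\phi(x)\log^+(k\phi(x))p_k(x)$. Then there exists an event $\Omega_0$ with $\mathbf P_x(\Omega_0)=1$ for every $x\in E$ such that for every $\omega\in\Omega_0$ and every bounded Borel function $f$ on $E$ with compact support whose set of discontinuity points has $m$-measure zero, $$\lim_{t\to\infty}e^{-\lambda_1t}\langle f,X_t\rangle=M_\infty(\phi)\int_E\widehat\phi(x)f(x)\,m(dx),$$ where $M_\infty(\phi)=\lim_{t\to\infty}e^{-\lambda_1t}\langle\phi,X_t\rangle/\phi(x)$ under $\mathbf P_x$.
   Context: Standing setup. Let $E$ be a locally compact separable metric space with one-point compactification $E_\Delta=E\cup\{\Delta\}$, and let $m$ be a $\sigma$-finite Borel measure on $E$ with full support. Every function $f$ on $E$ is extended to $E_\Delta$ by $f(\Delta)=0$. Let $Y=(Y_t,\Pi_x)$ be a Hunt process on $E$ with lifetime $\zeta=\inf\{t>0: Y_t=\Delta\}$ and transition semigroup $P_tf(x)=\Pi_x[f(Y_t)]$. Let $\beta\ge 0$ be a bounded Borel function on $E$ with $m(\{x:\beta(x)>0\})>0$, and for each $x\in E$ let $(p_n(x))_{n\ge 0}$ be a probability distribution on $\{0,1,2,\dots\}$ such that each $x\mapsto p_n(x)$ is Borel; assume $A(x):=\sum_{n\ge 0}np_n(x)$ is bounded. The $(Y,\beta,\psi)$-branching Hunt process $X$ is the particle system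 in which each particle, from its birth position, moves according to an independent copy of $Y$; given its path, a particle alive at time $t$ dies in $[t,t+dt)$ with probability $\beta(Y_t)dt+o(dt)$; when it dies at $x\in E$ it is replaced by $n$ particles at $x$ with probability $p_n(x)$ (possibly $n=0$), which then evolve independently in the same way; a particle reaching $\Delta$ stays there forever, never branches and is no longer counted. With $L_t$ the set of particles alive in $E$ at time $t$ and $Y^u_t$ the position of particle $u$, $X_t=\sum_{u\in L_t}\delta_{Y^u_t}$, $\langle f,\mu\rangle=\int f\,d\mu$, and $\mathbf P_x$ is the law of $X$ started from one particle at $x$. For Borel $f\ge 0$, $P^{(1-A)\beta}_tf(x):=\Pi_x\big[\exp\big(-\int_0^t (1-A(Y_s))\beta(Y_s)\,ds\big)f(Y_t)\big]$. Heat-kernel assumptions. (H1) There is a family of continuous strictly positive functions $p(t,\cdot,\cdot)$, $t>0$, on $E\times E$ with $P_tf(x)=\int_Ep(t,x,y)f(y)m(dy)$, and the dual semigroup is $\widehat P_tf(x)=\int_Ep(t,y,x)f(y)m(dy)$; moreover for each $t>0$ there is $c_t$ with $p(t,x,y)\le c_t$ for all $x,y$. Then $P^{(1-A)\beta}_t$ and its $L^2(E,m)$-dual $\widehat P^{(1-A)\beta}_t$ have a common continuous strictly positive kernel $p^{(1-A)\beta}(t,x,y)$ (resp. $p^{(1-A)\beta}(t,y,x)$); $\lambda_1$ denotes the supremum of the real parts of the spectrum of the $L^2(E,m)$-generator of $(P^{(1-A)\beta}_t)$, which is a simple eigenvalue of both this generator and its dual, and $\phi$, $\widehat\phi$ denote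 the corresponding eigenfunctions, continuous and strictly positive on $E$, normalized by $\int_E\phi^2dm=\int_E\phi\widehat\phi\,dm=1$; thus $\phi=e^{-\lambda_1t}P^{(1-A)\beta}_t\phi$ and $\widehat\phi=e^{-\lambda_1t}\widehat P^{(1-A)\beta}_t\widehat\phi$ for all $t\ge0$. (H2) Intrinsic ultracontractivity: for each $t>0$ there is $c_t$ with $p^{(1-A)\beta}(t,x,y)\le c_t\phi(x)\widehat\phi(y)$ for all $x,y\in E$.
   Formalization: M_∞(φ) is taken to be lim e^{-λ₁t}⟨φ,X_t⟩, without the division by φ(x): with that division the stated limit identity is off by the factor φ(x) and fails (e.g. one-point E with m of mass 4). *)

theory Defs
  imports "HOL-Probability.Probability"
begin

section \<open>State space E and its one-point compactification E_Delta = 'a option (None = Delta)\<close>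

type_synonym 'a path = "real \<Rightarrow> 'a option"
type_synonym 'a pdata = "'a path \<times> ennreal \<times> nat"
type_synonym 'a tree = "nat list \<Rightarrow> 'a pdata"

definition gD :: "('a \<Rightarrow> real) \<Rightarrow> 'a option \<Rightarrow> real" where
  "gD f y = (case y of None \<Rightarrow> 0 | Some x \<Rightarrow> f x)"

text \<open>Convergence in the one-point compactification: neighbourhoods of Delta are
  the complements of compact subsets of E.\<close>
definition convD :: "('b \<Rightarrow> 'a::topological_space option) \<Rightarrow> 'a option \<Rightarrow> 'b filter \<Rightarrow> bool" where
  "convD g L F = (case L of
      Some x \<Rightarrow> (\<forall>U. open U \<and> x \<in> U \<longrightarrow> eventually (\<lambda>s. g s \<in> Some ` U) F)
    | None \<Rightarrow> (\<forall>K. compact K \<longrightarrow> eventually (\<lambda>s. g s \<notin> Some ` K) F))"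

definition optB :: "'a::topological_space option measure" where
  "optB = sigma UNIV ({Some ` B | B. B \<in> sets borel} \<union> {{None}})"

definition hpaths :: "'a::topological_space path set" where
  "hpaths = {\<omega>. (\<forall>t\<ge>0. convD \<omega> (\<omega> t) (at_right t))
              \<and> (\<forall>t>0. \<exists>L. convD \<omega> L (at_left t))
              \<and> (\<forall>t s. 0 \<le> t \<and> t \<le> s \<and> \<omega> t = None \<longrightarrow> \<omega> s = None)}"

definition coordsets :: "real set \<Rightarrow> 'a::topological_space path set set" where
  "coordsets S = {(\<lambda>\<omega>. \<omega> s) -` A | s A. s \<in> S \<and> A \<in> sets optB}"

definition path_space :: "'a::topological_space path measure" where
  "path_space = restrict_space (sigma UNIV (coordsets {0..})) hpaths"

definition natF :: "real \<Rightarrow> 'a::topological_space path measure" where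
  "natF t = restrict_space (sigma UNIV (coordsets {0..t})) hpaths"

definition shiftp :: "'a path \<Rightarrow> real \<Rightarrow> 'a path" where
  "shiftp \<omega> s = (\<lambda>r. \<omega> (s + r))"

text \<open>Optional times (stopping times of the right-continuous filtration F_{t+}).\<close>
definition optional_time :: "('a::topological_space path \<Rightarrow> ennreal) \<Rightarrow> bool" where
  "optional_time T = (\<forall>t\<ge>0. {\<omega>\<in>hpaths. T \<omega> < ennreal t} \<in> sets (natF t))"

definition FT :: "('a::topological_space path \<Rightarrow> ennreal) \<Rightarrow> 'a path set set" where
  "FT T = {A \<in> sets path_space. \<forall>t\<ge>0. A \<inter> {\<omega>\<in>hpaths. T \<omega> < ennreal t} \<in> sets (natF t)}"

definition PiD :: "('a \<Rightarrow> 'a path measure) \<Rightarrow> 'a::topological_space option \<Rightarrow> 'a path measure" where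
  "PiD Yl y = (case y of Some x \<Rightarrow> Yl x | None \<Rightarrow> return path_space (\<lambda>_. None))"

definition hunt_process :: "('a::topological_space \<Rightarrow> 'a path measure) \<Rightarrow> bool" where
  "hunt_process Yl \<longleftrightarrow>
     (\<forall>x. prob_space (Yl x) \<and> sets (Yl x) = sets path_space
          \<and> emeasure (Yl x) {\<omega>\<in>hpaths. \<omega> 0 = Some x} = 1)
   \<and> (\<forall>B \<in> sets path_space. (\<lambda>x. emeasure (Yl x) B) \<in> borel_measurable borel)
   \<and> (\<forall>x T A B. optional_time T \<and> A \<in> FT T \<and> B \<in> sets path_space \<longrightarrow>
        emeasure (Yl x) (A \<inter> {\<omega>\<in>hpaths. T \<omega> < \<top> \<and> shiftp \<omega> (enn2real (T \<omega>)) \<in> B})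
        = (\<integral>\<^sup>+\<omega>. indicator (A \<inter> {\<omega>. T \<omega> < \<top>}) \<omega>
                   * emeasure (PiD Yl (\<omega> (enn2real (T \<omega>)))) B \<partial>Yl x))
   \<and> (\<forall>x Tn. (\<forall>n. optional_time (Tn n)) \<and> (\<forall>n \<omega>. Tn n \<omega> \<le> Tn (Suc n) \<omega>) \<longrightarrow>
        (AE \<omega> in Yl x. (SUP n. Tn n \<omega>) < \<top> \<longrightarrow>
           convD (\<lambda>n. \<omega> (enn2real (Tn n \<omega>))) (\<omega> (enn2real (SUP n. Tn n \<omega>))) sequentially))"

definition Psg :: "('a \<Rightarrow> 'a path measure) \<Rightarrow> real \<Rightarrow> ('a \<Rightarrow> real) \<Rightarrow> 'a \<Rightarrow> ennreal" where
  "Psg Yl t f x = (\<integral>\<^sup>+\<omega>. ennreal (gD f (\<omega> t)) \<partial>Yl x)"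

definition FKsg :: "('a \<Rightarrow> 'a path measure) \<Rightarrow> ('a \<Rightarrow> real) \<Rightarrow> real \<Rightarrow> ('a \<Rightarrow> real) \<Rightarrow> 'a \<Rightarrow> ennreal" where
  "FKsg Yl V t f x =
     (\<integral>\<^sup>+\<omega>. ennreal (exp (- (\<integral>s\<in>{0..t}. gD V (\<omega> s) \<partial>lborel)) * gD f (\<omega> t)) \<partial>Yl x)"

definition meanoff :: "(nat \<Rightarrow> 'a \<Rightarrow> real) \<Rightarrow> 'a \<Rightarrow> real" where
  "meanoff p x = (\<Sum>n. real n * p n x)"

definition logplus :: "real \<Rightarrow> real" where
  "logplus y = max 0 (ln y)"

text \<open>Each label u carries (path of u in its own age, lifetime of u, number of children).\<close>
definition D_space :: "'a::topological_space pdata measure" where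
  "D_space = path_space \<Otimes>\<^sub>M (borel \<Otimes>\<^sub>M count_space UNIV)"

definition Omega_space :: "'a::topological_space tree measure" where
  "Omega_space = PiM UNIV (\<lambda>_. D_space)"

definition dummyD :: "'a pdata" where
  "dummyD = ((\<lambda>_. None), \<top>, 0)"

definition dummyOmega :: "'a::topological_space tree measure" where
  "dummyOmega = return Omega_space (\<lambda>_. dummyD)"

text \<open>Death time: given the path, the particle dies in [t,t+dt) with probability
  beta(Y_t)dt + o(dt); realised as the first time the additive functional
  int_0^t beta(Y_s) ds exceeds an independent Exp(1) variable (infinite if never).\<close>
definition death_law :: "('a \<Rightarrow> real) \<Rightarrow> 'a path \<Rightarrow> ennreal measure" where
  "death_law \<beta> \<xi> = distr (density lborel (exponential_density 1)) borel
     (\<lambda>e. Inf (ennreal ` {s. 0 \<le> s \<and> (\<integral>r\<in>{0..s}. gD \<beta> (\<xi> r) \<partial>lborel) > e}))"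

definition offspring :: "(nat \<Rightarrow> 'a \<Rightarrow> real) \<Rightarrow> 'a \<Rightarrow> nat measure" where
  "offspring p z = density (count_space UNIV) (\<lambda>n. ennreal (p n z))"

definition off_at :: "(nat \<Rightarrow> 'a \<Rightarrow> real) \<Rightarrow> 'a path \<Rightarrow> ennreal \<Rightarrow> nat measure" where
  "off_at p \<xi> \<tau> = (if \<tau> < \<top> then (case \<xi> (enn2real \<tau>) of
        Some z \<Rightarrow> offspring p z | None \<Rightarrow> return (count_space UNIV) 0)
     else return (count_space UNIV) 0)"

definition particle_law :: "('a::topological_space \<Rightarrow> 'a path measure) \<Rightarrow> ('a \<Rightarrow> real)
    \<Rightarrow> (nat \<Rightarrow> 'a \<Rightarrow> real) \<Rightarrow> 'a \<Rightarrow> 'a pdata measure" where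
  "particle_law Yl \<beta> p x = bind (Yl x) (\<lambda>\<xi>. bind (death_law \<beta> \<xi>)
       (\<lambda>\<tau>. distr (off_at p \<xi> \<tau>) D_space (\<lambda>n. (\<xi>, \<tau>, n))))"

definition child_law :: "('a \<Rightarrow> 'a tree measure) \<Rightarrow> 'a::topological_space pdata \<Rightarrow> nat \<Rightarrow> 'a tree measure" where
  "child_law P d i = (case d of (\<xi>, \<tau>, N) \<Rightarrow>
     (if i < N \<and> \<tau> < \<top> then (case \<xi> (enn2real \<tau>) of Some z \<Rightarrow> P z | None \<Rightarrow> dummyOmega)
      else dummyOmega))"

fun graft :: "'a pdata \<Rightarrow> (nat \<Rightarrow> 'a tree) \<Rightarrow> 'a tree" where
  "graft d subs [] = d"
| "graft d subs (i # u) = subs i u"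

text \<open>P is the law of the (Y,beta,psi)-branching Hunt process: a probability kernel
  satisfying the branching (fixed point) equation: the root particle evolves
  according to particle_law and its children start independent copies at the
  death position.  This equation determines P uniquely.\<close>
definition branching_law :: "('a::topological_space \<Rightarrow> 'a path measure) \<Rightarrow> ('a \<Rightarrow> real)
    \<Rightarrow> (nat \<Rightarrow> 'a \<Rightarrow> real) \<Rightarrow> ('a \<Rightarrow> 'a tree measure) \<Rightarrow> bool" where
  "branching_law Yl \<beta> p P \<longleftrightarrow>
     (\<forall>x. prob_space (P x) \<and> sets (P x) = sets Omega_space)
   \<and> (\<forall>B \<in> sets Omega_space. (\<lambda>x. emeasure (P x) B) \<in> borel_measurable borel)
   \<and> (\<forall>x. P x = bind (particle_law Yl \<beta> p x)
                  (\<lambda>d. distr (PiM UNIV (child_law P d)) Omega_space (graft d)))"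

fun birth :: "'a tree \<Rightarrow> nat list \<Rightarrow> real option" where
  "birth \<omega> [] = Some 0"
| "birth \<omega> (i # u) = (case \<omega> [] of (\<xi>, \<tau>, N) \<Rightarrow>
     (if i < N \<and> \<tau> < \<top> \<and> \<xi> (enn2real \<tau>) \<noteq> None
      then map_option (\<lambda>b. enn2real \<tau> + b) (birth (\<lambda>v. \<omega> (i # v)) u) else None))"

definition pos :: "'a tree \<Rightarrow> real \<Rightarrow> nat list \<Rightarrow> 'a option" where
  "pos \<omega> t u = (case birth \<omega> u of None \<Rightarrow> None | Some b \<Rightarrow>
     (case \<omega> u of (\<xi>, \<tau>, N) \<Rightarrow>
        (if b \<le> t \<and> ennreal (t - b) < \<tau> then \<xi> (t - b) else None)))"

definition alive :: "'a tree \<Rightarrow> real \<Rightarrow> nat list set" where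
  "alive \<omega> t = {u. pos \<omega> t u \<noteq> None}"

definition Xf :: "'a tree \<Rightarrow> real \<Rightarrow> ('a \<Rightarrow> real) \<Rightarrow> real" where
  "Xf \<omega> t f = (\<Sum>u\<in>alive \<omega> t. f (the (pos \<omega> t u)))"

end

(* Write W_t = exp (- lam t) <phi, X_t>. Everything rests on the branching property at a fixed time,
   proved by induction on the label of a particle, and on a law of large numbers: for a functional G of
   the tree with a mean bounded by K phi and a finite L log L moment under phihat dm, the centred sums
   exp (- lam t_n) (sum over u alive at t_n of G (subtree of u) - its conditional mean) along a lattice
   t_n = d n are summable in L^1. (Truncate G at level exp (lam t_n / 2): the variances of the bounded
   parts decay geometrically, and the L log L moment makes the discarded parts summable.) Applied to
   G = <phi, X_d> this gives convergence of W along lattices without martingale theory. Intrinsic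
   ultracontractivity yields a Doeblin minorization and hence a spectral gap for the mean semigroup
   relative to phi, which turns the conditional means into mu (G) W.
   For continuous time, take for G the minimum of <f, X_s> over the rationals s in [0, d] and let d
   tend to 0: this gives lower bounds for every continuous 0 <= f <= r phi. The matching upper bound is
   only needed for f = phi, where a one-sided maximal inequality and Borel-Cantelli suffice. For a
   general f with |f| <= B phi, approximate B phi + f and B phi - f from below by a countable family
   of continuous functions and subtract from the limit of B W. *)
theory Submission
  imports Defs
begin

section \<open>Path space\<close>

text \<open>No filtration on trees is built. The past of a particle \<open>u\<close> at time
  \<open>s\<close> is encoded by \<open>killT s u\<close>, the tree in which \<open>u\<close> is
  frozen at \<open>s\<close> and its descendants are erased; a functional invariant under killing
  stands for information from before \<open>s\<close>. Integrals and sums over labels live in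
  \<open>ennreal\<close>, so they may be exchanged long before the population is known to be finite.
  The integrability hypothesis concerns one branching event, whereas the law of large numbers needs
  the moment z ln (1 + z) of the whole mass <phi, X_T>. The transfer is a Gronwall argument over the
  number of generations, carried out after integration against phihat dm: this measure is a left
  eigenmeasure and absorbs the mean semigroup. Intrinsic ultracontractivity then leads from phihat
  dm back to each starting point. One event has to serve all starting points and uncountably many
  \<open>f\<close>. It is therefore defined from the tree alone, with quantifiers over rational
  times and a countable family of tent functions. All lattices of spacing 1/k share the limit
  \<open>M\<close> because each contains the positive integers.\<close>

lemma gD_Some[simp]: "gD f (Some x) = f x" and gD_None[simp]: "gD f None = 0"
 by (simp_all add: gD_def)

section \<open>The Borel structure of the one-point compactification\<close>

lemma space_optB[simp]: "space optB = UNIV"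
 unfolding optB_def by (subst space_measure_of) auto

lemma sets_optB_gen: "sets optB = sigma_sets UNIV ({Some ` B | B. B \<in> sets borel} \<union> {{None}})"
 unfolding optB_def by (subst sets_measure_of) auto

lemma Some_measurable[measurable]: "Some \<in> borel \<rightarrow>\<^sub>M optB"
proof -
 have "Some -` {None} = ({} :: 'a set)" by auto
 then show ?thesis unfolding optB_def
  by (intro measurable_measure_of) (auto simp: inj_vimage_image_eq)
qed

text \<open>The added point is a measurable singleton, so only the trace on E restricts a set. Maps
  out of \<open>optB\<close> can therefore be checked on \<open>Some\<close> and \<open>None\<close>
  separately.\<close>

lemma sets_optB_iff: "A \<in> sets optB \<longleftrightarrow> Some -` A \<in> sets borel"
proof
 assume "A \<in> sets optB" from measurable_sets[OF Some_measurable this] show "Some -` A \<in> sets borel" by simp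
next
 assume *: "Some -` A \<in> sets borel"
 have 1: "Some ` (Some -` A) \<in> sets optB"
  unfolding sets_optB_gen using * by (intro sigma_sets.Basic) blast
 have 2: "{None} \<in> sets optB" unfolding sets_optB_gen by (intro sigma_sets.Basic) auto
 have "A = Some ` (Some -` A) \<or> A = Some ` (Some -` A) \<union> {None}"
  by (auto simp: image_iff) (metis option.exhaust)+
 then show "A \<in> sets optB" using 1 2 by (metis sets.Un)
qed

lemma measurable_optB_iff:
 "F \<in> optB \<rightarrow>\<^sub>M N \<longleftrightarrow> (\<lambda>x. F (Some x)) \<in> borel \<rightarrow>\<^sub>M N \<and> F None \<in> space N"
proof
 assume F: "F \<in> optB \<rightarrow>\<^sub>M N"
 show "(\<lambda>x. F (Some x)) \<in> borel \<rightarrow>\<^sub>M N \<and> F None \<in> space N"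
  using measurable_compose[OF Some_measurable F] measurable_space[OF F, of None] by simp
next
 assume a: "(\<lambda>x. F (Some x)) \<in> borel \<rightarrow>\<^sub>M N \<and> F None \<in> space N"
 show "F \<in> optB \<rightarrow>\<^sub>M N"
 proof (rule measurableI)
  fix y :: "'a option" show "F y \<in> space N"
   using a measurable_space[of "\<lambda>x. F (Some x)" borel N] by (cases y) auto
 next
  fix A assume "A \<in> sets N"
  then have "(\<lambda>x. F (Some x)) -` A \<inter> space borel \<in> sets borel"
   using a by (blast intro: measurable_sets)
  then show "F -` A \<inter> space optB \<in> sets optB" by (simp add: sets_optB_iff vimage_def)
 qed
qed

lemma measurable_case_option_optB[measurable (raw)]:
 assumes "g \<in> M \<rightarrow>\<^sub>M optB" "f \<in> borel \<rightarrow>\<^sub>M N" "c \<in> space N"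
 shows "(\<lambda>x. case g x of None => c | Some y => f y) \<in> M \<rightarrow>\<^sub>M N"
 by (rule measurable_compose[OF assms(1)]) (use assms(2,3) in \<open>simp add: measurable_optB_iff\<close>)

lemma gD_measurable[measurable]: "f \<in> borel_measurable borel ==> gD f \<in> borel_measurable optB"
 by (simp add: measurable_optB_iff)

lemma None_sets[measurable]: "{None} \<in> sets optB" unfolding sets_optB_gen by (intro sigma_sets.Basic) auto

lemma the_measurable: "(\<lambda>y. case y of Some x => x | None => c) \<in> optB \<rightarrow>\<^sub>M borel"
 by (simp add: measurable_optB_iff)

text \<open>Continuous test functions suffice: the constant 1 detects \<open>None\<close>, and an
  open set is where the distance to its complement is positive. Path regularity is only available
  through such test functions, so this is the route to joint measurability in time and path.\<close>

lemma measurable_into_optB: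
 fixes h :: "'b => 'a::metric_space option"
 assumes "\<And>f. continuous_on UNIV f ==> (\<lambda>x. gD f (h x)) \<in> borel_measurable M"
 shows "h \<in> M \<rightarrow>\<^sub>M optB"
proof -
 let ?G = "{Some ` U | U::'a set. open U} \<union> {{None}}"
 have eq: "sets (optB :: 'a option measure) = sigma_sets UNIV ?G"
 proof
  show "sigma_sets UNIV ?G \<subseteq> sets optB"
   unfolding sets_optB_gen by (rule sigma_sets_mono') auto
  have "Some ` B \<in> sigma_sets UNIV ?G" if "B \<in> sets borel" for B :: "'a set"
  proof -
   have "Some ` UNIV \<in> sigma_sets UNIV ?G" by (rule sigma_sets.Basic) (use open_UNIV in blast)
   note U = this
   have "B \<in> sigma_sets UNIV {S. open S}" using that by (simp add: borel_def)
   then show ?thesis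
   proof induction
    case (Basic a) then show ?case by (intro sigma_sets.Basic) auto
   next
    case (Compl a)
    have *: "Some ` (UNIV - a) = Some ` UNIV - Some ` a" by auto
    interpret sigma_algebra UNIV "sigma_sets UNIV ?G" by (rule sigma_algebra_sigma_sets) auto
    show ?case unfolding * using U Compl by (intro Diff)
   next
    case (Union a) then show ?case unfolding image_Union
     by (metis (no_types, lifting) UN_extend_simps(10) image_UN sigma_sets.Union)
   qed (auto intro: sigma_sets.Empty)
  qed
  then show "sets optB \<subseteq> sigma_sets UNIV ?G"
   unfolding sets_optB_gen by (intro sigma_sets_mono) (auto intro: sigma_sets.Basic)
 qed
 have 1: "h -` {None} \<inter> space M \<in> sets M"
 proof -
  have "h -` {None} \<inter> space M = (\<lambda>x. gD (\<lambda>_. 1) (h x)) -` {0} \<inter> space M"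
   by (auto simp: gD_def split: option.splits)
  then show ?thesis using assms[of "\<lambda>_. 1"] by (auto intro: measurable_sets)
 qed
 have 2: "h -` (Some ` U) \<inter> space M \<in> sets M" if "open U" for U
 \<comment> \<open>\<open>infdist\<close> to the empty set is 0 by convention, so the whole space
   cannot be written as a positivity set of a distance and is treated as the complement of
   \<open>None\<close>.\<close>
 proof (cases "U = UNIV")
  case True
  have "h -` (Some ` U) \<inter> space M = space M - (h -` {None} \<inter> space M)"
   unfolding True by (auto simp: notin_range_Some)
  then show ?thesis using 1 by auto
 next
  case False
  have "h -` (Some ` U) \<inter> space M = (\<lambda>x. gD (\<lambda>x. infdist x (-U)) (h x)) -` {0<..} \<inter> space M"
  proof -
   have "x \<in> U \<longleftrightarrow> infdist x (-U) > 0" for x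
   proof -
    have "- U \<noteq> {}" using False by blast
    then show ?thesis using that in_closed_iff_infdist_zero[of "-U" x] infdist_nonneg[of x "-U"]
    by (auto simp: less_le)
   qed
   then show ?thesis by (auto simp: gD_def image_iff split: option.splits)
  qed
  then show ?thesis
   using assms[of "\<lambda>x. infdist x (-U)", OF continuous_on_infdist[OF continuous_on_id]]
   by (auto intro: measurable_sets)
 qed
 show ?thesis
  by (rule measurable_sigma_sets[OF eq]) (use 1 2 in auto)
qed

section \<open>The canonical path space, its filtration and its coordinates\<close>

lemma space_path_space[simp]: "space path_space = hpaths"
 unfolding path_space_def space_restrict_space by (auto simp: space_measure_of_conv)

lemma space_natF[simp]: "space (natF t) = hpaths"
 unfolding natF_def space_restrict_space by (auto simp: space_measure_of_conv)

lemma eval_measurable0: "0 <= s ==> (\<lambda>w. w s) \<in> path_space \<rightarrow>\<^sub>M optB"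
 unfolding path_space_def
proof (rule measurable_restrict_space1, rule measurableI)
 fix A :: "'a option set" assume "0 <= s" "A \<in> sets optB"
 then have "(\<lambda>w. w s) -` A \<in> coordsets {0..}" unfolding coordsets_def by auto
 then show "(\<lambda>w. w s) -` A \<inter> space (sigma UNIV (coordsets {0..})) \<in> sets (sigma UNIV (coordsets {0..}))"
  by (auto simp: space_measure_of_conv intro: sigma_sets.Basic)
qed auto

lemma eval_natF: "0 <= s ==> s <= t ==> (\<lambda>w. w s) \<in> natF t \<rightarrow>\<^sub>M optB"
 unfolding natF_def
proof (rule measurable_restrict_space1, rule measurableI)
 fix A :: "'a option set" assume "0 <= s" "s <= t" "A \<in> sets optB"
 then have "(\<lambda>w. w s) -` A \<in> coordsets {0..t}" unfolding coordsets_def by auto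
 then show "(\<lambda>w. w s) -` A \<inter> space (sigma UNIV (coordsets {0..t})) \<in> sets (sigma UNIV (coordsets {0..t}))"
  by (auto simp: space_measure_of_conv intro: sigma_sets.Basic)
qed auto

lemma measurable_path_spaceI:
 fixes h :: "'b => 'a::topological_space path"
 assumes "\<And>x. x \<in> space M ==> h x \<in> hpaths"
  and "\<And>r. 0 <= r ==> (\<lambda>x. h x r) \<in> M \<rightarrow>\<^sub>M optB"
 shows "h \<in> M \<rightarrow>\<^sub>M path_space"
 unfolding path_space_def
proof (rule measurable_restrict_space2)
 show "h \<in> space M \<rightarrow> hpaths" using assms(1) by auto
 show "h \<in> M \<rightarrow>\<^sub>M sigma UNIV (coordsets {0..})"
 proof (rule measurable_measure_of)
  fix y :: "'a path set" assume "y \<in> coordsets {0..}"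
  then obtain s and A :: "'a option set" where y: "y = (\<lambda>w. w s) -` A" "0 <= s" "A \<in> sets optB"
   unfolding coordsets_def by auto
  show "h -` y \<inter> space M \<in> sets M"
   using measurable_sets[OF assms(2)[OF y(2)] y(3)] by (simp add: y(1) vimage_def)
 qed auto
qed

lemma natF_sub: "A \<in> sets (natF s :: 'a::topological_space path measure) ==> A \<in> sets path_space"
proof -
 have "(\<lambda>w. w) \<in> (path_space :: 'a path measure) \<rightarrow>\<^sub>M natF s"
  unfolding natF_def
 proof (rule measurable_restrict_space2)
  show "(\<lambda>w. w) \<in> (path_space :: 'a path measure) \<rightarrow>\<^sub>M sigma UNIV (coordsets {0..s})"
  proof (rule measurable_measure_of)
   fix y :: "'a path set" assume "y \<in> coordsets {0..s}"
   then obtain r and A :: "'a option set" where y: "y = (\<lambda>w. w r) -` A" "0 <= r" "A \<in> sets optB"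
    unfolding coordsets_def by auto
   show "(\<lambda>w. w) -` y \<inter> space path_space \<in> sets path_space"
    using measurable_sets[OF eval_measurable0[OF y(2)] y(3)] by (simp add: y(1) vimage_def)
  qed auto
 qed auto
 then show "A \<in> sets (natF s) ==> A \<in> sets path_space"
  using measurable_sets[of "\<lambda>w. w" path_space "natF s" A] sets.sets_into_space[of A "natF s"]
  by (auto simp: Int_absorb2)
qed

lemma natF_mono: "s <= t ==> A \<in> sets (natF s :: 'a::topological_space path measure) ==> A \<in> sets (natF t)"
proof -
 assume st: "s <= t"
 have "(\<lambda>w. w) \<in> (natF t :: 'a path measure) \<rightarrow>\<^sub>M natF s"
  unfolding natF_def[of s]
 proof (rule measurable_restrict_space2)
  show "(\<lambda>w. w) \<in> (natF t :: 'a path measure) \<rightarrow>\<^sub>M sigma UNIV (coordsets {0..s})"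
  proof (rule measurable_measure_of)
   fix y :: "'a path set" assume "y \<in> coordsets {0..s}"
   then obtain r and A :: "'a option set" where y: "y = (\<lambda>w. w r) -` A" "0 <= r" "r <= s" "A \<in> sets optB"
    unfolding coordsets_def by auto
   have "r <= t" using y st by simp
   from measurable_sets[OF eval_natF[OF y(2) this] y(4)]
   show "(\<lambda>w. w) -` y \<inter> space (natF t) \<in> sets (natF t)"
    by (simp add: y(1) vimage_def)
  qed auto
 qed auto
 then show "A \<in> sets (natF s) ==> A \<in> sets (natF t)"
  using measurable_sets[of "\<lambda>w. w" "natF t" "natF s" A] sets.sets_into_space[of A "natF s"]
  by (auto simp: Int_absorb2)
qed

lemma hpaths_dead: "w \<in> hpaths ==> 0 <= t ==> t <= s ==> w t = None ==> w s = None"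
 unfolding hpaths_def by blast

text \<open>The cemetery is absorbing: after death the function is constantly 0, and before death
  the path stays in E for a short while, where convergence is the ordinary one. Hence
  \<open>f\<close> need not vanish at infinity.\<close>

lemma gD_right_cont:
 fixes f :: "'a::topological_space => real"
 assumes "w \<in> hpaths" "continuous_on UNIV f" "0 <= t"
 shows "((\<lambda>s. gD f (w s)) \<longlongrightarrow> gD f (w t)) (at_right t)"
proof (cases "w t")
 case None
 have "eventually (\<lambda>s. gD f (w s) = 0) (at_right t)"
  using hpaths_dead[OF assms(1,3) _ None] by (auto simp: eventually_at_right_field gD_def intro: exI[of _ "t+1"])
 then show ?thesis using None by (simp add: tendsto_eventually)
next
 case (Some x)
 have c: "convD w (Some x) (at_right t)" using assms(1,3) Some unfolding hpaths_def by (metis (mono_tags, lifting) mem_Collect_eq)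
 show ?thesis
 proof (rule topological_tendstoI)
  fix S :: "real set" assume S: "open S" "gD f (w t) \<in> S"
  have "open (f -` S)" using S(1) assms(2) by (metis continuous_on_open_vimage inf_top.right_neutral open_UNIV)
  moreover have "x \<in> f -` S" using S Some by simp
  ultimately have "eventually (\<lambda>s. w s \<in> Some ` (f -` S)) (at_right t)" using c unfolding convD_def by auto
  then show "\<forall>\<^sub>F s in at_right t. gD f (w s) \<in> S" by eventually_elim auto
 qed
qed

text \<open>Approximation from the right along grids: by right continuity the path at a grid time
  just after \<open>s\<close> converges to the path at \<open>s\<close>, and each approximation
  reads only countably many coordinates.\<close>

lemma eval_joint: "(\<lambda>(s, w). w (max 0 s)) \<in> borel \<Otimes>\<^sub>M path_space \<rightarrow>\<^sub>M (optB :: 'a::metric_space option measure)"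
proof (rule measurable_into_optB)
 fix f :: "'a => real" assume f: "continuous_on UNIV f"
 have fm: "f \<in> borel_measurable borel" using f by (rule borel_measurable_continuous_onI)
 \<comment> \<open>The grid point strictly after \<open>s\<close>: the filter
   \<open>at_right\<close> excludes \<open>s\<close> itself, so rounding up with equality would not
   do.\<close>
 define sq where "sq n s = (of_int \<lfloor>real (Suc n) * s\<rfloor> + 1) / real (Suc n)" for n :: nat and s :: real
 have sq: "s < sq n s" "sq n s <= s + 1 / real (Suc n)" for n s
  unfolding sq_def by (simp_all add: field_simps del: of_nat_Suc) linarith+
 have "(\<lambda>x. gD f (case x of (s, w) => w (max 0 s))) \<in> borel_measurable (borel \<Otimes>\<^sub>M path_space)"
 proof (rule borel_measurable_LIMSEQ_real)
  fix x :: "real \<times> 'a path" assume x: "x \<in> space (borel \<Otimes>\<^sub>M path_space)"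
  obtain s w where so: "x = (s, w)" "w \<in> hpaths" using x by (auto simp: space_pair_measure)
  have lim: "(\<lambda>n. sq n (max 0 s)) \<longlonglongrightarrow> max 0 s"
  proof (rule tendsto_sandwich[of "\<lambda>_. max 0 s" _ _ "\<lambda>n. max 0 s + 1 / real (Suc n)"])
   show "(\<lambda>n. max 0 s + 1 / real (Suc n)) \<longlonglongrightarrow> max 0 s"
    using tendsto_add[OF tendsto_const[of "max 0 s"] LIMSEQ_Suc[OF lim_1_over_n]] by simp
   show "\<forall>\<^sub>F n in sequentially. max 0 s <= sq n (max 0 s)"
    by (intro always_eventually allI less_imp_le sq(1))
   show "\<forall>\<^sub>F n in sequentially. sq n (max 0 s) <= max 0 s + 1 / real (Suc n)"
    using sq(2)[of _ "max 0 s"] by (intro always_eventually allI)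
  qed simp
  have "filterlim (\<lambda>n. sq n (max 0 s)) (at_right (max 0 s)) sequentially"
   unfolding filterlim_at
  proof (rule conjI)
   have "sq n (max 0 s) \<in> {max 0 s<..} \<and> sq n (max 0 s) \<noteq> max 0 s" for n
    using sq(1)[of "max 0 s" n] by (metis greaterThan_iff less_irrefl)
   then show "\<forall>\<^sub>F n in sequentially. sq n (max 0 s) \<in> {max 0 s<..} \<and> sq n (max 0 s) \<noteq> max 0 s"
    by (intro always_eventually allI)
  qed (rule lim)
  from filterlim_compose[OF gD_right_cont[OF so(2) f, of "max 0 s"] this]
  show "(\<lambda>n. gD f (snd x (sq n (max 0 (fst x))))) \<longlonglongrightarrow> gD f (case x of (s, w) => w (max 0 s))"
   by (simp add: so)
 next
  fix n
  \<comment> \<open>Clipping the integer at 0 does not change its value here, but it keeps every one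
    of the countably many evaluation times nonnegative, where coordinates are measurable.\<close>
  have "(\<lambda>x. gD f (snd x ((of_int (max 0 \<lfloor>real (Suc n) * max 0 (fst x)\<rfloor>) + 1) / real (Suc n))))
     \<in> borel_measurable (borel \<Otimes>\<^sub>M path_space)"
  proof (rule measurable_compose_countable[where f="\<lambda>(k::int) x. gD f (snd x ((of_int (max 0 k) + 1) / real (Suc n)))"])
   fix k :: int
   have "(\<lambda>w. w ((of_int (max 0 k) + 1) / real (Suc n))) \<in> path_space \<rightarrow>\<^sub>M (optB :: 'a option measure)"
    by (rule eval_measurable0) auto
   from measurable_compose[OF measurable_snd measurable_compose[OF this gD_measurable[OF fm]]]
   show "(\<lambda>x. gD f (snd x ((of_int (max 0 k) + 1) / real (Suc n)))) \<in> borel_measurable (borel \<Otimes>\<^sub>M path_space)"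
    by simp
  next
   show "(\<lambda>x. \<lfloor>real (Suc n) * max 0 (fst x)\<rfloor>) \<in> borel \<Otimes>\<^sub>M path_space \<rightarrow>\<^sub>M count_space UNIV"
    by measurable
  qed
  moreover have "max 0 \<lfloor>real (Suc n) * max 0 a\<rfloor> = \<lfloor>real (Suc n) * max 0 a\<rfloor>" for a :: real
   by (rule max_absorb2) (simp del: of_nat_Suc)
  ultimately show "(\<lambda>x. gD f (snd x (sq n (max 0 (fst x))))) \<in> borel_measurable (borel \<Otimes>\<^sub>M path_space)"
   unfolding sq_def by simp
 qed
 then show "(\<lambda>x. gD f (case x of (s, w) => w (max 0 s))) \<in> borel_measurable (borel \<Otimes>\<^sub>M path_space)" .
qed

lemma eval_measurable:
 fixes h :: "'b => 'a::metric_space path"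
 assumes "g \<in> borel_measurable M" "h \<in> M \<rightarrow>\<^sub>M path_space"
 shows "(\<lambda>x. h x (max 0 (g x))) \<in> M \<rightarrow>\<^sub>M optB"
 using measurable_compose[OF measurable_Pair[OF assms] eval_joint] by simp

lemma eval_measurable_nonneg:
 fixes h :: "'b => 'a::metric_space path"
 assumes "g \<in> borel_measurable M" "h \<in> M \<rightarrow>\<^sub>M path_space" "\<And>x. x \<in> space M ==> 0 <= g x"
 shows "(\<lambda>x. h x (g x)) \<in> M \<rightarrow>\<^sub>M optB"
proof -
 have "(\<lambda>x. h x (max 0 (g x))) \<in> M \<rightarrow>\<^sub>M optB" using assms(1,2) by (rule eval_measurable)
 moreover have "h x (g x) = h x (max 0 (g x))" if "x \<in> space M" for x using assms(3)[OF that] by (simp add: max_absorb2)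
 ultimately show ?thesis by (subst measurable_cong)
qed

lemma eval_enn2real_measurable:
 fixes h :: "'b => 'a::metric_space path"
 assumes "g \<in> borel_measurable M" "h \<in> M \<rightarrow>\<^sub>M path_space"
 shows "(\<lambda>x. h x (enn2real (g x))) \<in> M \<rightarrow>\<^sub>M optB"
 by (rule eval_measurable_nonneg) (use assms in auto)

section \<open>Shifting and stopping paths\<close>

lemma convD_filtermap: "convD g L (filtermap h F) = convD (\<lambda>x. g (h x)) L F"
 unfolding convD_def by (simp add: eventually_filtermap split: option.split)

lemma convD_cong: "eventually (\<lambda>r. g r = h r) F ==> convD g L F ==> convD h L F"
proof -
 assume e: "eventually (\<lambda>r. g r = h r) F" and c: "convD g L F"
 have "eventually (\<lambda>r. P (h r)) F" if "eventually (\<lambda>r. P (g r)) F" for P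
  using e that by eventually_elim simp
 note * = this[of "\<lambda>y. y \<in> Some ` A" for A] this[of "\<lambda>y. y \<notin> Some ` A" for A]
 show ?thesis using c unfolding convD_def by (cases L) (simp_all add: *)
qed

lemma convD_const: "convD (\<lambda>_. L) L F"
 unfolding convD_def by (auto split: option.splits)

lemma at_right_plus: "at_right (s + t :: real) = filtermap (\<lambda>r. s + r) (at_right t)"
 using filtermap_at_right_shift[of "-s" t] by (simp add: add.commute)

lemma at_left_plus: "at_left (s + t :: real) = filtermap (\<lambda>r. s + r) (at_left t)"
proof -
 have "filtermap (\<lambda>x. x - (-s)) (at_left t) = at_left (t - (-s))"
  unfolding at_left_minus[of t] at_left_minus[of "t - - s"] filtermap_filtermap
  using filtermap_at_right_shift[of "s" "-t", THEN arg_cong[of _ _ "filtermap uminus"]]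
  unfolding filtermap_filtermap by (simp add: algebra_simps minus_diff_commute)
 then show ?thesis by (simp add: add.commute)
qed

lemma shiftp_hpaths:
 assumes "w \<in> hpaths" "0 <= s" shows "shiftp w s \<in> hpaths"
proof -
 have 1: "convD (shiftp w s) (shiftp w s t) (at_right t)" if "0 <= t" for t
 proof -
  have "convD w (w (s + t)) (at_right (s + t))" using assms that unfolding hpaths_def by simp
  then show ?thesis unfolding at_right_plus convD_filtermap shiftp_def .
 qed
 have 2: "\<exists>L. convD (shiftp w s) L (at_left t)" if "0 < t" for t
 proof -
  have "\<exists>L. convD w L (at_left (s + t))" using assms that unfolding hpaths_def by simp
  then show ?thesis unfolding at_left_plus convD_filtermap shiftp_def .
 qed
 have 3: "shiftp w s r = None" if "0 <= t" "t <= r" "shiftp w s t = None" for t r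
  using hpaths_dead[OF assms(1), of "s + t" "s + r"] that assms(2) by (simp add: shiftp_def)
 show ?thesis using 1 2 3 unfolding hpaths_def by blast
qed

text \<open>The path frozen at its position at time \<open>s\<close>. It is a path again and depends
  on the coordinates up to \<open>s\<close> alone, so functionals of it are exactly the kind of
  past-measurable factor that the Markov property accepts.\<close>

definition stopp :: "real => 'a path => 'a path" where
 "stopp s w = (\<lambda>r. w (min r s))"

lemma stopp_hpaths:
 assumes "w \<in> hpaths" "0 <= s" shows "stopp s w \<in> hpaths"
proof -
 have 1: "convD (stopp s w) (stopp s w t) (at_right t)" if t: "0 <= t" for t
 proof (cases "t < s")
  case True
  have c: "convD w (w t) (at_right t)" using assms t unfolding hpaths_def by simp
  have "eventually (\<lambda>r. w r = stopp s w r) (at_right t)"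
   using True by (auto simp: eventually_at_right_field stopp_def intro!: exI[of _ s])
  from convD_cong[OF this c] True show ?thesis by (simp add: stopp_def)
 next
  case False
  have "eventually (\<lambda>r. w s = stopp s w r) (at_right t)"
   using False by (auto simp: eventually_at_right_field stopp_def min_def intro!: exI[of _ "t+1"])
  moreover have "w s = stopp s w t" using False by (simp add: stopp_def min_absorb2)
  ultimately show ?thesis using convD_cong[OF _ convD_const] by metis
 qed
 have 2: "\<exists>L. convD (stopp s w) L (at_left t)" if t: "0 < t" for t
 proof (cases "t <= s")
  case True
  obtain L where c: "convD w L (at_left t)" using assms t unfolding hpaths_def by blast
  have "eventually (\<lambda>r. w r = stopp s w r) (at_left t)"
   using True by (auto simp: eventually_at_left_field stopp_def intro!: exI[of _ "t - 1"])
  from convD_cong[OF this c] show ?thesis by blast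
 next
  case False
  have "eventually (\<lambda>r. w s = stopp s w r) (at_left t)"
   using False by (auto simp: eventually_at_left_field stopp_def min_def intro!: exI[of _ s])
  from convD_cong[OF this convD_const] show ?thesis by blast
 qed
 have 3: "stopp s w r = None" if "0 <= t" "t <= r" "stopp s w t = None" for t r
  using hpaths_dead[OF assms(1), of "min t s" "min r s"] that assms(2) by (auto simp: stopp_def)
 show ?thesis using 1 2 3 unfolding hpaths_def by blast
qed

lemma shiftp_measurable:
 fixes h :: "'b => 'a::metric_space path"
 assumes "g \<in> borel_measurable M" "h \<in> M \<rightarrow>\<^sub>M path_space" "\<And>x. x \<in> space M ==> 0 <= g x"
 shows "(\<lambda>x. shiftp (h x) (g x)) \<in> M \<rightarrow>\<^sub>M path_space"
proof (rule measurable_path_spaceI)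
 show "x \<in> space M ==> shiftp (h x) (g x) \<in> hpaths" for x
  using shiftp_hpaths[of "h x" "g x"] assms(3)[of x] measurable_space[OF assms(2), of x] by simp
 show "0 <= r ==> (\<lambda>x. shiftp (h x) (g x) r) \<in> M \<rightarrow>\<^sub>M optB" for r
  unfolding shiftp_def by (rule eval_measurable_nonneg) (use assms in auto)
qed

lemma stopp_measurable:
 fixes h :: "'b => 'a::metric_space path"
 assumes "g \<in> borel_measurable M" "h \<in> M \<rightarrow>\<^sub>M path_space" "\<And>x. x \<in> space M ==> 0 <= g x"
 shows "(\<lambda>x. stopp (g x) (h x)) \<in> M \<rightarrow>\<^sub>M path_space"
proof (rule measurable_path_spaceI)
 show "x \<in> space M ==> stopp (g x) (h x) \<in> hpaths" for x
  using stopp_hpaths[of "h x" "g x"] assms(3)[of x] measurable_space[OF assms(2), of x] by simp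
 show "0 <= r ==> (\<lambda>x. stopp (g x) (h x) r) \<in> M \<rightarrow>\<^sub>M optB" for r
  unfolding stopp_def by (rule eval_measurable_nonneg) (use assms in auto)
qed

lemma stopp_natF:
 assumes "0 <= s" shows "stopp s \<in> natF s \<rightarrow>\<^sub>M (path_space :: 'a::metric_space path measure)"
proof (rule measurable_path_spaceI)
 show "x \<in> space (natF s) ==> stopp s x \<in> hpaths" for x :: "'a path"
  using stopp_hpaths[of x s] assms by simp
 show "0 <= r ==> (\<lambda>x. stopp s x r) \<in> natF s \<rightarrow>\<^sub>M optB" for r
  unfolding stopp_def by (rule eval_natF) (use assms in auto)
qed

lemma dead_path_hpaths: "(\<lambda>_. None) \<in> hpaths"
 unfolding hpaths_def using convD_const by auto

section \<open>Path laws and the Markov property at a fixed time\<close>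

locale hunt =
 fixes Yl :: "'a::{metric_space, second_countable_topology} => 'a path measure"
 assumes hunt: "hunt_process Yl"
begin

lemma prob_Yl: "prob_space (Yl x)" and sets_Yl[simp, measurable_cong]: "sets (Yl x) = sets path_space"
 and Yl_start: "emeasure (Yl x) {w\<in>hpaths. w 0 = Some x} = 1"
 using hunt unfolding hunt_process_def by blast+

lemma space_Yl[simp]: "space (Yl x) = hpaths"
 using sets_eq_imp_space_eq[OF sets_Yl] by simp

lemma Yl_kernel[measurable]: "Yl \<in> borel \<rightarrow>\<^sub>M prob_algebra path_space"
proof (rule measurable_prob_algebraI)
 show "Yl \<in> borel \<rightarrow>\<^sub>M subprob_algebra path_space"
 proof (rule measurable_subprob_algebra)
  show "subprob_space (Yl a)" for a using prob_Yl by (rule prob_space_imp_subprob_space)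
  show "A \<in> sets path_space ==> (\<lambda>a. emeasure (Yl a) A) \<in> borel_measurable borel" for A
   using hunt unfolding hunt_process_def by blast
 qed simp
qed (rule prob_Yl)

lemma AE_start: "AE w in Yl x. w 0 = Some x"
proof -
 interpret prob_space "Yl x" by (rule prob_Yl)
 have m: "{w\<in>space (Yl x). w 0 = Some x} \<in> sets (Yl x)"
 proof -
  have "(\<lambda>w. w 0) -` {Some x} \<inter> space (Yl x) \<in> sets (Yl x)"
   using measurable_sets[OF eval_measurable0[of 0], of "{Some x}"]
   by (auto simp: sets_optB_iff vimage_def)
  then show ?thesis by (simp add: vimage_def Int_def conj_commute)
 qed
 show ?thesis
  by (rule AE_I_eq_1[OF _ m[unfolded space_Yl, folded space_Yl[of x]]]) (use Yl_start[of x] in simp)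
qed

lemma PiD_kernel[measurable]: "PiD Yl \<in> optB \<rightarrow>\<^sub>M prob_algebra path_space"
 unfolding measurable_optB_iff
proof
 show "(\<lambda>x. PiD Yl (Some x)) \<in> borel \<rightarrow>\<^sub>M prob_algebra path_space" by (simp add: PiD_def)
 have "return path_space (\<lambda>_. None) \<in> space (prob_algebra path_space)"
  using measurable_space[OF measurable_return_prob_space, of "\<lambda>_. None" path_space] dead_path_hpaths by simp
 then show "PiD Yl None \<in> space (prob_algebra path_space)" by (simp add: PiD_def)
qed

lemma markov_sets:
 assumes s: "0 <= s" and A: "A \<in> sets (natF s)" and B: "B \<in> sets path_space"
 shows "emeasure (Yl x) (A \<inter> {w\<in>hpaths. shiftp w s \<in> B})
    = (\<integral>\<^sup>+w. indicator A w * emeasure (PiD Yl (w s)) B \<partial>Yl x)"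
proof -
 let ?T = "\<lambda>_::'a path. ennreal s"
 have oT: "optional_time ?T" unfolding optional_time_def
 proof (intro allI impI)
  fix t :: real assume "0 <= t"
  show "{w \<in> (hpaths :: 'a path set). ennreal s < ennreal t} \<in> sets (natF t)"
   using sets.top[of "natF t :: 'a path measure"] by (cases "ennreal s < ennreal t") auto
 qed
 have FA: "A \<in> FT ?T" unfolding FT_def
 proof (intro CollectI conjI allI impI natF_sub[OF A])
  fix t :: real assume "0 <= t"
  show "A \<inter> {w \<in> hpaths. ennreal s < ennreal t} \<in> sets (natF t)"
  proof (cases "s < t")
   case True
   then have "A \<inter> {w \<in> hpaths. ennreal s < ennreal t} = A"
    using sets.sets_into_space[OF A] s by (auto simp: ennreal_less_iff)
   then show ?thesis using natF_mono[OF _ A] True by simp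
  next
   case False
   then have "A \<inter> {w \<in> hpaths. ennreal s < ennreal t} = {}" using \<open>0 <= t\<close> s by (auto simp: ennreal_less_iff)
   then show ?thesis by (metis sets.empty_sets)
  qed
 qed
 have "emeasure (Yl x) (A \<inter> {w\<in>hpaths. ?T w < \<top> \<and> shiftp w (enn2real (?T w)) \<in> B})
    = (\<integral>\<^sup>+w. indicator (A \<inter> {w. ?T w < \<top>}) w
          * emeasure (PiD Yl (w (enn2real (?T w)))) B \<partial>Yl x)"
  using hunt oT FA B unfolding hunt_process_def by blast
 then show ?thesis using s by simp
qed

text \<open>Both sides are integrals of \<open>F\<close> against measures on pairs (stopped path,
  shifted path). The two measures agree on rectangles by the set version, and rectangles form an
  intersection-stable generator.\<close>

lemma markov:
 assumes s: "0 <= s" and F[measurable]: "F \<in> borel_measurable (path_space \<Otimes>\<^sub>M path_space)"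
 shows "(\<integral>\<^sup>+w. F (stopp s w, shiftp w s) \<partial>Yl x) = (\<integral>\<^sup>+w. \<integral>\<^sup>+xi. F (stopp s w, xi) \<partial>PiD Yl (w s) \<partial>Yl x)"
proof -
 interpret prob_space "Yl x" by (rule prob_Yl)
 let ?P = "path_space :: 'a path measure" and ?Q = "path_space \<Otimes>\<^sub>M path_space :: ('a path \<times> 'a path) measure"
 have [measurable]: "(\<lambda>w. stopp s w) \<in> ?P \<rightarrow>\<^sub>M ?P" by (rule stopp_measurable) (use s in auto)
 have [measurable]: "(\<lambda>w. shiftp w s) \<in> ?P \<rightarrow>\<^sub>M ?P" by (rule shiftp_measurable) (use s in auto)
 have ev[measurable]: "(\<lambda>w. w s) \<in> ?P \<rightarrow>\<^sub>M optB" by (rule eval_measurable0[OF s])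
 have k1[measurable]: "(\<lambda>w. PiD Yl (w s)) \<in> ?P \<rightarrow>\<^sub>M subprob_algebra ?P"
  by (rule measurable_prob_algebraD) measurable
 have k2[measurable]: "(\<lambda>w. distr (PiD Yl (w s)) ?Q (\<lambda>xi. (stopp s w, xi))) \<in> ?P \<rightarrow>\<^sub>M subprob_algebra ?Q"
  by (rule measurable_distr2[where M="?P"]) measurable
 define N1 where "N1 = distr (Yl x) ?Q (\<lambda>w. (stopp s w, shiftp w s))"
 define N2 where "N2 = bind (Yl x) (\<lambda>w. distr (PiD Yl (w s)) ?Q (\<lambda>xi. (stopp s w, xi)))"
 have k2': "(\<lambda>w. distr (PiD Yl (w s)) ?Q (\<lambda>xi. (stopp s w, xi))) \<in> Yl x \<rightarrow>\<^sub>M subprob_algebra ?Q"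
  by measurable
 have sP: "sets (PiD Yl y) = sets ?P" for y
  using measurable_space[OF PiD_kernel, of y] by (simp add: space_prob_algebra)
 note sP[measurable_cong]
 have eq: "emeasure N1 (A \<times> B) = emeasure N2 (A \<times> B)" if A[measurable]: "A \<in> sets ?P" and B[measurable]: "B \<in> sets ?P" for A B
 proof -
  let ?A' = "stopp s -` A \<inter> space (natF s)"
  have A': "?A' \<in> sets (natF s)" by (rule measurable_sets[OF stopp_natF[OF s] A])
  have "emeasure N1 (A \<times> B) = emeasure (Yl x) (?A' \<inter> {w\<in>hpaths. shiftp w s \<in> B})"
   unfolding N1_def by (subst emeasure_distr) (auto intro!: arg_cong[where f="emeasure (Yl x)"])
  also have "... = (\<integral>\<^sup>+w. indicator ?A' w * emeasure (PiD Yl (w s)) B \<partial>Yl x)"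
   by (rule markov_sets[OF s A' B])
  also have "... = (\<integral>\<^sup>+w. emeasure (distr (PiD Yl (w s)) ?Q (\<lambda>xi. (stopp s w, xi))) (A \<times> B) \<partial>Yl x)"
  proof (rule nn_integral_cong)
   fix w assume wa: "w \<in> space (Yl x)"
   then have "stopp s w \<in> hpaths" using stopp_hpaths s by auto
   then have "emeasure (distr (PiD Yl (w s)) ?Q (\<lambda>xi. (stopp s w, xi))) (A \<times> B)
    = emeasure (PiD Yl (w s)) ((\<lambda>xi. (stopp s w, xi)) -` (A \<times> B) \<inter> space (PiD Yl (w s)))"
    by (intro emeasure_distr) auto
   also have "(\<lambda>xi. (stopp s w, xi)) -` (A \<times> B) \<inter> space (PiD Yl (w s)) = (if stopp s w \<in> A then B else {})"
    using sets.sets_into_space[OF B] sets_eq_imp_space_eq[OF sP] by auto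
   finally show "indicator ?A' w * emeasure (PiD Yl (w s)) B
     = emeasure (distr (PiD Yl (w s)) ?Q (\<lambda>xi. (stopp s w, xi))) (A \<times> B)"
    using wa by (simp add: indicator_def)
  qed
  also have "... = emeasure N2 (A \<times> B)"
   unfolding N2_def by (rule emeasure_bind[symmetric, OF not_empty k2']) auto
  finally show ?thesis .
 qed
 have s2: "sets N2 = sets ?Q" unfolding N2_def by (rule sets_bind[OF _ not_empty]) (simp)
 have "N1 = N2"
 proof (rule measure_eqI_generator_eq[OF Int_stable_pair_measure_generator[of ?P ?P]])
  show "{a \<times> b |a b. a \<in> sets ?P \<and> b \<in> sets ?P} \<subseteq> Pow (space ?P \<times> space ?P)"
   using sets.sets_into_space by blast
  show "X \<in> {a \<times> b |a b. a \<in> sets ?P \<and> b \<in> sets ?P} ==> emeasure N1 X = emeasure N2 X" for X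
   using eq by auto
  show "sets N1 = sigma_sets (space ?P \<times> space ?P) {a \<times> b |a b. a \<in> sets ?P \<and> b \<in> sets ?P}"
   by (simp add: N1_def sets_pair_measure)
  show "sets N2 = sigma_sets (space ?P \<times> space ?P) {a \<times> b |a b. a \<in> sets ?P \<and> b \<in> sets ?P}"
   by (simp add: s2 sets_pair_measure)
  show "range (\<lambda>_::nat. space ?P \<times> space ?P) \<subseteq> {a \<times> b |a b. a \<in> sets ?P \<and> b \<in> sets ?P}" by blast
  show "(\<Union>i::nat. space ?P \<times> space ?P) = space ?P \<times> space ?P" by simp
  have "prob_space N1" unfolding N1_def by (rule prob_space_distr) measurable
  then show "emeasure N1 (space ?P \<times> space ?P) \<noteq> \<infinity>" for i :: nat
   using finite_measure.emeasure_finite[OF prob_space.axioms(1)] by auto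
 qed
 then have "(\<integral>\<^sup>+z. F z \<partial>N1) = (\<integral>\<^sup>+z. F z \<partial>N2)" by simp
 also have "(\<integral>\<^sup>+z. F z \<partial>N1) = (\<integral>\<^sup>+w. F (stopp s w, shiftp w s) \<partial>Yl x)"
  unfolding N1_def by (rule nn_integral_distr) measurable
 also have "(\<integral>\<^sup>+z. F z \<partial>N2) = (\<integral>\<^sup>+w. \<integral>\<^sup>+z. F z \<partial>distr (PiD Yl (w s)) ?Q (\<lambda>xi. (stopp s w, xi)) \<partial>Yl x)"
  unfolding N2_def by (rule nn_integral_bind[OF F k2'])
 also have "... = (\<integral>\<^sup>+w. \<integral>\<^sup>+xi. F (stopp s w, xi) \<partial>PiD Yl (w s) \<partial>Yl x)"
 proof (rule nn_integral_cong)
  fix w assume "w \<in> space (Yl x)"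
  then have [simp]: "stopp s w \<in> hpaths" using stopp_hpaths s by auto
  show "(\<integral>\<^sup>+z. F z \<partial>distr (PiD Yl (w s)) ?Q (\<lambda>xi. (stopp s w, xi))) = (\<integral>\<^sup>+xi. F (stopp s w, xi) \<partial>PiD Yl (w s))"
   by (rule nn_integral_distr) auto
 qed
 finally show ?thesis .
qed

end

section \<open>Additive functionals along one path\<close>

definition Ib :: "(real => real) => real => real" where
 "Ib b t = (LINT r:{0..t}|lborel. b r)"

text \<open>Death times are analysed for one frozen path, so a rate is just a function of time. The
  bound \<open>K\<close> makes its primitive Lipschitz; besides measurability no regularity of the
  rate in time is available.\<close>

locale rate =
 fixes b :: "real => real" and K :: real
 assumes bm[measurable]: "b \<in> borel_measurable borel" and b_nonneg: "\<And>r. 0 <= b r" and b_le: "\<And>r. b r <= K"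
begin

lemma K_nonneg: "0 <= K" using b_nonneg[of 0] b_le[of 0] by simp

lemma set_int: "set_integrable lborel {s..t} b"
proof (rule set_integrable_bound[where f="\<lambda>_. K"])
 show "set_integrable lborel {s..t} (\<lambda>_. K)" unfolding set_integrable_def by (intro integrable_scaleR_left integrable_real_indicator) (auto simp: emeasure_lborel_Icc_eq)
qed (use b_nonneg b_le K_nonneg in \<open>auto simp: set_borel_measurable_def intro!: AE_I2\<close>)

lemma set_int': "set_integrable lborel {s<..t} b"
 by (rule set_integrable_subset[OF set_int[of s t]]) auto

lemma Ib_0: "t <= 0 ==> Ib b t = 0"
proof -
 assume "t <= 0"
 then have "{0..t} = {} \<or> {0..t} = {0}" by auto
 then show ?thesis unfolding Ib_def set_lebesgue_integral_def
  by (auto intro!: integral_eq_zero_AE AE_I[where N="{0}"] simp: indicator_def split: if_splits)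
qed

lemma ennreal_Ib: "ennreal (Ib b t) = (\<integral>\<^sup>+r. ennreal (b r) * indicator {0..t} r \<partial>lborel)"
proof -
 have "(\<integral>\<^sup>+r. ennreal (b r) * indicator {0..t} r \<partial>lborel) = (\<integral>\<^sup>+r. ennreal (indicator {0..t} r *\<^sub>R b r) \<partial>lborel)"
  by (intro nn_integral_cong) (auto split: split_indicator)
 also have "... = ennreal (Ib b t)"
  unfolding Ib_def set_lebesgue_integral_def
  by (rule nn_integral_eq_integral) (use set_int[of 0 t] b_nonneg in \<open>auto simp: set_integrable_def intro!: AE_I2\<close>)
 finally show ?thesis by simp
qed

lemma Ib_split: "0 <= s ==> s <= t ==> Ib b t = Ib b s + (LINT r:{s<..t}|lborel. b r)"
proof -
 assume "0 <= s" "s <= t"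
 then have eq: "{0..t} = {0..s} \<union> {s<..t}" by auto
 show ?thesis unfolding Ib_def eq
  by (rule set_integral_Un) (use set_int[of 0 s] set_int'[of s t] in auto)
qed

lemma Ib_incr: assumes "0 <= s" "s <= t" shows "Ib b s <= Ib b t" "Ib b t - Ib b s <= K * (t - s)"
proof -
 have "0 <= (LINT r:{s<..t}|lborel. b r)"
  unfolding set_lebesgue_integral_def by (intro Bochner_Integration.integral_nonneg) (use b_nonneg in auto)
 then show "Ib b s <= Ib b t" using Ib_split[OF assms] by simp
 have "(LINT r:{s<..t}|lborel. b r) <= (LINT r:{s<..t}|lborel. K)"
  by (rule set_integral_mono[OF set_int']) (use b_le assms in \<open>auto simp: set_integrable_def intro!: integrable_scaleR_left integrable_real_indicator simp del: integrable_mult_left_iff\<close>)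
 also have "... = K * (t - s)" using assms by (simp add: set_lebesgue_integral_def)
 finally show "Ib b t - Ib b s <= K * (t - s)" using Ib_split[OF assms] by simp
qed

lemma Ib_mono: "s <= t ==> Ib b s <= Ib b t"
 using Ib_incr(1)[of s t] Ib_incr(1)[of 0 t] Ib_0[of s] Ib_0[of t] Ib_0[of 0] by (cases "0 <= s"; cases "0 <= t") auto

lemma Ib_nonneg: "0 <= Ib b t" using Ib_mono[of 0 t] Ib_mono[of t 0] Ib_0[of 0] Ib_0[of t] by (cases "0 <= t") auto

lemma Ib_le: "0 <= t ==> Ib b t <= K * t" using Ib_incr(2)[of 0 t] Ib_0[of 0] by simp

lemma Ib_lipschitz: "\<bar>Ib b t - Ib b s\<bar> <= K * \<bar>t - s\<bar>"
proof -
 have *: "\<bar>Ib b t - Ib b s\<bar> <= K * \<bar>t - s\<bar>" if st: "s <= t" for s t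
 proof -
  consider "0 <= s" | "s < 0" "0 <= t" | "t < 0" by linarith
  then show ?thesis
  proof cases
   case 1 then show ?thesis using Ib_incr[of s t] st by auto
  next
   case 2
   have "K * t <= K * (t - s)" by (rule mult_left_mono) (use 2 K_nonneg in auto)
   then show ?thesis using Ib_le[of t] Ib_0[of s] Ib_nonneg[of t] 2 st by auto
  next
   case 3 then show ?thesis using Ib_0[of s] Ib_0[of t] K_nonneg st by auto
  qed
 qed
 show ?thesis using *[of s t] *[of t s] by (cases "s <= t") (auto simp: abs_minus_commute)
qed

lemma Ib_cont: "continuous_on UNIV (Ib b)"
proof (rule continuous_onI)
 fix x e :: real assume "0 < e"
 have "dist (Ib b x') (Ib b x) <= e" if d: "dist x' x < e / (K + 1)" for x'
 proof -
  have "\<bar>Ib b x' - Ib b x\<bar> <= K * \<bar>x' - x\<bar>" by (rule Ib_lipschitz)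
  also have "... <= K * (e / (K+1))" using d K_nonneg by (intro mult_left_mono) (auto simp: dist_real_def)
  also have "... <= e" using K_nonneg \<open>0 < e\<close> by (simp add: field_simps)
  finally show ?thesis by (simp add: dist_real_def)
 qed
 then show "\<exists>d>0. \<forall>x'\<in>UNIV. dist x' x < d \<longrightarrow> dist (Ib b x') (Ib b x) <= e"
  using \<open>0 < e\<close> K_nonneg by (intro exI[of _ "e / (K+1)"]) auto
qed

lemma Ib_measurable[measurable]: "Ib b \<in> borel_measurable borel"
 by (rule borel_measurable_continuous_onI[OF Ib_cont])

text \<open>Substitution e = \<open>Ib b r\<close>: the image of b dr under its own primitive is
  Lebesgue measure on the range. Since \<open>b\<close> is merely measurable and \<open>Ib b\<close>
  may have flat stretches, there is no inverse function; both measures are compared on half-lines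
  instead.\<close>

lemma distr_Ib:
 assumes "0 <= t"
 shows "distr (density lborel (\<lambda>r. ennreal (b r) * indicator {0..t} r)) borel (Ib b)
    = density lborel (indicator {0..Ib b t})"
proof (rule measure_eqI_lessThan)
 let ?M = "distr (density lborel (\<lambda>r. ennreal (b r) * indicator {0..t} r)) borel (Ib b)"
 let ?N = "density lborel (indicator {0..Ib b t} :: real => ennreal)"
 have M: "emeasure ?M {c<..} = (\<integral>\<^sup>+r. ennreal (b r) * indicator {r\<in>{0..t}. c < Ib b r} r \<partial>lborel)" for c
 proof -
  have "Ib b -` {c<..} \<in> sets borel" using measurable_sets[OF Ib_measurable, of "{c<..}"] by simp
  then show ?thesis
   by (subst emeasure_distr) (auto simp: emeasure_density intro!: nn_integral_cong split: split_indicator)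
 qed
 show "emeasure ?M {c<..} < \<infinity>" for c
 proof -
  have "emeasure ?M {c<..} <= (\<integral>\<^sup>+r. ennreal (b r) * indicator {0..t} r \<partial>lborel)"
   unfolding M by (intro nn_integral_mono) (auto split: split_indicator)
  also have "... < \<infinity>" unfolding ennreal_Ib[symmetric] by simp
  finally show ?thesis .
 qed
 show "emeasure ?M {c<..} = emeasure ?N {c<..}" for c
 proof -
  have N: "emeasure ?N {c<..} = emeasure lborel ({0..Ib b t} \<inter> {c<..})"
   by (subst emeasure_density) (auto simp: nn_integral_indicator[symmetric] simp del: nn_integral_indicator intro!: nn_integral_cong split: split_indicator)
  consider "c < 0" | "0 <= c" "c < Ib b t" | "Ib b t <= c" by linarith
  then show ?thesis
  proof cases
   case 1
   then have "{r\<in>{0..t}. c < Ib b r} = {0..t}" "{0..Ib b t} \<inter> {c<..} = {0..Ib b t}"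
    using Ib_nonneg less_le_trans by auto
   then show ?thesis unfolding M N using Ib_nonneg[of t] by (simp add: ennreal_Ib)
  next
   case 3
   have "\<And>r. r <= t ==> \<not> c < Ib b r" using Ib_mono[of _ t] 3 by force
   then have "{r\<in>{0..t}. c < Ib b r} = {}" "{0..Ib b t} \<inter> {c<..} = {}" using 3 by auto
   then show ?thesis unfolding M N by simp
  next
   case 2
   \<comment> \<open>Its supremum \<open>r1\<close> is the last time at level at most
     \<open>c\<close>; by the intermediate value theorem the level there is exactly
     \<open>c\<close>, so the half-line pulls back to the interval after \<open>r1\<close>.\<close>
   define S where "S = {r\<in>{0..t}. Ib b r <= c}"
   have "S = {0..t} \<inter> {r. Ib b r <= c}" unfolding S_def by auto
   then have "closed S"
    using closed_Collect_le[OF Ib_cont, of "\<lambda>_. c"] by (auto intro!: closed_Int)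
   have "0 \<in> S" using Ib_0[of 0] 2 assms by (simp add: S_def)
   have bdd: "bdd_above S" unfolding S_def by auto
   define r1 where "r1 = Sup S"
   have r1: "r1 \<in> S" unfolding r1_def using closed_contains_Sup[OF _ bdd \<open>closed S\<close>] \<open>0 \<in> S\<close> by blast
   have eqS: "{r\<in>{0..t}. c < Ib b r} = {r1<..t}"
   proof safe
    fix r assume "r \<in> {0..t}" "c < Ib b r"
    then show "r \<in> {r1<..t}" using r1 Ib_mono[of r r1] by (force simp: S_def)
   next
    fix r assume r: "r \<in> {r1<..t}"
    show "c < Ib b r"
    proof (rule ccontr)
     assume "\<not> c < Ib b r" then have "r \<in> S" using r r1 by (auto simp: S_def)
     then show False using cSup_upper[OF _ bdd] r r1_def by force
    qed
    show "r \<in> {0..t}" using r r1 by (auto simp: S_def)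
   qed
   have r1c: "Ib b r1 = c"
   proof -
    obtain r0 where r0: "0 <= r0" "r0 <= t" "Ib b r0 = c"
     using IVT'[of "Ib b" 0 c t] 2 Ib_0[of 0] assms continuous_on_subset[OF Ib_cont] by auto
    then have "r0 \<in> S" by (simp add: S_def)
    then have "r0 <= r1" unfolding r1_def by (rule cSup_upper[OF _ bdd])
    then show ?thesis using Ib_mono[of r0 r1] r0 r1 by (auto simp: S_def)
   qed
   have "emeasure ?M {c<..} = (\<integral>\<^sup>+r. ennreal (b r) * indicator {r1<..t} r \<partial>lborel)"
    unfolding M eqS ..
   also have "... = (\<integral>\<^sup>+r. ennreal (indicator {r1<..t} r *\<^sub>R b r) \<partial>lborel)"
    by (intro nn_integral_cong) (auto split: split_indicator)
   also have "... = ennreal (LINT r:{r1<..t}|lborel. b r)"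
    unfolding set_lebesgue_integral_def
    by (rule nn_integral_eq_integral) (use set_int'[of r1 t] b_nonneg in \<open>auto simp: set_integrable_def intro!: AE_I2\<close>)
   also have "(LINT r:{r1<..t}|lborel. b r) = Ib b t - c"
    using Ib_split[of r1 t] r1 r1c by (auto simp: S_def)
   also have "{0..Ib b t} \<inter> {c<..} = {c<..Ib b t}" using 2 by auto
   then have "ennreal (Ib b t - c) = emeasure ?N {c<..}" unfolding N using 2 by simp
   finally show ?thesis .
  qed
 qed
qed auto

lemma nn_integral_Ib:
 assumes "0 <= t" and [measurable]: "F \<in> borel_measurable borel"
 shows "(\<integral>\<^sup>+r. F (Ib b r) * ennreal (b r) * indicator {0..t} r \<partial>lborel)
    = (\<integral>\<^sup>+e. F e * indicator {0..Ib b t} e \<partial>lborel)"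
proof -
 have "(\<integral>\<^sup>+e. F e \<partial>distr (density lborel (\<lambda>r. ennreal (b r) * indicator {0..t} r)) borel (Ib b))
   = (\<integral>\<^sup>+e. F e \<partial>density lborel (indicator {0..Ib b t}))"
  unfolding distr_Ib[OF assms(1)] ..
 then show ?thesis
  by (subst (asm) nn_integral_distr) (auto simp: nn_integral_density ac_simps)
qed

text \<open>This is the passage from generation \<open>n\<close> to \<open>Suc n\<close> in the
  expansion of the mean by generations: after the substitution it is the integral of a power, and it
  builds up the terms of an exponential series.\<close>

lemma nn_integral_Ib_power:
 assumes "0 <= t"
 shows "(\<integral>\<^sup>+r. ennreal (b r * (Ib b t - Ib b r) ^ n / fact n) * indicator {0..t} r \<partial>lborel)
    = ennreal ((Ib b t) ^ Suc n / fact (Suc n))"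
proof -
 let ?I = "Ib b t"
 have "(\<integral>\<^sup>+r. ennreal (b r * (?I - Ib b r) ^ n / fact n) * indicator {0..t} r \<partial>lborel)
   = (\<integral>\<^sup>+r. ennreal ((?I - Ib b r) ^ n / fact n) * ennreal (b r) * indicator {0..t} r \<partial>lborel)"
 proof (rule nn_integral_cong)
  fix r show "ennreal (b r * (?I - Ib b r) ^ n / fact n) * indicator {0..t} r
   = ennreal ((?I - Ib b r) ^ n / fact n) * ennreal (b r) * indicator {0..t} r"
  proof (cases "r \<in> {0..t}")
   case True
   then have "0 <= ?I - Ib b r" using Ib_mono[of r t] by simp
   then show ?thesis using b_nonneg[of r] by (simp add: ennreal_mult'[symmetric] mult.commute)
  qed simp
 qed
 also have "... = (\<integral>\<^sup>+e. ennreal ((?I - e) ^ n / fact n) * indicator {0..?I} e \<partial>lborel)"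
  by (rule nn_integral_Ib[OF assms, of "\<lambda>e. ennreal ((?I - e) ^ n / fact n)"]) measurable
 also have "... = ennreal (- ((?I - ?I) ^ Suc n / fact (Suc n)) - - ((?I - 0) ^ Suc n / fact (Suc n)))"
 proof (rule nn_integral_FTC_Icc)
  fix x assume x: "x \<in> {0..?I}"
  have "((\<lambda>a. (?I - a) ^ Suc n) has_real_derivative - (real (Suc n) * (?I - x) ^ n)) (at x)"
   by (auto intro!: derivative_eq_intros simp del: power_Suc of_nat_Suc)
  from DERIV_minus[OF DERIV_cdivide[OF this, of "fact (Suc n)"]]
  show "((\<lambda>a. - ((?I - a) ^ Suc n / fact (Suc n))) has_real_derivative (?I - x) ^ n / fact n) (at x)"
   by (simp add: fact_Suc del: of_nat_Suc power_Suc)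
  show "0 <= (?I - x) ^ n / fact n" using x by simp
 qed (use Ib_nonneg in auto)
 finally show ?thesis by simp
qed

end

subsection \<open>The first passage time of an additive functional\<close>

definition tauf :: "(real => real) => real => ennreal" where
 "tauf b e = Inf (ennreal ` {s. 0 <= s \<and> Ib b s > e})"

context rate
begin

lemma tauf_less: "0 <= e ==> e < Ib b t ==> tauf b e < ennreal t"
proof -
 assume e: "0 <= e" "e < Ib b t"
 then have t: "0 < t" using Ib_0[of t] by force
 obtain s where s: "0 <= s" "s <= t" "Ib b s = (e + Ib b t)/2"
  using IVT'[of "Ib b" 0 "(e + Ib b t)/2" t] e Ib_0[of 0] t continuous_on_subset[OF Ib_cont] by auto
 then have "s < t" "e < Ib b s" using e by (auto simp: less_le)
 have "tauf b e <= ennreal s" unfolding tauf_def using \<open>e < Ib b s\<close> s by (intro Inf_lower) auto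
 also have "... < ennreal t" using \<open>s < t\<close> s by (simp add: ennreal_less_iff)
 finally show ?thesis .
qed

lemma tauf_ge: "Ib b t <= e ==> ennreal t <= tauf b e"
 unfolding tauf_def
proof (rule Inf_greatest)
 fix x assume a: "Ib b t <= e" "x \<in> ennreal ` {s. 0 <= s \<and> e < Ib b s}"
 then obtain s where "x = ennreal s" "0 <= s" "e < Ib b s" by auto
 then have "t <= s" using a(1) Ib_mono[of s t] by (meson le_less_trans not_le order.strict_trans1 less_imp_le)
 then show "ennreal t <= x" using \<open>x = ennreal s\<close> by (simp add: ennreal_leI)
qed

lemma tauf_gt: "0 <= t ==> Ib b t < e ==> ennreal t < tauf b e"
proof -
 assume t: "0 <= t" "Ib b t < e"
 define d where "d = (e - Ib b t) / (K + 1)"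
 have "d > 0" using t K_nonneg by (simp add: d_def)
 have "Ib b (t + d) - Ib b t <= K * d" using Ib_incr(2)[of t "t + d"] t \<open>d > 0\<close> by simp
 also have "... <= e - Ib b t" using K_nonneg t by (simp add: d_def field_simps)
 finally have "ennreal (t + d) <= tauf b e" by (intro tauf_ge) simp
 moreover have "ennreal t < ennreal (t + d)" using t \<open>d > 0\<close> by (simp add: ennreal_less_iff)
 ultimately show ?thesis by simp
qed

lemma tauf_measurable[measurable]: "tauf b \<in> borel_measurable borel"
proof (rule borel_measurableI_less)
 fix y :: ennreal
 have "{e \<in> space borel. tauf b e < y} = (\<Union>s\<in>{s. 0 <= s \<and> ennreal s < y}. {..<Ib b s})"
  unfolding tauf_def by (auto simp: Inf_less_iff)
 then show "{e \<in> space borel. tauf b e < y} \<in> sets borel" by (auto intro!: borel_open)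
qed

text \<open>The passage time inverts \<open>Ib b\<close> except where \<open>Ib b\<close> stays flat
  to the right of \<open>r\<close>. In that case \<open>r\<close> has the same level as some later
  rational, and for each rational the set of such \<open>r\<close> is null for b dr, because its
  image under \<open>Ib b\<close> is a single level.\<close>

lemma AE_tauf_Ib:
 assumes "0 <= t"
 shows "AE r in lborel. r \<in> {0..t} \<longrightarrow> b r \<noteq> 0 \<longrightarrow> tauf b (Ib b r) = ennreal r"
proof -
 have 1: "AE r in lborel. r \<in> {0..real_of_rat q} \<longrightarrow> b r \<noteq> 0 \<longrightarrow> Ib b r \<noteq> Ib b (real_of_rat q)" if q: "0 <= real_of_rat q" for q
 proof -
  let ?q = "real_of_rat q"
  have "(\<integral>\<^sup>+r. indicator {Ib b ?q} (Ib b r) * ennreal (b r) * indicator {0..?q} r \<partial>lborel)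
    = (\<integral>\<^sup>+e. indicator {Ib b ?q} e * indicator {0..Ib b ?q} e \<partial>lborel)"
   by (rule nn_integral_Ib[OF q]) measurable
  also have "... = (\<integral>\<^sup>+e. indicator {Ib b ?q} e \<partial>lborel)"
   using Ib_nonneg[of ?q] by (intro nn_integral_cong) (auto split: split_indicator)
  also have "... = 0" by simp
  finally have "AE r in lborel. indicator {Ib b ?q} (Ib b r) * ennreal (b r) * indicator {0..?q} r = 0"
   by (subst (asm) nn_integral_0_iff_AE) auto
  then show ?thesis
   by eventually_elim (use b_nonneg in \<open>auto simp: ennreal_eq_0_iff indicator_def dest: antisym split: if_splits\<close>)
 qed
 have "AE r in lborel. \<forall>q. 0 <= real_of_rat q \<longrightarrow> r \<in> {0..real_of_rat q} \<longrightarrow> b r \<noteq> 0 \<longrightarrow> Ib b r \<noteq> Ib b (real_of_rat q)"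
  unfolding AE_all_countable using 1 by auto
 then show ?thesis
 proof (eventually_elim, intro impI)
  fix r assume *: "\<forall>q. 0 <= real_of_rat q \<longrightarrow> r \<in> {0..real_of_rat q} \<longrightarrow> b r \<noteq> 0 \<longrightarrow> Ib b r \<noteq> Ib b (real_of_rat q)"
   and r: "r \<in> {0..t}" "b r \<noteq> 0"
  show "tauf b (Ib b r) = ennreal r"
  proof (rule antisym[OF _ tauf_ge], rule ccontr)
   assume "\<not> tauf b (Ib b r) <= ennreal r"
   then have "ennreal r < tauf b (Ib b r)" by simp
   then obtain u where u: "ennreal r < u" "u < tauf b (Ib b r)" using dense by blast
   then have "u < \<top>" by (auto simp: less_top[symmetric])
   then obtain v where v: "u = ennreal v" "0 <= v" by (cases u) auto
   then have "r < v" using u r by (simp add: ennreal_less_iff)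
   then obtain q where q: "r < real_of_rat q" "real_of_rat q < v" using of_rat_dense by blast
   have "\<not> Ib b r < Ib b (real_of_rat q)"
   proof
    assume "Ib b r < Ib b (real_of_rat q)"
    have "0 <= r" using r by simp
    then have "0 <= real_of_rat q" using q(1) by linarith
    note [simp del] = zero_le_of_rat_iff
    then have "tauf b (Ib b r) <= ennreal (real_of_rat q)" unfolding tauf_def using \<open>0 <= real_of_rat q\<close> \<open>Ib b r < Ib b (real_of_rat q)\<close> by (intro Inf_lower imageI) auto
    also have "... <= u" unfolding v using q by (intro ennreal_leI) simp
    finally show False using u by simp
   qed
   then have "Ib b r = Ib b (real_of_rat q)" using Ib_mono[of r "real_of_rat q"] q by simp
   moreover have "0 <= r" using r by simp
   then have q0: "0 <= real_of_rat q" using q(1) by linarith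
   moreover have "r \<in> {0..real_of_rat q}" using q(1) \<open>0 <= r\<close> by simp
   ultimately show False using *[rule_format, of q] r(2) by metis
  qed simp
 qed
qed

text \<open>The death time has density b exp (- Ib b): the exponential level is pulled back through
  \<open>Ib b\<close>. The two indicators can differ only at the level \<open>Ib b t\<close>, which
  is one point.\<close>

lemma nn_integral_death:
 assumes t: "0 <= t" and [measurable]: "h \<in> borel_measurable borel"
 shows "(\<integral>\<^sup>+e. ennreal (exponential_density 1 e) * (if tauf b e <= ennreal t then h (enn2real (tauf b e)) else 0) \<partial>lborel)
    = (\<integral>\<^sup>+r. h r * ennreal (b r * exp (- Ib b r)) * indicator {0..t} r \<partial>lborel)"
proof -
 have "(\<integral>\<^sup>+r. h r * ennreal (b r * exp (- Ib b r)) * indicator {0..t} r \<partial>lborel)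
   = (\<integral>\<^sup>+r. (h (enn2real (tauf b (Ib b r))) * ennreal (exp (- Ib b r))) * ennreal (b r) * indicator {0..t} r \<partial>lborel)"
  using AE_tauf_Ib[OF t]
  by (intro nn_integral_cong_AE, eventually_elim) (auto simp: ennreal_mult' b_nonneg ac_simps split: split_indicator)
 also have "... = (\<integral>\<^sup>+e. (h (enn2real (tauf b e)) * ennreal (exp (- e))) * indicator {0..Ib b t} e \<partial>lborel)"
  by (rule nn_integral_Ib[OF t, of "\<lambda>e. h (enn2real (tauf b e)) * ennreal (exp (- e))"]) measurable
 also have "... = (\<integral>\<^sup>+e. ennreal (exponential_density 1 e) * (if tauf b e <= ennreal t then h (enn2real (tauf b e)) else 0) \<partial>lborel)"
 proof (rule nn_integral_cong_AE)
  have "AE e in lborel. e \<noteq> Ib b t" by (rule AE_lborel_singleton)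
  then show "AE e in lborel. (h (enn2real (tauf b e)) * ennreal (exp (- e))) * indicator {0..Ib b t} e
    = ennreal (exponential_density 1 e) * (if tauf b e <= ennreal t then h (enn2real (tauf b e)) else 0)"
  proof eventually_elim
   fix e assume "e \<noteq> Ib b t"
   then consider "e < 0" | "0 <= e" "e < Ib b t" | "Ib b t < e" by linarith
   then show "(h (enn2real (tauf b e)) * ennreal (exp (- e))) * indicator {0..Ib b t} e
    = ennreal (exponential_density 1 e) * (if tauf b e <= ennreal t then h (enn2real (tauf b e)) else 0)"
   proof cases
    case 1 then show ?thesis by (simp add: exponential_density_def)
   next
    case 2 then show ?thesis using tauf_less[of e t] by (simp add: exponential_density_def less_imp_le mult.commute)
   next
    case 3 then show ?thesis using tauf_gt[OF t, of e] by (simp add: not_le)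
   qed
  qed
 qed
 finally show ?thesis by simp
qed

lemma Ib_add:
 assumes s: "0 <= s" "0 <= t" and b': "\<And>r. 0 <= r ==> b' r = b (s + r)"
 shows "Ib b (s + t) = Ib b s + Ib b' t"
proof -
 have "(LINT r:{s<..s+t}|lborel. b r) = (LINT r:{s..s+t}|lborel. b r)"
  unfolding set_lebesgue_integral_def
  by (rule integral_cong_AE) (auto intro!: AE_I[where N="{s}"] split: split_indicator)
 also have "... = (\<integral>r. indicator {s..s+t} (s + 1 * r) *\<^sub>R b (s + 1 * r) \<partial>lborel)"
  unfolding set_lebesgue_integral_def
  using lborel_integral_real_affine[of 1 "\<lambda>r. indicator {s..s+t} r *\<^sub>R b r" s] by simp
 also have "... = Ib b' t" unfolding Ib_def set_lebesgue_integral_def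
  by (rule Bochner_Integration.integral_cong) (auto simp: b' split: split_indicator)
 finally show ?thesis using Ib_split[of s "s + t"] s by simp
qed

text \<open>Lack of memory of the exponential clock. Given survival beyond \<open>s\<close>, the
  excess of the level over \<open>Ib b s\<close> is again exponential, and the residual lifetime is
  the passage time of the shifted rate \<open>b'\<close> over that excess.\<close>

lemma nn_integral_memoryless:
 assumes s: "0 <= s" and b': "rate b' K" "\<And>r. 0 <= r ==> b' r = b (s + r)"
  and [measurable]: "g \<in> borel_measurable borel"
 shows "(\<integral>\<^sup>+e. ennreal (exponential_density 1 e) * (if tauf b e > ennreal s then g (tauf b e - ennreal s) else 0) \<partial>lborel)
    = ennreal (exp (- Ib b s)) * (\<integral>\<^sup>+e. ennreal (exponential_density 1 e) * g (tauf b' e) \<partial>lborel)"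
proof -
 interpret b': rate b' K by fact
 let ?I = "Ib b s"
 have tau: "tauf b (?I + e) = ennreal s + tauf b' e" if e: "0 <= e" for e
 proof -
  have set_eq: "{u. 0 <= u \<and> Ib b u > ?I + e} = (\<lambda>u. s + u) ` {u. 0 <= u \<and> Ib b' u > e}"
  proof safe
   fix u assume u: "0 <= u" "Ib b u > ?I + e"
   then have "s <= u" using Ib_mono[of u s] e by force
   then have "Ib b u = ?I + Ib b' (u - s)" using Ib_add[OF s _ b'(2), of "u - s"] by simp
   then show "u \<in> (\<lambda>u. s + u) ` {u. 0 <= u \<and> Ib b' u > e}" using u \<open>s <= u\<close>
    by (intro image_eqI[of _ _ "u - s"]) auto
  qed (use s Ib_add[OF s _ b'(2)] in auto)
  have "tauf b (?I + e) = (INF u\<in>{u. 0 <= u \<and> Ib b' u > e}. ennreal s + ennreal u)"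
   unfolding tauf_def set_eq image_image using s by (intro INF_cong) auto
  also have "... = ennreal s + tauf b' e"
  proof (cases "{u. 0 <= u \<and> Ib b' u > e} = {}")
   case True then show ?thesis unfolding tauf_def by (simp only: image_empty) simp
  next
   case False
   then show ?thesis unfolding tauf_def
    using continuous_at_Inf_mono[of "\<lambda>x. ennreal s + x" "ennreal ` {u. 0 <= u \<and> Ib b' u > e}"]
     continuous_add[of "at_right (Inf (ennreal ` {u. 0 <= u \<and> Ib b' u > e}))" "\<lambda>x. ennreal s" "\<lambda>x. x"]
    by (simp add: mono_def image_comp add_left_mono o_def)
  qed
  finally show ?thesis .
 qed
 define F where "F e = ennreal (exponential_density 1 e) * (if tauf b e > ennreal s then g (tauf b e - ennreal s) else 0)" for e
 have [measurable]: "F \<in> borel_measurable borel" unfolding F_def by measurable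
 have "(\<integral>\<^sup>+e. F e \<partial>lborel) = (\<integral>\<^sup>+e. F (?I + 1 * e) \<partial>lborel)"
  using nn_integral_real_affine[of F 1 ?I] by simp
 also have "... = (\<integral>\<^sup>+e. ennreal (exp (- ?I)) * (ennreal (exponential_density 1 e) * g (tauf b' e)) \<partial>lborel)"
 proof (rule nn_integral_cong_AE)
  \<comment> \<open>At zero excess, survival beyond \<open>s\<close> depends on whether
    \<open>Ib b\<close> is flat just after \<open>s\<close>; the point is discarded as a null
    set.\<close>
  have "AE e in lborel. e \<noteq> (0::real)" by (rule AE_lborel_singleton)
  then show "AE e in lborel. F (?I + 1 * e)
    = ennreal (exp (- ?I)) * (ennreal (exponential_density 1 e) * g (tauf b' e))"
  proof eventually_elim
   fix e :: real assume "e \<noteq> 0"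
   show "F (?I + 1 * e)
    = ennreal (exp (- ?I)) * (ennreal (exponential_density 1 e) * g (tauf b' e))"
   proof (cases "0 < e")
    case True
    have "exp (- ?I - e) = exp (- ?I) * exp (- e)" by (simp add: exp_diff exp_minus divide_inverse)
    then have 1: "ennreal (exponential_density 1 (?I + 1 * e)) = ennreal (exp (- ?I)) * ennreal (exponential_density 1 e)"
     using True Ib_nonneg[of s] by (simp add: exponential_density_def ennreal_mult'[symmetric])
    have 2: "tauf b (?I + 1 * e) - ennreal s = tauf b' e" using tau[of e] True by simp
    have 3: "tauf b (?I + 1 * e) > ennreal s" using tauf_gt[OF s, of "?I + e"] True by simp
    show ?thesis unfolding F_def 1 2 using 3 by (simp only: if_True mult.assoc)
   next
    case False
    then have e: "e < 0" using \<open>e \<noteq> 0\<close> by simp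
    have "\<not> tauf b (?I + e) > ennreal s" if "0 <= ?I + e" using tauf_less[of "?I + e" s] that e by auto
    then show ?thesis using e by (auto simp: F_def exponential_density_def)
   qed
  qed
 qed
 also have "... = ennreal (exp (- ?I)) * (\<integral>\<^sup>+e. ennreal (exponential_density 1 e) * g (tauf b' e) \<partial>lborel)"
  by (rule nn_integral_cmult) measurable
 finally show ?thesis unfolding F_def .
qed

end

section \<open>Measurability of the branching mechanism\<close>

text \<open>Time is clipped at 0 because a path is unconstrained at negative times, whereas
  \<open>rate\<close> asks for measurability and bounds on the whole line.\<close>

definition vp :: "('a => real) => 'a path => real => real" where
 "vp V xi r = gD V (xi (max 0 r))"

lemma vp_measurable:
 fixes h :: "'b => 'a::metric_space path"
 assumes "V \<in> borel_measurable borel" "g \<in> borel_measurable M" "h \<in> M \<rightarrow>\<^sub>M path_space"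
 shows "(\<lambda>x. vp V (h x) (g x)) \<in> borel_measurable M"
 unfolding vp_def using measurable_compose[OF eval_measurable[OF assms(2,3)] gD_measurable[OF assms(1)]] by simp

lemma vp_measurable_time:
 assumes "V \<in> borel_measurable borel" "xi \<in> (hpaths :: 'a::metric_space path set)"
 shows "vp V xi \<in> borel_measurable borel"
 by (rule vp_measurable[OF assms(1), of "\<lambda>r. r" borel "\<lambda>_. xi", simplified]) (use assms(2) in auto)

lemma Ib_vp: "Ib (vp V xi) t = (LINT r:{0..t}|lborel. gD V (xi r))"
 unfolding Ib_def by (rule set_lebesgue_integral_cong) (auto simp: vp_def)

lemma Ib_vp_measurable:
 fixes h :: "'b => 'a::metric_space path"
 assumes V: "V \<in> borel_measurable borel" and g[measurable]: "g \<in> borel_measurable M" and h[measurable]: "h \<in> M \<rightarrow>\<^sub>M path_space"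
 shows "(\<lambda>x. Ib (vp V (h x)) (g x)) \<in> borel_measurable M"
proof -
 have [measurable]: "(\<lambda>z. vp V (h (fst z)) (snd z)) \<in> borel_measurable (M \<Otimes>\<^sub>M lborel)"
  by (rule vp_measurable[OF V]) measurable
 have "(\<lambda>x. \<integral>r. (if 0 <= r \<and> r <= g x then vp V (h x) r else 0) \<partial>lborel) \<in> borel_measurable M"
  by (rule sigma_finite_measure.borel_measurable_lebesgue_integral[OF sigma_finite_lborel]) (simp add: split_beta', measurable)
 also have "(\<lambda>x. \<integral>r. (if 0 <= r \<and> r <= g x then vp V (h x) r else 0) \<partial>lborel) = (\<lambda>x. Ib (vp V (h x)) (g x))"
  unfolding Ib_def set_lebesgue_integral_def
  by (intro ext Bochner_Integration.integral_cong) (auto split: split_indicator)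
 finally show ?thesis .
qed

lemma vp_shift: "0 <= s ==> 0 <= r ==> vp V (shiftp xi s) r = vp V xi (s + r)"
 by (simp add: vp_def shiftp_def)

lemma Ib_vp_stop: "s <= t ==> Ib (vp V (stopp t xi)) s = Ib (vp V xi) s"
 unfolding Ib_vp by (rule set_lebesgue_integral_cong) (auto simp: stopp_def)

text \<open>The family of all sibling subtrees is an infinite independent family whose law depends
  on the root. On a cylinder its law is a finite product of measurable functions of the root data,
  and cylinders generate.\<close>

lemma measurable_PiM_prob:
 fixes K :: "'i => 'b => 'c measure"
 assumes K: "\<And>i. K i \<in> M \<rightarrow>\<^sub>M prob_algebra N"
 shows "(\<lambda>x. PiM UNIV (\<lambda>i. K i x)) \<in> M \<rightarrow>\<^sub>M prob_algebra (PiM UNIV (\<lambda>_. N))"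
proof -
 have pK: "prob_space (K i x)" and sK: "sets (K i x) = sets N" if "x \<in> space M" for i x
  using measurable_space[OF K that, of i] by (auto simp: space_prob_algebra)
 show ?thesis
 proof (rule measurable_prob_algebra_generated[OF sets_PiM Int_stable_prod_algebra prod_algebra_sets_into_space])
  fix x assume x: "x \<in> space M"
  show "prob_space (Pi\<^sub>M UNIV (\<lambda>i. K i x))" by (rule prob_space_PiM) (rule pK[OF x])
  show "sets (Pi\<^sub>M UNIV (\<lambda>i. K i x)) = sets (Pi\<^sub>M UNIV (\<lambda>_. N))" by (rule sets_PiM_cong) (simp_all add: sK[OF x])
 next
  fix A assume "A \<in> prod_algebra UNIV (\<lambda>_::'i. N)"
  then obtain J F where A: "A = prod_emb UNIV (\<lambda>_. N) J (Pi\<^sub>E J F)" "finite J" "\<And>j. j \<in> J ==> F j \<in> sets N"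
   by (auto elim!: prod_algebraE)
  have "emeasure (Pi\<^sub>M UNIV (\<lambda>i. K i x)) A = (\<Prod>j\<in>J. emeasure (K j x) (F j))" if x: "x \<in> space M" for x
  proof -
   have "A = prod_emb UNIV (\<lambda>i. K i x) J (Pi\<^sub>E J F)"
    unfolding A(1) prod_emb_def using sets_eq_imp_space_eq[OF sK[OF x]] by simp
   then show ?thesis using A by (simp add: emeasure_PiM_emb pK[OF x] sK[OF x])
  qed
  moreover have "(\<lambda>x. \<Prod>j\<in>J. emeasure (K j x) (F j)) \<in> borel_measurable M"
  proof (rule borel_measurable_prod_ennreal)
   fix j assume "j \<in> J"
   then show "(\<lambda>x. emeasure (K j x) (F j)) \<in> borel_measurable M"
    using measurable_emeasure_kernel[OF measurable_prob_algebraD[OF K] A(3)] by simp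
  qed
  ultimately show "(\<lambda>a. emeasure (Pi\<^sub>M UNIV (\<lambda>i. K i a)) A) \<in> borel_measurable M"
   by (subst measurable_cong)
 qed
qed

text \<open>Replacing one coordinate by an independent copy leaves a product measure unchanged. This
  isolates the subtree of a single child, which is what an induction on labels needs.\<close>

lemma nn_integral_PiM_resample:
 fixes K :: "'i => 'c measure"
 assumes K: "\<And>i. prob_space (K i)" and F[measurable]: "F \<in> borel_measurable (PiM UNIV K)"
 shows "(\<integral>\<^sup>+wa. F wa \<partial>PiM UNIV K) = (\<integral>\<^sup>+wa. (\<integral>\<^sup>+y. F (wa(i := y)) \<partial>K i) \<partial>PiM UNIV K)"
proof -
 interpret Ki: prob_space "K i" by (rule K)
 interpret PK: prob_space "PiM UNIV K" by (rule prob_space_PiM) (rule K)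
 interpret pair_sigma_finite "K i" "PiM UNIV K" ..
 have m: "(\<lambda>(x, X). X(i := x)) \<in> K i \<Otimes>\<^sub>M PiM UNIV K \<rightarrow>\<^sub>M PiM UNIV K"
  unfolding split_beta' by (rule measurable_fun_upd[where J=UNIV]) auto
 have "PiM UNIV K = distr (K i \<Otimes>\<^sub>M PiM UNIV K) (PiM UNIV K) (\<lambda>(x, X). X(i := x))"
  using distr_pair_PiM_eq_PiM[of UNIV K i] K by (simp add: insert_absorb)
 then have "(\<integral>\<^sup>+wa. F wa \<partial>PiM UNIV K) = (\<integral>\<^sup>+wa. F wa \<partial>distr (K i \<Otimes>\<^sub>M PiM UNIV K) (PiM UNIV K) (\<lambda>(x, X). X(i := x)))"
  by simp
 also have "... = (\<integral>\<^sup>+z. F ((snd z)(i := fst z)) \<partial>(K i \<Otimes>\<^sub>M PiM UNIV K))"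
  by (subst nn_integral_distr[OF m]) (use F in \<open>simp_all add: split_beta'\<close>)
 also have "... = (\<integral>\<^sup>+wa. (\<integral>\<^sup>+y. F (wa(i := y)) \<partial>K i) \<partial>PiM UNIV K)"
  using measurable_compose[OF m F] by (subst nn_integral_snd[symmetric]) (auto simp: split_beta')
 finally show ?thesis .
qed

subsection \<open>Maps on trees\<close>

definition sub :: "'a tree => nat => 'a tree" where "sub w i = (\<lambda>v. w (i # v))"
definition rpath :: "'a tree => 'a path" where "rpath w = fst (w [])"
definition rlife :: "'a tree => ennreal" where "rlife w = fst (snd (w []))"
definition rnum :: "'a tree => nat" where "rnum w = snd (snd (w []))"
definition rtime :: "'a tree => real" where "rtime w = enn2real (rlife w)"
text \<open>Child \<open>i\<close> is really born: the test made in \<open>birth\<close>. A root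
  that is already in the cemetery at its death time leaves no children.\<close>

definition okc :: "'a tree => nat => bool" where
 "okc w i \<longleftrightarrow> i < rnum w \<and> rlife w < \<top> \<and> rpath w (rtime w) \<noteq> None"

lemmas r_defs = rpath_def rlife_def rnum_def rtime_def okc_def sub_def

lemma birth_Cons: "birth w (i # u) = (if okc w i then map_option (\<lambda>b. rtime w + b) (birth (sub w i) u) else None)"
 by (auto simp: r_defs split: prod.splits)

lemma pos_Nil: "pos w t [] = (if 0 <= t \<and> ennreal t < rlife w then rpath w t else None)"
 by (auto simp: pos_def r_defs split: prod.splits)

lemma pos_Cons: "pos w t (i # u) = (if okc w i then pos (sub w i) (t - rtime w) u else None)"
 unfolding pos_def birth_Cons
 by (auto simp: sub_def algebra_simps split: option.splits prod.splits)

declare birth.simps(2)[simp del]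

text \<open>The tree seen from the particle \<open>u\<close> at time \<open>s\<close> with its clock
  reset to 0: path shifted, remaining lifetime shortened, offspring kept. Time is always read on the
  clock of the current root, hence \<open>s - rtime w\<close> in the recursion; \<open>max 0\<close>
  keeps the shifted path admissible for negative \<open>s\<close>.\<close>

fun subT :: "real => nat list => 'a tree => 'a tree" where
 "subT s [] w = fun_upd w [] (shiftp (rpath w) (max 0 s), rlife w - ennreal s, rnum w)"
| "subT s (i # u) w = subT (s - rtime w) u (sub w i)"

text \<open>What is known when the future of \<open>u\<close> after \<open>s\<close> is hidden: its
  path is stopped, it never dies, has no children, and its descendants are overwritten by dummies.
  All other lines of descent are untouched.\<close>

fun killT :: "real => nat list => 'a tree => 'a tree" where
 "killT s [] w = graft (stopp (max 0 s) (rpath w), \<top>, 0) (\<lambda>_ _. dummyD)"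
| "killT s (i # u) w = graft (w []) ((sub w)(i := killT (s - rtime w) u (sub w i)))"

lemma graft_simps[simp]: "sub (graft d s) i = s i" "rpath (graft d s) = fst d" "rlife (graft d s) = fst (snd d)"
  "rnum (graft d s) = snd (snd d)" "rtime (graft d s) = enn2real (fst (snd d))"
 by (auto simp: r_defs)

lemma D_proj[measurable (raw)]:
 assumes "g \<in> M \<rightarrow>\<^sub>M D_space"
 shows "(\<lambda>x. fst (g x)) \<in> M \<rightarrow>\<^sub>M path_space" "(\<lambda>x. fst (snd (g x))) \<in> borel_measurable M"
  "(\<lambda>x. snd (snd (g x))) \<in> M \<rightarrow>\<^sub>M count_space UNIV"
proof -
 note [measurable] = assms[unfolded D_space_def]
 show "(\<lambda>x. fst (g x)) \<in> M \<rightarrow>\<^sub>M path_space" "(\<lambda>x. fst (snd (g x))) \<in> borel_measurable M"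
  "(\<lambda>x. snd (snd (g x))) \<in> M \<rightarrow>\<^sub>M count_space UNIV" by measurable
qed

lemma Pair_D[measurable (raw)]: "f \<in> M \<rightarrow>\<^sub>M path_space ==> g \<in> borel_measurable M ==> h \<in> M \<rightarrow>\<^sub>M count_space UNIV
  ==> (\<lambda>x. (f x, g x, h x)) \<in> M \<rightarrow>\<^sub>M D_space"
 unfolding D_space_def by (intro measurable_Pair)

lemma space_D: "space D_space = hpaths \<times> UNIV"
 unfolding D_space_def by (simp add: space_pair_measure)

lemma dummyD_space: "dummyD \<in> space D_space" using dead_path_hpaths by (auto simp: dummyD_def space_D)

lemma space_Omega: "space Omega_space = {w. \<forall>u. w u \<in> space D_space}"
 unfolding Omega_space_def by (auto simp: space_PiM)

lemma measurable_Omega_iff: "g \<in> M \<rightarrow>\<^sub>M Omega_space \<longleftrightarrow> (\<forall>u. (\<lambda>x. g x u) \<in> M \<rightarrow>\<^sub>M D_space)"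
proof
 assume "g \<in> M \<rightarrow>\<^sub>M Omega_space"
 from measurable_compose[OF this[unfolded Omega_space_def] measurable_component_singleton]
 show "\<forall>u. (\<lambda>x. g x u) \<in> M \<rightarrow>\<^sub>M D_space" by simp
next
 assume "\<forall>u. (\<lambda>x. g x u) \<in> M \<rightarrow>\<^sub>M D_space"
 then show "g \<in> M \<rightarrow>\<^sub>M Omega_space"
  unfolding Omega_space_def by (intro measurable_PiM_single') (auto dest: measurable_space)
qed

lemma Omega_app: "g \<in> M \<rightarrow>\<^sub>M Omega_space ==> (\<lambda>x. g x u) \<in> M \<rightarrow>\<^sub>M D_space"
 by (simp add: measurable_Omega_iff)

lemma sub_measurable[measurable (raw)]: "g \<in> M \<rightarrow>\<^sub>M Omega_space ==> (\<lambda>x. sub (g x) i) \<in> M \<rightarrow>\<^sub>M Omega_space"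
 unfolding measurable_Omega_iff sub_def by auto

lemma r_measurable[measurable (raw)]:
 assumes "g \<in> M \<rightarrow>\<^sub>M Omega_space"
 shows "(\<lambda>x. rpath (g x)) \<in> M \<rightarrow>\<^sub>M path_space" "(\<lambda>x. rlife (g x)) \<in> borel_measurable M"
  "(\<lambda>x. rnum (g x)) \<in> M \<rightarrow>\<^sub>M count_space UNIV" "(\<lambda>x. rtime (g x)) \<in> borel_measurable M"
 unfolding r_defs using Omega_app[OF assms] by measurable

lemma okc_measurable[measurable (raw)]:
 fixes g :: "'b => 'a::metric_space tree"
 assumes [measurable]: "g \<in> M \<rightarrow>\<^sub>M Omega_space" shows "Measurable.pred M (\<lambda>x. okc (g x) i)"
proof -
 have [measurable]: "(\<lambda>x. rpath (g x) (rtime (g x))) \<in> M \<rightarrow>\<^sub>M optB"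
  unfolding rtime_def by (rule eval_enn2real_measurable) measurable
 show ?thesis unfolding okc_def by measurable
qed

lemma graft_measurable[measurable (raw)]:
 assumes [measurable]: "d \<in> M \<rightarrow>\<^sub>M D_space" and s: "\<And>i. (\<lambda>x. s x i) \<in> M \<rightarrow>\<^sub>M Omega_space"
 shows "(\<lambda>x. graft (d x) (s x)) \<in> M \<rightarrow>\<^sub>M Omega_space"
 unfolding measurable_Omega_iff
proof
 fix u show "(\<lambda>x. graft (d x) (s x) u) \<in> M \<rightarrow>\<^sub>M D_space"
  using Omega_app[OF s] by (cases u) auto
qed

lemma pos_measurable:
 fixes g :: "'b => 'a::metric_space tree"
 assumes "f \<in> borel_measurable M" "g \<in> M \<rightarrow>\<^sub>M Omega_space"
 shows "(\<lambda>x. pos (g x) (f x) u) \<in> M \<rightarrow>\<^sub>M optB"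
 using assms
proof (induction u arbitrary: f g)
 case Nil
 note [measurable] = Nil
 have [measurable]: "(\<lambda>x. rpath (g x) (max 0 (f x))) \<in> M \<rightarrow>\<^sub>M optB" by (rule eval_measurable) measurable
 have "(\<lambda>x. if 0 <= f x \<and> ennreal (f x) < rlife (g x) then rpath (g x) (max 0 (f x)) else None) \<in> M \<rightarrow>\<^sub>M optB"
  by measurable
 also have "(\<lambda>x. if 0 <= f x \<and> ennreal (f x) < rlife (g x) then rpath (g x) (max 0 (f x)) else None) = (\<lambda>x. pos (g x) (f x) [])"
  by (auto simp: pos_Nil max_absorb2)
 finally show ?case .
next
 case (Cons i u)
 note [measurable] = Cons.prems
 have [measurable]: "(\<lambda>x. pos (sub (g x) i) (f x - rtime (g x)) u) \<in> M \<rightarrow>\<^sub>M optB" by (rule Cons.IH) measurable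
 show ?case unfolding pos_Cons by measurable
qed

lemma subT_measurable:
 fixes g :: "'b => 'a::metric_space tree"
 assumes "f \<in> borel_measurable M" "g \<in> M \<rightarrow>\<^sub>M Omega_space"
 shows "(\<lambda>x. subT (f x) u (g x)) \<in> M \<rightarrow>\<^sub>M Omega_space"
 using assms
proof (induction u arbitrary: f g)
 case Nil
 note [measurable] = Nil
 have [measurable]: "(\<lambda>x. shiftp (rpath (g x)) (max 0 (f x))) \<in> M \<rightarrow>\<^sub>M path_space" by (rule shiftp_measurable) auto
 show ?case unfolding measurable_Omega_iff subT.simps using Omega_app[OF Nil(2)] by (auto simp: fun_upd_def)
next
 case (Cons i u)
 note [measurable] = Cons.prems
 show ?case unfolding subT.simps by (rule Cons.IH) measurable
qed

lemma killT_measurable: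
 fixes g :: "'b => 'a::metric_space tree"
 assumes "f \<in> borel_measurable M" "g \<in> M \<rightarrow>\<^sub>M Omega_space"
 shows "(\<lambda>x. killT (f x) u (g x)) \<in> M \<rightarrow>\<^sub>M Omega_space"
 using assms
proof (induction u arbitrary: f g)
 case Nil
 note [measurable] = Nil
 have [measurable]: "(\<lambda>x. stopp (max 0 (f x)) (rpath (g x))) \<in> M \<rightarrow>\<^sub>M path_space" by (rule stopp_measurable) auto
 have "(\<lambda>x. \<lambda>_. dummyD) \<in> M \<rightarrow>\<^sub>M Omega_space"
  unfolding measurable_Omega_iff by (auto intro!: measurable_const dummyD_space)
 then show ?case unfolding killT.simps by (intro graft_measurable) auto
next
 case (Cons i u)
 note [measurable] = Cons.prems
 have "(\<lambda>x. killT (f x - rtime (g x)) u (sub (g x) i)) \<in> M \<rightarrow>\<^sub>M Omega_space" by (rule Cons.IH) measurable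
 then show ?case unfolding killT.simps using Omega_app[OF Cons.prems(2)]
  by (intro graft_measurable) (auto simp: fun_upd_def)
qed

subsection \<open>The law of the tree\<close>

definition offk :: "(nat => 'a => real) => 'a option => nat measure" where
 "offk p y = (case y of Some z => offspring p z | None => return (count_space UNIV) 0)"

lemma off_at_offk: "off_at p xi \<tau> = (if \<tau> < \<top> then offk p (xi (enn2real \<tau>)) else return (count_space UNIV) 0)"
 by (simp add: off_at_def offk_def)

locale branching = hunt Yl for Yl :: "'a::{metric_space, second_countable_topology} => 'a path measure" +
 fixes \<beta> :: "'a => real" and p :: "nat => 'a => real" and P :: "'a => 'a tree measure" and Kb KA :: real
 assumes \<beta>_meas[measurable]: "\<beta> \<in> borel_measurable borel"
  and \<beta>_nonneg: "\<And>x. 0 <= \<beta> x" and \<beta>_le: "\<And>x. \<beta> x <= Kb"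
  and p_meas[measurable]: "\<And>n. p n \<in> borel_measurable borel"
  and p_nonneg: "\<And>n x. 0 <= p n x"
  and p_sum: "\<And>x. (\<lambda>n. p n x) sums 1"
  and A_summable: "\<And>x. summable (\<lambda>n. real n * p n x)"
  and A_le: "\<And>x. meanoff p x <= KA"
  and X_law: "branching_law Yl \<beta> p P"
begin

lemma Kb_nonneg: "0 <= Kb" using \<beta>_nonneg[of undefined] \<beta>_le[of undefined] by simp

abbreviation bp :: "'a path => real => real" where "bp xi \<equiv> vp \<beta> xi"

lemma rate_bp: "xi \<in> hpaths ==> rate (bp xi) Kb"
proof
 show "xi \<in> hpaths ==> bp xi \<in> borel_measurable borel" by (rule vp_measurable_time) simp_all
 show "0 <= bp xi r" "bp xi r <= Kb" for r
  using \<beta>_nonneg \<beta>_le Kb_nonneg by (auto simp: vp_def gD_def split: option.split)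
qed

lemma death_law_tauf: "death_law \<beta> xi = distr (density lborel (exponential_density 1)) borel (tauf (bp xi))"
 unfolding death_law_def tauf_def Ib_vp ..

text \<open>\<open>Ib\<close> is nondecreasing in time, so if some time witnesses that the passage
  occurs before \<open>y\<close>, a slightly later rational does too. The event becomes a countable
  union of jointly measurable ones.\<close>

lemma tauf_bp_measurable:
 assumes g[measurable]: "g \<in> borel_measurable M" and h[measurable]: "h \<in> M \<rightarrow>\<^sub>M path_space"
 shows "(\<lambda>x. tauf (bp (h x)) (g x)) \<in> borel_measurable M"
proof (rule borel_measurableI_less)
 fix y :: ennreal
 have I[measurable]: "(\<lambda>x. Ib (bp (h x)) q) \<in> borel_measurable M" for q by (rule Ib_vp_measurable) auto
 have eq: "tauf (bp (h x)) (g x) < y \<longleftrightarrow> (\<exists>q. 0 <= real_of_rat q \<and> ennreal (real_of_rat q) < y \<and> g x < Ib (bp (h x)) (real_of_rat q))"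
  if x: "x \<in> space M" for x
 proof
  interpret rate "bp (h x)" Kb using measurable_space[OF h x] by (intro rate_bp) simp
  assume "tauf (bp (h x)) (g x) < y"
  then obtain s where s: "0 <= s" "ennreal s < y" "g x < Ib (bp (h x)) s" unfolding tauf_def by (auto simp: Inf_less_iff)
  obtain u where u: "ennreal s < u" "u < y" using dense[OF s(2)] by blast
  have "u < \<top>" using u(2) by (auto simp: less_top[symmetric])
  then obtain v where v: "u = ennreal v" "0 <= v" by (cases u) auto
  then have "s < v" using u s by (simp add: ennreal_less_iff)
  then obtain q where q: "s < real_of_rat q" "real_of_rat q < v" using of_rat_dense by blast
  have "ennreal (real_of_rat q) <= ennreal v" using q by (intro ennreal_leI) simp
  then have "ennreal (real_of_rat q) < y" using u(2) unfolding v(1) by (rule order.strict_trans1)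
  moreover have "g x < Ib (bp (h x)) (real_of_rat q)" using s(3) Ib_mono[of s "real_of_rat q"] q by simp
  moreover have "0 <= real_of_rat q" using s(1) q(1) by linarith
  ultimately show "\<exists>q. 0 <= real_of_rat q \<and> ennreal (real_of_rat q) < y \<and> g x < Ib (bp (h x)) (real_of_rat q)" by blast
 next
  assume "\<exists>q. 0 <= real_of_rat q \<and> ennreal (real_of_rat q) < y \<and> g x < Ib (bp (h x)) (real_of_rat q)"
  then show "tauf (bp (h x)) (g x) < y" unfolding tauf_def by (auto simp: Inf_less_iff simp del: zero_le_of_rat_iff)
 qed
 have "{x \<in> space M. tauf (bp (h x)) (g x) < y}
  = {x \<in> space M. \<exists>q. 0 <= real_of_rat q \<and> ennreal (real_of_rat q) < y \<and> g x < Ib (bp (h x)) (real_of_rat q)}"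
  using eq by auto
 also have "... \<in> sets M" by measurable
 finally show "{x \<in> space M. tauf (bp (h x)) (g x) < y} \<in> sets M" .
qed

abbreviation expo :: "real measure" where "expo \<equiv> density lborel (\<lambda>x. ennreal (exponential_density 1 x))"

lemma prob_expo: "prob_space expo" by (rule prob_space_exponential_density) simp

lemma expo_integral: "(\<integral>\<^sup>+e. ennreal (exponential_density 1 e) \<partial>lborel) = 1"
 using prob_space.emeasure_space_1[OF prob_expo] by (simp add: emeasure_density)

lemma death_kernel[measurable]: "death_law \<beta> \<in> path_space \<rightarrow>\<^sub>M prob_algebra borel"
proof (rule measurable_prob_algebraI)
 show "xi \<in> space path_space ==> prob_space (death_law \<beta> xi)" for xi
  unfolding death_law_tauf using rate.tauf_measurable[OF rate_bp]
  by (intro prob_space.prob_space_distr[OF prob_expo]) simp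
 have t: "(\<lambda>z. tauf (bp (fst z)) (snd z)) \<in> path_space \<Otimes>\<^sub>M expo \<rightarrow>\<^sub>M borel"
  by (rule tauf_bp_measurable) measurable
 show "death_law \<beta> \<in> path_space \<rightarrow>\<^sub>M subprob_algebra borel"
  unfolding death_law_tauf[abs_def]
 proof (rule measurable_distr2[where M=expo])
  show "(\<lambda>(x, y). tauf (bp x) y) \<in> path_space \<Otimes>\<^sub>M expo \<rightarrow>\<^sub>M borel" using t by (simp add: split_beta')
  show "(\<lambda>x. expo) \<in> path_space \<rightarrow>\<^sub>M subprob_algebra expo"
   using prob_space_imp_subprob_space[OF prob_expo] by (intro measurable_const) (simp add: space_subprob_algebra)
 qed
qed

lemma prob_offspring: "prob_space (offspring p z)"
proof (rule prob_spaceI)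
 have "(\<integral>\<^sup>+n. ennreal (p n z) \<partial>count_space UNIV) = (\<Sum>n. ennreal (p n z))" by (rule nn_integral_count_space_nat)
 also have "... = 1" using suminf_ennreal2[OF p_nonneg sums_summable[OF p_sum], of z] sums_unique[OF p_sum[of z]] by simp
 finally show "emeasure (offspring p z) (space (offspring p z)) = 1" by (simp add: offspring_def emeasure_density)
qed

lemma offk_kernel[measurable]: "offk p \<in> optB \<rightarrow>\<^sub>M prob_algebra (count_space UNIV)"
 unfolding measurable_optB_iff
proof
 show "(\<lambda>x. offk p (Some x)) \<in> borel \<rightarrow>\<^sub>M prob_algebra (count_space UNIV)"
 proof (rule measurable_prob_algebraI)
  show "(\<lambda>x. offk p (Some x)) \<in> borel \<rightarrow>\<^sub>M subprob_algebra (count_space UNIV)"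
  proof (rule measurable_subprob_algebra)
   show "subprob_space (offk p (Some a))" for a using prob_offspring by (simp add: offk_def prob_space_imp_subprob_space)
   show "sets (offk p (Some a)) = sets (count_space UNIV)" for a by (simp add: offk_def offspring_def)
   show "(\<lambda>a. emeasure (offk p (Some a)) A) \<in> borel_measurable borel" for A
   proof -
    have "emeasure (offk p (Some a)) A = (\<Sum>n. ennreal (p n a) * indicator A n)" for a
     by (simp add: offk_def offspring_def emeasure_density nn_integral_count_space_nat)
    then show ?thesis by simp
   qed
  qed
 qed (simp add: offk_def prob_offspring)
 show "offk p None \<in> space (prob_algebra (count_space UNIV))"
  using measurable_space[OF measurable_return_prob_space, of 0 "count_space UNIV :: nat measure"] by (simp add: offk_def)
qed

lemma off_at_kernel:
 assumes [measurable]: "h \<in> M \<rightarrow>\<^sub>M path_space" "t \<in> borel_measurable M"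
 shows "(\<lambda>x. off_at p (h x) (t x)) \<in> M \<rightarrow>\<^sub>M prob_algebra (count_space UNIV)"
proof -
 have [measurable]: "(\<lambda>x. h x (enn2real (t x))) \<in> M \<rightarrow>\<^sub>M optB" by (rule eval_enn2real_measurable) measurable
 have [measurable]: "(\<lambda>x::'b. return (count_space UNIV) (0::nat)) \<in> M \<rightarrow>\<^sub>M prob_algebra (count_space UNIV)"
  using measurable_space[OF measurable_return_prob_space, of 0 "count_space UNIV :: nat measure"] by (intro measurable_const) simp
 show ?thesis unfolding off_at_offk by measurable
qed

lemma prob_P: "prob_space (P x)" and sets_P[simp, measurable_cong]: "sets (P x) = sets Omega_space"
 using X_law unfolding branching_law_def by blast+

lemma space_P[simp]: "space (P x) = space Omega_space" using sets_eq_imp_space_eq[OF sets_P] by simp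

lemma P_kernel[measurable]: "P \<in> borel \<rightarrow>\<^sub>M prob_algebra Omega_space"
proof (rule measurable_prob_algebraI[OF prob_P])
 show "P \<in> borel \<rightarrow>\<^sub>M subprob_algebra Omega_space"
 proof (rule measurable_subprob_algebra)
  show "subprob_space (P a)" for a using prob_P by (rule prob_space_imp_subprob_space)
  show "A \<in> sets Omega_space ==> (\<lambda>a. emeasure (P a) A) \<in> borel_measurable borel" for A
   using X_law unfolding branching_law_def by blast
 qed simp
qed

lemma dummyOmega_prob: "dummyOmega \<in> space (prob_algebra Omega_space)"
 unfolding dummyOmega_def
 using measurable_space[OF measurable_return_prob_space, of "\<lambda>_. dummyD" Omega_space] dummyD_space by (auto simp: space_Omega)

definition chk :: "'a option => 'a tree measure" where
 "chk y = (case y of Some z => P z | None => dummyOmega)"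

lemma chk_kernel[measurable]: "chk \<in> optB \<rightarrow>\<^sub>M prob_algebra Omega_space"
 unfolding measurable_optB_iff chk_def using dummyOmega_prob by simp

lemma child_law_chk: "child_law P d i = (if i < snd (snd d) \<and> fst (snd d) < \<top> then chk (fst d (enn2real (fst (snd d)))) else dummyOmega)"
 by (simp add: child_law_def chk_def split: prod.split)

lemma child_kernel[measurable]: "(\<lambda>d. child_law P d i) \<in> D_space \<rightarrow>\<^sub>M prob_algebra Omega_space"
proof -
 have [measurable]: "(\<lambda>d. fst d (enn2real (fst (snd d)))) \<in> D_space \<rightarrow>\<^sub>M (optB :: 'a option measure)"
  by (rule eval_enn2real_measurable) measurable
 have [measurable]: "(\<lambda>_. dummyOmega) \<in> D_space \<rightarrow>\<^sub>M prob_algebra (Omega_space :: 'a tree measure)"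
  by (rule measurable_const) (rule dummyOmega_prob)
 show ?thesis unfolding child_law_chk by measurable
qed

lemma child_prob: "prob_space (child_law P d i)" and child_sets[simp]: "sets (child_law P d i) = sets Omega_space"
proof -
 have "prob_space (chk y)" "sets (chk y) = sets Omega_space" for y
  using measurable_space[OF chk_kernel, of y] by (auto simp: space_prob_algebra)
 then show "prob_space (child_law P d i)" "sets (child_law P d i) = sets Omega_space"
  using dummyOmega_prob by (auto simp: child_law_chk space_prob_algebra)
qed

abbreviation subs_law :: "'a pdata => (nat => 'a tree) measure" where
 "subs_law d \<equiv> PiM UNIV (child_law P d)"

lemma sets_subs_law[simp, measurable_cong]: "sets (subs_law d) = sets (PiM UNIV (\<lambda>_::nat. Omega_space))"
 by (rule sets_PiM_cong) simp_all

lemma prob_subs_law: "prob_space (subs_law d)" by (rule prob_space_PiM) (rule child_prob)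

lemma subs_kernel[measurable]: "subs_law \<in> D_space \<rightarrow>\<^sub>M prob_algebra (PiM UNIV (\<lambda>_::nat. Omega_space))"
 by (rule measurable_PiM_prob) (rule child_kernel)

text \<open>The conditional mean of \<open>F\<close> given path, lifetime and offspring number of
  the root.\<close>

definition J :: "('a tree => ennreal) => 'a pdata => ennreal" where
 "J F d = (\<integral>\<^sup>+wa. F (graft d wa) \<partial>subs_law d)"

text \<open>The conditional mean of \<open>F\<close> given path and lifetime of the root; the
  offspring number is averaged as well.\<close>

definition R :: "('a tree => ennreal) => 'a path => ennreal => ennreal" where
 "R F xi \<tau> = (\<integral>\<^sup>+n. J F (xi, \<tau>, n) \<partial>off_at p xi \<tau>)"

lemma graft_subs[measurable]: "(\<lambda>z. graft (fst z) (snd z)) \<in> D_space \<Otimes>\<^sub>M PiM UNIV (\<lambda>_::nat. Omega_space) \<rightarrow>\<^sub>M Omega_space"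
 by (rule graft_measurable) measurable

lemma graft_subs'[measurable]: "d \<in> space D_space ==> graft d \<in> PiM UNIV (\<lambda>_::nat. Omega_space) \<rightarrow>\<^sub>M Omega_space"
 by (rule graft_measurable) measurable

lemma J_measurable[measurable]: "F \<in> borel_measurable Omega_space ==> J F \<in> borel_measurable D_space"
 unfolding J_def
proof (rule nn_integral_measurable_subprob_algebra2[OF _ measurable_prob_algebraD[OF subs_kernel]])
 assume "F \<in> borel_measurable Omega_space"
 from measurable_compose[OF graft_subs this]
 show "(\<lambda>(x, y). F (graft x y)) \<in> borel_measurable (D_space \<Otimes>\<^sub>M PiM UNIV (\<lambda>_::nat. Omega_space))" by (simp add: split_beta')
qed

lemma R_measurable:
 assumes F[measurable]: "F \<in> borel_measurable Omega_space" and [measurable]: "h \<in> M \<rightarrow>\<^sub>M path_space" "t \<in> borel_measurable M"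
 shows "(\<lambda>x. R F (h x) (t x)) \<in> borel_measurable M"
 unfolding R_def
proof (rule nn_integral_measurable_subprob_algebra2[OF _ measurable_prob_algebraD[OF off_at_kernel[OF assms(2,3)]]])
 show "(\<lambda>(x, y). J F (h x, t x, y)) \<in> borel_measurable (M \<Otimes>\<^sub>M count_space UNIV)"
  unfolding split_beta' by measurable
qed

lemma sets_particle[simp]: "sets (particle_law Yl \<beta> p x) = sets D_space"
 and nn_integral_particle: "F \<in> borel_measurable D_space ==> (\<integral>\<^sup>+d. F d \<partial>particle_law Yl \<beta> p x)
   = (\<integral>\<^sup>+xi. (\<integral>\<^sup>+e. ennreal (exponential_density 1 e) * (\<integral>\<^sup>+n. F (xi, tauf (bp xi) e, n) \<partial>off_at p xi (tauf (bp xi) e)) \<partial>lborel) \<partial>Yl x)"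
proof -
 interpret Y: prob_space "Yl x" by (rule prob_Yl)
 have k1: "(\<lambda>z. distr (off_at p (fst z) (snd z)) D_space (\<lambda>n. (fst z, snd z, n))) \<in> path_space \<Otimes>\<^sub>M borel \<rightarrow>\<^sub>M prob_algebra D_space"
 proof (rule measurable_prob_algebraI)
  have off: "(\<lambda>z. off_at p (fst z) (snd z)) \<in> path_space \<Otimes>\<^sub>M borel \<rightarrow>\<^sub>M prob_algebra (count_space UNIV)"
   by (rule off_at_kernel) measurable
  show "(\<lambda>z. distr (off_at p (fst z) (snd z)) D_space (\<lambda>n. (fst z, snd z, n))) \<in> path_space \<Otimes>\<^sub>M borel \<rightarrow>\<^sub>M subprob_algebra D_space"
   by (rule measurable_distr2[OF _ measurable_prob_algebraD[OF off]]) (unfold split_beta', measurable)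
  fix z :: "'a path \<times> ennreal" assume z: "z \<in> space (path_space \<Otimes>\<^sub>M borel)"
  then have "fst z \<in> hpaths" by (auto simp: space_pair_measure)
  have s: "sets (off_at p (fst z) (snd z)) = sets (count_space UNIV)" "prob_space (off_at p (fst z) (snd z))"
   using measurable_space[OF off z] by (auto simp: space_prob_algebra)
  show "prob_space (distr (off_at p (fst z) (snd z)) D_space (\<lambda>n. (fst z, snd z, n)))"
  proof (rule prob_space.prob_space_distr[OF s(2)])
   have "(\<lambda>n. (fst z, snd z, n)) \<in> count_space UNIV \<rightarrow>\<^sub>M D_space" using \<open>fst z \<in> hpaths\<close> by (intro Pair_D measurable_const measurable_ident) auto
   then show "(\<lambda>n. (fst z, snd z, n)) \<in> off_at p (fst z) (snd z) \<rightarrow>\<^sub>M D_space"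
    using measurable_cong_sets[OF s(1) refl] by blast
  qed
 qed
 have k2: "(\<lambda>xi. bind (death_law \<beta> xi) (\<lambda>\<tau>. distr (off_at p xi \<tau>) D_space (\<lambda>n. (xi, \<tau>, n)))) \<in> path_space \<rightarrow>\<^sub>M prob_algebra D_space"
  by (rule measurable_bind_prob_space2[OF death_kernel]) (use k1 in \<open>simp add: split_beta'\<close>)
 have k2': "(\<lambda>xi. bind (death_law \<beta> xi) (\<lambda>\<tau>. distr (off_at p xi \<tau>) D_space (\<lambda>n. (xi, \<tau>, n)))) \<in> Yl x \<rightarrow>\<^sub>M subprob_algebra D_space"
  using measurable_prob_algebraD[OF k2] by measurable
 show "sets (particle_law Yl \<beta> p x) = sets D_space"
  unfolding particle_law_def using k2' Y.not_empty by (rule sets_bind_measurable)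
 assume F[measurable]: "F \<in> borel_measurable D_space"
 have "(\<integral>\<^sup>+d. F d \<partial>particle_law Yl \<beta> p x)
  = (\<integral>\<^sup>+xi. (\<integral>\<^sup>+d. F d \<partial>bind (death_law \<beta> xi) (\<lambda>\<tau>. distr (off_at p xi \<tau>) D_space (\<lambda>n. (xi, \<tau>, n)))) \<partial>Yl x)"
  unfolding particle_law_def by (rule nn_integral_bind[OF F k2'])
 also have "... = (\<integral>\<^sup>+xi. (\<integral>\<^sup>+e. ennreal (exponential_density 1 e) * (\<integral>\<^sup>+n. F (xi, tauf (bp xi) e, n) \<partial>off_at p xi (tauf (bp xi) e)) \<partial>lborel) \<partial>Yl x)"
 proof (rule nn_integral_cong)
  fix xi assume "xi \<in> space (Yl x)"
  then have xi: "xi \<in> hpaths" by simp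
  interpret rate "bp xi" Kb by (rule rate_bp[OF xi])
  have sd: "sets (death_law \<beta> xi) = sets borel" by (simp add: death_law_def)
  have off: "(\<lambda>\<tau>. off_at p xi \<tau>) \<in> borel \<rightarrow>\<^sub>M prob_algebra (count_space UNIV)" by (rule off_at_kernel) (use xi in auto)
  have so: "sets (off_at p xi \<tau>) = sets (count_space UNIV)" for \<tau>
   using measurable_space[OF off, of \<tau>] by (auto simp: space_prob_algebra)
  have [measurable]: "(\<lambda>_::ennreal. xi) \<in> borel \<rightarrow>\<^sub>M path_space" "(\<lambda>_::nat. xi) \<in> count_space UNIV \<rightarrow>\<^sub>M path_space"
    "(\<lambda>_::ennreal \<times> nat. xi) \<in> borel \<Otimes>\<^sub>M count_space UNIV \<rightarrow>\<^sub>M path_space" using xi by auto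
  have "(\<lambda>\<tau>. (xi, \<tau>)) \<in> borel \<rightarrow>\<^sub>M path_space \<Otimes>\<^sub>M borel" by (rule measurable_Pair) measurable
  from measurable_prob_algebraD[OF measurable_compose[OF this k1]]
  have k3: "(\<lambda>\<tau>. distr (off_at p xi \<tau>) D_space (\<lambda>n. (xi, \<tau>, n))) \<in> death_law \<beta> xi \<rightarrow>\<^sub>M subprob_algebra D_space"
   unfolding measurable_cong_sets[OF sd refl] by simp
  have m1: "(\<lambda>\<tau>. \<integral>\<^sup>+n. F (xi, \<tau>, n) \<partial>off_at p xi \<tau>) \<in> borel_measurable borel"
   by (rule nn_integral_measurable_subprob_algebra2[OF _ measurable_prob_algebraD[OF off]]) (use xi in \<open>unfold split_beta', measurable\<close>)
  have "(\<integral>\<^sup>+d. F d \<partial>bind (death_law \<beta> xi) (\<lambda>\<tau>. distr (off_at p xi \<tau>) D_space (\<lambda>n. (xi, \<tau>, n))))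
    = (\<integral>\<^sup>+\<tau>. \<integral>\<^sup>+d. F d \<partial>distr (off_at p xi \<tau>) D_space (\<lambda>n. (xi, \<tau>, n)) \<partial>death_law \<beta> xi)"
   by (rule nn_integral_bind[OF F k3])
  also have "... = (\<integral>\<^sup>+\<tau>. \<integral>\<^sup>+n. F (xi, \<tau>, n) \<partial>off_at p xi \<tau> \<partial>death_law \<beta> xi)"
  proof (rule nn_integral_cong, rule nn_integral_distr)
   fix \<tau> show "F \<in> borel_measurable (distr (off_at p xi \<tau>) D_space (\<lambda>n. (xi, \<tau>, n)))" using F by simp
   have "(\<lambda>n. (xi, \<tau>, n)) \<in> count_space UNIV \<rightarrow>\<^sub>M D_space" using xi by measurable
   then show "(\<lambda>n. (xi, \<tau>, n)) \<in> off_at p xi \<tau> \<rightarrow>\<^sub>M D_space" using measurable_cong_sets[OF so refl] by blast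
  qed
  also have "... = (\<integral>\<^sup>+e. (\<integral>\<^sup>+n. F (xi, tauf (bp xi) e, n) \<partial>off_at p xi (tauf (bp xi) e)) \<partial>expo)"
   unfolding death_law_tauf by (rule nn_integral_distr) (use m1 in auto)
  also have "... = (\<integral>\<^sup>+e. ennreal (exponential_density 1 e) * (\<integral>\<^sup>+n. F (xi, tauf (bp xi) e, n) \<partial>off_at p xi (tauf (bp xi) e)) \<partial>lborel)"
   by (rule nn_integral_density) (use measurable_compose[OF tauf_measurable m1] in auto)
  finally show "(\<integral>\<^sup>+d. F d \<partial>bind (death_law \<beta> xi) (\<lambda>\<tau>. distr (off_at p xi \<tau>) D_space (\<lambda>n. (xi, \<tau>, n))))
    = (\<integral>\<^sup>+e. ennreal (exponential_density 1 e) * (\<integral>\<^sup>+n. F (xi, tauf (bp xi) e, n) \<partial>off_at p xi (tauf (bp xi) e)) \<partial>lborel)" .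
 qed
 finally show "(\<integral>\<^sup>+d. F d \<partial>particle_law Yl \<beta> p x)
   = (\<integral>\<^sup>+xi. (\<integral>\<^sup>+e. ennreal (exponential_density 1 e) * (\<integral>\<^sup>+n. F (xi, tauf (bp xi) e, n) \<partial>off_at p xi (tauf (bp xi) e)) \<partial>lborel) \<partial>Yl x)" .
qed

lemma nn_integral_P_particle:
 assumes F[measurable]: "F \<in> borel_measurable Omega_space"
 shows "(\<integral>\<^sup>+w. F w \<partial>P x) = (\<integral>\<^sup>+d. J F d \<partial>particle_law Yl \<beta> p x)"
proof -
 have gk: "(\<lambda>d. distr (subs_law d) Omega_space (graft d)) \<in> D_space \<rightarrow>\<^sub>M subprob_algebra Omega_space"
  by (rule measurable_distr2[OF _ measurable_prob_algebraD[OF subs_kernel]]) (use graft_subs in \<open>simp add: split_beta'\<close>)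
 then have gk': "(\<lambda>d. distr (subs_law d) Omega_space (graft d)) \<in> particle_law Yl \<beta> p x \<rightarrow>\<^sub>M subprob_algebra Omega_space"
  using measurable_cong_sets[OF sets_particle refl] by blast
 have "P x = bind (particle_law Yl \<beta> p x) (\<lambda>d. distr (subs_law d) Omega_space (graft d))"
  using X_law unfolding branching_law_def by blast
 then have "(\<integral>\<^sup>+w. F w \<partial>P x) = (\<integral>\<^sup>+w. F w \<partial>bind (particle_law Yl \<beta> p x) (\<lambda>d. distr (subs_law d) Omega_space (graft d)))"
  by simp
 also have "... = (\<integral>\<^sup>+d. \<integral>\<^sup>+w. F w \<partial>distr (subs_law d) Omega_space (graft d) \<partial>particle_law Yl \<beta> p x)"
  by (rule nn_integral_bind[OF F gk'])
 also have "... = (\<integral>\<^sup>+d. J F d \<partial>particle_law Yl \<beta> p x)"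
 proof (rule nn_integral_cong)
  fix d assume "d \<in> space (particle_law Yl \<beta> p x)"
  then have [measurable]: "d \<in> space D_space" using sets_eq_imp_space_eq[OF sets_particle] by blast
  show "(\<integral>\<^sup>+w. F w \<partial>distr (subs_law d) Omega_space (graft d)) = J F d"
   unfolding J_def by (rule nn_integral_distr) measurable
 qed
 finally show ?thesis .
qed

text \<open>With the lifetime written as a passage time over an exponential level, the inner
  integral runs over Lebesgue measure, and the formulas for a single frozen path (survival, density
  of death, lack of memory) apply to the root.\<close>

lemma nn_integral_P:
 assumes F[measurable]: "F \<in> borel_measurable Omega_space"
 shows "(\<integral>\<^sup>+w. F w \<partial>P x) = (\<integral>\<^sup>+xi. (\<integral>\<^sup>+e. ennreal (exponential_density 1 e) * R F xi (tauf (bp xi) e) \<partial>lborel) \<partial>Yl x)"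
 unfolding nn_integral_P_particle[OF F] R_def by (rule nn_integral_particle) measurable

end

section \<open>The branching property\<close>

lemma measurable_nn_integral_countable:
 fixes f :: "'i::countable => 'b => ennreal"
 assumes "\<And>i. f i \<in> borel_measurable M"
 shows "(\<lambda>x. \<integral>\<^sup>+i. f i x \<partial>count_space UNIV) \<in> borel_measurable M"
proof -
 interpret sigma_finite_measure "count_space (UNIV :: 'i set)" by (rule sigma_finite_measure_count_space)
 have "(\<lambda>z. f (fst z) (snd z)) \<in> borel_measurable (count_space UNIV \<Otimes>\<^sub>M M)"
  by (rule measurable_pair_measure_countable1) (simp_all add: assms)
 from measurable_compose[OF measurable_pair_swap' this]
 show ?thesis by (intro borel_measurable_nn_integral) (simp add: split_beta')
qed

text \<open>A sum over all labels as an integral against counting measure: it makes sense before the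
  population is known to be finite, and its finiteness is eventually derived from such sums.\<close>

definition XE :: "'a tree => real => ('a option => ennreal) => ennreal" where
 "XE w s g = (\<integral>\<^sup>+u. (if pos w s u = None then 0 else g (pos w s u)) \<partial>count_space UNIV)"

definition SE :: "'a tree => real => ('a tree => ennreal) => ennreal" where
 "SE w s G = (\<integral>\<^sup>+u. (if pos w s u = None then 0 else G (subT s u w)) \<partial>count_space UNIV)"

lemma rtime_nonneg: "0 <= rtime w" by (simp add: rtime_def)

lemma pos_neg: "t < 0 ==> pos w t u = None"
proof (induction u arbitrary: w t)
 case (Cons i u) then show ?case using rtime_nonneg[of w] by (simp add: pos_Cons)
qed (simp add: pos_Nil)

lemma alive_rtime: "pos w t (i # u) \<noteq> None ==> okc w i \<and> rtime w <= t"
 using pos_neg[of "t - rtime w" "sub w i" u] by (force simp: pos_Cons split: if_splits)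

lemma okc_rtime: "okc w i ==> rlife w = ennreal (rtime w)"
 by (auto simp: okc_def rtime_def)

lemma root_alive_before: "pos w t [] \<noteq> None ==> okc w i ==> t < rtime w"
 using okc_rtime[of w i] rtime_nonneg[of w] by (auto simp: pos_Nil ennreal_less_iff split: if_splits)

lemma killT_Nil_simps: "rpath (killT s [] w) = stopp (max 0 s) (rpath w)" "rlife (killT s [] w) = \<top>" "rnum (killT s [] w) = 0"
 by simp_all

lemma okc_killT_Nil[simp]: "\<not> okc (killT s [] w) i" by (simp add: okc_def)

lemma killT_Cons_simps: "rpath (killT s (i # u) w) = rpath w" "rlife (killT s (i # u) w) = rlife w"
  "rnum (killT s (i # u) w) = rnum w" "rtime (killT s (i # u) w) = rtime w"
  "sub (killT s (i # u) w) j = (if j = i then killT (s - rtime w) u (sub w i) else sub w j)"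
 by (simp_all add: r_defs)

lemma okc_killT_Cons[simp]: "okc (killT s (i # u) w) j = okc w j"
 unfolding okc_def killT_Cons_simps ..

declare killT.simps[simp del]

text \<open>A particle alive at \<open>s\<close> has no child born by then, so freezing it at
  \<open>s\<close> and erasing its descendants changes no position up to time
  \<open>s\<close>.\<close>

lemma pos_killT:
 assumes "pos w s u \<noteq> None" "r <= s"
 shows "pos (killT s u w) r wa = pos w r wa"
 using assms
proof (induction u arbitrary: w s r wa)
 case Nil
 show ?case
 proof (cases wa)
  case Nil
  have "0 <= s" "ennreal s < rlife w" using Nil.prems(1) by (auto simp: pos_Nil split: if_splits)
  moreover have "ennreal r <= ennreal s" using Nil.prems(2) by (rule ennreal_leI)
  ultimately have "ennreal r < rlife w" using le_less_trans by blast
  then show ?thesis using Nil.prems(2) \<open>0 <= s\<close>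
   by (simp add: Nil pos_Nil killT_Nil_simps stopp_def min_absorb1 max_absorb2)
 next
  case (Cons j wa')
  have "pos w r (j # wa') = None"
  proof (rule ccontr)
   assume "pos w r (j # wa') \<noteq> None"
   from alive_rtime[OF this] have "okc w j" "rtime w <= r" by auto
   then show False using root_alive_before[OF Nil.prems(1)] Nil.prems(2) by fastforce
  qed
  then show ?thesis by (simp add: Cons pos_Cons[of "killT s [] w"])
 qed
next
 case (Cons i u)
 have ok: "okc w i" "pos (sub w i) (s - rtime w) u \<noteq> None"
  using Cons.prems(1) by (auto simp: pos_Cons split: if_splits)
 show ?case
 proof (cases wa)
  case Nil then show ?thesis by (simp add: pos_Nil killT_Cons_simps)
 next
  case (Cons j wa')
  then show ?thesis using Cons.IH[OF ok(2), of "r - rtime w" wa'] Cons.prems(2)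
   by (simp add: pos_Cons killT_Cons_simps)
 qed
qed

text \<open>Two distinct particles alive at the same time lie on different lines of descent, so
  hiding the future of one leaves the subtree of the other intact. This is the independence behind
  the vanishing of covariances.\<close>

lemma subT_killT:
 assumes "pos w s u \<noteq> None" "pos w s v \<noteq> None" "u \<noteq> v"
 shows "subT s v (killT s u w) = subT s v w"
 using assms
proof (induction u arbitrary: w s v)
 case Nil
 then obtain j v' where v: "v = j # v'" by (cases v) auto
 then show ?case using alive_rtime[of w s j v'] root_alive_before[OF Nil(1), of j] Nil(2) by fastforce
next
 case (Cons i u)
 have ok: "okc w i" "pos (sub w i) (s - rtime w) u \<noteq> None"
  using Cons.prems(1) by (auto simp: pos_Cons split: if_splits)
 show ?case
 proof (cases v)
  case Nil
  then show ?thesis using alive_rtime[OF Cons.prems(1)] root_alive_before[of w s i] Cons.prems(2) by fastforce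
 next
  case (Cons j v')
  have "pos (sub w j) (s - rtime w) v' \<noteq> None" using Cons.prems(2) Cons by (auto simp: pos_Cons split: if_splits)
  then show ?thesis using Cons.IH[OF ok(2), of v'] Cons.prems(3) Cons
   by (auto simp: killT_Cons_simps)
 qed
qed

lemma Omega_rpath: "w \<in> space Omega_space ==> rpath w \<in> hpaths"
 unfolding space_Omega space_D rpath_def by (auto simp: mem_Times_iff)

lemma Omega_sub: "w \<in> space Omega_space ==> sub w i \<in> space Omega_space"
 unfolding space_Omega sub_def by auto

lemma subT_Nil_simps: "rpath (subT s [] w) = shiftp (rpath w) (max 0 s)" "rlife (subT s [] w) = rlife w - ennreal s"
  "rnum (subT s [] w) = rnum w" "sub (subT s [] w) j = sub w j"
 by (simp_all add: r_defs)

lemma life_minus: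
 assumes "0 <= t" "ennreal t < \<tau>" "\<tau> < \<top>"
 shows "t + enn2real (\<tau> - ennreal t) = enn2real \<tau>"
proof -
 obtain r where r: "\<tau> = ennreal r" "0 <= r" using assms(3) by (cases \<tau>) auto
 then have "t < r" using assms by (simp add: ennreal_less_iff)
 then show ?thesis using r assms(1) by (simp add: ennreal_minus)
qed

lemma minus_less_top_iff: "(\<tau> - ennreal t < \<top>) = (\<tau> < (\<top>::ennreal))"
 by (cases \<tau>) (auto simp: ennreal_minus_eq_top less_top[symmetric])

lemma subT_Nil_okc:
 assumes "pos w t [] \<noteq> None"
 shows "okc (subT t [] w) j = okc w j" "okc w j ==> rtime (subT t [] w) = rtime w - t"
proof -
 have t: "0 <= t" "ennreal t < rlife w" using assms by (auto simp: pos_Nil split: if_splits)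
 have 1: "t + rtime (subT t [] w) = rtime w" if "rlife w < \<top>"
  unfolding rtime_def subT_Nil_simps by (rule life_minus) (use t that in auto)
 show "okc (subT t [] w) j = okc w j"
  unfolding okc_def subT_Nil_simps minus_less_top_iff using 1 t by (auto simp: shiftp_def max_absorb2)
 show "okc w j ==> rtime (subT t [] w) = rtime w - t" using 1 by (auto simp: okc_def)
qed

text \<open>A particle alive at time \<open>t + s\<close> has exactly one ancestor alive at time \<open>t\<close>, so exactly one
 prefix of its label contributes.\<close>
lemma pos_split:
 assumes "w \<in> space Omega_space" "0 <= t" "0 <= s" and F: "F None = (0::ennreal)"
 shows "F (pos w (t + s) wa)
  = (\<Sum>k\<le>length wa. if pos w t (take k wa) = None then 0 else F (pos (subT t (take k wa) w) s (drop k wa)))"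
 using assms(1,2)
proof (induction wa arbitrary: w t)
 case Nil
 show ?case
 proof (cases "pos w t [] = None")
  case True
  have "pos w (t + s) [] = None"
  proof (rule ccontr)
   assume "pos w (t + s) [] \<noteq> None"
   then have a: "ennreal (t + s) < rlife w" "rpath w (t + s) \<noteq> None" by (auto simp: pos_Nil split: if_splits)
   have "ennreal t <= ennreal (t + s)" using assms(3) by (intro ennreal_leI) simp
   then have "ennreal t < rlife w" using a(1) by simp
   then have "rpath w t = None" using True Nil(2) by (simp add: pos_Nil)
   then show False using hpaths_dead[OF Omega_rpath[OF Nil(1)] Nil(2), of "t + s"] a(2) assms(3) by simp
  qed
  then show ?thesis using True F by simp
 next
  case False
  then have t: "ennreal t < rlife w" by (auto simp: pos_Nil split: if_splits)
  have "ennreal (t + s) < rlife w \<longleftrightarrow> ennreal s < rlife w - ennreal t"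
  proof (cases "rlife w")
   case (real r)
   then show ?thesis using Nil(2) assms(3) t by (simp add: ennreal_less_iff ennreal_minus ennreal_plus[symmetric] del: ennreal_plus) linarith
  qed simp
  moreover have "(\<Sum>k\<le>length ([] :: nat list). if pos w t (take k []) = None then 0
    else F (pos (subT t (take k []) w) s (drop k []))) = F (pos (subT t [] w) s [])"
  proof -
   have "{..length ([] :: nat list)} = {0}" by simp
   then show ?thesis by (simp only:) (use False in \<open>simp del: subT.simps not_None_eq\<close>)
  qed
  moreover have "pos (subT t [] w) s [] = (if ennreal s < rlife w - ennreal t then rpath w (t + s) else None)"
   using Nil(2) assms(3) by (simp add: pos_Nil[of "subT t [] w"] subT_Nil_simps shiftp_def max_absorb2 del: subT.simps)
  moreover have "pos w (t + s) [] = (if ennreal (t + s) < rlife w then rpath w (t + s) else None)"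
   using Nil(2) assms(3) by (simp add: pos_Nil del: ennreal_plus)
  ultimately show ?thesis by presburger
 qed
next
 case (Cons j wa)
 have wf: "sub w j \<in> space Omega_space" by (rule Omega_sub[OF Cons.prems(1)])
 let ?h = "\<lambda>k. if pos w t (take k (j # wa)) = None then 0 else F (pos (subT t (take k (j # wa)) w) s (drop k (j # wa)))"
 have split: "(\<Sum>k\<le>length (j # wa). ?h k) = ?h 0 + (\<Sum>k\<le>length wa. ?h (Suc k))"
  by (simp add: sum.atMost_Suc_shift del: sum.atMost_Suc)
 show ?case
 proof (cases "okc w j")
  case False
  have "?h (Suc k) = 0" for k using False by (simp add: pos_Cons)
  moreover have "?h 0 = 0"
   using False F subT_Nil_okc(1)[of w t j] by (simp add: pos_Cons del: subT.simps)
  ultimately show ?thesis unfolding split using False F by (simp add: pos_Cons)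
 next
  case True
  show ?thesis
  \<comment> \<open>If the root is alive at \<open>t\<close>, its children are born later and only
    the empty prefix contributes. Otherwise the root must have died by \<open>t\<close>, since a
    path that produces a child at its death was not in the cemetery before, and the claim is passed
    to the child.\<close>
  proof (cases "pos w t [] = None")
   case False
   have lt: "t < rtime w" using root_alive_before[OF False True] .
   have "?h (Suc k) = 0" for k using pos_neg[of "t - rtime w" "sub w j"] lt by (simp add: pos_Cons)
   moreover have "pos (subT t [] w) s (j # wa) = pos w (t + s) (j # wa)"
   proof -
    have e: "s - (rtime w - t) = t + s - rtime w" by simp
    show ?thesis unfolding pos_Cons subT_Nil_okc(1)[OF False] subT_Nil_okc(2)[OF False True] subT_Nil_simps(4) e ..
   qed
   then have "?h 0 = F (pos w (t + s) (j # wa))"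
    using False by (simp del: subT.simps not_None_eq)
   ultimately show ?thesis unfolding split by simp
  next
   case none: True
   have le: "rtime w <= t"
   proof (rule ccontr)
    assume "\<not> rtime w <= t"
    then have a: "t < rtime w" by simp
    then have "ennreal t < rlife w" using okc_rtime[OF True] Cons.prems(2) by (simp add: ennreal_less_iff)
    then have "rpath w t = None" using none Cons.prems(2) by (simp add: pos_Nil)
    then have "rpath w (rtime w) = None"
     using hpaths_dead[OF Omega_rpath[OF Cons.prems(1)] Cons.prems(2), of "rtime w"] a by simp
    then show False using True by (simp add: okc_def)
   qed
   have "?h 0 = 0" using none by simp
   moreover have "?h (Suc k) = (if pos (sub w j) (t - rtime w) (take k wa) = None then 0
     else F (pos (subT (t - rtime w) (take k wa) (sub w j)) s (drop k wa)))" for k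
    using True by (simp add: pos_Cons)
   moreover have "F (pos w (t + s) (j # wa)) = F (pos (sub w j) ((t - rtime w) + s) wa)"
    using True by (simp add: pos_Cons algebra_simps)
   ultimately show ?thesis unfolding split using Cons.IH[OF wf, of "t - rtime w"] le by simp
  qed
 qed
qed

text \<open>Cutting a word at a position and concatenating two words are inverse to each other, so
  this is a reindexing of a sum over pairs.\<close>

lemma nn_integral_splits:
 fixes h :: "'a list => 'a list => ennreal"
 shows "(\<integral>\<^sup>+wa. (\<Sum>k\<le>length wa. h (take k wa) (drop k wa)) \<partial>count_space UNIV)
    = (\<integral>\<^sup>+u. \<integral>\<^sup>+v. h u v \<partial>count_space UNIV \<partial>count_space UNIV)"
proof -
 let ?A = "{wk :: 'a list \<times> nat. snd wk <= length (fst wk)}"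
 let ?f = "\<lambda>wk. (take (snd wk) (fst wk), drop (snd wk) (fst wk))"
 have bij: "bij_betw ?f ?A (UNIV :: ('a list \<times> 'a list) set)"
 proof (rule bij_betwI[where g="\<lambda>uv. (fst uv @ snd uv, length (fst uv))"])
 qed (auto simp: min_absorb2)
 have "(\<integral>\<^sup>+u. \<integral>\<^sup>+v. h u v \<partial>count_space UNIV \<partial>count_space UNIV)
   = (\<integral>\<^sup>+uv. h (fst uv) (snd uv) \<partial>count_space UNIV)"
  using nn_integral_fst_count_space[of "\<lambda>uv. h (fst uv) (snd uv)"] by simp
 also have "... = (\<integral>\<^sup>+wk. h (fst (?f wk)) (snd (?f wk)) \<partial>count_space ?A)"
  by (rule nn_integral_bij_count_space[OF bij, symmetric])
 also have "... = (\<integral>\<^sup>+wk. h (fst (?f wk)) (snd (?f wk)) * indicator ?A wk \<partial>count_space UNIV)"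
  by (rule nn_integral_count_space_indicator) simp
 also have "... = (\<integral>\<^sup>+wa. \<integral>\<^sup>+k. h (take k wa) (drop k wa) * indicator ?A (wa, k) \<partial>count_space UNIV \<partial>count_space UNIV)"
  using nn_integral_fst_count_space[of "\<lambda>wk. h (fst (?f wk)) (snd (?f wk)) * indicator ?A wk"] by simp
 also have "... = (\<integral>\<^sup>+wa. (\<Sum>k\<le>length wa. h (take k wa) (drop k wa)) \<partial>count_space UNIV)"
 proof (rule nn_integral_cong)
  fix wa :: "'a list"
  have "(\<integral>\<^sup>+k. h (take k wa) (drop k wa) * indicator ?A (wa, k) \<partial>count_space UNIV)
    = (\<integral>\<^sup>+k. h (take k wa) (drop k wa) * indicator {..length wa} k \<partial>count_space UNIV)"
   by (intro nn_integral_cong) (auto split: split_indicator)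
  also have "... = (\<integral>\<^sup>+k. h (take k wa) (drop k wa) \<partial>count_space {..length wa})"
   by (rule nn_integral_count_space_indicator[symmetric]) simp
  also have "... = (\<Sum>k\<le>length wa. h (take k wa) (drop k wa))" by (rule nn_integral_count_space_finite) simp
  finally show "(\<integral>\<^sup>+k. h (take k wa) (drop k wa) * indicator ?A (wa, k) \<partial>count_space UNIV)
   = (\<Sum>k\<le>length wa. h (take k wa) (drop k wa))" .
 qed
 finally show ?thesis by simp
qed

text \<open>A deterministic identity: the population at \<open>t + s\<close> is the disjoint union
  of the populations at age \<open>s\<close> in the subtrees rooted at the particles alive at
  \<open>t\<close>. Randomness enters later, through the law of these subtrees.\<close>

lemma XE_add:
 assumes "w \<in> space Omega_space" "0 <= t" "0 <= s"
 shows "XE w (t + s) g = SE w t (\<lambda>w'. XE w' s g)"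
proof -
 let ?F = "\<lambda>y. if y = None then 0 else g y"
 have "XE w (t + s) g = (\<integral>\<^sup>+wa. (\<Sum>k\<le>length wa. if pos w t (take k wa) = None then 0
   else ?F (pos (subT t (take k wa) w) s (drop k wa))) \<partial>count_space UNIV)"
  unfolding XE_def by (intro nn_integral_cong pos_split[OF assms, of ?F]) simp
 also have "... = (\<integral>\<^sup>+u. \<integral>\<^sup>+v. (if pos w t u = None then 0 else ?F (pos (subT t u w) s v)) \<partial>count_space UNIV \<partial>count_space UNIV)"
  by (rule nn_integral_splits)
 also have "... = SE w t (\<lambda>w'. XE w' s g)"
  unfolding SE_def XE_def
 proof (rule nn_integral_cong)
  fix u show "(\<integral>\<^sup>+v. (if pos w t u = None then 0 else ?F (pos (subT t u w) s v)) \<partial>count_space UNIV)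
   = (if pos w t u = None then 0 else \<integral>\<^sup>+v. ?F (pos (subT t u w) s v) \<partial>count_space UNIV)"
   by (cases "pos w t u") simp_all
 qed
 finally show ?thesis .
qed

lemma XE_killT:
 assumes "pos w s u \<noteq> None" "r <= s" shows "XE (killT s u w) r g = XE w r g"
 unfolding XE_def pos_killT[OF assms] ..

lemma XE_measurable[measurable]:
 assumes [measurable]: "g \<in> borel_measurable (optB :: 'a::metric_space option measure)"
 shows "(\<lambda>w. XE w s g) \<in> borel_measurable Omega_space"
 unfolding XE_def
proof (rule measurable_nn_integral_countable)
 fix u
 have [measurable]: "(\<lambda>w. pos w s u) \<in> Omega_space \<rightarrow>\<^sub>M (optB :: 'a option measure)" by (rule pos_measurable) measurable
 show "(\<lambda>w. if pos w s u = None then 0 else g (pos w s u)) \<in> borel_measurable Omega_space" by measurable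
qed

lemma SE_measurable[measurable]:
 assumes [measurable]: "G \<in> borel_measurable (Omega_space :: 'a::metric_space tree measure)"
 shows "(\<lambda>w. SE w s G) \<in> borel_measurable Omega_space"
 unfolding SE_def
proof (rule measurable_nn_integral_countable)
 fix u
 have [measurable]: "(\<lambda>w. pos w s u) \<in> Omega_space \<rightarrow>\<^sub>M (optB :: 'a option measure)" by (rule pos_measurable) measurable
 have [measurable]: "(\<lambda>w. subT s u w) \<in> Omega_space \<rightarrow>\<^sub>M (Omega_space :: 'a tree measure)" by (rule subT_measurable) measurable
 show "(\<lambda>w. if pos w s u = None then 0 else G (subT s u w)) \<in> borel_measurable Omega_space" by measurable
qed

context branching
begin

definition gP :: "('a tree => ennreal) => 'a option => ennreal" where
 "gP G y = (case y of None => 0 | Some x => \<integral>\<^sup>+w. G w \<partial>P x)"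

lemma EP_measurable[measurable]: "G \<in> borel_measurable Omega_space ==> (\<lambda>x. \<integral>\<^sup>+w. G w \<partial>P x) \<in> borel_measurable borel"
 by (rule measurable_compose[OF measurable_prob_algebraD[OF P_kernel] nn_integral_measurable_subprob_algebra])

lemma gP_measurable[measurable]: "G \<in> borel_measurable Omega_space ==> gP G \<in> borel_measurable optB"
 unfolding measurable_optB_iff gP_def by simp

lemma sets_off_at: "xi \<in> hpaths ==> sets (off_at p xi \<tau>) = sets (count_space UNIV) \<and> prob_space (off_at p xi \<tau>)"
 using measurable_space[OF off_at_kernel[of "\<lambda>_. xi" borel "\<lambda>\<tau>. \<tau>"], of \<tau>] by (auto simp: space_prob_algebra)

lemma survival:
 assumes "xi \<in> hpaths" "0 <= s"
 shows "(\<integral>\<^sup>+e. ennreal (exponential_density 1 e) * (if ennreal s < tauf (bp xi) e then c else 0) \<partial>lborel) = ennreal (exp (- Ib (bp xi) s)) * c"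
proof -
 interpret rate "bp xi" Kb by (rule rate_bp[OF assms(1)])
 have "(\<integral>\<^sup>+e. ennreal (exponential_density 1 e) * c \<partial>lborel) = c"
  by (subst nn_integral_multc) (simp_all add: expo_integral)
 then show ?thesis
  using nn_integral_memoryless[OF assms(2) rate_bp[OF shiftp_hpaths[OF assms]], of "\<lambda>_. c"] assms(2)
  by (simp add: vp_shift)
qed

text \<open>The base case combines two restarts at time \<open>s\<close>: the exponential clock
  restarts with the shifted rate, and the motion restarts from its current position. The factor
  \<open>H\<close> sees nothing but the stopped path.\<close>

lemma branching_property_root:
 assumes H[measurable]: "H \<in> borel_measurable Omega_space" and G[measurable]: "G \<in> borel_measurable Omega_space"
 shows "(\<integral>\<^sup>+w. (if pos w s [] = None then 0 else H (killT s [] w) * G (subT s [] w)) \<partial>P x)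
    = (\<integral>\<^sup>+w. (if pos w s [] = None then 0 else H (killT s [] w) * gP G (pos w s [])) \<partial>P x)"
  (is "(\<integral>\<^sup>+w. ?\<Phi> w \<partial>P x) = (\<integral>\<^sup>+w. ?\<Psi> w \<partial>P x)")
proof (cases "0 <= s")
 case False then show ?thesis by (simp add: pos_neg)
next
 case s: True
 have [measurable]: "(\<lambda>w. killT s [] w) \<in> Omega_space \<rightarrow>\<^sub>M (Omega_space :: 'a tree measure)" by (rule killT_measurable) measurable
 have [measurable]: "(\<lambda>w. subT s [] w) \<in> Omega_space \<rightarrow>\<^sub>M (Omega_space :: 'a tree measure)" by (rule subT_measurable) measurable
 have [measurable]: "(\<lambda>w. pos w s []) \<in> Omega_space \<rightarrow>\<^sub>M (optB :: 'a option measure)" by (rule pos_measurable) measurable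
 have m\<Phi>: "?\<Phi> \<in> borel_measurable Omega_space" by measurable
 have m\<Psi>: "?\<Psi> \<in> borel_measurable Omega_space" by measurable
 have ev[measurable]: "(\<lambda>xi. xi s) \<in> path_space \<rightarrow>\<^sub>M (optB :: 'a option measure)" by (rule eval_measurable0[OF s])
 \<comment> \<open>The value of \<open>H\<close> on the killed tree, as a function of the root path;
   it is unchanged when the path is stopped at \<open>s\<close>.\<close>
 define K where "K xi = H (graft (stopp s xi, \<top>, 0) (\<lambda>_ _. dummyD))" for xi :: "'a path"
 have dO: "(\<lambda>_. dummyD) \<in> space (Omega_space :: 'a tree measure)" using dummyD_space by (auto simp: space_Omega)
 have [measurable]: "(\<lambda>xi. stopp s xi) \<in> path_space \<rightarrow>\<^sub>M (path_space :: 'a path measure)" by (rule stopp_measurable) (use s in auto)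
 have mK[measurable]: "K \<in> borel_measurable path_space" unfolding K_def
  by (rule measurable_compose[OF graft_measurable H]) (use dO in measurable)
 define V where "V xi = (\<integral>\<^sup>+e. ennreal (exponential_density 1 e) * R G xi (tauf (bp xi) e) \<partial>lborel)" for xi
 have mV[measurable]: "V \<in> borel_measurable path_space"
 proof -
  have [measurable]: "(\<lambda>z. tauf (bp (fst z)) (snd z)) \<in> borel_measurable (path_space \<Otimes>\<^sub>M lborel)" by (rule tauf_bp_measurable) measurable
  have [measurable]: "(\<lambda>z. R G (fst z) (tauf (bp (fst z)) (snd z))) \<in> borel_measurable (path_space \<Otimes>\<^sub>M lborel)" by (rule R_measurable) measurable
  show ?thesis unfolding V_def
   by (rule sigma_finite_measure.borel_measurable_nn_integral[OF sigma_finite_lborel]) (simp add: split_beta', measurable)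
 qed
 have VP: "(\<integral>\<^sup>+xi. V xi \<partial>Yl y) = (\<integral>\<^sup>+w. G w \<partial>P y)" for y unfolding V_def nn_integral_P[OF G] ..
 define al where "al xi \<tau> \<longleftrightarrow> ennreal s < \<tau> \<and> xi s \<noteq> None" for xi :: "'a path" and \<tau>
 have R\<Phi>: "R ?\<Phi> xi \<tau> = (if al xi \<tau> then K xi * R G (shiftp xi s) (\<tau> - ennreal s) else 0)" if xi: "xi \<in> hpaths" for xi \<tau>
 proof -
  have *: "?\<Phi> (graft (xi, \<tau>, n) wa) = (if al xi \<tau> then K xi * G (graft (shiftp xi s, \<tau> - ennreal s, n) wa) else 0)" for n wa
  proof -
   have "subT s [] (graft (xi, \<tau>, n) wa) = graft (shiftp xi s, \<tau> - ennreal s, n) wa"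
   proof
    fix v show "subT s [] (graft (xi, \<tau>, n) wa) v = graft (shiftp xi s, \<tau> - ennreal s, n) wa v"
     using s by (cases v) (simp_all add: max_absorb2)
   qed
   then show ?thesis using s by (auto simp: al_def pos_Nil killT.simps K_def max_absorb2 simp del: subT.simps)
  qed
  show ?thesis
  proof (cases "al xi \<tau>")
   case False then show ?thesis unfolding R_def J_def by (simp only: * if_False) simp
  next
   case True
   then have al: "ennreal s < \<tau>" "xi s \<noteq> None" by (auto simp: al_def)
   have enn: "shiftp xi s (enn2real (\<tau> - ennreal s)) = xi (enn2real \<tau>)" if "\<tau> < \<top>"
    using life_minus[OF s al(1) that] by (simp add: shiftp_def)
   \<comment> \<open>The death position is the same on the old clock and on the reset one, hence so
     are the laws of the children and of their number.\<close>
   have cl: "child_law P (shiftp xi s, \<tau> - ennreal s, n) = child_law P (xi, \<tau>, n)" for n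
    by (auto simp: child_law_chk minus_less_top_iff enn fun_eq_iff)
   have oa: "off_at p (shiftp xi s) (\<tau> - ennreal s) = off_at p xi \<tau>"
    by (auto simp: off_at_offk minus_less_top_iff enn)
   have J: "J ?\<Phi> (xi, \<tau>, n) = K xi * J G (shiftp xi s, \<tau> - ennreal s, n)" for n
   proof -
    have [measurable]: "(shiftp xi s, \<tau> - ennreal s, n) \<in> space D_space" using shiftp_hpaths[OF xi s] by (simp add: space_D)
    show ?thesis unfolding J_def cl using True by (simp only: * if_True) (rule nn_integral_cmult, measurable)
   qed
   have "(\<lambda>n. J G (shiftp xi s, \<tau> - ennreal s, n)) \<in> borel_measurable (off_at p xi \<tau>)"
    unfolding measurable_cong_sets[OF conjunct1[OF sets_off_at[OF xi]] refl] by simp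
   then show ?thesis unfolding R_def oa J using True by (simp add: nn_integral_cmult)
  qed
 qed
 have R\<Psi>: "R ?\<Psi> xi \<tau> = (if al xi \<tau> then K xi * gP G (xi s) else 0)" if xi: "xi \<in> hpaths" for xi \<tau>
 proof -
  have *: "?\<Psi> (graft (xi, \<tau>, n) wa) = (if al xi \<tau> then K xi * gP G (xi s) else 0)" for n wa
   using s by (auto simp: al_def pos_Nil killT.simps K_def max_absorb2)
  have "prob_space (off_at p xi \<tau>)" using sets_off_at[OF xi] by blast
  then show ?thesis unfolding R_def J_def *
   by (simp add: prob_space.emeasure_space_1 prob_subs_law)
 qed
 have mB[measurable]: "(\<lambda>xi. Ib (bp xi) s) \<in> borel_measurable path_space" by (rule Ib_vp_measurable) measurable
 have L: "(\<integral>\<^sup>+e. ennreal (exponential_density 1 e) * R ?\<Phi> xi (tauf (bp xi) e) \<partial>lborel)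
   = ennreal (exp (- Ib (bp xi) s)) * (if xi s = None then 0 else K xi * V (shiftp xi s))" if xi: "xi \<in> hpaths" for xi
 proof (cases "xi s = None")
  case True then show ?thesis unfolding R\<Phi>[OF xi] al_def by simp
 next
  case False
  interpret rate "bp xi" Kb by (rule rate_bp[OF xi])
  note xi' = shiftp_hpaths[OF xi s]
  have mR[measurable]: "(\<lambda>\<tau>. R G (shiftp xi s) \<tau>) \<in> borel_measurable borel" by (rule R_measurable[OF G]) (use xi' in auto)
  interpret b': rate "bp (shiftp xi s)" Kb by (rule rate_bp[OF xi'])
  have "(\<integral>\<^sup>+e. ennreal (exponential_density 1 e) * R ?\<Phi> xi (tauf (bp xi) e) \<partial>lborel)
    = (\<integral>\<^sup>+e. ennreal (exponential_density 1 e) * (if ennreal s < tauf (bp xi) e then K xi * R G (shiftp xi s) (tauf (bp xi) e - ennreal s) else 0) \<partial>lborel)"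
   unfolding R\<Phi>[OF xi] al_def using False by simp
  also have "... = ennreal (exp (- Ib (bp xi) s)) * (\<integral>\<^sup>+e. ennreal (exponential_density 1 e) * (K xi * R G (shiftp xi s) (tauf (bp (shiftp xi s)) e)) \<partial>lborel)"
   by (rule nn_integral_memoryless[OF s rate_bp[OF xi'], of "\<lambda>\<tau>. K xi * R G (shiftp xi s) \<tau>"]) (use s in \<open>auto simp: vp_shift\<close>)
  also have "(\<integral>\<^sup>+e. ennreal (exponential_density 1 e) * (K xi * R G (shiftp xi s) (tauf (bp (shiftp xi s)) e)) \<partial>lborel) = K xi * V (shiftp xi s)"
   unfolding V_def by (subst nn_integral_cmult[symmetric]) (auto simp: ac_simps)
  finally show ?thesis using False by (simp only: if_False)
 qed
 have Rr: "(\<integral>\<^sup>+e. ennreal (exponential_density 1 e) * R ?\<Psi> xi (tauf (bp xi) e) \<partial>lborel)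
   = ennreal (exp (- Ib (bp xi) s)) * (if xi s = None then 0 else K xi * gP G (xi s))" if xi: "xi \<in> hpaths" for xi
 proof (cases "xi s = None")
  case True then show ?thesis unfolding R\<Psi>[OF xi] al_def by simp
 next
  case False then show ?thesis unfolding R\<Psi>[OF xi] al_def using survival[OF xi s, of "K xi * gP G (xi s)"]
   by (simp only: False not_False_eq_True simp_thms if_False)
 qed
 \<comment> \<open>Past factors are read from the first path and \<open>V\<close> from the second,
   so the Markov property applies to the pair (stopped path, shifted path).\<close>
 define FF where "FF z = ennreal (exp (- Ib (bp (fst z)) s)) * (if fst z s = None then 0 else K (fst z) * V (snd z))" for z :: "'a path \<times> 'a path"
 have mFF[measurable]: "FF \<in> borel_measurable (path_space \<Otimes>\<^sub>M path_space)" unfolding FF_def by measurable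
 have Kst: "K (stopp s xi) = K xi" for xi unfolding K_def by (simp add: stopp_def)
 have st: "stopp s xi s = xi s" for xi :: "'a path" by (simp add: stopp_def)
 have "(\<integral>\<^sup>+w. ?\<Phi> w \<partial>P x) = (\<integral>\<^sup>+xi. FF (stopp s xi, shiftp xi s) \<partial>Yl x)"
  unfolding nn_integral_P[OF m\<Phi>] FF_def by (intro nn_integral_cong) (simp add: L Ib_vp_stop Kst st)
 also have "... = (\<integral>\<^sup>+xi. \<integral>\<^sup>+xi'. FF (stopp s xi, xi') \<partial>PiD Yl (xi s) \<partial>Yl x)" by (rule markov[OF s mFF])
 also have "... = (\<integral>\<^sup>+w. ?\<Psi> w \<partial>P x)"
  unfolding nn_integral_P[OF m\<Psi>]
 proof (rule nn_integral_cong)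
  fix xi assume "xi \<in> space (Yl x)" then have xi: "xi \<in> hpaths" by simp
  show "(\<integral>\<^sup>+xi'. FF (stopp s xi, xi') \<partial>PiD Yl (xi s)) = (\<integral>\<^sup>+e. ennreal (exponential_density 1 e) * R ?\<Psi> xi (tauf (bp xi) e) \<partial>lborel)"
  proof (cases "xi s")
   case None then show ?thesis unfolding Rr[OF xi] FF_def by (simp add: st)
  next
   case (Some y)
   have "(\<integral>\<^sup>+xi'. FF (stopp s xi, xi') \<partial>PiD Yl (xi s)) = (\<integral>\<^sup>+xi'. (ennreal (exp (- Ib (bp xi) s)) * K xi) * V xi' \<partial>Yl y)"
    unfolding FF_def by (simp add: st Some PiD_def Ib_vp_stop Kst mult.assoc)
   also have "... = (ennreal (exp (- Ib (bp xi) s)) * K xi) * (\<integral>\<^sup>+xi'. V xi' \<partial>Yl y)"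
    by (rule nn_integral_cmult) measurable
   finally show ?thesis unfolding Rr[OF xi] VP by (simp add: Some gP_def mult.assoc)
  qed
 qed
 finally show ?thesis .
qed

text \<open>For a label starting with \<open>i\<close>, everything at the root and in the other
  subtrees is frozen and only the subtree of child \<open>i\<close> is resampled. That subtree has
  law \<open>P z\<close> with \<open>z\<close> the death position, and the induction hypothesis
  applies on its own clock.\<close>

lemma branching_property:
 assumes G[measurable]: "G \<in> borel_measurable Omega_space" and H: "H \<in> borel_measurable Omega_space"
 shows "(\<integral>\<^sup>+w. (if pos w s u = None then 0 else H (killT s u w) * G (subT s u w)) \<partial>P x)
    = (\<integral>\<^sup>+w. (if pos w s u = None then 0 else H (killT s u w) * gP G (pos w s u)) \<partial>P x)"
 using H
proof (induction u arbitrary: H s x)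
 case Nil then show ?case using branching_property_root[OF _ G] by blast
next
 case (Cons i v)
 note H[measurable] = Cons.prems
 let ?\<Phi> = "\<lambda>w. (if pos w s (i # v) = None then 0 else H (killT s (i # v) w) * G (subT s (i # v) w))"
 let ?\<Psi> = "\<lambda>w. (if pos w s (i # v) = None then 0 else H (killT s (i # v) w) * gP G (pos w s (i # v)))"
 have [measurable]: "(\<lambda>w. killT s (i # v) w) \<in> Omega_space \<rightarrow>\<^sub>M (Omega_space :: 'a tree measure)" by (rule killT_measurable) measurable
 have [measurable]: "(\<lambda>w. subT s (i # v) w) \<in> Omega_space \<rightarrow>\<^sub>M (Omega_space :: 'a tree measure)" by (rule subT_measurable) measurable
 have [measurable]: "(\<lambda>w. pos w s (i # v)) \<in> Omega_space \<rightarrow>\<^sub>M (optB :: 'a option measure)" by (rule pos_measurable) measurable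
 have m\<Phi>[measurable]: "?\<Phi> \<in> borel_measurable Omega_space" by measurable
 have m\<Psi>[measurable]: "?\<Psi> \<in> borel_measurable Omega_space" by measurable
 have "J ?\<Phi> d = J ?\<Psi> d" if d: "d \<in> space D_space" for d
 proof -
  obtain xi \<tau> n where d': "d = (xi, \<tau>, n)" by (cases d)
  define ok where "ok \<longleftrightarrow> i < n \<and> \<tau> < \<top> \<and> xi (enn2real \<tau>) \<noteq> None"
  have okg: "okc (graft d wa) i = ok" for wa by (simp add: okc_def ok_def d')
  show ?thesis
  proof (cases ok)
   case False then show ?thesis unfolding J_def by (simp add: pos_Cons okg)
  next
   case True
   then obtain z where z: "xi (enn2real \<tau>) = Some z" "i < n" "\<tau> < \<top>" by (auto simp: ok_def)
   have ci: "child_law P d i = P z" by (simp add: child_law_chk d' z chk_def)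
   let ?s = "s - enn2real \<tau>"
   have k: "killT s (i # v) (graft d wa) = graft d (wa(i := killT ?s v (wa i)))" for wa
   proof -
    have "sub (graft d wa) = wa" by (rule ext) simp
    then show ?thesis by (simp add: killT.simps d')
   qed
   have pg: "pos (graft d wa) s (i # v) = pos (wa i) ?s v" for wa
    unfolding pos_Cons okg using True by (simp add: d')
   have tg: "subT s (i # v) (graft d wa) = subT ?s v (wa i)" for wa by (simp add: d')
   have md: "graft d \<in> PiM UNIV (\<lambda>_::nat. Omega_space) \<rightarrow>\<^sub>M Omega_space" by (rule graft_subs'[OF d])
   have m1: "(\<lambda>wa. ?\<Phi> (graft d wa)) \<in> borel_measurable (subs_law d)"
    using measurable_compose[OF md m\<Phi>] by (simp cong: measurable_cong_sets)
   have m2: "(\<lambda>wa. ?\<Psi> (graft d wa)) \<in> borel_measurable (subs_law d)"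
    using measurable_compose[OF md m\<Psi>] by (simp cong: measurable_cong_sets)
   have "J ?\<Phi> d = (\<integral>\<^sup>+wa. \<integral>\<^sup>+y. ?\<Phi> (graft d (wa(i := y))) \<partial>P z \<partial>subs_law d)"
    unfolding J_def using nn_integral_PiM_resample[OF child_prob m1, of i] by (simp add: ci)
   also have "... = (\<integral>\<^sup>+wa. \<integral>\<^sup>+y. ?\<Psi> (graft d (wa(i := y))) \<partial>P z \<partial>subs_law d)"
   proof (rule nn_integral_cong)
    fix wa assume "wa \<in> space (subs_law d)"
    then have wa: "wa j \<in> space Omega_space" for j using sets_eq_imp_space_eq[OF sets_subs_law, of d] by (auto simp: space_PiM)
    \<comment> \<open>After freezing the siblings, \<open>H\<close> becomes a different functional
      of one subtree; hence the induction is over all \<open>H\<close> at once.\<close>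
    define H' where "H' y = H (graft d (wa(i := y)))" for y
    have "(\<lambda>y. graft d (wa(i := y))) \<in> Omega_space \<rightarrow>\<^sub>M Omega_space"
     by (rule graft_measurable) (use d wa in \<open>auto simp: fun_upd_def\<close>)
    then have mH': "H' \<in> borel_measurable Omega_space" unfolding H'_def by (rule measurable_compose[OF _ H])
    show "(\<integral>\<^sup>+y. ?\<Phi> (graft d (wa(i := y))) \<partial>P z) = (\<integral>\<^sup>+y. ?\<Psi> (graft d (wa(i := y))) \<partial>P z)"
     unfolding pg k tg fun_upd_same fun_upd_upd by (rule Cons.IH[OF mH', where s="?s" and x=z, unfolded H'_def])
   qed
   also have "... = J ?\<Psi> d"
    unfolding J_def using nn_integral_PiM_resample[OF child_prob m2, of i] by (simp add: ci)
   finally show ?thesis .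
  qed
 qed
 then show ?case
  unfolding nn_integral_P_particle[OF m\<Phi>] nn_integral_P_particle[OF m\<Psi>]
  using sets_eq_imp_space_eq[OF sets_particle] by (intro nn_integral_cong) blast
qed

text \<open>The conditional expectation at time \<open>s\<close>: a functional \<open>H\<close> that
  does not notice the killing of any particle alive at \<open>s\<close> plays the role of an event
  of the past, and the identity is summed over the countably many labels.\<close>

lemma nn_integral_SE:
 assumes G[measurable]: "G \<in> borel_measurable Omega_space" and H[measurable]: "H \<in> borel_measurable Omega_space"
  and inv: "\<And>w u. pos w s u \<noteq> None ==> H (killT s u w) = H w"
 shows "(\<integral>\<^sup>+w. H w * SE w s G \<partial>P x) = (\<integral>\<^sup>+w. H w * XE w s (gP G) \<partial>P x)"
proof -
 have mp[measurable]: "(\<lambda>w. pos w s u) \<in> Omega_space \<rightarrow>\<^sub>M (optB :: 'a option measure)" for u by (rule pos_measurable) measurable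
 have ms[measurable]: "(\<lambda>w. subT s u w) \<in> Omega_space \<rightarrow>\<^sub>M (Omega_space :: 'a tree measure)" for u by (rule subT_measurable) measurable
 have "(\<integral>\<^sup>+w. H w * SE w s G \<partial>P x) = (\<integral>\<^sup>+w. \<integral>\<^sup>+u. (if pos w s u = None then 0 else H (killT s u w) * G (subT s u w)) \<partial>count_space UNIV \<partial>P x)"
  unfolding SE_def by (intro nn_integral_cong, subst nn_integral_cmult[symmetric]) (auto intro!: nn_integral_cong simp: inv)
 also have "... = (\<integral>\<^sup>+u. \<integral>\<^sup>+w. (if pos w s u = None then 0 else H (killT s u w) * G (subT s u w)) \<partial>P x \<partial>count_space UNIV)"
 proof (rule nn_integral_count_space_nn_integral)
  fix u
  have "(\<lambda>w. if pos w s u = None then 0 else H w * G (subT s u w)) \<in> borel_measurable (P x)" by measurable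
  also have "(\<lambda>w. if pos w s u = None then 0 else H w * G (subT s u w)) = (\<lambda>w. if pos w s u = None then 0 else H (killT s u w) * G (subT s u w))"
   using inv by (intro ext) auto
  finally show "(\<lambda>w. if pos w s u = None then 0 else H (killT s u w) * G (subT s u w)) \<in> borel_measurable (P x)" .
 qed simp
 also have "... = (\<integral>\<^sup>+u. \<integral>\<^sup>+w. (if pos w s u = None then 0 else H (killT s u w) * gP G (pos w s u)) \<partial>P x \<partial>count_space UNIV)"
  unfolding branching_property[OF G H] ..
 also have "... = (\<integral>\<^sup>+w. \<integral>\<^sup>+u. (if pos w s u = None then 0 else H (killT s u w) * gP G (pos w s u)) \<partial>count_space UNIV \<partial>P x)"
 proof (rule nn_integral_count_space_nn_integral[symmetric])
  fix u
  have "(\<lambda>w. if pos w s u = None then 0 else H w * gP G (pos w s u)) \<in> borel_measurable (P x)" by measurable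
  also have "(\<lambda>w. if pos w s u = None then 0 else H w * gP G (pos w s u)) = (\<lambda>w. if pos w s u = None then 0 else H (killT s u w) * gP G (pos w s u))"
   using inv by (intro ext) auto
  finally show "(\<lambda>w. if pos w s u = None then 0 else H (killT s u w) * gP G (pos w s u)) \<in> borel_measurable (P x)" .
 qed simp
 also have "... = (\<integral>\<^sup>+w. H w * XE w s (gP G) \<partial>P x)"
  unfolding XE_def by (intro nn_integral_cong, subst nn_integral_cmult[symmetric]) (auto intro!: nn_integral_cong simp: inv)
 finally show ?thesis .
qed

lemma nn_integral_SE': "G \<in> borel_measurable Omega_space ==> (\<integral>\<^sup>+w. SE w s G \<partial>P x) = (\<integral>\<^sup>+w. XE w s (gP G) \<partial>P x)"
 using nn_integral_SE[of G "\<lambda>_. 1" s x] by simp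

end

section \<open>Decomposition at the first branching and the many-to-one formula\<close>

lemma nn_integral_list:
 fixes h :: "'b list => ennreal"
 shows "(\<integral>\<^sup>+u. h u \<partial>count_space UNIV) = h [] + (\<integral>\<^sup>+i. \<integral>\<^sup>+v. h (i # v) \<partial>count_space UNIV \<partial>count_space UNIV)"
proof -
 have bij: "bij_betw (\<lambda>iv. fst iv # snd iv) (UNIV :: ('b \<times> 'b list) set) (- {[]})"
 proof (rule bij_betwI[where g="\<lambda>u. (hd u, tl u)"])
 qed auto
 have "(\<integral>\<^sup>+u. h u \<partial>count_space UNIV) = (\<integral>\<^sup>+u. h u * indicator {[]} u + h u * indicator (- {[]}) u \<partial>count_space UNIV)"
  by (intro nn_integral_cong) (auto split: split_indicator)
 also have "... = (\<integral>\<^sup>+u. h u * indicator {[]} u \<partial>count_space UNIV) + (\<integral>\<^sup>+u. h u * indicator (- {[]}) u \<partial>count_space UNIV)"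
  by (rule nn_integral_add) auto
 also have "(\<integral>\<^sup>+u. h u * indicator {[]} u \<partial>count_space UNIV) = h []"
  by (subst nn_integral_count_space_indicator[symmetric]) (auto simp: nn_integral_count_space_finite)
 also have "(\<integral>\<^sup>+u. h u * indicator (- {[]}) u \<partial>count_space UNIV) = (\<integral>\<^sup>+u. h u \<partial>count_space (- {[]}))"
  by (rule nn_integral_count_space_indicator[symmetric]) simp
 also have "... = (\<integral>\<^sup>+iv. h (fst iv # snd iv) \<partial>count_space UNIV)"
  by (rule nn_integral_bij_count_space[OF bij, symmetric])
 also have "... = (\<integral>\<^sup>+i. \<integral>\<^sup>+v. h (i # v) \<partial>count_space UNIV \<partial>count_space UNIV)"
  using nn_integral_fst_count_space[of "\<lambda>iv. h (fst iv # snd iv)"] by simp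
 finally show ?thesis .
qed

text \<open>The common recursion scheme: a quantity that sums over the children of the root, each
  child being given the time left on its own clock.\<close>

definition ksum :: "'a tree => real => (real => 'a tree => ennreal) => ennreal" where
 "ksum w t \<Psi> = (\<integral>\<^sup>+i. (if okc w i then \<Psi> (t - rtime w) (sub w i) else 0) \<partial>count_space UNIV)"

lemma ksum_measurable:
 fixes g :: "'b => 'a::metric_space tree"
 assumes [measurable]: "f \<in> borel_measurable M" "g \<in> M \<rightarrow>\<^sub>M Omega_space"
  and \<Psi>: "(\<lambda>z. \<Psi> (fst z) (snd z)) \<in> borel_measurable (borel \<Otimes>\<^sub>M Omega_space)"
 shows "(\<lambda>x. ksum (g x) (f x) \<Psi>) \<in> borel_measurable M"
 unfolding ksum_def
proof (rule measurable_nn_integral_countable)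
 fix i
 have "(\<lambda>x. (f x - rtime (g x), sub (g x) i)) \<in> M \<rightarrow>\<^sub>M borel \<Otimes>\<^sub>M Omega_space" by measurable
 from measurable_compose[OF this \<Psi>]
 have [measurable]: "(\<lambda>x. \<Psi> (f x - rtime (g x)) (sub (g x) i)) \<in> borel_measurable M" by simp
 show "(\<lambda>x. if okc (g x) i then \<Psi> (f x - rtime (g x)) (sub (g x) i) else 0) \<in> borel_measurable M" by measurable
qed

text \<open>The contribution of generation \<open>n\<close> alone. It obeys an explicit recursion in
  \<open>n\<close>, whereas the total over all generations would only satisfy an implicit
  equation.\<close>

definition XG :: "nat => ('a option => ennreal) => real => 'a tree => ennreal" where
 "XG n g t w = (\<integral>\<^sup>+u. (if length u = n \<and> pos w t u \<noteq> None then g (pos w t u) else 0) \<partial>count_space UNIV)"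

lemma XG_0: "XG 0 g t w = (if pos w t [] = None then 0 else g (pos w t []))"
 unfolding XG_def by (subst nn_integral_list) simp

lemma XG_Suc: "XG (Suc n) g t w = ksum w t (XG n g)"
 unfolding XG_def ksum_def
 by (subst nn_integral_list) (auto intro!: nn_integral_cong simp: pos_Cons simp del: not_None_eq)

lemma XG_neg: "t < 0 ==> XG n g t w = 0"
 unfolding XG_def by (simp add: pos_neg)

lemma XG_measurable:
 fixes h :: "'b => 'a::metric_space tree"
 assumes [measurable]: "g \<in> borel_measurable optB" and f: "f \<in> borel_measurable M" "h \<in> M \<rightarrow>\<^sub>M Omega_space"
 shows "(\<lambda>x. XG n g (f x) (h x)) \<in> borel_measurable M"
 unfolding XG_def
proof (rule measurable_nn_integral_countable)
 fix u
 have [measurable]: "(\<lambda>x. pos (h x) (f x) u) \<in> M \<rightarrow>\<^sub>M (optB :: 'a option measure)" by (rule pos_measurable[OF f])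
 show "(\<lambda>x. if length u = n \<and> pos (h x) (f x) u \<noteq> None then g (pos (h x) (f x) u) else 0) \<in> borel_measurable M" by measurable
qed

lemma XE_XG: "XE w t g = (\<Sum>n. XG n g t w)"
proof -
 have "(\<Sum>n. XG n g t w) = (\<integral>\<^sup>+u. (\<Sum>n. if length u = n \<and> pos w t u \<noteq> None then g (pos w t u) else 0) \<partial>count_space UNIV)"
  unfolding XG_def by (rule nn_integral_suminf[symmetric]) simp
 also have "... = XE w t g"
  unfolding XE_def
 proof (rule nn_integral_cong)
  fix u :: "nat list"
  have "(\<Sum>n. if length u = n \<and> pos w t u \<noteq> None then g (pos w t u) else 0)
   = (\<Sum>n\<in>{length u}. if length u = n \<and> pos w t u \<noteq> None then g (pos w t u) else 0)"
   by (rule suminf_finite) auto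
  then show "(\<Sum>n. if length u = n \<and> pos w t u \<noteq> None then g (pos w t u) else 0) = (if pos w t u = None then 0 else g (pos w t u))"
   by (simp del: not_None_eq)
 qed
 finally show ?thesis by simp
qed

section \<open>Counting births up to a given time\<close>

definition born :: "'a tree => real => nat list => bool" where
 "born w T u \<longleftrightarrow> (\<exists>b. birth w u = Some b \<and> b <= T)"

lemma born_Nil: "born w T [] \<longleftrightarrow> 0 <= T" by (simp add: born_def)

lemma born_Cons: "born w T (i # u) \<longleftrightarrow> okc w i \<and> born (sub w i) (T - rtime w) u"
 by (auto simp: born_def birth_Cons algebra_simps)

lemma born_neg: "T < 0 ==> \<not> born w T u"
proof (induction u arbitrary: w T)
 case (Cons i u) then show ?case using rtime_nonneg[of w] by (simp add: born_Cons)
qed (simp add: born_Nil)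

lemma pos_born: "pos w t u \<noteq> None ==> born w t u"
 unfolding pos_def born_def by (auto split: option.splits prod.splits if_splits)

lemma born_measurable:
 fixes g :: "'b => 'a::metric_space tree"
 assumes "f \<in> borel_measurable M" "g \<in> M \<rightarrow>\<^sub>M Omega_space"
 shows "Measurable.pred M (\<lambda>x. born (g x) (f x) u)"
 using assms
proof (induction u arbitrary: f g)
 case Nil
 note [measurable] = Nil show ?case unfolding born_Nil by measurable
next
 case (Cons i u)
 note [measurable] = Cons.prems
 have [measurable]: "Measurable.pred M (\<lambda>x. born (sub (g x) i) (f x - rtime (g x)) u)" by (rule Cons.IH) measurable
 show ?case unfolding born_Cons by measurable
qed

text \<open>Births are counted rather than living particles because the set of labels born by
  \<open>T\<close> grows with \<open>T\<close>; finiteness at integer times then covers all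
  times.\<close>

definition BE :: "nat => real => 'a tree => ennreal" where
 "BE n T w = (\<integral>\<^sup>+u. (if length u = n \<and> born w T u then 1 else 0) \<partial>count_space UNIV)"

lemma BE_0: "BE 0 T w = (if 0 <= T then 1 else 0)"
 unfolding BE_def by (subst nn_integral_list) (simp add: born_Nil)

lemma BE_Suc: "BE (Suc n) T w = ksum w T (BE n)"
 unfolding BE_def ksum_def by (subst nn_integral_list) (auto intro!: nn_integral_cong simp: born_Cons)

lemma BE_neg: "T < 0 ==> BE n T w = 0"
 unfolding BE_def by (simp add: born_neg)

lemma BE_measurable:
 fixes h :: "'b => 'a::metric_space tree"
 assumes f: "f \<in> borel_measurable M" "h \<in> M \<rightarrow>\<^sub>M Omega_space"
 shows "(\<lambda>x. BE n (f x) (h x)) \<in> borel_measurable M"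
 unfolding BE_def
proof (rule measurable_nn_integral_countable)
 fix u
 have [measurable]: "Measurable.pred M (\<lambda>x. born (h x) (f x) u)" by (rule born_measurable[OF f])
 show "(\<lambda>x. if length u = n \<and> born (h x) (f x) u then 1 else 0 :: ennreal) \<in> borel_measurable M" by measurable
qed

lemma sum_BE: "(\<Sum>n. BE n T w) = emeasure (count_space UNIV) {u. born w T u}"
proof -
 have "(\<Sum>n. BE n T w) = (\<integral>\<^sup>+u. (\<Sum>n. if length u = n \<and> born w T u then 1 else 0) \<partial>count_space UNIV)"
  unfolding BE_def by (rule nn_integral_suminf[symmetric]) simp
 also have "... = (\<integral>\<^sup>+u. indicator {u. born w T u} u \<partial>count_space UNIV)"
 proof (rule nn_integral_cong)
  fix u :: "nat list"
  have "(\<Sum>n. if length u = n \<and> born w T u then 1 else 0 :: ennreal) = (\<Sum>n\<in>{length u}. if length u = n \<and> born w T u then 1 else 0)"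
   by (rule suminf_finite) auto
  then show "(\<Sum>n. if length u = n \<and> born w T u then 1 else 0 :: ennreal) = indicator {u. born w T u} u" by simp
 qed
 finally show ?thesis by simp
qed

context branching
begin

lemma meanoff_nonneg: "0 <= meanoff p x" unfolding meanoff_def using A_summable p_nonneg by (intro suminf_nonneg) auto

lemma KA_nonneg: "0 <= KA" using meanoff_nonneg[of undefined] A_le[of undefined] by simp

lemma meanoff_measurable[measurable]: "meanoff p \<in> borel_measurable borel"
 unfolding meanoff_def[abs_def] by measurable

text \<open>The rate at which children are produced along a path: death rate times mean offspring
  number.\<close>

abbreviation ap :: "'a path => real => real" where "ap xi \<equiv> vp (\<lambda>x. meanoff p x * \<beta> x) xi"

lemma rate_ap: "xi \<in> hpaths ==> rate (ap xi) (KA * Kb)"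
proof
 show "xi \<in> hpaths ==> ap xi \<in> borel_measurable borel" by (rule vp_measurable_time) simp_all
 show "0 <= ap xi r" for r
  using \<beta>_nonneg meanoff_nonneg by (auto simp: vp_def gD_def split: option.split)
 show "ap xi r <= KA * Kb" for r
  using \<beta>_nonneg \<beta>_le Kb_nonneg KA_nonneg meanoff_nonneg A_le by (auto simp: vp_def gD_def intro!: mult_mono split: option.split)
qed

lemma nn_integral_offspring: "(\<integral>\<^sup>+n. h n \<partial>offspring p z) = (\<Sum>n. ennreal (p n z) * h n)"
 unfolding offspring_def by (subst nn_integral_density) (simp_all add: nn_integral_count_space_nat)

lemma R_Some: "xi r = Some z ==> 0 <= r ==> R F xi (ennreal r) = (\<Sum>n. ennreal (p n z) * J F (xi, ennreal r, n))"
 unfolding R_def by (simp add: off_at_offk offk_def nn_integral_offspring)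

text \<open>Split by whether the root survives time \<open>t\<close>. On survival \<open>F\<close>
  is assumed to depend on the current position alone, and survival has probability exp (- Ib);
  otherwise the death time has the density computed for one frozen path.\<close>

lemma root_decomposition:
 assumes F[measurable]: "F \<in> borel_measurable Omega_space" and t: "0 <= t"
  and f0: "\<And>xi \<tau> n wa. xi \<in> hpaths ==> ennreal t < \<tau> ==> F (graft (xi, \<tau>, n) wa) = f0 (xi t)"
 shows "(\<integral>\<^sup>+w. F w \<partial>P x) = (\<integral>\<^sup>+xi. (ennreal (exp (- Ib (bp xi) t)) * f0 (xi t)
   + (\<integral>\<^sup>+r. R F xi (ennreal r) * ennreal (bp xi r * exp (- Ib (bp xi) r)) * indicator {0..t} r \<partial>lborel)) \<partial>Yl x)"
 unfolding nn_integral_P[OF F]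
proof (rule nn_integral_cong)
 fix xi assume "xi \<in> space (Yl x)" then have xi: "xi \<in> hpaths" by simp
 interpret rate "bp xi" Kb by (rule rate_bp[OF xi])
 have Rm[measurable]: "(\<lambda>\<tau>. R F xi \<tau>) \<in> borel_measurable borel" by (rule R_measurable[OF F]) (use xi in auto)
 have R0: "R F xi \<tau> = f0 (xi t)" if "ennreal t < \<tau>" for \<tau>
  unfolding R_def J_def using f0[OF xi that] sets_off_at[OF xi] by (simp add: prob_space.emeasure_space_1 prob_subs_law)
 have "(\<integral>\<^sup>+e. ennreal (exponential_density 1 e) * R F xi (tauf (bp xi) e) \<partial>lborel)
  = (\<integral>\<^sup>+e. ennreal (exponential_density 1 e) * (if ennreal t < tauf (bp xi) e then f0 (xi t) else 0)
    + ennreal (exponential_density 1 e) * (if tauf (bp xi) e <= ennreal t then R F xi (ennreal (enn2real (tauf (bp xi) e))) else 0) \<partial>lborel)"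
 proof (rule nn_integral_cong)
  fix e
  show "ennreal (exponential_density 1 e) * R F xi (tauf (bp xi) e) = ennreal (exponential_density 1 e) * (if ennreal t < tauf (bp xi) e then f0 (xi t) else 0)
    + ennreal (exponential_density 1 e) * (if tauf (bp xi) e <= ennreal t then R F xi (ennreal (enn2real (tauf (bp xi) e))) else 0)"
  proof (cases "ennreal t < tauf (bp xi) e")
   case True then show ?thesis by (simp add: R0 not_le[symmetric] del: not_le)
  next
   case False
   then have "tauf (bp xi) e <= ennreal t" by simp
   then have "tauf (bp xi) e < \<top>" using ennreal_less_top le_less_trans by blast
   then show ?thesis using False by simp
  qed
 qed
 also have "... = (\<integral>\<^sup>+e. ennreal (exponential_density 1 e) * (if ennreal t < tauf (bp xi) e then f0 (xi t) else 0) \<partial>lborel)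
  + (\<integral>\<^sup>+e. ennreal (exponential_density 1 e) * (if tauf (bp xi) e <= ennreal t then R F xi (ennreal (enn2real (tauf (bp xi) e))) else 0) \<partial>lborel)"
  by (rule nn_integral_add) measurable
 also have "... = ennreal (exp (- Ib (bp xi) t)) * f0 (xi t)
   + (\<integral>\<^sup>+r. R F xi (ennreal r) * ennreal (bp xi r * exp (- Ib (bp xi) r)) * indicator {0..t} r \<partial>lborel)"
  unfolding survival[OF xi t] by (subst nn_integral_death[OF t, of "\<lambda>r. R F xi (ennreal r)"]) auto
 finally show "(\<integral>\<^sup>+e. ennreal (exponential_density 1 e) * R F xi (tauf (bp xi) e) \<partial>lborel)
   = ennreal (exp (- Ib (bp xi) t)) * f0 (xi t)
   + (\<integral>\<^sup>+r. R F xi (ennreal r) * ennreal (bp xi r * exp (- Ib (bp xi) r)) * indicator {0..t} r \<partial>lborel)" .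
qed

lemma child_Some: "xi r = Some z ==> 0 <= r ==> i < k ==> child_law P (xi, ennreal r, k) i = P z"
 by (simp add: child_law_chk chk_def)

lemma nn_integral_component:
 assumes [measurable]: "f \<in> borel_measurable Omega_space"
 shows "(\<integral>\<^sup>+wa. f (wa i) \<partial>subs_law d) = (\<integral>\<^sup>+y. f y \<partial>child_law P d i)"
proof -
 have "(\<integral>\<^sup>+y. f y \<partial>child_law P d i) = (\<integral>\<^sup>+y. f y \<partial>distr (subs_law d) (child_law P d i) (\<lambda>wa. wa i))"
  by (subst distr_PiM_component) (auto intro: child_prob)
 also have "... = (\<integral>\<^sup>+wa. f (wa i) \<partial>subs_law d)"
  by (rule nn_integral_distr) (auto cong: measurable_cong_sets)
 finally show ?thesis ..
qed

lemma J_ksum: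
 assumes \<Psi>: "(\<lambda>z. \<Psi> (fst z) (snd z)) \<in> borel_measurable (borel \<Otimes>\<^sub>M Omega_space)"
  and r: "xi r = Some z" "0 <= r"
 shows "J (\<lambda>w. ksum w t \<Psi>) (xi, ennreal r, k) = of_nat k * (\<integral>\<^sup>+y. \<Psi> (t - r) y \<partial>P z)"
proof -
 have m[measurable]: "\<Psi> s \<in> borel_measurable Omega_space" for s
  using measurable_compose[OF measurable_Pair1' \<Psi>, of s] by simp
 have ok: "okc (graft (xi, ennreal r, k) wa) i \<longleftrightarrow> i < k" for wa i using r by (simp add: okc_def)
 have "J (\<lambda>w. ksum w t \<Psi>) (xi, ennreal r, k) = (\<integral>\<^sup>+wa. \<integral>\<^sup>+i. (if i < k then \<Psi> (t - r) (wa i) else 0) \<partial>count_space UNIV \<partial>subs_law (xi, ennreal r, k))"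
 proof -
  have rt: "rtime (graft (xi, ennreal r, k) wa) = r" for wa using r(2) by simp
  show ?thesis unfolding J_def ksum_def ok rt graft_simps(1) ..
 qed
 also have "... = (\<integral>\<^sup>+i. \<integral>\<^sup>+wa. (if i < k then \<Psi> (t - r) (wa i) else 0) \<partial>subs_law (xi, ennreal r, k) \<partial>count_space UNIV)"
  by (rule nn_integral_count_space_nn_integral) (auto cong: measurable_cong_sets)
 also have "... = (\<integral>\<^sup>+i. (\<integral>\<^sup>+y. \<Psi> (t - r) y \<partial>P z) * indicator {..<k} i \<partial>count_space UNIV)"
 proof (rule nn_integral_cong)
  fix i
  show "(\<integral>\<^sup>+wa. (if i < k then \<Psi> (t - r) (wa i) else 0) \<partial>subs_law (xi, ennreal r, k)) = (\<integral>\<^sup>+y. \<Psi> (t - r) y \<partial>P z) * indicator {..<k} i"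
   using nn_integral_component[OF m[of "t - r"], where i=i and d="(xi, ennreal r, k)"] child_Some[of xi r z i k] r by (cases "i < k") simp_all
 qed
 also have "... = of_nat k * (\<integral>\<^sup>+y. \<Psi> (t - r) y \<partial>P z)"
  by (subst nn_integral_cmult) (auto simp: mult.commute ennreal_of_nat_eq_real_of_nat)
 finally show ?thesis .
qed

lemma suminf_offspring_mean: "(\<Sum>k. ennreal (p k z) * (of_nat k * c)) = ennreal (meanoff p z) * c"
proof -
 have "(\<Sum>k. ennreal (p k z) * (of_nat k * c)) = (\<Sum>k. ennreal (real k * p k z) * c)"
  by (intro suminf_cong) (simp add: ennreal_mult' ennreal_of_nat_eq_real_of_nat[symmetric] ac_simps p_nonneg)
 also have "... = (\<Sum>k. ennreal (real k * p k z)) * c" by (rule ennreal_suminf_multc)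
 also have "(\<Sum>k. ennreal (real k * p k z)) = ennreal (meanoff p z)"
  unfolding meanoff_def by (rule suminf_ennreal2) (use A_summable p_nonneg in auto)
 finally show ?thesis .
qed

text \<open>The density of death times the mean offspring number yields the birth rate
  \<open>ap\<close>; the assumption on negative times removes the case in which the root outlives
  \<open>t\<close>.\<close>

lemma nn_integral_ksum:
 assumes \<Psi>: "(\<lambda>z. \<Psi> (fst z) (snd z)) \<in> borel_measurable (borel \<Otimes>\<^sub>M Omega_space)"
  and neg: "\<And>s w. s < 0 ==> \<Psi> s w = 0" and t: "0 <= t"
 shows "(\<integral>\<^sup>+w. ksum w t \<Psi> \<partial>P x) = (\<integral>\<^sup>+xi. \<integral>\<^sup>+r. ennreal (ap xi r * exp (- Ib (bp xi) r)) * gP (\<Psi> (t - r)) (xi r) * indicator {0..t} r \<partial>lborel \<partial>Yl x)"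
proof -
 have Fm: "(\<lambda>w. ksum w t \<Psi>) \<in> borel_measurable Omega_space" by (rule ksum_measurable[OF _ _ \<Psi>]) measurable
 have "(\<integral>\<^sup>+w. ksum w t \<Psi> \<partial>P x) = (\<integral>\<^sup>+xi. (ennreal (exp (- Ib (bp xi) t)) * 0
   + (\<integral>\<^sup>+r. R (\<lambda>w. ksum w t \<Psi>) xi (ennreal r) * ennreal (bp xi r * exp (- Ib (bp xi) r)) * indicator {0..t} r \<partial>lborel)) \<partial>Yl x)"
 proof (rule root_decomposition[OF Fm t])
  fix xi :: "'a path" and \<tau> n wa assume a: "xi \<in> hpaths" "ennreal t < \<tau>"
  have "\<Psi> (t - rtime (graft (xi, \<tau>, n) wa)) y = 0" if "okc (graft (xi, \<tau>, n) wa) i" for i y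
  proof (rule neg)
   have "rlife (graft (xi, \<tau>, n) wa) = ennreal (rtime (graft (xi, \<tau>, n) wa))" by (rule okc_rtime[OF that])
   then have "\<tau> = ennreal (enn2real \<tau>)" by simp
   then have "t < enn2real \<tau>" using a(2) t by (metis ennreal_less_iff)
   then show "t - rtime (graft (xi, \<tau>, n) wa) < 0" by simp
  qed
  then show "ksum (graft (xi, \<tau>, n) wa) t \<Psi> = 0" unfolding ksum_def by (simp cong: if_cong)
 qed
 also have "... = (\<integral>\<^sup>+xi. \<integral>\<^sup>+r. ennreal (ap xi r * exp (- Ib (bp xi) r)) * gP (\<Psi> (t - r)) (xi r) * indicator {0..t} r \<partial>lborel \<partial>Yl x)"
 proof (simp, intro nn_integral_cong)
  fix xi r
  show "R (\<lambda>w. ksum w t \<Psi>) xi (ennreal r) * ennreal (bp xi r * exp (- Ib (bp xi) r)) * indicator {0..t} r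
    = ennreal (ap xi r * exp (- Ib (bp xi) r)) * gP (\<Psi> (t - r)) (xi r) * indicator {0..t} r"
  proof (cases "r \<in> {0..t}")
   case True
   then have r: "0 <= r" by simp
   show ?thesis
   proof (cases "xi r")
    case None then show ?thesis using r by (simp add: vp_def)
   next
    case (Some z)
    have "R (\<lambda>w. ksum w t \<Psi>) xi (ennreal r) = ennreal (meanoff p z) * gP (\<Psi> (t - r)) (xi r)"
     unfolding R_Some[of xi r z, OF Some r] J_ksum[OF \<Psi>, of xi r z, OF Some r] suminf_offspring_mean by (simp add: gP_def Some)
    then show ?thesis using Some r meanoff_nonneg[of z] \<beta>_nonneg[of z]
     by (simp add: vp_def ennreal_mult' ac_simps mult_nonneg_nonneg)
   qed
  qed simp
 qed
 finally show ?thesis .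
qed

lemma prob_Y[simp]: "sigma_finite_measure (Yl x)" using prob_space_imp_sigma_finite[OF prob_Yl] .

text \<open>Generation \<open>n\<close> sees one path of \<open>Y\<close> weighted by the
  probability of not dying and by the n-th term of the exponential series of the accumulated birth
  rate. In the step the subtree born at time \<open>r\<close> is glued to the ancestral path by the
  Markov property, after which one integrates over \<open>r\<close>.\<close>

lemma many_to_one_generation:
 assumes g[measurable]: "g \<in> borel_measurable optB" and g0: "g None = 0" and t: "0 <= t"
 shows "(\<integral>\<^sup>+w. XG n g t w \<partial>P x) = (\<integral>\<^sup>+xi. ennreal (exp (- Ib (bp xi) t) * (Ib (ap xi) t) ^ n / fact n) * g (xi t) \<partial>Yl x)"
 using t
proof (induction n arbitrary: t x)
 case 0
 have m: "(\<lambda>w. XG 0 g t w) \<in> borel_measurable Omega_space" by (rule XG_measurable) measurable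
 have "(\<integral>\<^sup>+w. XG 0 g t w \<partial>P x) = (\<integral>\<^sup>+xi. (ennreal (exp (- Ib (bp xi) t)) * g (xi t)
   + (\<integral>\<^sup>+r. R (\<lambda>w. XG 0 g t w) xi (ennreal r) * ennreal (bp xi r * exp (- Ib (bp xi) r)) * indicator {0..t} r \<partial>lborel)) \<partial>Yl x)"
  by (rule root_decomposition[OF m 0]) (use g0 0 in \<open>auto simp: XG_0 pos_Nil\<close>)
 also have "... = (\<integral>\<^sup>+xi. ennreal (exp (- Ib (bp xi) t)) * g (xi t) \<partial>Yl x)"
 proof (intro nn_integral_cong)
  fix xi assume "xi \<in> space (Yl x)"
  have "R (\<lambda>w. XG 0 g t w) xi (ennreal r) = 0" if "r \<in> {0..t}" for r
   unfolding R_def J_def XG_0 using that by (simp add: pos_Nil ennreal_less_iff not_less)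
  note R0 = this
  have "(\<integral>\<^sup>+r. R (\<lambda>w. XG 0 g t w) xi (ennreal r) * ennreal (bp xi r * exp (- Ib (bp xi) r)) * indicator {0..t} r \<partial>lborel) = (\<integral>\<^sup>+r. 0 \<partial>(lborel :: real measure))"
  proof (rule nn_integral_cong)
   fix r show "R (\<lambda>w. XG 0 g t w) xi (ennreal r) * ennreal (bp xi r * exp (- Ib (bp xi) r)) * indicator {0..t} r = 0"
    using R0[of r] by (cases "r \<in> {0..t}") simp_all
  qed
  then show "ennreal (exp (- Ib (bp xi) t)) * g (xi t)
   + (\<integral>\<^sup>+r. R (\<lambda>w. XG 0 g t w) xi (ennreal r) * ennreal (bp xi r * exp (- Ib (bp xi) r)) * indicator {0..t} r \<partial>lborel)
   = ennreal (exp (- Ib (bp xi) t)) * g (xi t)" by simp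
 qed
 finally show ?case by simp
next
 case (Suc n)
 note t = \<open>0 <= t\<close>
 have \<Psi>: "(\<lambda>z. XG n g (fst z) (snd z)) \<in> borel_measurable (borel \<Otimes>\<^sub>M (Omega_space :: 'a tree measure))" by (rule XG_measurable) measurable
 interpret S: pair_sigma_finite "Yl x" lborel by (intro pair_sigma_finite.intro prob_Y sigma_finite_lborel)
 have [measurable]: "(\<lambda>z. Ib (bp (fst z)) (snd z)) \<in> borel_measurable (path_space \<Otimes>\<^sub>M lborel)"
  "(\<lambda>z. ap (fst z) (snd z)) \<in> borel_measurable (path_space \<Otimes>\<^sub>M lborel)"
  "(\<lambda>z. Ib (ap (fst z)) (snd z)) \<in> borel_measurable (path_space \<Otimes>\<^sub>M lborel)"
  by (rule Ib_vp_measurable vp_measurable; measurable)+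
 have [measurable]: "(\<lambda>xi. xi t) \<in> path_space \<rightarrow>\<^sub>M (optB :: 'a option measure)" by (rule eval_measurable0[OF t])
 have [measurable]: "(\<lambda>z. Ib (ap (fst z)) t) \<in> borel_measurable (path_space \<Otimes>\<^sub>M lborel)"
   "(\<lambda>z. Ib (bp (fst z)) t) \<in> borel_measurable (path_space \<Otimes>\<^sub>M lborel)" by (rule Ib_vp_measurable; measurable)+
 \<comment> \<open>\<open>?L\<close> starts an independent tree at the position at time
   \<open>r\<close>; \<open>?M\<close> continues the same path to time \<open>t\<close>. They are
   equal in mean for each fixed \<open>r\<close>, so the order of integration is exchanged, and
   exchanged back afterwards.\<close>
 let ?L = "\<lambda>xi r. ennreal (ap xi r * exp (- Ib (bp xi) r)) * gP (XG n g (t - r)) (xi r) * indicator {0..t} r"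
 let ?M = "\<lambda>xi r. ennreal (ap xi r * (Ib (ap xi) t - Ib (ap xi) r) ^ n / fact n) * (ennreal (exp (- Ib (bp xi) t)) * g (xi t)) * indicator {0..t} r"
 have mL: "(\<lambda>(xi, r). ?L xi r) \<in> borel_measurable (Yl x \<Otimes>\<^sub>M lborel)"
 proof -
  have "(\<lambda>z. \<integral>\<^sup>+w. XG n g (t - fst z) w \<partial>P (snd z)) \<in> borel_measurable (borel \<Otimes>\<^sub>M borel)"
  proof (rule nn_integral_measurable_subprob_algebra2[where N=Omega_space])
   have "(\<lambda>z. XG n g (t - fst (fst z)) (snd z)) \<in> borel_measurable ((borel \<Otimes>\<^sub>M (borel :: 'a measure)) \<Otimes>\<^sub>M Omega_space)"
    by (rule XG_measurable) measurable
   then show "(\<lambda>(z, w). XG n g (t - fst z) w) \<in> borel_measurable ((borel \<Otimes>\<^sub>M (borel :: 'a measure)) \<Otimes>\<^sub>M Omega_space)" by (simp add: split_beta')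
   show "(\<lambda>x. P (snd x)) \<in> borel \<Otimes>\<^sub>M borel \<rightarrow>\<^sub>M subprob_algebra Omega_space"
    by (rule measurable_prob_algebraD) measurable
  qed
  then have k: "(\<lambda>z. \<integral>\<^sup>+w. XG n g (t - fst z) w \<partial>P (snd z)) \<in> borel_measurable (borel \<Otimes>\<^sub>M borel)" .
  have e: "(\<lambda>z. fst z (max 0 (snd z))) \<in> path_space \<Otimes>\<^sub>M lborel \<rightarrow>\<^sub>M (optB :: 'a option measure)" by (rule eval_measurable) measurable
  have g1: "(\<lambda>z. gP (XG n g (t - snd z)) (fst z (max 0 (snd z)))) \<in> borel_measurable (path_space \<Otimes>\<^sub>M lborel)"
  proof -
   let ?c = "undefined :: 'a"
   have v: "(\<lambda>z. case fst z (max 0 (snd z)) of Some y => y | None => ?c) \<in> path_space \<Otimes>\<^sub>M lborel \<rightarrow>\<^sub>M (borel :: 'a measure)"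
    by (rule measurable_compose[OF e the_measurable])
   have "(\<lambda>z. (snd z, case fst z (max 0 (snd z)) of Some y => y | None => ?c)) \<in> path_space \<Otimes>\<^sub>M lborel \<rightarrow>\<^sub>M borel \<Otimes>\<^sub>M (borel :: 'a measure)"
    using v by (intro measurable_Pair) (auto intro: measurable_snd simp: measurable_lborel1)
   from measurable_compose[OF this k]
   have k2: "(\<lambda>z. \<integral>\<^sup>+w. XG n g (t - snd z) w \<partial>P (case fst z (max 0 (snd z)) of Some y => y | None => ?c)) \<in> borel_measurable (path_space \<Otimes>\<^sub>M lborel)"
    by simp
   note [measurable] = e k2
   have "(\<lambda>z. if fst z (max 0 (snd z)) = None then 0 else \<integral>\<^sup>+w. XG n g (t - snd z) w \<partial>P (case fst z (max 0 (snd z)) of Some y => y | None => ?c))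
     \<in> borel_measurable (path_space \<Otimes>\<^sub>M lborel)" by measurable
   also have "(\<lambda>z. if fst z (max 0 (snd z)) = None then 0 else \<integral>\<^sup>+w. XG n g (t - snd z) w \<partial>P (case fst z (max 0 (snd z)) of Some y => y | None => ?c))
     = (\<lambda>z. gP (XG n g (t - snd z)) (fst z (max 0 (snd z))))"
    by (auto simp: gP_def fun_eq_iff split: option.split)
   finally show ?thesis .
  qed
  note [measurable] = g1
  have "(\<lambda>z. ennreal (ap (fst z) (snd z) * exp (- Ib (bp (fst z)) (snd z))) * gP (XG n g (t - snd z)) (fst z (max 0 (snd z))) * indicator {0..t} (snd z))
    \<in> borel_measurable (path_space \<Otimes>\<^sub>M lborel)" by measurable
  also have "(\<lambda>z. ennreal (ap (fst z) (snd z) * exp (- Ib (bp (fst z)) (snd z))) * gP (XG n g (t - snd z)) (fst z (max 0 (snd z))) * indicator {0..t} (snd z))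
    = (\<lambda>(xi, r). ?L xi r)"
   by (auto simp: fun_eq_iff max_absorb2 split: split_indicator)
  finally show ?thesis by (simp cong: measurable_cong_sets)
 qed
 have mM: "(\<lambda>(xi, r). ?M xi r) \<in> borel_measurable (Yl x \<Otimes>\<^sub>M lborel)"
 proof -
  have "(\<lambda>z. ?M (fst z) (snd z)) \<in> borel_measurable (path_space \<Otimes>\<^sub>M lborel)" by measurable
  then show ?thesis by (simp add: split_beta' cong: measurable_cong_sets)
 qed
 have LM: "(\<integral>\<^sup>+xi. ?L xi r \<partial>Yl x) = (\<integral>\<^sup>+xi. ?M xi r \<partial>Yl x)" for r
 proof (cases "r \<in> {0..t}")
  case True
  then have r: "0 <= r" "0 <= t - r" by auto
  define FF where "FF z = ennreal (ap (fst z) r * exp (- Ib (bp (fst z)) r)) *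
    (ennreal (exp (- Ib (bp (snd z)) (t - r)) * (Ib (ap (snd z)) (t - r)) ^ n / fact n) * g (snd z (t - r)))" for z :: "'a path \<times> 'a path"
  have [measurable]: "(\<lambda>xi. xi (t - r)) \<in> path_space \<rightarrow>\<^sub>M (optB :: 'a option measure)" by (rule eval_measurable0[OF r(2)])
  have [measurable]: "(\<lambda>xi. Ib (bp xi) q) \<in> borel_measurable path_space" "(\<lambda>xi. Ib (ap xi) q) \<in> borel_measurable path_space"
    "(\<lambda>xi. ap xi q) \<in> borel_measurable path_space" for q
   by (rule Ib_vp_measurable vp_measurable; measurable)+
  have mFF[measurable]: "FF \<in> borel_measurable (path_space \<Otimes>\<^sub>M path_space)" unfolding FF_def by measurable
  have st: "ap (stopp r xi) r = ap xi r" for xi using r by (simp add: vp_def stopp_def)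
  have "(\<integral>\<^sup>+xi. ?L xi r \<partial>Yl x) = (\<integral>\<^sup>+xi. \<integral>\<^sup>+xi'. FF (stopp r xi, xi') \<partial>PiD Yl (xi r) \<partial>Yl x)"
  proof (rule nn_integral_cong)
   fix xi
   show "?L xi r = (\<integral>\<^sup>+xi'. FF (stopp r xi, xi') \<partial>PiD Yl (xi r))"
   proof (cases "xi r")
    case None
    then have "ap xi r = 0" using r by (simp add: vp_def)
    then show ?thesis unfolding FF_def fst_conv snd_conv st by simp
   next
    case (Some z)
    have "(\<integral>\<^sup>+xi'. FF (stopp r xi, xi') \<partial>PiD Yl (xi r)) = ennreal (ap xi r * exp (- Ib (bp xi) r)) *
     (\<integral>\<^sup>+xi'. ennreal (exp (- Ib (bp xi') (t - r)) * (Ib (ap xi') (t - r)) ^ n / fact n) * g (xi' (t - r)) \<partial>Yl z)"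
     unfolding FF_def fst_conv snd_conv st Ib_vp_stop[OF order_refl] Some PiD_def option.case by (rule nn_integral_cmult) measurable
    then show ?thesis using True Suc.IH[OF r(2), of z] by (simp add: Some gP_def)
   qed
  qed
  also have "... = (\<integral>\<^sup>+xi. FF (stopp r xi, shiftp xi r) \<partial>Yl x)" by (rule markov[OF r(1) mFF, symmetric])
  also have "... = (\<integral>\<^sup>+xi. ?M xi r \<partial>Yl x)"
  proof (rule nn_integral_cong)
   fix xi assume "xi \<in> space (Yl x)" then have xi: "xi \<in> hpaths" by simp
   interpret b: rate "bp xi" Kb by (rule rate_bp[OF xi])
   interpret a: rate "ap xi" "KA * Kb" by (rule rate_ap[OF xi])
   have 1: "Ib (bp (shiftp xi r)) (t - r) = Ib (bp xi) t - Ib (bp xi) r"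
    using b.Ib_add[OF r, of "bp (shiftp xi r)", OF vp_shift[OF r(1)]] by simp
   have 2: "Ib (ap (shiftp xi r)) (t - r) = Ib (ap xi) t - Ib (ap xi) r"
    using a.Ib_add[OF r, of "ap (shiftp xi r)", OF vp_shift[OF r(1)]] by simp
   have 3: "shiftp xi r (t - r) = xi t" by (simp add: shiftp_def)
   have nn: "0 <= Ib (ap xi) t - Ib (ap xi) r" using a.Ib_mono[of r t] r by simp
   have e: "exp (- Ib (bp xi) r) * exp (- (Ib (bp xi) t - Ib (bp xi) r)) = exp (- Ib (bp xi) t)"
    by (simp add: exp_add[symmetric])
   have "FF (stopp r xi, shiftp xi r) = (ennreal (ap xi r * exp (- Ib (bp xi) r)) *
     ennreal (exp (- (Ib (bp xi) t - Ib (bp xi) r)) * (Ib (ap xi) t - Ib (ap xi) r) ^ n / fact n)) * g (xi t)"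
    unfolding FF_def fst_conv snd_conv 1 2 3 st Ib_vp_stop[OF order_refl] by (simp only: mult.assoc)
   also have "ennreal (ap xi r * exp (- Ib (bp xi) r)) *
     ennreal (exp (- (Ib (bp xi) t - Ib (bp xi) r)) * (Ib (ap xi) t - Ib (ap xi) r) ^ n / fact n)
     = ennreal ((ap xi r * (Ib (ap xi) t - Ib (ap xi) r) ^ n / fact n) * exp (- Ib (bp xi) t))"
    unfolding e[symmetric] using a.b_nonneg[of r] nn by (subst ennreal_mult[symmetric]) (auto simp: field_simps)
   also have "... = ennreal (ap xi r * (Ib (ap xi) t - Ib (ap xi) r) ^ n / fact n) * ennreal (exp (- Ib (bp xi) t))"
    using a.b_nonneg[of r] nn by (intro ennreal_mult) auto
   finally show "FF (stopp r xi, shiftp xi r) = ?M xi r" using True by (simp add: mult.assoc)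
  qed
  finally show ?thesis .
 qed simp
 have "(\<integral>\<^sup>+w. XG (Suc n) g t w \<partial>P x) = (\<integral>\<^sup>+xi. \<integral>\<^sup>+r. ?L xi r \<partial>lborel \<partial>Yl x)"
  unfolding XG_Suc by (rule nn_integral_ksum[OF \<Psi> _ t]) (rule XG_neg)
 also have "... = (\<integral>\<^sup>+r. \<integral>\<^sup>+xi. ?L xi r \<partial>Yl x \<partial>lborel)" by (rule S.Fubini'[OF mL, symmetric])
 also have "... = (\<integral>\<^sup>+r. \<integral>\<^sup>+xi. ?M xi r \<partial>Yl x \<partial>lborel)" unfolding LM ..
 also have "... = (\<integral>\<^sup>+xi. \<integral>\<^sup>+r. ?M xi r \<partial>lborel \<partial>Yl x)" by (rule S.Fubini'[OF mM])
 also have "... = (\<integral>\<^sup>+xi. ennreal (exp (- Ib (bp xi) t) * (Ib (ap xi) t) ^ Suc n / fact (Suc n)) * g (xi t) \<partial>Yl x)"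
 proof (rule nn_integral_cong)
  fix xi assume "xi \<in> space (Yl x)" then have xi: "xi \<in> hpaths" by simp
  interpret a: rate "ap xi" "KA * Kb" by (rule rate_ap[OF xi])
  have "(\<integral>\<^sup>+r. ?M xi r \<partial>lborel) = (\<integral>\<^sup>+r. (ennreal (exp (- Ib (bp xi) t)) * g (xi t)) * (ennreal (ap xi r * (Ib (ap xi) t - Ib (ap xi) r) ^ n / fact n) * indicator {0..t} r) \<partial>lborel)"
   by (intro nn_integral_cong) (simp only: ac_simps)
  also have "... = (ennreal (exp (- Ib (bp xi) t)) * g (xi t)) * ennreal ((Ib (ap xi) t) ^ Suc n / fact (Suc n))"
   unfolding a.nn_integral_Ib_power[OF t, symmetric] by (rule nn_integral_cmult) measurable
  also have "... = ennreal (exp (- Ib (bp xi) t) * ((Ib (ap xi) t) ^ Suc n / fact (Suc n))) * g (xi t)"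
   using a.Ib_nonneg[of t] by (subst ennreal_mult) (auto simp: ac_simps simp del: fact_Suc power_Suc)
  finally show "(\<integral>\<^sup>+r. ?M xi r \<partial>lborel) = ennreal (exp (- Ib (bp xi) t) * (Ib (ap xi) t) ^ Suc n / fact (Suc n)) * g (xi t)"
   by simp
 qed
 finally show ?case .
qed

lemma exp_sums: "(\<lambda>n. c ^ n / fact n) sums exp (c :: real)"
 using exp_converges[of c] by (simp add: divide_inverse mult.commute)

text \<open>The generations sum to an exponential series, and the weights combine into the
  Feynman-Kac factor exp (integral of (A - 1) \<beta>).\<close>

lemma many_to_one:
 assumes g[measurable]: "g \<in> borel_measurable optB" and g0: "g None = 0" and t: "0 <= t"
 shows "(\<integral>\<^sup>+w. XE w t g \<partial>P x) = (\<integral>\<^sup>+xi. ennreal (exp (- Ib (bp xi) t + Ib (ap xi) t)) * g (xi t) \<partial>Yl x)"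
proof -
 have [measurable]: "(\<lambda>xi. xi t) \<in> path_space \<rightarrow>\<^sub>M (optB :: 'a option measure)" by (rule eval_measurable0[OF t])
 have [measurable]: "(\<lambda>xi. Ib (bp xi) t) \<in> borel_measurable path_space" "(\<lambda>xi. Ib (ap xi) t) \<in> borel_measurable path_space"
  by (rule Ib_vp_measurable; measurable)+
 have m[measurable]: "(\<lambda>w. XG n g t w) \<in> borel_measurable Omega_space" for n by (rule XG_measurable) measurable
 have "(\<integral>\<^sup>+w. XE w t g \<partial>P x) = (\<Sum>n. \<integral>\<^sup>+w. XG n g t w \<partial>P x)"
  unfolding XE_XG by (rule nn_integral_suminf) measurable
 also have "... = (\<integral>\<^sup>+xi. (\<Sum>n. ennreal (exp (- Ib (bp xi) t) * (Ib (ap xi) t) ^ n / fact n) * g (xi t)) \<partial>Yl x)"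
  unfolding many_to_one_generation[OF g g0 t] by (rule nn_integral_suminf[symmetric]) measurable
 also have "... = (\<integral>\<^sup>+xi. ennreal (exp (- Ib (bp xi) t + Ib (ap xi) t)) * g (xi t) \<partial>Yl x)"
 proof (rule nn_integral_cong)
  fix xi assume "xi \<in> space (Yl x)" then have xi: "xi \<in> hpaths" by simp
  interpret a: rate "ap xi" "KA * Kb" by (rule rate_ap[OF xi])
  have s: "(\<lambda>n. exp (- Ib (bp xi) t) * (Ib (ap xi) t) ^ n / fact n) sums (exp (- Ib (bp xi) t) * exp (Ib (ap xi) t))"
   using sums_mult[OF exp_sums, of "exp (- Ib (bp xi) t)" "Ib (ap xi) t"] by (simp only: times_divide_eq_right)
  have "(\<Sum>n. ennreal (exp (- Ib (bp xi) t) * (Ib (ap xi) t) ^ n / fact n)) = ennreal (exp (- Ib (bp xi) t) * exp (Ib (ap xi) t))"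
   unfolding sums_unique[OF s] by (rule suminf_ennreal2[OF _ sums_summable[OF s]]) (use a.Ib_nonneg[of t] in simp)
  then show "(\<Sum>n. ennreal (exp (- Ib (bp xi) t) * (Ib (ap xi) t) ^ n / fact n) * g (xi t)) = ennreal (exp (- Ib (bp xi) t + Ib (ap xi) t)) * g (xi t)"
   by (simp only: ennreal_suminf_multc exp_add)
 qed
 finally show ?thesis .
qed

abbreviation V :: "'a => real" where "V \<equiv> \<lambda>y. (1 - meanoff p y) * \<beta> y"

lemma many_to_one_FK:
 assumes f[measurable]: "f \<in> borel_measurable borel" and f0: "\<And>x. 0 <= f x" and t: "0 <= t"
 shows "(\<integral>\<^sup>+w. XE w t (\<lambda>y. ennreal (gD f y)) \<partial>P x) = FKsg Yl V t f x"
proof -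
 have m: "(\<lambda>y. ennreal (gD f y)) \<in> borel_measurable optB" by measurable
 show ?thesis unfolding FKsg_def
 proof (subst many_to_one[OF m _ t], simp, rule nn_integral_cong)
  fix xi assume "xi \<in> space (Yl x)" then have xi: "xi \<in> hpaths" by simp
  interpret a: rate "ap xi" "KA * Kb" by (rule rate_ap[OF xi])
  interpret b: rate "bp xi" Kb by (rule rate_bp[OF xi])
  have "Ib (bp xi) t - Ib (ap xi) t = (LINT r:{0..t}|lborel. bp xi r - ap xi r)"
   unfolding Ib_def by (rule set_integral_diff(2)[symmetric, OF b.set_int a.set_int])
  also have "... = (LINT s:{0..t}|lborel. gD V (xi s))"
   by (rule set_lebesgue_integral_cong) (auto simp: vp_def gD_def algebra_simps split: option.split)
  finally have "- Ib (bp xi) t + Ib (ap xi) t = - (LINT s:{0..t}|lborel. gD V (xi s))" by simp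
  moreover have "0 <= gD f (xi t)" using f0 by (simp add: gD_def split: option.split)
  ultimately show "ennreal (exp (- Ib (bp xi) t + Ib (ap xi) t)) * ennreal (gD f (xi t)) = ennreal (exp (- (LINT s:{0..t}|lborel. gD V (xi s))) * gD f (xi t))"
   by (simp add: ennreal_mult')
 qed
qed

text \<open>Comparison with constant birth rate \<open>KA * Kb\<close>: the survival factor is
  bounded by 1 and the iterated integrals of a constant produce the factorial, so the expected total
  number of births is at most an exponential.\<close>

lemma BE_bound: "0 <= T ==> (\<integral>\<^sup>+w. BE n T w \<partial>P x) <= ennreal ((KA * Kb * T) ^ n / fact n)"
proof (induction n arbitrary: T x)
 case 0 then show ?case using prob_space.emeasure_space_1[OF prob_P] by (simp add: BE_0)
next
 case (Suc n)
 let ?c = "KA * Kb"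
 have c: "0 <= ?c" using KA_nonneg Kb_nonneg by simp
 have \<Psi>: "(\<lambda>z. BE n (fst z) (snd z)) \<in> borel_measurable (borel \<Otimes>\<^sub>M (Omega_space :: 'a tree measure))" by (rule BE_measurable) measurable
 \<comment> \<open>The constant rate as an instance, so that the identity for powers of a primitive
   can be reused.\<close>
 interpret rate "\<lambda>_. ?c" ?c by standard (use c in auto)
 have I: "Ib (\<lambda>_. ?c) r = ?c * r" if "0 <= r" for r using that by (simp add: Ib_def set_lebesgue_integral_def)
 have "(\<integral>\<^sup>+w. BE (Suc n) T w \<partial>P x) = (\<integral>\<^sup>+xi. \<integral>\<^sup>+r. ennreal (ap xi r * exp (- Ib (bp xi) r)) * gP (BE n (T - r)) (xi r) * indicator {0..T} r \<partial>lborel \<partial>Yl x)"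
  unfolding BE_Suc by (rule nn_integral_ksum[OF \<Psi> _ Suc.prems]) (rule BE_neg)
 also have "... <= (\<integral>\<^sup>+xi. \<integral>\<^sup>+r. ennreal (?c * (Ib (\<lambda>_. ?c) T - Ib (\<lambda>_. ?c) r) ^ n / fact n) * indicator {0..T} r \<partial>lborel \<partial>Yl x)"
 proof (intro nn_integral_mono)
  fix xi r assume "xi \<in> space (Yl x)" then have xi: "xi \<in> hpaths" by simp
  interpret a: rate "ap xi" "KA * Kb" by (rule rate_ap[OF xi])
  interpret b: rate "bp xi" Kb by (rule rate_bp[OF xi])
  show "ennreal (ap xi r * exp (- Ib (bp xi) r)) * gP (BE n (T - r)) (xi r) * indicator {0..T} r
    <= ennreal (?c * (Ib (\<lambda>_. ?c) T - Ib (\<lambda>_. ?c) r) ^ n / fact n) * indicator {0..T} r"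
  proof (cases "r \<in> {0..T}")
   case True
   have b1: "gP (BE n (T - r)) (xi r) <= ennreal ((?c * (T - r)) ^ n / fact n)"
    using Suc.IH[of "T - r"] True by (cases "xi r") (auto simp: gP_def)
   have "ap xi r * exp (- Ib (bp xi) r) <= ?c * 1"
    by (rule mult_mono) (use a.b_le[of r] b.Ib_nonneg[of r] c in auto)
   then have b2: "ennreal (ap xi r * exp (- Ib (bp xi) r)) <= ennreal ?c" by (intro ennreal_leI) simp
   have "ennreal (ap xi r * exp (- Ib (bp xi) r)) * gP (BE n (T - r)) (xi r) <= ennreal ?c * ennreal ((?c * (T - r)) ^ n / fact n)"
    by (rule mult_mono[OF b2 b1]) auto
   also have "... = ennreal (?c * (?c * (T - r)) ^ n / fact n)" using c True by (subst ennreal_mult[symmetric]) auto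
   also have "?c * (T - r) = Ib (\<lambda>_. ?c) T - Ib (\<lambda>_. ?c) r" using True I[of T] I[of r] by (simp add: algebra_simps)
   finally show ?thesis using True by simp
  qed simp
 qed
 also have "... = ennreal ((?c * T) ^ Suc n / fact (Suc n))"
  unfolding nn_integral_Ib_power[OF Suc.prems] using prob_space.emeasure_space_1[OF prob_Yl, of x] I[OF Suc.prems] by (simp del: fact_Suc power_Suc)
 finally show ?case .
qed

text \<open>Trees without explosion. Quantifying over integer times keeps the set measurable, and
  monotonicity of births in time extends finiteness to all times.\<close>

definition Reg :: "'a tree set" where
 "Reg = {w \<in> space Omega_space. \<forall>T::nat. emeasure (count_space UNIV) {u. born w (real T) u} < \<top>}"

lemma sum_BE_measurable[measurable]: "(\<lambda>w. \<Sum>n. BE n T w) \<in> borel_measurable (Omega_space :: 'a tree measure)"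
proof -
 have [measurable]: "(\<lambda>w. BE n T w) \<in> borel_measurable (Omega_space :: 'a tree measure)" for n by (rule BE_measurable) measurable
 show ?thesis by measurable
qed

lemma Reg_sets[measurable]: "Reg \<in> sets Omega_space"
 unfolding Reg_def sum_BE[symmetric] by measurable

lemma AE_Reg: "AE w in P x. w \<in> Reg"
proof -
 have "AE w in P x. (\<Sum>n. BE n (real T) w) \<noteq> \<infinity>" for T :: nat
 proof (rule nn_integral_noteq_infinite)
  let ?c = "KA * Kb * real T"
  have m: "(\<lambda>w. BE n (real T) w) \<in> borel_measurable (P x)" for n by (rule BE_measurable) measurable
  have c: "0 <= ?c" using KA_nonneg Kb_nonneg by simp
  have "(\<integral>\<^sup>+w. (\<Sum>n. BE n (real T) w) \<partial>P x) = (\<Sum>n. \<integral>\<^sup>+w. BE n (real T) w \<partial>P x)" by (rule nn_integral_suminf[OF m])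
  also have "... <= (\<Sum>n. ennreal (?c ^ n / fact n))" by (intro suminf_le BE_bound) auto
  also have "... = ennreal (exp ?c)"
   unfolding sums_unique[OF exp_sums[of ?c]] by (rule suminf_ennreal2[OF _ sums_summable[OF exp_sums]]) (use c in simp)
  finally show "(\<integral>\<^sup>+w. (\<Sum>n. BE n (real T) w) \<partial>P x) \<noteq> \<infinity>" by (auto simp: top_unique)
 qed simp
 then have "AE w in P x. \<forall>T::nat. (\<Sum>n. BE n (real T) w) \<noteq> \<infinity>" by (simp add: AE_all_countable)
 then show ?thesis by (rule AE_mp) (auto intro!: AE_I2 simp: Reg_def sum_BE less_top)
qed

lemma Reg_finite: "w \<in> Reg ==> finite {u. born w t u}"
proof -
 assume r: "w \<in> Reg"
 obtain T :: nat where "t <= real T" using real_arch_simple by blast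
 then have "{u. born w t u} \<subseteq> {u. born w (real T) u}" by (auto simp: born_def)
 moreover have "finite {u. born w (real T) u}" using r
  by (auto simp: Reg_def emeasure_count_space split: if_splits)
 ultimately show ?thesis by (rule finite_subset)
qed

lemma Reg_alive: "w \<in> Reg ==> finite (alive w t)"
 by (rule finite_subset[OF _ Reg_finite[of w t]]) (auto simp: alive_def intro!: pos_born)

end

section \<open>Second moments and right continuity\<close>

definition SS :: "'a tree => real => ('a tree => real) => real" where
 "SS w s g = (\<Sum>u\<in>alive w s. g (subT s u w))"

lemma XE_finite: "finite (alive w t) ==> XE w t g = (\<Sum>u\<in>alive w t. g (pos w t u))"
proof -
 assume f: "finite (alive w t)"
 have "XE w t g = (\<Sum>u\<in>alive w t. if pos w t u = None then 0 else g (pos w t u))"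
  unfolding XE_def by (rule nn_integral_count_space'[OF f]) (auto simp: alive_def)
 also have "... = (\<Sum>u\<in>alive w t. g (pos w t u))" by (intro sum.cong) (auto simp: alive_def)
 finally show ?thesis .
qed

lemma SE_finite: "finite (alive w t) ==> SE w t g = (\<Sum>u\<in>alive w t. g (subT t u w))"
proof -
 assume f: "finite (alive w t)"
 have "SE w t g = (\<Sum>u\<in>alive w t. if pos w t u = None then 0 else g (subT t u w))"
  unfolding SE_def by (rule nn_integral_count_space'[OF f]) (auto simp: alive_def)
 also have "... = (\<Sum>u\<in>alive w t. g (subT t u w))" by (intro sum.cong) (auto simp: alive_def)
 finally show ?thesis .
qed

lemma Xf_gD: "Xf w t f = (\<Sum>u\<in>alive w t. gD f (pos w t u))"
 unfolding Xf_def by (rule sum.cong) (auto simp: alive_def)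

lemma XE_Xf:
 assumes "finite (alive w t)" "\<And>x. 0 <= f x"
 shows "XE w t (\<lambda>y. ennreal (gD f y)) = ennreal (Xf w t f)"
proof -
 have "0 <= gD f y" for y using assms(2) by (simp add: gD_def split: option.split)
 then show ?thesis unfolding XE_finite[OF assms(1)] Xf_gD by (simp add: sum_ennreal)
qed

lemma SE_SS:
 assumes "finite (alive w t)" "\<And>x. 0 <= f x"
 shows "SE w t (\<lambda>y. ennreal (f y)) = ennreal (SS w t f)"
 unfolding SE_finite[OF assms(1)] SS_def using assms(2) by (simp add: sum_ennreal)

text \<open>Lifetimes are half open: a particle alive at \<open>t\<close> is alive a little longer,
  and one dead at \<open>t\<close> is dead from then on. A birth is no obstacle either, as a child
  is already present at its birth time.\<close>

lemma pos_right_cont: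
 fixes f :: "'a::metric_space => real"
 assumes f: "continuous_on UNIV f" and "w \<in> space Omega_space"
 shows "((\<lambda>s. gD f (pos w s u)) \<longlongrightarrow> gD f (pos w t u)) (at_right t)"
 using assms(2)
proof (induction u arbitrary: w t)
 case Nil
 have h: "rpath w \<in> hpaths" by (rule Omega_rpath[OF Nil])
 consider "t < 0" | "0 <= t" "ennreal t < rlife w" | "0 <= t" "rlife w <= ennreal t" by fastforce
 then show ?case
 proof cases
  case 1
  then have "eventually (\<lambda>s. gD f (pos w s []) = gD f (pos w t [])) (at_right t)"
   by (auto simp: eventually_at_right_field pos_neg intro!: exI[of _ 0])
  then show ?thesis by (rule tendsto_eventually)
 next
  case 2
  obtain u where u: "ennreal t < u" "u < rlife w" using dense[OF 2(2)] by blast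
  have "u < \<top>" using u(2) by (auto simp: less_top[symmetric])
  then obtain v where v: "u = ennreal v" "0 <= v" by (cases u) auto
  have tv: "t < v" using u(1) v 2(1) by (simp add: ennreal_less_iff)
  have "ennreal s < rlife w" if "s < v" for s
  proof -
   have "ennreal s <= ennreal v" using that by (intro ennreal_leI) simp
   then show ?thesis using u(2) v(1) by simp
  qed
  then have "eventually (\<lambda>s. gD f (rpath w s) = gD f (pos w s [])) (at_right t)"
   using tv 2(1) by (auto simp: eventually_at_right_field pos_Nil intro!: exI[of _ v])
  moreover have "pos w t [] = rpath w t" using 2 by (simp add: pos_Nil)
  ultimately show ?thesis using gD_right_cont[OF h f 2(1)] by (simp add: tendsto_cong)
 next
  case 3
  have "\<not> ennreal s < rlife w" if "t < s" for s
  proof -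
   have "ennreal t <= ennreal s" using that by (intro ennreal_leI) simp
   then show ?thesis using 3(2) by (simp add: not_less)
  qed
  then have "eventually (\<lambda>s. gD f (pos w s []) = gD f (pos w t [])) (at_right t)"
   using 3 by (auto simp: eventually_at_right_field pos_Nil intro!: exI[of _ "t+1"])
  then show ?thesis by (rule tendsto_eventually)
 qed
next
 case (Cons i u)
 show ?case
 proof (cases "okc w i")
  case True
  have "filterlim (\<lambda>s. s - rtime w) (at_right (t - rtime w)) (at_right t)"
   unfolding filterlim_def filtermap_at_right_shift ..
  from filterlim_compose[OF Cons.IH[OF Omega_sub[OF Cons.prems]] this]
  show ?thesis using True by (simp add: pos_Cons)
 qed (simp add: pos_Cons)
qed

context branching
begin

lemma Reg_space: "w \<in> Reg ==> w \<in> space Omega_space" by (simp add: Reg_def)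

text \<open>Up to time \<open>t + 1\<close> all sums run over the same finite set, the labels born
  by \<open>t + 1\<close>, so the continuity of each summand carries over.\<close>

lemma Xf_right_cont:
 assumes r: "w \<in> Reg" and f: "continuous_on UNIV f"
 shows "((\<lambda>s. Xf w s f) \<longlongrightarrow> Xf w t f) (at_right t)"
proof -
 let ?B = "{u. born w (t + 1) u}"
 have fin: "finite ?B" by (rule Reg_finite[OF r])
 have eq: "Xf w s f = (\<Sum>u\<in>?B. gD f (pos w s u))" if "s <= t + 1" for s
  unfolding Xf_gD
 proof (rule sum.mono_neutral_left[OF fin])
  show "alive w s \<subseteq> ?B" using that pos_born[of w s] by (fastforce simp: alive_def born_def)
 qed (auto simp: alive_def)
 have "((\<lambda>s. \<Sum>u\<in>?B. gD f (pos w s u)) \<longlongrightarrow> (\<Sum>u\<in>?B. gD f (pos w t u))) (at_right t)"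
  by (intro tendsto_sum pos_right_cont[OF f Reg_space[OF r]])
 moreover have "eventually (\<lambda>s. (\<Sum>u\<in>?B. gD f (pos w s u)) = Xf w s f) (at_right t)"
  using eq by (auto simp: eventually_at_right_field intro!: exI[of _ "t+1"])
 ultimately show ?thesis using eq[of t] by (simp add: tendsto_cong)
qed

text \<open>Given the tree with the future of \<open>u\<close> hidden, the term of \<open>v\<close>
  is fixed while the term of \<open>u\<close> has conditional mean zero. Mean zero is expressed as
  equality of positive and negative parts, since the branching property is about nonnegative
  functionals.\<close>

lemma orthogonality:
 fixes s :: real
 assumes g[measurable]: "g \<in> borel_measurable Omega_space" and gK: "\<And>w. \<bar>g w\<bar> <= K"
  and g0: "\<And>y. (\<integral>\<^sup>+w. ennreal (g w) \<partial>P y) = (\<integral>\<^sup>+w. ennreal (- g w) \<partial>P y)"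
  and uv: "u \<noteq> v"
 defines "Y \<equiv> \<lambda>u w. if pos w s u = None then 0 else g (subT s u w)"
 shows "(\<integral>w. Y u w * Y v w \<partial>P x) = 0"
proof -
 interpret prob_space "P x" by (rule prob_P)
 have mp[measurable]: "(\<lambda>w. pos w s u) \<in> Omega_space \<rightarrow>\<^sub>M (optB :: 'a option measure)" for u by (rule pos_measurable) measurable
 have ms[measurable]: "(\<lambda>w. subT s u w) \<in> Omega_space \<rightarrow>\<^sub>M (Omega_space :: 'a tree measure)" for u by (rule subT_measurable) measurable
 have mY[measurable]: "Y u \<in> borel_measurable Omega_space" for u unfolding Y_def by measurable
 have K: "0 <= K" using gK[of undefined] by linarith
 have YK: "\<bar>Y u w\<bar> <= K" for u w using gK K by (auto simp: Y_def)
 have Yk: "Y v (killT s u w) = Y v w" if "pos w s u \<noteq> None" for w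
  using pos_killT[OF that order_refl, of v] subT_killT[OF that _ uv] by (auto simp: Y_def)
 have Yu: "Y u w = (if pos w s u = None then 0 else g (subT s u w))" for w by (simp add: Y_def)
 \<comment> \<open>Used twice, with \<open>H\<close> the positive and the negative part, because the
   factor belonging to \<open>v\<close> must be nonnegative.\<close>
 have key: "(\<integral>w. Y u w * H (Y v w) \<partial>P x) = 0" if Hm[measurable]: "H \<in> borel_measurable borel" and Hb: "\<And>a. \<bar>a\<bar> <= K ==> 0 <= H a \<and> H a <= K" for H :: "real => real"
 proof -
  have c: "(\<integral>\<^sup>+w. ennreal (H (Y v w)) * ennreal (c * Y u w) \<partial>P x)
    = (\<integral>\<^sup>+w. (if pos w s u = None then 0 else ennreal (H (Y v (killT s u w))) * gP (\<lambda>w. ennreal (c * g w)) (pos w s u)) \<partial>P x)" for c :: real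
  proof -
   have "(\<integral>\<^sup>+w. ennreal (H (Y v w)) * ennreal (c * Y u w) \<partial>P x)
    = (\<integral>\<^sup>+w. (if pos w s u = None then 0 else ennreal (H (Y v (killT s u w))) * ennreal (c * g (subT s u w))) \<partial>P x)"
    by (intro nn_integral_cong) (auto simp: Yk Yu)
   also have "... = (\<integral>\<^sup>+w. (if pos w s u = None then 0 else ennreal (H (Y v (killT s u w))) * gP (\<lambda>w. ennreal (c * g w)) (pos w s u)) \<partial>P x)"
    by (rule branching_property[of "\<lambda>w. ennreal (c * g w)" "\<lambda>w. ennreal (H (Y v w))"]) measurable
   finally show ?thesis .
  qed
  have G1: "gP (\<lambda>w. ennreal (1 * g w)) = gP (\<lambda>w. ennreal ((-1) * g w))"
   using g0 by (auto simp: gP_def fun_eq_iff split: option.split)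
  have eq: "(\<integral>\<^sup>+w. ennreal (H (Y v w)) * ennreal (1 * Y u w) \<partial>P x) = (\<integral>\<^sup>+w. ennreal (H (Y v w)) * ennreal ((-1) * Y u w) \<partial>P x)"
   unfolding c G1 ..
  have H0: "0 <= H (Y v w)" "H (Y v w) <= K" for w using Hb[OF YK] by auto
  have m: "ennreal (H (Y v w)) * ennreal a = ennreal (H (Y v w) * max 0 a)" for w a
   using H0 by (cases "0 <= a") (simp_all add: ennreal_mult max_def ennreal_neg)
  have b: "\<bar>H (Y v w) * max 0 (c * Y u w)\<bar> <= K * K" if "\<bar>c\<bar> = 1" for c w
  proof -
   have "\<bar>max 0 (c * Y u w)\<bar> <= K" using YK[of u w] K that by (auto simp: max_def abs_if split: if_splits)
   then show ?thesis unfolding abs_mult using H0[of w] by (intro mult_mono) auto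
  qed
  have i: "integrable (P x) (\<lambda>w. H (Y v w) * max 0 (c * Y u w))" if "\<bar>c\<bar> = 1" for c
   by (rule integrable_const_bound[where B="K * K"]) (use b[OF that] in auto)
  have "(\<integral>w. H (Y v w) * max 0 (1 * Y u w) \<partial>P x) = (\<integral>w. H (Y v w) * max 0 ((-1) * Y u w) \<partial>P x)"
   using eq unfolding m using H0 by (subst (1 2) integral_eq_nn_integral) (auto intro!: AE_I2)
  moreover have "Y u w * H (Y v w) = H (Y v w) * max 0 (1 * Y u w) - H (Y v w) * max 0 ((-1) * Y u w)" for w
   by (auto simp: max_def algebra_simps)
  ultimately show ?thesis using i[of 1] i[of "-1"] by simp
 qed
 have "(\<integral>w. Y u w * max 0 (Y v w) \<partial>P x) = 0" by (rule key[of "\<lambda>a. max 0 a"]) (use K in auto)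
 moreover have "(\<integral>w. Y u w * max 0 (- Y v w) \<partial>P x) = 0" by (rule key[of "\<lambda>a. max 0 (- a)"]) (use K in auto)
 moreover have "integrable (P x) (\<lambda>w. Y u w * max 0 (c * Y v w))" if "\<bar>c\<bar> = 1" for c
 proof (rule integrable_const_bound[where B="K * K"])
  have "\<bar>max 0 (c * Y v w)\<bar> <= K" for w using YK[of v w] K that by (auto simp: max_def abs_if split: if_splits)
  then show "AE w in P x. norm (Y u w * max 0 (c * Y v w)) <= K * K"
   using YK K by (auto simp: abs_mult intro!: AE_I2 mult_mono)
 qed simp
 note this[of 1] this[of "-1"]
 moreover have "Y u w * Y v w = Y u w * max 0 (Y v w) - Y u w * max 0 (- Y v w)" for w
  by (auto simp: max_def algebra_simps)
 ultimately show ?thesis by simp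
qed

text \<open>Off-diagonal terms vanish for finite sets of labels. On a tree without explosion the
  finite sums are eventually constant, and Fatou's lemma carries the bound to the limit.\<close>

lemma second_moment:
 assumes g[measurable]: "g \<in> borel_measurable Omega_space" and gK: "\<And>w. \<bar>g w\<bar> <= K"
  and g0: "\<And>y. (\<integral>\<^sup>+w. ennreal (g w) \<partial>P y) = (\<integral>\<^sup>+w. ennreal (- g w) \<partial>P y)"
 shows "(\<integral>\<^sup>+w. ennreal ((SS w s g)\<^sup>2) \<partial>P x) <= (\<integral>\<^sup>+w. SE w s (\<lambda>w. ennreal ((g w)\<^sup>2)) \<partial>P x)"
proof -
 interpret prob_space "P x" by (rule prob_P)
 define Y where "Y u w = (if pos w s u = None then 0 else g (subT s u w))" for u w
 have mp[measurable]: "(\<lambda>w. pos w s u) \<in> Omega_space \<rightarrow>\<^sub>M (optB :: 'a option measure)" for u by (rule pos_measurable) measurable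
 have ms[measurable]: "(\<lambda>w. subT s u w) \<in> Omega_space \<rightarrow>\<^sub>M (Omega_space :: 'a tree measure)" for u by (rule subT_measurable) measurable
 have mY[measurable]: "Y u \<in> borel_measurable Omega_space" for u unfolding Y_def by measurable
 have K: "0 <= K" using gK[of undefined] by linarith
 have YK: "\<bar>Y u w\<bar> <= K" for u w using gK K by (auto simp: Y_def)
 have iY: "integrable (P x) (\<lambda>w. Y u w * Y v w)" for u v
  by (rule integrable_const_bound[where B="K * K"]) (use YK K in \<open>auto simp: abs_mult intro!: AE_I2 mult_mono\<close>)
 define F where "F n = (from_nat :: nat => nat list) ` {..<n}" for n
 have finF: "finite (F n)" for n unfolding F_def by simp
 have bound: "(\<integral>\<^sup>+w. ennreal ((\<Sum>u\<in>F n. Y u w)\<^sup>2) \<partial>P x) <= (\<integral>\<^sup>+w. SE w s (\<lambda>w. ennreal ((g w)\<^sup>2)) \<partial>P x)" for n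
 proof -
  have sq: "(\<Sum>u\<in>F n. Y u w)\<^sup>2 = (\<Sum>u\<in>F n. \<Sum>v\<in>F n. Y u w * Y v w)" for w
   by (simp add: power2_eq_square sum_product)
  have "(\<integral>\<^sup>+w. ennreal ((\<Sum>u\<in>F n. Y u w)\<^sup>2) \<partial>P x) = ennreal (\<integral>w. (\<Sum>u\<in>F n. Y u w)\<^sup>2 \<partial>P x)"
  proof (rule nn_integral_eq_integral)
   show "integrable (P x) (\<lambda>w. (\<Sum>u\<in>F n. Y u w)\<^sup>2)" unfolding sq by (intro Bochner_Integration.integrable_sum iY)
  qed simp
  also have "(\<integral>w. (\<Sum>u\<in>F n. Y u w)\<^sup>2 \<partial>P x) = (\<Sum>u\<in>F n. \<Sum>v\<in>F n. \<integral>w. Y u w * Y v w \<partial>P x)"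
   unfolding sq by (subst Bochner_Integration.integral_sum; intro Bochner_Integration.integrable_sum iY sum.cong refl)
    (rule Bochner_Integration.integral_sum, rule iY)
  also have "... = (\<Sum>u\<in>F n. \<Sum>v\<in>F n. if v = u then \<integral>w. Y u w * Y u w \<partial>P x else 0)"
  proof -
   have "(\<integral>w. Y u w * Y v w \<partial>P x) = 0" if "u \<noteq> v" for u v
    unfolding Y_def by (rule orthogonality[OF g gK g0 that])
   then show ?thesis by (intro sum.cong refl) auto
  qed
  also have "... = (\<Sum>u\<in>F n. \<integral>w. Y u w * Y u w \<partial>P x)"
   using finF[of n] by (intro sum.cong refl) (simp add: sum.delta)
  also have "... = (\<integral>w. (\<Sum>u\<in>F n. Y u w * Y u w) \<partial>P x)"
   by (rule Bochner_Integration.integral_sum[symmetric]) (rule iY)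
  also have "ennreal ... = (\<integral>\<^sup>+w. ennreal (\<Sum>u\<in>F n. Y u w * Y u w) \<partial>P x)"
   by (rule nn_integral_eq_integral[symmetric]) (auto intro!: iY AE_I2 sum_nonneg)
  also have "... <= (\<integral>\<^sup>+w. SE w s (\<lambda>w. ennreal ((g w)\<^sup>2)) \<partial>P x)"
  proof (rule nn_integral_mono)
   fix w
   have "ennreal (\<Sum>u\<in>F n. Y u w * Y u w) = (\<Sum>u\<in>F n. ennreal (Y u w * Y u w))"
    by (rule sum_ennreal[symmetric]) simp
   also have "... = (\<integral>\<^sup>+u. ennreal (Y u w * Y u w) * indicator (F n) u \<partial>count_space UNIV)"
    by (subst nn_integral_count_space'[OF finF[of n]]) (auto intro!: sum.cong)
   also have "... <= SE w s (\<lambda>w. ennreal ((g w)\<^sup>2))"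
    unfolding SE_def by (intro nn_integral_mono) (auto simp: Y_def power2_eq_square split: split_indicator)
   finally show "ennreal (\<Sum>u\<in>F n. Y u w * Y u w) <= SE w s (\<lambda>w. ennreal ((g w)\<^sup>2))" .
  qed
  finally show ?thesis .
 qed
 have lim: "AE w in P x. ennreal ((SS w s g)\<^sup>2) = liminf (\<lambda>n. ennreal ((\<Sum>u\<in>F n. Y u w)\<^sup>2))"
  using AE_Reg
 proof eventually_elim
  fix w assume "w \<in> Reg"
  then have fin: "finite (alive w s)" by (rule Reg_alive)
  obtain N where N: "\<And>u. u \<in> alive w s ==> to_nat u < N"
   using finite_nat_set_iff_bounded[of "to_nat ` alive w s"] fin by auto
  have "(\<Sum>u\<in>F n. Y u w) = SS w s g" if "N <= n" for n
  proof -
   have "alive w s \<subseteq> F n"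
   proof
    fix u assume "u \<in> alive w s"
    then show "u \<in> F n" unfolding F_def using N[of u] that by (intro image_eqI[of _ _ "to_nat u"]) auto
   qed
   then have "(\<Sum>u\<in>F n. Y u w) = (\<Sum>u\<in>alive w s. Y u w)"
    by (intro sum.mono_neutral_right finF) (auto simp: Y_def alive_def)
   also have "... = SS w s g" unfolding SS_def by (intro sum.cong) (auto simp: Y_def alive_def)
   finally show ?thesis .
  qed
  then have "eventually (\<lambda>n. ennreal ((\<Sum>u\<in>F n. Y u w)\<^sup>2) = ennreal ((SS w s g)\<^sup>2)) sequentially"
   unfolding eventually_sequentially by (intro exI[of _ N]) simp
  then have "(\<lambda>n. ennreal ((\<Sum>u\<in>F n. Y u w)\<^sup>2)) \<longlonglongrightarrow> ennreal ((SS w s g)\<^sup>2)" by (rule tendsto_eventually)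
  then show "ennreal ((SS w s g)\<^sup>2) = liminf (\<lambda>n. ennreal ((\<Sum>u\<in>F n. Y u w)\<^sup>2))"
   by (intro lim_imp_Liminf[symmetric]) simp_all
 qed
 have "(\<integral>\<^sup>+w. ennreal ((SS w s g)\<^sup>2) \<partial>P x) = (\<integral>\<^sup>+w. liminf (\<lambda>n. ennreal ((\<Sum>u\<in>F n. Y u w)\<^sup>2)) \<partial>P x)"
  by (rule nn_integral_cong_AE[OF lim])
 also have "... <= liminf (\<lambda>n. \<integral>\<^sup>+w. ennreal ((\<Sum>u\<in>F n. Y u w)\<^sup>2) \<partial>P x)"
  by (rule nn_integral_liminf) measurable
 also have "... <= (\<integral>\<^sup>+w. SE w s (\<lambda>w. ennreal ((g w)\<^sup>2)) \<partial>P x)"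
  by (rule Liminf_le) (auto simp: bound)
 finally show ?thesis .
qed

subsection \<open>The mean semigroup\<close>

definition oE :: "('a => ennreal) => 'a option => ennreal" where
 "oE f y = (case y of None => 0 | Some x => f x)"

lemma oE_simps[simp]: "oE f None = 0" "oE f (Some x) = f x" by (simp_all add: oE_def)

lemma oE_measurable[measurable]: "f \<in> borel_measurable borel ==> oE f \<in> borel_measurable optB"
 by (simp add: measurable_optB_iff)

lemma oE_gD: "(\<lambda>y. ennreal (gD f y)) = oE (\<lambda>x. ennreal (f x))"
 by (auto simp: gD_def oE_def fun_eq_iff split: option.split)

text \<open>The mean semigroup of the branching process, for arbitrary nonnegative extended-real
  functions. The many-to-one formula identifies it with the Feynman-Kac semigroup.\<close>

definition QQ :: "real => ('a => ennreal) => 'a => ennreal" where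
 "QQ t f x = (\<integral>\<^sup>+w. XE w t (oE f) \<partial>P x)"

lemma QQ_measurable[measurable]: "f \<in> borel_measurable borel ==> QQ t f \<in> borel_measurable borel"
 unfolding QQ_def[abs_def] by measurable

lemma gP_oE: "gP G = oE (\<lambda>x. \<integral>\<^sup>+w. G w \<partial>P x)"
 by (auto simp: gP_def oE_def)

lemma QQ_SE: "G \<in> borel_measurable Omega_space ==> (\<integral>\<^sup>+w. SE w t G \<partial>P x) = QQ t (\<lambda>y. \<integral>\<^sup>+w. G w \<partial>P y) x"
 unfolding QQ_def gP_oE[symmetric] by (rule nn_integral_SE')

text \<open>The semigroup property is inherited from the deterministic splitting of the population
  at time \<open>t\<close> and the branching property.\<close>

lemma QQ_add:
 assumes f[measurable]: "f \<in> borel_measurable borel" and "0 <= t" "0 <= s"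
 shows "QQ (t + s) f x = QQ t (QQ s f) x"
proof -
 have "QQ (t + s) f x = (\<integral>\<^sup>+w. SE w t (\<lambda>w'. XE w' s (oE f)) \<partial>P x)"
  unfolding QQ_def using XE_add[OF _ assms(2,3)] by (intro nn_integral_cong) simp
 also have "... = QQ t (QQ s f) x"
  unfolding QQ_def[of s, abs_def] by (rule QQ_SE) measurable
 finally show ?thesis .
qed

lemma QQ_path:
 assumes [measurable]: "f \<in> borel_measurable borel" and "0 <= t"
 shows "QQ t f x = (\<integral>\<^sup>+xi. ennreal (exp (- Ib (bp xi) t + Ib (ap xi) t)) * oE f (xi t) \<partial>Yl x)"
 unfolding QQ_def by (rule many_to_one) (use assms in auto)

lemma QQ_le:
 assumes [measurable]: "f \<in> borel_measurable borel" and t: "0 <= t"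
 shows "QQ t f x <= ennreal (exp (KA * Kb * t)) * (\<integral>\<^sup>+xi. oE f (xi t) \<partial>Yl x)"
proof -
 have [measurable]: "(\<lambda>xi. xi t) \<in> path_space \<rightarrow>\<^sub>M (optB :: 'a option measure)" by (rule eval_measurable0[OF t])
 have "QQ t f x <= (\<integral>\<^sup>+xi. ennreal (exp (KA * Kb * t)) * oE f (xi t) \<partial>Yl x)"
  unfolding QQ_path[OF assms]
 proof (intro nn_integral_mono mult_right_mono ennreal_leI)
  fix xi assume "xi \<in> space (Yl x)" then have xi: "xi \<in> hpaths" by simp
  interpret a: rate "ap xi" "KA * Kb" by (rule rate_ap[OF xi])
  interpret b: rate "bp xi" Kb by (rule rate_bp[OF xi])
  show "exp (- Ib (bp xi) t + Ib (ap xi) t) <= exp (KA * Kb * t)"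
   using a.Ib_le[OF t] b.Ib_nonneg[of t] by simp
 qed simp
 also have "... = ennreal (exp (KA * Kb * t)) * (\<integral>\<^sup>+xi. oE f (xi t) \<partial>Yl x)" by (rule nn_integral_cmult) measurable
 finally show ?thesis .
qed

lemma QQ_0:
 assumes [measurable]: "f \<in> borel_measurable borel"
 shows "QQ 0 f x = f x"
proof -
 have "QQ 0 f x = (\<integral>\<^sup>+xi. f x \<partial>Yl x)"
  unfolding QQ_path[OF assms order_refl]
 proof (rule nn_integral_cong_AE)
  show "AE xi in Yl x. ennreal (exp (- Ib (bp xi) 0 + Ib (ap xi) 0)) * oE f (xi 0) = f x"
  proof (rule AE_mp[OF AE_start], rule AE_I2, rule impI)
   fix xi assume "xi \<in> space (Yl x)" and 0: "xi 0 = Some x" then have xi: "xi \<in> hpaths" by simp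
   show "ennreal (exp (- Ib (bp xi) 0 + Ib (ap xi) 0)) * oE f (xi 0) = f x"
    using rate.Ib_0[OF rate_bp[OF xi], of 0] rate.Ib_0[OF rate_ap[OF xi], of 0] by (simp add: 0)
  qed
 qed
 then show ?thesis using prob_space.emeasure_space_1[OF prob_Yl, of x] by simp
qed

lemma QQ_cong: "(\<And>x. f x = g x) ==> QQ t f x = QQ t g x"
proof -
 assume "\<And>x. f x = g x"
 then have "f = g" by (rule ext)
 then show ?thesis by simp
qed

lemma QQ_mono: "(\<And>x. f x <= g x) ==> QQ t f x <= QQ t g x"
 unfolding QQ_def XE_def oE_def by (intro nn_integral_mono) (auto split: option.split)

lemma XE_oE_add: "XE w t (oE (\<lambda>x. f x + g x)) = XE w t (oE f) + XE w t (oE g)"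
 unfolding XE_def by (subst nn_integral_add[symmetric]) (auto intro!: nn_integral_cong simp: oE_def split: option.split)

lemma XE_oE_cmult: "XE w t (oE (\<lambda>x. c * f x)) = c * XE w t (oE f)"
 unfolding XE_def by (subst nn_integral_cmult[symmetric]) (auto intro!: nn_integral_cong simp: oE_def split: option.split)

lemma QQ_add_fun:
 assumes [measurable]: "f \<in> borel_measurable borel" "g \<in> borel_measurable borel"
 shows "QQ t (\<lambda>x. f x + g x) x = QQ t f x + QQ t g x"
 unfolding QQ_def XE_oE_add by (rule nn_integral_add) measurable

lemma QQ_cmult:
 assumes [measurable]: "f \<in> borel_measurable borel"
 shows "QQ t (\<lambda>x. c * f x) x = c * QQ t f x"
 unfolding QQ_def XE_oE_cmult by (rule nn_integral_cmult) measurable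

end

section \<open>Ergodicity of the mean semigroup\<close>

text \<open>Subtraction of a possibly infinite quantity is avoided: if at most half of a finite
  total is lost, the remainder carries the other half.\<close>

lemma ennreal_half_le:
 assumes "ennreal (2 * r) <= ennreal r + G" "0 <= r" shows "ennreal r <= G"
proof (cases G)
 case (real g)
 then have "ennreal (2 * r) <= ennreal (r + g)" using assms by simp
 then have "2 * r <= r + g" using real(1) assms(2) by (subst (asm) ennreal_le_iff) auto
 then show ?thesis using real by (simp add: ennreal_leI)
qed simp

locale supercritical = branching Yl \<beta> p P Kb KA
 for Yl :: "'a::{metric_space, second_countable_topology} => 'a path measure" and \<beta> p P Kb KA +
 fixes m :: "'a measure" and q :: "real => 'a => 'a => real" and lam :: real and \<phi> \<phi>h :: "'a => real"
 assumes m_sets[measurable_cong, simp]: "sets m = sets borel"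
  and m_sf: "sigma_finite_measure m"
  and q_cont: "\<And>t. 0 < t ==> continuous_on UNIV (\<lambda>(x, y). q t x y)"
  and q_pos: "\<And>t x y. 0 < t ==> 0 < q t x y"
  and q_kernel: "\<And>t f x. 0 < t ==> f \<in> borel_measurable borel ==> (\<And>y. 0 <= f y) ==>
           FKsg Yl (\<lambda>y. (1 - meanoff p y) * \<beta> y) t f x = (\<integral>\<^sup>+y. ennreal (q t x y * f y) \<partial>m)"
  and \<phi>_cont: "continuous_on UNIV \<phi>" and \<phi>_pos: "\<And>x. 0 < \<phi> x"
  and \<phi>h_cont: "continuous_on UNIV \<phi>h" and \<phi>h_pos: "\<And>x. 0 < \<phi>h x"
  and \<phi>\<phi>h_norm: "(\<integral>x. \<phi> x * \<phi>h x \<partial>m) = 1"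
  and \<phi>_eig: "\<And>t x. 0 < t ==> FKsg Yl (\<lambda>y. (1 - meanoff p y) * \<beta> y) t \<phi> x = ennreal (exp (lam * t) * \<phi> x)"
  and \<phi>h_eig: "\<And>t x. 0 < t ==> (\<integral>\<^sup>+y. ennreal (q t y x * \<phi>h y) \<partial>m) = ennreal (exp (lam * t) * \<phi>h x)"
  and H2: "\<And>t. 0 < t ==> \<exists>c. \<forall>x y. q t x y <= c * \<phi> x * \<phi>h y"
  and lam_pos: "0 < lam"
  and LlogL: "(\<integral>\<^sup>+x. ennreal (\<phi>h x * \<beta> x) * (\<Sum>k. if k \<ge> 2 then ennreal (real k * \<phi> x * logplus (real k * \<phi> x) * p k x)
             else 0) \<partial>m) < \<top>"
begin

lemma space_m[simp]: "space m = UNIV" using sets_eq_imp_space_eq[OF m_sets] by simp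

sublocale m: sigma_finite_measure m by (rule m_sf)
sublocale mm: pair_sigma_finite m m ..

lemma \<phi>_measurable[measurable]: "\<phi> \<in> borel_measurable borel" by (rule borel_measurable_continuous_onI[OF \<phi>_cont])
lemma \<phi>h_measurable[measurable]: "\<phi>h \<in> borel_measurable borel" by (rule borel_measurable_continuous_onI[OF \<phi>h_cont])

lemma \<phi>_nonneg: "0 <= \<phi> x" and \<phi>h_nonneg: "0 <= \<phi>h x" using \<phi>_pos[of x] \<phi>h_pos[of x] by auto

lemma q_measurable:
 assumes "0 < t" "f \<in> M \<rightarrow>\<^sub>M borel" "g \<in> M \<rightarrow>\<^sub>M borel"
 shows "(\<lambda>z. q t (f z) (g z)) \<in> borel_measurable M"
proof -
 have "(\<lambda>(x, y). q t x y) \<in> borel_measurable (borel \<Otimes>\<^sub>M borel)"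
  using borel_measurable_continuous_onI[OF q_cont[OF assms(1)]] by (simp add: borel_prod)
 from measurable_compose[OF measurable_Pair[OF assms(2,3)] this] show ?thesis by simp
qed

text \<open>Integration against phihat dm, the left eigenmeasure of the mean semigroup.\<close>

definition mu :: "('a => ennreal) => ennreal" where
 "mu f = (\<integral>\<^sup>+x. ennreal (\<phi>h x) * f x \<partial>m)"

lemma mu_cmult: "f \<in> borel_measurable borel ==> mu (\<lambda>x. c * f x) = c * mu f"
 unfolding mu_def by (subst nn_integral_cmult[symmetric]) (auto simp: ac_simps)

lemma mu_add: "f \<in> borel_measurable borel ==> g \<in> borel_measurable borel ==> mu (\<lambda>x. f x + g x) = mu f + mu g"
 unfolding mu_def by (subst nn_integral_add[symmetric]) (auto simp: distrib_left)

lemma mu_mono: "(\<And>x. f x <= g x) ==> mu f <= mu g"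
 unfolding mu_def by (intro nn_integral_mono mult_left_mono) auto

lemma mu_\<phi>: "mu (\<lambda>x. ennreal (\<phi> x)) = 1"
proof -
 \<comment> \<open>A function that is not integrable would have Bochner integral 0, not 1.\<close>
 have i: "integrable m (\<lambda>x. \<phi> x * \<phi>h x)" using \<phi>\<phi>h_norm not_integrable_integral_eq by fastforce
 have "mu (\<lambda>x. ennreal (\<phi> x)) = (\<integral>\<^sup>+x. ennreal (\<phi> x * \<phi>h x) \<partial>m)"
  unfolding mu_def using \<phi>_nonneg \<phi>h_nonneg by (intro nn_integral_cong) (simp add: ennreal_mult mult.commute)
 also have "... = ennreal (\<integral>x. \<phi> x * \<phi>h x \<partial>m)"
  by (rule nn_integral_eq_integral[OF i]) (use \<phi>_nonneg \<phi>h_nonneg in auto)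
 finally show ?thesis using \<phi>\<phi>h_norm by simp
qed

lemma QQ_real_kernel:
 assumes "0 < t" and f[measurable]: "f \<in> borel_measurable borel" and f0: "\<And>x. 0 <= f x"
 shows "QQ t (\<lambda>x. ennreal (f x)) x = (\<integral>\<^sup>+y. ennreal (q t x y) * ennreal (f y) \<partial>m)"
proof -
 have "QQ t (\<lambda>x. ennreal (f x)) x = FKsg Yl V t f x"
  unfolding QQ_def oE_gD[symmetric] by (rule many_to_one_FK[OF f f0]) (use assms(1) in auto)
 also have "... = (\<integral>\<^sup>+y. ennreal (q t x y * f y) \<partial>m)" by (rule q_kernel[OF assms(1) f f0])
 also have "... = (\<integral>\<^sup>+y. ennreal (q t x y) * ennreal (f y) \<partial>m)"
  using f0 q_pos[OF assms(1)] by (intro nn_integral_cong) (simp add: ennreal_mult less_imp_le)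
 finally show ?thesis .
qed

lemma SUP_min_of_nat: "(SUP n. min a (of_nat n)) = (a :: ennreal)"
proof (rule antisym)
 show "(SUP n. min a (of_nat n)) <= a" by (rule SUP_least) simp
 show "a <= (SUP n. min a (of_nat n))"
 proof (cases "a = \<top>")
  case True then show ?thesis by (simp add: min_def ennreal_SUP_of_nat_eq_top top_unique)
 next
  case False
  then obtain n :: nat where "a < of_nat n" using ennreal_Ex_less_of_nat[of a] by (auto simp: less_top)
  then have "a <= min a (of_nat n)" by simp
  also have "... <= (SUP n. min a (of_nat n))" by (rule SUP_upper) simp
  finally show ?thesis .
 qed
qed

text \<open>The kernel is given for real functions; truncating at the integers and monotone
  convergence extend it to extended-real ones, so that it can be applied to the semigroup
  itself.\<close>

lemma QQ_kernel:
 assumes t: "0 < t" and f[measurable]: "f \<in> borel_measurable borel"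
 shows "QQ t f x = (\<integral>\<^sup>+y. ennreal (q t x y) * f y \<partial>m)"
proof -
 define fn where "fn n y = min (f y) (of_nat n)" for n :: nat and y
 have [measurable]: "fn n \<in> borel_measurable borel" for n unfolding fn_def by measurable
 have fnr: "fn n y = ennreal (enn2real (fn n y))" for n y
 proof -
  have "fn n y \<noteq> \<top>" by (auto simp: fn_def min_def top_unique ennreal_of_nat_eq_real_of_nat)
  then show ?thesis by (simp add: less_top)
 qed
 have inc: "fn n y <= fn (Suc n) y" for n y unfolding fn_def by (intro min.mono) (auto simp: le_SucI)
 have sup: "f y = (SUP n. fn n y)" for y unfolding fn_def SUP_min_of_nat ..
 have [measurable]: "(\<lambda>y. q t x y) \<in> borel_measurable borel" by (rule q_measurable[OF t]) measurable
 have [measurable]: "(\<lambda>xi. xi t) \<in> path_space \<rightarrow>\<^sub>M (optB :: 'a option measure)" by (rule eval_measurable0) (use t in simp)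
 have [measurable]: "(\<lambda>xi. Ib (bp xi) t) \<in> borel_measurable path_space" "(\<lambda>xi. Ib (ap xi) t) \<in> borel_measurable path_space"
  by (rule Ib_vp_measurable; measurable)+
 have eq: "QQ t (fn n) x = (\<integral>\<^sup>+y. ennreal (q t x y) * fn n y \<partial>m)" for n
  using QQ_real_kernel[OF t, of "\<lambda>y. enn2real (fn n y)" x] unfolding fnr[symmetric] by simp
 have oEs: "oE f y = (SUP n. oE (fn n) y)" for y by (cases y) (simp_all add: sup[symmetric])
 have "QQ t f x = (\<integral>\<^sup>+xi. (SUP n. ennreal (exp (- Ib (bp xi) t + Ib (ap xi) t)) * oE (fn n) (xi t)) \<partial>Yl x)"
  using t by (simp add: QQ_path oEs SUP_mult_left_ennreal)
 also have "... = (SUP n. \<integral>\<^sup>+xi. ennreal (exp (- Ib (bp xi) t + Ib (ap xi) t)) * oE (fn n) (xi t) \<partial>Yl x)"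
  by (rule nn_integral_monotone_convergence_SUP)
   (auto simp: incseq_Suc_iff le_fun_def oE_def inc intro!: mult_left_mono split: option.split)
 also have "... = (SUP n. QQ t (fn n) x)" using t by (simp add: QQ_path)
 also have "... = (\<integral>\<^sup>+y. (SUP n. ennreal (q t x y) * fn n y) \<partial>m)"
  unfolding eq by (rule nn_integral_monotone_convergence_SUP[symmetric])
   (auto simp: incseq_Suc_iff le_fun_def inc intro!: mult_left_mono)
 also have "... = (\<integral>\<^sup>+y. ennreal (q t x y) * f y \<partial>m)" by (simp add: sup SUP_mult_left_ennreal)
 finally show ?thesis .
qed

lemma QQ_\<phi>: "0 <= t ==> QQ t (\<lambda>x. ennreal (\<phi> x)) x = ennreal (exp (lam * t) * \<phi> x)"
proof (cases "t = 0")
 case False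
 assume "0 <= t"
 then have "0 < t" using False by simp
 have "QQ t (\<lambda>x. ennreal (\<phi> x)) x = FKsg Yl V t \<phi> x"
  unfolding QQ_def oE_gD[symmetric] by (rule many_to_one_FK) (use \<phi>_nonneg \<open>0 <= t\<close> in auto)
 then show ?thesis by (simp add: \<phi>_eig[OF \<open>0 < t\<close>])
qed (simp add: QQ_0)

lemma \<phi>h_eig': "0 < t ==> (\<integral>\<^sup>+y. ennreal (\<phi>h y) * ennreal (q t y x) \<partial>m) = ennreal (exp (lam * t) * \<phi>h x)"
 unfolding \<phi>h_eig[symmetric] using q_pos \<phi>h_nonneg by (intro nn_integral_cong) (simp add: ennreal_mult less_imp_le mult.commute)

lemma Fubini_q:
 assumes t: "0 < t" and [measurable]: "h \<in> borel_measurable borel" "f \<in> borel_measurable borel"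
 shows "(\<integral>\<^sup>+x. h x * (\<integral>\<^sup>+y. ennreal (q t x y) * f y \<partial>m) \<partial>m) = (\<integral>\<^sup>+y. (\<integral>\<^sup>+x. h x * ennreal (q t x y) \<partial>m) * f y \<partial>m)"
proof -
 have [measurable]: "(\<lambda>z. q t (fst z) (snd z)) \<in> borel_measurable (m \<Otimes>\<^sub>M m)" by (rule q_measurable[OF t]) measurable
 have [measurable]: "(\<lambda>y. q t x y) \<in> borel_measurable borel" "(\<lambda>x. q t x y) \<in> borel_measurable borel" for x y
  by (rule q_measurable[OF t]; measurable)+
 have "(\<integral>\<^sup>+x. h x * (\<integral>\<^sup>+y. ennreal (q t x y) * f y \<partial>m) \<partial>m) = (\<integral>\<^sup>+x. \<integral>\<^sup>+y. h x * ennreal (q t x y) * f y \<partial>m \<partial>m)"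
  by (subst nn_integral_cmult[symmetric]) (auto simp: mult.assoc)
 also have "... = (\<integral>\<^sup>+y. \<integral>\<^sup>+x. h x * ennreal (q t x y) * f y \<partial>m \<partial>m)"
  by (rule mm.Fubini'[symmetric]) (unfold split_beta', measurable)
 also have "... = (\<integral>\<^sup>+y. (\<integral>\<^sup>+x. h x * ennreal (q t x y) \<partial>m) * f y \<partial>m)"
  by (subst nn_integral_multc) auto
 finally show ?thesis .
qed

lemma mu_QQ:
 assumes t: "0 <= t" and [measurable]: "f \<in> borel_measurable borel"
 shows "mu (QQ t f) = ennreal (exp (lam * t)) * mu f"
proof (cases "t = 0")
 case True
 have "QQ 0 f = f" by (rule ext) (rule QQ_0, measurable)
 then show ?thesis using True by simp
next
 case False
 then have t: "0 < t" using t by simp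
 have "mu (QQ t f) = (\<integral>\<^sup>+y. (\<integral>\<^sup>+x. ennreal (\<phi>h x) * ennreal (q t x y) \<partial>m) * f y \<partial>m)"
  unfolding mu_def QQ_kernel[OF t assms(2)] by (rule Fubini_q[OF t]) measurable
 also have "... = ennreal (exp (lam * t)) * mu f"
  unfolding \<phi>h_eig'[OF t] mu_def using \<phi>h_nonneg by (subst nn_integral_cmult[symmetric]) (auto simp: ennreal_mult mult.assoc)
 finally show ?thesis .
qed

lemma q_bound:
 assumes "0 < t" obtains C where "0 < C" "\<And>x y. q t x y <= C * \<phi> x * \<phi>h y"
proof -
 obtain c where c: "\<And>x y. q t x y <= c * \<phi> x * \<phi>h y" using H2[OF assms] by blast
 show thesis
 proof (rule that[of "max 1 c"])
  fix x y
  have "c * (\<phi> x * \<phi>h y) <= max 1 c * (\<phi> x * \<phi>h y)" using \<phi>_nonneg \<phi>h_nonneg by (intro mult_right_mono) auto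
  then show "q t x y <= max 1 c * \<phi> x * \<phi>h y" using c[of x y] by (simp add: mult.assoc)
 qed simp
qed

text \<open>The kernel bound is spent on the first stretch of length \<open>d\<close>, and the
  remaining time is absorbed by the eigenmeasure. Thus \<open>C\<close> does not depend on
  \<open>t\<close>, and bounds in the mean under phihat dm become bounds at every point.\<close>

lemma QQ_upper:
 assumes d: "0 < d"
 shows "\<exists>C>0. \<forall>t\<ge>d. \<forall>f\<in>borel_measurable borel. \<forall>x. QQ t f x <= ennreal (C * exp (lam * t) * \<phi> x) * mu f"
proof -
 obtain C where C: "0 < C" "\<And>x y. q d x y <= C * \<phi> x * \<phi>h y" using q_bound[OF d] by blast
 show ?thesis
 proof (intro exI[of _ C] conjI allI impI ballI C(1))
  fix t and f :: "'a => ennreal" and x assume t: "d <= t" and f[measurable]: "f \<in> borel_measurable borel"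
  have "QQ t f x = QQ d (QQ (t - d) f) x" using QQ_add[OF f, of d "t - d"] t d by simp
  also have "... = (\<integral>\<^sup>+y. ennreal (q d x y) * QQ (t - d) f y \<partial>m)" by (rule QQ_kernel[OF d]) measurable
  also have "... <= (\<integral>\<^sup>+y. ennreal (C * \<phi> x) * (ennreal (\<phi>h y) * QQ (t - d) f y) \<partial>m)"
  proof (rule nn_integral_mono)
   fix y
   have "ennreal (q d x y) <= ennreal (C * \<phi> x * \<phi>h y)" using C(2) by (rule ennreal_leI)
   also have "... = ennreal (C * \<phi> x) * ennreal (\<phi>h y)" using C(1) \<phi>_nonneg \<phi>h_nonneg by (simp add: ennreal_mult)
   finally have "ennreal (q d x y) * QQ (t - d) f y <= (ennreal (C * \<phi> x) * ennreal (\<phi>h y)) * QQ (t - d) f y" by (rule mult_right_mono) simp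
   then show "ennreal (q d x y) * QQ (t - d) f y <= ennreal (C * \<phi> x) * (ennreal (\<phi>h y) * QQ (t - d) f y)" by (simp add: mult.assoc)
  qed
  also have "... = ennreal (C * \<phi> x) * mu (QQ (t - d) f)" unfolding mu_def by (rule nn_integral_cmult) measurable
  also have "mu (QQ (t - d) f) = ennreal (exp (lam * (t - d))) * mu f" by (rule mu_QQ) (use t in auto)
  also have "ennreal (C * \<phi> x) * (ennreal (exp (lam * (t - d))) * mu f) = ennreal (C * \<phi> x * exp (lam * (t - d))) * mu f"
   using C(1) \<phi>_nonneg by (simp add: ennreal_mult mult.assoc)
  also have "... <= ennreal (C * exp (lam * t) * \<phi> x) * mu f"
  proof (intro mult_right_mono ennreal_leI)
   have "exp (lam * (t - d)) <= exp (lam * t)" using lam_pos d by simp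
   then have "(C * \<phi> x) * exp (lam * (t - d)) <= (C * \<phi> x) * exp (lam * t)" using C(1) \<phi>_nonneg by (intro mult_left_mono) auto
   then show "C * \<phi> x * exp (lam * (t - d)) <= C * exp (lam * t) * \<phi> x" by (simp add: ac_simps)
  qed simp
  finally show "QQ t f x <= ennreal (C * exp (lam * t) * \<phi> x) * mu f" .
 qed
qed

text \<open>Doeblin minorization: since the kernel is dominated by \<open>C \<phi> \<otimes> \<phi>h\<close>, almost all of its mass
 sits where it is bounded below, and two further steps spread that lower bound to all targets.\<close>
lemma doeblin:
 assumes d: "0 < d"
 shows "\<exists>\<epsilon>>0. \<forall>f\<in>borel_measurable borel. \<forall>x. ennreal (\<epsilon> * \<phi> x) * mu f <= QQ (3 * d) f x"
proof -
 obtain C where C: "0 < C" "\<And>x y. q d x y <= C * \<phi> x * \<phi>h y" using q_bound[OF d] by blast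
 define a where "a = exp (lam * d)"
 have a: "0 < a" by (simp add: a_def)
 \<comment> \<open>With \<open>C * \<theta> = a / 2\<close>, a set of \<phi>\<phi>h-mass at most
   \<open>\<theta>\<close> can swallow at most half of the mass \<open>a\<close> which the
   eigenfunction equations provide.\<close>
 define \<theta> where "\<theta> = a / (2 * C)"
 have \<theta>: "0 < \<theta>" "C * \<theta> = a / 2" using a C by (auto simp: \<theta>_def field_simps)
 define N where "N = density m (\<lambda>y. ennreal (\<phi> y * \<phi>h y))"
 have sN[measurable_cong, simp]: "sets N = sets borel" by (simp add: N_def)
 have spN[simp]: "space N = UNIV" using sets_eq_imp_space_eq[OF sN] by simp
 have N1: "emeasure N UNIV = 1" unfolding N_def using mu_\<phi> \<phi>_nonneg \<phi>h_nonneg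
  by (subst emeasure_density) (auto simp: mu_def ennreal_mult mult.commute)
 interpret N: prob_space N by (rule prob_spaceI) (simp add: N1)
 have [measurable]: "(\<lambda>z. q d (snd z) (fst z)) \<in> borel_measurable (borel \<Otimes>\<^sub>M borel)" by (rule q_measurable[OF d]) measurable
 have [measurable]: "(\<lambda>y. q d x y) \<in> borel_measurable borel" "(\<lambda>x. q d x y) \<in> borel_measurable borel" for x y
  by (rule q_measurable[OF d]; measurable)+
 \<comment> \<open>Points from which the target \<open>z\<close> is reached with too small a density
   relative to \<phi> and \<phi>h. For fixed \<open>z\<close> these sets decrease to the empty set
   because the kernel is strictly positive.\<close>
 define bad where "bad k z = {y. q d y z < \<phi> y * \<phi>h z / real (Suc k)}" for k z
 have bad_m[measurable]: "bad k z \<in> sets borel" for k z unfolding bad_def by measurable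
 have w0: "(\<lambda>k. emeasure N (bad k z)) \<longlonglongrightarrow> 0" for z
 proof -
  have "(\<lambda>k. emeasure N (bad k z)) \<longlonglongrightarrow> emeasure N (\<Inter>k. bad k z)"
  proof (rule Lim_emeasure_decseq)
   show "decseq (\<lambda>k. bad k z)"
   proof (rule decseq_SucI, rule subsetI)
    fix k y assume "y \<in> bad (Suc k) z"
    moreover have "\<phi> y * \<phi>h z / real (Suc (Suc k)) <= \<phi> y * \<phi>h z / real (Suc k)"
     using \<phi>_nonneg \<phi>h_nonneg by (intro divide_left_mono) (auto intro: mult_nonneg_nonneg)
    ultimately show "y \<in> bad k z" by (simp add: bad_def)
   qed
  qed auto
  also have "(\<Inter>k. bad k z) = {}"
  proof (rule ccontr)
   assume "(\<Inter>k. bad k z) \<noteq> {}"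
   then obtain y where y: "\<And>k. q d y z < \<phi> y * \<phi>h z / real (Suc k)" by (auto simp: bad_def)
   have "(\<lambda>k. \<phi> y * \<phi>h z / real (Suc k)) \<longlonglongrightarrow> 0" by (rule LIMSEQ_Suc[OF lim_const_over_n])
   then have "q d y z <= 0" by (rule LIMSEQ_le_const) (use y in \<open>auto intro: less_imp_le\<close>)
   then show False using q_pos[OF d, of y z] by simp
  qed
  finally show ?thesis by simp
 qed
 \<comment> \<open>Targets whose bad set is small. As \<open>k\<close> grows they exhaust the space,
   again up to mass tending to 0.\<close>
 define B where "B k = {z. emeasure N (bad k z) <= ennreal \<theta>}" for k
 have B_m[measurable]: "B k \<in> sets borel" for k
 proof -
  have Q: "{zy \<in> space (borel \<Otimes>\<^sub>M N). q d (snd zy) (fst zy) < \<phi> (snd zy) * \<phi>h (fst zy) / real (Suc k)} \<in> sets (borel \<Otimes>\<^sub>M N)"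
   by measurable
  from N.measurable_emeasure_Pair[OF this]
  have "(\<lambda>z. emeasure N (bad k z)) \<in> borel_measurable borel"
   by (simp add: bad_def vimage_def space_pair_measure)
  then show ?thesis unfolding B_def by measurable
 qed
 have "(\<lambda>k. emeasure N (- B k)) \<longlonglongrightarrow> emeasure N (\<Inter>k. - B k)"
 proof (rule Lim_emeasure_decseq)
  show "decseq (\<lambda>k. - B k)"
  proof (rule decseq_SucI, rule subsetI)
   fix k z assume z: "z \<in> - B (Suc k)"
   have "bad (Suc k) z \<subseteq> bad k z"
   proof
    fix y assume "y \<in> bad (Suc k) z"
    moreover have "\<phi> y * \<phi>h z / real (Suc (Suc k)) <= \<phi> y * \<phi>h z / real (Suc k)"
     using \<phi>_nonneg \<phi>h_nonneg by (intro divide_left_mono) (auto intro: mult_nonneg_nonneg)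
    ultimately show "y \<in> bad k z" by (simp add: bad_def)
   qed
   then have "emeasure N (bad (Suc k) z) <= emeasure N (bad k z)" by (rule emeasure_mono) simp
   then show "z \<in> - B k" using z by (auto simp: B_def not_le)
  qed
 qed auto
 also have "(\<Inter>k. - B k) = {}"
 proof (rule ccontr)
  assume "(\<Inter>k. - B k) \<noteq> {}"
  then obtain z where "z \<in> (\<Inter>k. - B k)" by blast
  then have z: "ennreal \<theta> < emeasure N (bad k z)" for k by (auto simp: B_def not_le)
  have "ennreal \<theta> <= 0" by (rule LIMSEQ_le_const[OF w0[of z]]) (use z in \<open>auto intro: less_imp_le\<close>)
  then show False using \<theta>(1) by simp
 qed
 finally have "(\<lambda>k. emeasure N (- B k)) \<longlonglongrightarrow> 0" by simp
 \<comment> \<open>One level \<open>k\<close> serves all good targets at once; the targets that are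
   not good have mass below the same threshold.\<close>
 from order_tendstoD(2)[OF this, of "ennreal \<theta>"] \<theta>(1)
 obtain k where k: "emeasure N (- B k) < ennreal \<theta>" by (auto simp: eventually_sequentially)
 have Nint: "emeasure N A = (\<integral>\<^sup>+y. ennreal (\<phi> y * \<phi>h y) * indicator A y \<partial>m)" if "A \<in> sets borel" for A
  unfolding N_def by (subst emeasure_density) (use that in auto)
 have small: "ennreal (C * c) * emeasure N A <= ennreal (a * c / 2)" if "emeasure N A <= ennreal \<theta>" "0 <= c" for A c
 proof -
  have "ennreal (C * c) * emeasure N A <= ennreal (C * c) * ennreal \<theta>" using that by (intro mult_left_mono) auto
  also have "... = ennreal (C * c * \<theta>)" using C(1) that \<theta>(1) by (simp add: ennreal_mult)
  also have "C * c * \<theta> = a * c / 2" using \<theta>(2) by (simp add: field_simps)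
  finally show ?thesis .
 qed
 \<comment> \<open>Two steps from \<open>x\<close> to a good target: in the eigenfunction equation
   at \<open>x\<close> the bad intermediate points cost at most half, and from the others the second
   step has density at least \<phi> times \<phi>h divided by \<open>Suc k\<close>.\<close>
 have step1: "ennreal (a / 2 / real (Suc k) * \<phi> x * \<phi>h z) <= (\<integral>\<^sup>+y. ennreal (q d x y) * ennreal (q d y z) \<partial>m)" if z: "z \<in> B k" for x z
 proof -
  let ?G = "\<integral>\<^sup>+y. ennreal (q d x y) * ennreal (\<phi> y) * indicator (- bad k z) y \<partial>m"
  have "ennreal (2 * (a * \<phi> x / 2)) = QQ d (\<lambda>y. ennreal (\<phi> y)) x" using QQ_\<phi>[of d x] d by (simp add: a_def)
  also have "... = (\<integral>\<^sup>+y. ennreal (q d x y) * ennreal (\<phi> y) \<partial>m)" by (rule QQ_kernel[OF d]) measurable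
  also have "... = (\<integral>\<^sup>+y. ennreal (q d x y) * ennreal (\<phi> y) * indicator (bad k z) y + ennreal (q d x y) * ennreal (\<phi> y) * indicator (- bad k z) y \<partial>m)"
   by (intro nn_integral_cong) (auto split: split_indicator)
  also have "... = (\<integral>\<^sup>+y. ennreal (q d x y) * ennreal (\<phi> y) * indicator (bad k z) y \<partial>m) + ?G"
   by (rule nn_integral_add) measurable
  finally have eq: "ennreal (2 * (a * \<phi> x / 2)) = (\<integral>\<^sup>+y. ennreal (q d x y) * ennreal (\<phi> y) * indicator (bad k z) y \<partial>m) + ?G" .
  have "(\<integral>\<^sup>+y. ennreal (q d x y) * ennreal (\<phi> y) * indicator (bad k z) y \<partial>m) <= (\<integral>\<^sup>+y. ennreal (C * \<phi> x) * (ennreal (\<phi> y * \<phi>h y) * indicator (bad k z) y) \<partial>m)"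
  proof (rule nn_integral_mono)
   fix y
   have "ennreal (q d x y) * ennreal (\<phi> y) = ennreal (q d x y * \<phi> y)" using q_pos[OF d, of x y] \<phi>_nonneg[of y] by (simp add: ennreal_mult)
   also have "... <= ennreal ((C * \<phi> x * \<phi>h y) * \<phi> y)" using C(2)[of x y] \<phi>_nonneg[of y] by (intro ennreal_leI mult_right_mono)
   also have "... = ennreal (C * \<phi> x) * ennreal (\<phi> y * \<phi>h y)" using C(1) \<phi>_nonneg \<phi>h_nonneg by (simp add: ennreal_mult[symmetric] ac_simps)
   finally show "ennreal (q d x y) * ennreal (\<phi> y) * indicator (bad k z) y <= ennreal (C * \<phi> x) * (ennreal (\<phi> y * \<phi>h y) * indicator (bad k z) y)"
    by (simp split: split_indicator)
  qed
  also have "(\<integral>\<^sup>+y. ennreal (C * \<phi> x) * (ennreal (\<phi> y * \<phi>h y) * indicator (bad k z) y) \<partial>m) = ennreal (C * \<phi> x) * emeasure N (bad k z)"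
   unfolding Nint[OF bad_m] by (rule nn_integral_cmult) measurable
  also have "... <= ennreal (a * \<phi> x / 2)" by (rule small) (use z \<phi>_nonneg in \<open>auto simp: B_def\<close>)
  finally have "ennreal (2 * (a * \<phi> x / 2)) <= ennreal (a * \<phi> x / 2) + ?G" unfolding eq by (rule add_right_mono)
  then have G: "ennreal (a * \<phi> x / 2) <= ?G" by (rule ennreal_half_le) (use a \<phi>_nonneg[of x] in auto)
  have "ennreal (a / 2 / real (Suc k) * \<phi> x * \<phi>h z) = ennreal (a * \<phi> x / 2) * ennreal (\<phi>h z / real (Suc k))"
   using a \<phi>_nonneg[of x] \<phi>h_nonneg[of z] by (subst ennreal_mult[symmetric]) (auto simp: field_simps simp del: of_nat_Suc)
  also have "... <= ?G * ennreal (\<phi>h z / real (Suc k))" using G by (rule mult_right_mono) simp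
  also have "... = (\<integral>\<^sup>+y. ennreal (q d x y) * ennreal (\<phi> y) * indicator (- bad k z) y * ennreal (\<phi>h z / real (Suc k)) \<partial>m)"
   by (rule nn_integral_multc[symmetric]) measurable
  also have "... <= (\<integral>\<^sup>+y. ennreal (q d x y) * ennreal (q d y z) \<partial>m)"
  proof (rule nn_integral_mono)
   fix y
   have "ennreal (\<phi> y) * ennreal (\<phi>h z / real (Suc k)) <= ennreal (q d y z)" if "y \<notin> bad k z"
    using that \<phi>_nonneg[of y] \<phi>h_nonneg[of z] by (subst ennreal_mult[symmetric]) (auto simp: bad_def not_less intro!: ennreal_leI)
   then show "ennreal (q d x y) * ennreal (\<phi> y) * indicator (- bad k z) y * ennreal (\<phi>h z / real (Suc k)) <= ennreal (q d x y) * ennreal (q d y z)"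
    by (auto simp: mult.assoc intro!: mult_left_mono split: split_indicator)
  qed
  finally show ?thesis .
 qed
 let ?c = "a / 2 / real (Suc k)"
 have c: "0 < ?c" using a by simp
 have step2: "ennreal (?c * \<phi> x) * (\<integral>\<^sup>+z. (ennreal (\<phi>h z) * indicator (B k) z) * g z \<partial>m) <= QQ (2 * d) g x" if g[measurable]: "g \<in> borel_measurable borel" for g x
 proof -
  have "QQ (2 * d) g x = QQ d (QQ d g) x" using QQ_add[OF g, of d d] d unfolding mult_2 by simp
  also have "... = (\<integral>\<^sup>+y. ennreal (q d x y) * (\<integral>\<^sup>+z. ennreal (q d y z) * g z \<partial>m) \<partial>m)"
   by (subst QQ_kernel[OF d]) (auto simp: QQ_kernel[OF d g])
  also have "... = (\<integral>\<^sup>+z. (\<integral>\<^sup>+y. ennreal (q d x y) * ennreal (q d y z) \<partial>m) * g z \<partial>m)"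
   by (rule Fubini_q[OF d]) measurable
  finally have eq: "QQ (2 * d) g x = (\<integral>\<^sup>+z. (\<integral>\<^sup>+y. ennreal (q d x y) * ennreal (q d y z) \<partial>m) * g z \<partial>m)" .
  have "ennreal (?c * \<phi> x) * (\<integral>\<^sup>+z. (ennreal (\<phi>h z) * indicator (B k) z) * g z \<partial>m) = (\<integral>\<^sup>+z. ennreal (?c * \<phi> x) * ((ennreal (\<phi>h z) * indicator (B k) z) * g z) \<partial>m)"
   by (rule nn_integral_cmult[symmetric]) measurable
  also have "... <= QQ (2 * d) g x"
   unfolding eq
  proof (rule nn_integral_mono)
   fix z
   have "ennreal (?c * \<phi> x) * ennreal (\<phi>h z) = ennreal (?c * \<phi> x * \<phi>h z)"
    by (rule ennreal_mult[OF mult_nonneg_nonneg[OF less_imp_le[OF c] \<phi>_nonneg] \<phi>h_nonneg, symmetric])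
   then have "ennreal (?c * \<phi> x) * (ennreal (\<phi>h z) * indicator (B k) z) <= (\<integral>\<^sup>+y. ennreal (q d x y) * ennreal (q d y z) \<partial>m)"
    using step1[of z x] by (auto split: split_indicator)
   from mult_right_mono[OF this, of "g z"]
   show "ennreal (?c * \<phi> x) * ((ennreal (\<phi>h z) * indicator (B k) z) * g z) <= (\<integral>\<^sup>+y. ennreal (q d x y) * ennreal (q d y z) \<partial>m) * g z"
    by (simp add: mult.assoc)
  qed
  finally show ?thesis .
 qed
 \<comment> \<open>The dual argument spreads the bound from good targets to all targets: in the
   equation for \<phi>h the starting points outside \<open>B k\<close> carry at most half of the
   mass.\<close>
 have step3: "ennreal (a / 2) * mu f <= (\<integral>\<^sup>+z. (ennreal (\<phi>h z) * indicator (B k) z) * QQ d f z \<partial>m)" if f[measurable]: "f \<in> borel_measurable borel" for f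
 proof -
  have "ennreal (a / 2) * mu f = (\<integral>\<^sup>+wa. ennreal (a * \<phi>h wa / 2) * f wa \<partial>m)"
   unfolding mu_def using a \<phi>h_nonneg by (subst nn_integral_cmult[symmetric]) (auto intro!: nn_integral_cong simp: ennreal_mult'[symmetric] mult.assoc[symmetric])
  also have "... <= (\<integral>\<^sup>+wa. (\<integral>\<^sup>+z. (ennreal (\<phi>h z) * indicator (B k) z) * ennreal (q d z wa) \<partial>m) * f wa \<partial>m)"
  proof (intro nn_integral_mono mult_right_mono)
   fix wa
   let ?G = "\<integral>\<^sup>+z. (ennreal (\<phi>h z) * indicator (B k) z) * ennreal (q d z wa) \<partial>m"
   have "ennreal (2 * (a * \<phi>h wa / 2)) = (\<integral>\<^sup>+z. ennreal (\<phi>h z) * ennreal (q d z wa) \<partial>m)" by (simp add: \<phi>h_eig'[OF d] a_def)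
   also have "... = (\<integral>\<^sup>+z. (ennreal (\<phi>h z) * indicator (- B k) z) * ennreal (q d z wa) + (ennreal (\<phi>h z) * indicator (B k) z) * ennreal (q d z wa) \<partial>m)"
    by (intro nn_integral_cong) (auto split: split_indicator)
   also have "... = (\<integral>\<^sup>+z. (ennreal (\<phi>h z) * indicator (- B k) z) * ennreal (q d z wa) \<partial>m) + ?G"
    by (rule nn_integral_add) measurable
   finally have eq: "ennreal (2 * (a * \<phi>h wa / 2)) = (\<integral>\<^sup>+z. (ennreal (\<phi>h z) * indicator (- B k) z) * ennreal (q d z wa) \<partial>m) + ?G" .
   have "(\<integral>\<^sup>+z. (ennreal (\<phi>h z) * indicator (- B k) z) * ennreal (q d z wa) \<partial>m) <= (\<integral>\<^sup>+z. ennreal (C * \<phi>h wa) * (ennreal (\<phi> z * \<phi>h z) * indicator (- B k) z) \<partial>m)"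
   proof (rule nn_integral_mono)
    fix z
    have "ennreal (\<phi>h z) * ennreal (q d z wa) = ennreal (\<phi>h z * q d z wa)" using q_pos[OF d, of z wa] \<phi>h_nonneg[of z] by (simp add: ennreal_mult)
    also have "... <= ennreal (\<phi>h z * (C * \<phi> z * \<phi>h wa))" using C(2)[of z wa] \<phi>h_nonneg[of z] by (intro ennreal_leI mult_left_mono)
    also have "... = ennreal (C * \<phi>h wa) * ennreal (\<phi> z * \<phi>h z)" using C(1) \<phi>_nonneg \<phi>h_nonneg by (simp add: ennreal_mult[symmetric] ac_simps)
    finally show "(ennreal (\<phi>h z) * indicator (- B k) z) * ennreal (q d z wa) <= ennreal (C * \<phi>h wa) * (ennreal (\<phi> z * \<phi>h z) * indicator (- B k) z)"
     by (simp split: split_indicator)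
   qed
   also have "(\<integral>\<^sup>+z. ennreal (C * \<phi>h wa) * (ennreal (\<phi> z * \<phi>h z) * indicator (- B k) z) \<partial>m) = ennreal (C * \<phi>h wa) * emeasure N (- B k)"
    by (subst Nint) (auto intro!: nn_integral_cmult)
   also have "... <= ennreal (a * \<phi>h wa / 2)" by (rule small) (use k \<phi>h_nonneg in \<open>auto intro: less_imp_le\<close>)
   finally have "ennreal (2 * (a * \<phi>h wa / 2)) <= ennreal (a * \<phi>h wa / 2) + ?G" unfolding eq by (rule add_right_mono)
   then show "ennreal (a * \<phi>h wa / 2) <= ?G" by (rule ennreal_half_le) (use a \<phi>h_nonneg[of wa] in auto)
  qed simp
  also have "... = (\<integral>\<^sup>+z. (ennreal (\<phi>h z) * indicator (B k) z) * (\<integral>\<^sup>+wa. ennreal (q d z wa) * f wa \<partial>m) \<partial>m)"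
   by (rule Fubini_q[OF d, symmetric]) measurable
  also have "... = (\<integral>\<^sup>+z. (ennreal (\<phi>h z) * indicator (B k) z) * QQ d f z \<partial>m)" by (simp add: QQ_kernel[OF d f])
  finally show ?thesis .
 qed
 show ?thesis
 proof (intro exI[of _ "?c * (a / 2)"] conjI ballI allI)
  show "0 < ?c * (a / 2)" using a c by (intro mult_pos_pos) auto
  fix f :: "'a => ennreal" and x assume f[measurable]: "f \<in> borel_measurable borel"
  have "ennreal (?c * (a / 2) * \<phi> x) * mu f = ennreal (?c * \<phi> x) * (ennreal (a / 2) * mu f)"
  proof -
   have "ennreal (?c * (a / 2) * \<phi> x) = ennreal ((?c * \<phi> x) * (a / 2))" by (rule arg_cong[where f=ennreal]) (simp only: ac_simps)
   also have "... = ennreal (?c * \<phi> x) * ennreal (a / 2)"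
    by (rule ennreal_mult[OF mult_nonneg_nonneg[OF less_imp_le[OF c] \<phi>_nonneg]]) (use a in simp)
   finally show ?thesis by (simp only: mult.assoc)
  qed
  also have "... <= ennreal (?c * \<phi> x) * (\<integral>\<^sup>+z. (ennreal (\<phi>h z) * indicator (B k) z) * QQ d f z \<partial>m)"
   by (rule mult_left_mono[OF step3[OF f]]) simp
  also have "... <= QQ (2 * d) (QQ d f) x" by (rule step2) measurable
  also have "... = QQ (3 * d) f x" using QQ_add[OF f, of "2 * d" d x] d by simp
  finally show "ennreal (?c * (a / 2) * \<phi> x) * mu f <= QQ (3 * d) f x" .
 qed
qed

text \<open>The minorization applied to the constant 1 bounds \<phi> by a multiple of the mean
  number of particles at time 3, which is bounded since the birth rate is.\<close>

lemma \<phi>_bounded: "\<exists>K>0. \<forall>x. \<phi> x <= K"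
proof -
 obtain \<epsilon> where \<epsilon>: "\<epsilon> > 0" "\<And>f x. f \<in> borel_measurable borel ==> ennreal (\<epsilon> * \<phi> x) * mu f <= QQ (3 * 1) f x"
  using doeblin[of 1] by auto
 have "mu (\<lambda>_. 1) \<noteq> 0"
 proof
  assume "mu (\<lambda>_. 1) = 0"
  then have "AE x in m. ennreal (\<phi>h x) = 0" unfolding mu_def by (simp add: nn_integral_0_iff_AE)
  then have "mu (\<lambda>x. ennreal (\<phi> x)) = (\<integral>\<^sup>+x. 0 \<partial>m)" unfolding mu_def by (intro nn_integral_cong_AE) (auto elim!: eventually_mono)
  then show False by (simp add: mu_\<phi>)
 qed
 \<comment> \<open>The cut at 1 turns the total mass of phihat dm, not yet known to be finite, into
   a positive real.\<close>
 define r where "r = enn2real (min 1 (mu (\<lambda>_. 1)))"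
 have r: "0 < r" "ennreal r <= mu (\<lambda>_. 1)"
 proof -
  have "min 1 (mu (\<lambda>_. 1)) < \<top>" by (simp add: min_less_iff_disj)
  then show "0 < r" "ennreal r <= mu (\<lambda>_. 1)"
   using \<open>mu (\<lambda>_. 1) \<noteq> 0\<close> by (auto simp: r_def enn2real_positive_iff zero_less_iff_neq_zero min_less_iff_disj)
 qed
 let ?E = "exp (KA * Kb * (3 * 1))"
 show ?thesis
 proof (intro exI[of _ "?E / (\<epsilon> * r)"] conjI allI)
  fix x
  have "ennreal (\<epsilon> * \<phi> x * r) = ennreal (\<epsilon> * \<phi> x) * ennreal r" using r \<epsilon> \<phi>_nonneg[of x] by (simp add: ennreal_mult)
  also have "... <= ennreal (\<epsilon> * \<phi> x) * mu (\<lambda>_. 1)" by (rule mult_left_mono[OF r(2)]) simp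
  also have "... <= QQ (3 * 1) (\<lambda>_. 1) x" by (rule \<epsilon>(2)) simp
  also have "... <= ennreal ?E * (\<integral>\<^sup>+xi. oE (\<lambda>_. 1) (xi (3 * 1)) \<partial>Yl x)" by (rule QQ_le) auto
  also have "... <= ennreal ?E * (\<integral>\<^sup>+xi. 1 \<partial>Yl x)"
   by (intro mult_left_mono nn_integral_mono) (auto simp: oE_def split: option.split)
  also have "... = ennreal ?E" using prob_space.emeasure_space_1[OF prob_Yl, of x] by simp
  finally have "\<epsilon> * \<phi> x * r <= ?E" by (simp add: ennreal_le_iff)
  then show "\<phi> x <= ?E / (\<epsilon> * r)" using r \<epsilon> by (simp add: field_simps)
 qed (use r \<epsilon> in simp)
qed

text \<open>Contraction in the supremum norm relative to \<phi>. If the normalized mean is within D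
  \<phi> of its limit, then D \<phi> plus or minus the difference is nonnegative with
  \<open>mu\<close>-integral D, and the minorization gains a fixed multiple of D \<phi> in each
  step. The time step \<open>3 * d\<close> is that of the minorization.\<close>

lemma ergodic:
 assumes d: "0 < d"
 shows "\<exists>\<rho>\<ge>0. \<rho> < 1 \<and> (\<forall>K h. 0 <= K \<longrightarrow> h \<in> borel_measurable borel \<longrightarrow> (\<forall>x. 0 <= h x \<and> h x <= K * \<phi> x) \<longrightarrow>
   (\<forall>k x. \<bar>exp (- lam * (3 * d * real k)) * enn2real (QQ (3 * d * real k) (\<lambda>x. ennreal (h x)) x)
    - enn2real (mu (\<lambda>x. ennreal (h x))) * \<phi> x\<bar> <= \<rho> ^ k * K * \<phi> x))"
proof -
 obtain \<epsilon> where \<epsilon>: "\<epsilon> > 0" "\<And>f x. f \<in> borel_measurable borel ==> ennreal (\<epsilon> * \<phi> x) * mu f <= QQ (3 * d) f x"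
  using doeblin[OF d] by blast
 define a where "a = exp (lam * (3 * d))"
 have a: "0 < a" by (simp add: a_def)
 have QQa: "QQ (3 * d) (\<lambda>x. ennreal (c * \<phi> x)) x = ennreal (a * (c * \<phi> x))" if "0 <= c" for c x
 proof -
  have "QQ (3 * d) (\<lambda>x. ennreal (c * \<phi> x)) x = QQ (3 * d) (\<lambda>x. ennreal c * ennreal (\<phi> x)) x"
   using that by (intro QQ_cong) (simp add: ennreal_mult' )
  also have "... = ennreal c * QQ (3 * d) (\<lambda>x. ennreal (\<phi> x)) x" by (rule QQ_cmult) measurable
  also have "... = ennreal c * ennreal (a * \<phi> x)" using d by (simp add: QQ_\<phi> a_def)
  finally show ?thesis using that by (simp add: ennreal_mult'[symmetric] ac_simps)
 qed
 have mua: "mu (\<lambda>x. ennreal (c * \<phi> x)) = ennreal c" if "0 <= c" for c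
  using mu_cmult[of "\<lambda>x. ennreal (\<phi> x)" "ennreal c"] that by (simp add: mu_\<phi> ennreal_mult')
 \<comment> \<open>Testing the minorization on \<phi> itself compares its constant with the
   eigenvalue and makes \<rho> nonnegative.\<close>
 have \<epsilon>a: "\<epsilon> <= a"
 proof -
  fix x0 :: 'a
  have "ennreal (\<epsilon> * \<phi> x0) <= ennreal (a * (1 * \<phi> x0))"
   using \<epsilon>(2)[of "\<lambda>x. ennreal (1 * \<phi> x)" x0] unfolding mua[OF zero_le_one] QQa[OF zero_le_one] by simp
  then have "\<epsilon> * \<phi> x0 <= a * \<phi> x0" using a \<phi>_nonneg[of x0] by (subst (asm) ennreal_le_iff) auto
  then show ?thesis using \<phi>_pos[of x0] by simp
 qed
 define \<rho> where "\<rho> = 1 - \<epsilon> / a"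
 have \<rho>: "0 <= \<rho>" "\<rho> < 1" using \<epsilon>(1) \<epsilon>a a by (auto simp: \<rho>_def field_simps)
 show ?thesis
 proof (intro exI[of _ \<rho>] conjI \<rho> allI impI)
  fix K h k x assume K: "0 <= K" and hm[measurable]: "h \<in> borel_measurable borel" and h: "\<forall>x. 0 <= h x \<and> h x <= K * \<phi> x"
  define mh where "mh = enn2real (mu (\<lambda>x. ennreal (h x)))"
  have "mu (\<lambda>x. ennreal (h x)) <= mu (\<lambda>x. ennreal (K * \<phi> x))" using h by (intro mu_mono ennreal_leI) auto
  then have muK: "mu (\<lambda>x. ennreal (h x)) <= ennreal K" unfolding mua[OF K] .
  then have muh: "mu (\<lambda>x. ennreal (h x)) = ennreal mh"
   unfolding mh_def using le_less_trans[OF muK ennreal_less_top] by simp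
  have mh: "0 <= mh" "mh <= K" using muK K unfolding muh by (auto simp: mh_def ennreal_le_iff)
  define t where "t k = 3 * d * real k" for k
  have t0: "0 <= t k" for k using d by (simp add: t_def)
  define H where "H k x = exp (- lam * t k) * enn2real (QQ (t k) (\<lambda>x. ennreal (h x)) x)" for k x
  have QQfin: "QQ (t k) (\<lambda>x. ennreal (h x)) x < \<top>" for k x
  proof -
   have "QQ (t k) (\<lambda>x. ennreal (h x)) x <= QQ (t k) (\<lambda>x. ennreal K * ennreal (\<phi> x)) x"
    using h K by (intro QQ_mono) (simp add: ennreal_mult'[symmetric] ennreal_leI)
   also have "... = ennreal K * QQ (t k) (\<lambda>x. ennreal (\<phi> x)) x" by (rule QQ_cmult) measurable
   also have "... < \<top>" by (simp add: QQ_\<phi> t0 ennreal_mult_less_top)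
   finally show ?thesis .
  qed
  have Hm[measurable]: "H k \<in> borel_measurable borel" for k unfolding H_def by measurable
  have He: "ennreal (H k x) = ennreal (exp (- lam * t k)) * QQ (t k) (\<lambda>x. ennreal (h x)) x" for k x
   unfolding H_def using QQfin[of k x] by (simp add: ennreal_mult')
  have H0: "0 <= H k x" for k x by (simp add: H_def)
  have muH: "mu (\<lambda>x. ennreal (H k x)) = ennreal mh" for k
  proof -
   have "mu (\<lambda>x. ennreal (H k x)) = ennreal (exp (- lam * t k)) * mu (QQ (t k) (\<lambda>x. ennreal (h x)))"
    unfolding He by (rule mu_cmult) measurable
   also have "... = ennreal (exp (- lam * t k)) * (ennreal (exp (lam * t k)) * ennreal mh)"
    using mu_QQ[OF t0[of k], of "\<lambda>x. ennreal (h x)"] muh by simp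
   also have "... = ennreal mh" by (simp add: ennreal_mult'[symmetric] mult.assoc[symmetric] exp_add[symmetric])
   finally show ?thesis .
  qed
  have rec: "QQ (3 * d) (\<lambda>x. ennreal (H k x)) x = ennreal (a * H (Suc k) x)" for k x
  proof -
   have "QQ (3 * d) (\<lambda>x. ennreal (H k x)) x = ennreal (exp (- lam * t k)) * QQ (3 * d) (QQ (t k) (\<lambda>x. ennreal (h x))) x"
    unfolding He by (rule QQ_cmult) measurable
   also have "QQ (3 * d) (QQ (t k) (\<lambda>x. ennreal (h x))) x = QQ (t (Suc k)) (\<lambda>x. ennreal (h x)) x"
    using QQ_add[of "\<lambda>x. ennreal (h x)" "3 * d" "t k" x] d t0[of k] by (simp add: t_def algebra_simps)
   also have "exp (- lam * t k) = a * exp (- lam * t (Suc k))" unfolding a_def t_def by (simp add: exp_add[symmetric] algebra_simps)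
   finally show ?thesis using He[of "Suc k" x] a H0[of "Suc k" x] by (simp add: ennreal_mult' mult.assoc)
  qed
  have "\<bar>H k x - mh * \<phi> x\<bar> <= \<rho> ^ k * K * \<phi> x" for x
  proof (induction k arbitrary: x)
   case 0
   have "(\<lambda>x. ennreal (h x)) \<in> borel_measurable borel" by measurable
   then have "H 0 x = h x" unfolding H_def t_def using h by (simp add: QQ_0)
   moreover have "mh * \<phi> x <= K * \<phi> x" "0 <= mh * \<phi> x" using mh \<phi>_nonneg[of x] by (auto intro: mult_right_mono)
   ultimately show ?case using h by (auto simp: abs_le_iff) (smt (verit, best))+
  next
   case (Suc k)
   define D where "D = \<rho> ^ k * K"
   have D: "0 <= D" using \<rho>(1) K by (simp add: D_def)
   have IH: "\<bar>H k x - mh * \<phi> x\<bar> <= D * \<phi> x" for x using Suc.IH unfolding D_def .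
   have r: "a * (\<rho> * (D * \<phi> x)) = a * D * \<phi> x - \<epsilon> * \<phi> x * D" using a by (simp add: \<rho>_def field_simps)
   have lower: "- (\<rho> * (D * \<phi> x)) <= H (Suc k) x - mh * \<phi> x"
   proof -
    define f where "f x = H k x - mh * \<phi> x + D * \<phi> x" for x
    have f0: "0 <= f x" for x using IH[of x] by (simp add: f_def abs_le_iff)
    have fm[measurable]: "f \<in> borel_measurable borel" unfolding f_def by measurable
    \<comment> \<open>\<open>ennreal\<close> has no honest subtraction, so the definition of
      \<open>f\<close> is stated additively and \<open>mu\<close> and \<open>QQ\<close> are applied
      to both sides; the common finite term is cancelled afterwards.\<close>
    have s: "ennreal (f x) + ennreal (mh * \<phi> x) = ennreal (H k x) + ennreal (D * \<phi> x)" for x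
     using f0[of x] mh \<phi>_nonneg[of x] H0[of k x] D by (simp add: ennreal_plus[symmetric] f_def del: ennreal_plus)
    have "mu (\<lambda>x. ennreal (f x)) + ennreal mh = ennreal mh + ennreal D"
     using mu_add[of "\<lambda>x. ennreal (f x)" "\<lambda>x. ennreal (mh * \<phi> x)"] mu_add[of "\<lambda>x. ennreal (H k x)" "\<lambda>x. ennreal (D * \<phi> x)"]
     by (simp add: s mua mh D muH)
    then have muf: "mu (\<lambda>x. ennreal (f x)) = ennreal D" by (simp add: add.commute[of _ "ennreal mh"])
    have "QQ (3 * d) (\<lambda>x. ennreal (f x)) x + ennreal (a * (mh * \<phi> x)) = ennreal (a * H (Suc k) x) + ennreal (a * (D * \<phi> x))"
     using QQ_add_fun[of "\<lambda>x. ennreal (f x)" "\<lambda>x. ennreal (mh * \<phi> x)" "3 * d" x] QQ_add_fun[of "\<lambda>x. ennreal (H k x)" "\<lambda>x. ennreal (D * \<phi> x)" "3 * d" x]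
     by (simp add: s QQa mh D rec)
    moreover have "ennreal (\<epsilon> * \<phi> x * D) <= QQ (3 * d) (\<lambda>x. ennreal (f x)) x"
     using \<epsilon>(2)[of "\<lambda>x. ennreal (f x)" x] \<epsilon>(1) \<phi>_nonneg[of x] D unfolding muf by (simp add: ennreal_mult')
    ultimately have "ennreal (\<epsilon> * \<phi> x * D) + ennreal (a * (mh * \<phi> x)) <= ennreal (a * H (Suc k) x) + ennreal (a * (D * \<phi> x))"
     by (metis add_right_mono)
    then have "ennreal (\<epsilon> * \<phi> x * D + a * (mh * \<phi> x)) <= ennreal (a * H (Suc k) x + a * (D * \<phi> x))"
     using \<epsilon>(1) a \<phi>_nonneg[of x] D mh H0[of "Suc k" x] by (simp add: ennreal_plus)
    then have "\<epsilon> * \<phi> x * D + a * (mh * \<phi> x) <= a * H (Suc k) x + a * (D * \<phi> x)"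
     using a \<phi>_nonneg[of x] D H0[of "Suc k" x] by (subst (asm) ennreal_le_iff) auto
    then have "a * (- (\<rho> * (D * \<phi> x))) <= a * (H (Suc k) x - mh * \<phi> x)" using r by (simp add: algebra_simps)
    then show ?thesis using a by (simp only: mult_le_cancel_left_pos)
   qed
   have upper: "H (Suc k) x - mh * \<phi> x <= \<rho> * (D * \<phi> x)"
   proof -
    define f where "f x = D * \<phi> x + mh * \<phi> x - H k x" for x
    have f0: "0 <= f x" for x using IH[of x] by (simp add: f_def abs_le_iff)
    have fm[measurable]: "f \<in> borel_measurable borel" unfolding f_def by measurable
    have s: "ennreal (f x) + ennreal (H k x) = ennreal ((D + mh) * \<phi> x)" for x
     using f0[of x] H0[of k x] by (simp add: ennreal_plus[symmetric] f_def distrib_right del: ennreal_plus)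
    have Dm: "0 <= D + mh" using D mh by simp
    have "mu (\<lambda>x. ennreal (f x)) + ennreal mh = ennreal D + ennreal mh"
     using mu_add[of "\<lambda>x. ennreal (f x)" "\<lambda>x. ennreal (H k x)"] D mh by (simp add: s mua Dm muH)
    then have muf: "mu (\<lambda>x. ennreal (f x)) = ennreal D" by (simp add: add.commute[of _ "ennreal mh"])
    have "QQ (3 * d) (\<lambda>x. ennreal (f x)) x + ennreal (a * H (Suc k) x) = ennreal (a * ((D + mh) * \<phi> x))"
     using QQ_add_fun[of "\<lambda>x. ennreal (f x)" "\<lambda>x. ennreal (H k x)" "3 * d" x] by (simp add: s QQa Dm rec)
    moreover have "ennreal (\<epsilon> * \<phi> x * D) <= QQ (3 * d) (\<lambda>x. ennreal (f x)) x"
     using \<epsilon>(2)[of "\<lambda>x. ennreal (f x)" x] \<epsilon>(1) \<phi>_nonneg[of x] D unfolding muf by (simp add: ennreal_mult')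
    ultimately have "ennreal (\<epsilon> * \<phi> x * D) + ennreal (a * H (Suc k) x) <= ennreal (a * ((D + mh) * \<phi> x))"
     by (metis add_right_mono)
    then have "ennreal (\<epsilon> * \<phi> x * D + a * H (Suc k) x) <= ennreal (a * ((D + mh) * \<phi> x))"
     using \<epsilon>(1) a \<phi>_nonneg[of x] D H0[of "Suc k" x] by (simp add: ennreal_plus)
    then have "\<epsilon> * \<phi> x * D + a * H (Suc k) x <= a * ((D + mh) * \<phi> x)"
     using a \<phi>_nonneg[of x] Dm by (subst (asm) ennreal_le_iff) auto
    then have "a * (H (Suc k) x - mh * \<phi> x) <= a * (\<rho> * (D * \<phi> x))" using r by (simp add: algebra_simps)
    then show ?thesis using a by (simp only: mult_le_cancel_left_pos)
   qed
   show ?case using lower upper by (simp add: D_def abs_le_iff mult.assoc)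
  qed
  then show "\<bar>exp (- lam * (3 * d * real k)) * enn2real (QQ (3 * d * real k) (\<lambda>x. ennreal (h x)) x)
    - enn2real (mu (\<lambda>x. ennreal (h x))) * \<phi> x\<bar> <= \<rho> ^ k * K * \<phi> x"
   unfolding H_def t_def mh_def .
 qed
qed

end

section \<open>The L log L moment of the martingale\<close>

text \<open>The function z ln (1 + z): nondecreasing, 0 at 0, and comparable at infinity with z log
  z. The value at infinity is set by hand because \<open>enn2real\<close> sends it to 0.\<close>

definition LL :: "ennreal => ennreal" where
 "LL z = (if z = \<top> then \<top> else ennreal (enn2real z * ln (1 + enn2real z)))"

lemma LL_measurable[measurable]: "LL \<in> borel_measurable borel"
 unfolding LL_def[abs_def] by measurable

lemma LL_0[simp]: "LL 0 = 0" by (simp add: LL_def)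

lemma LL_ennreal: "0 <= z ==> LL (ennreal z) = ennreal (z * ln (1 + z))"
 by (simp add: LL_def)

text \<open>The tangent of \<open>ln\<close> at \<open>1 + c\<close> decouples the summands, at the price of pair products.\<close>
lemma LL_sum_real:
 fixes z :: "nat => real"
 assumes z: "\<And>i. 0 <= z i" and c: "0 <= c"
 shows "(\<Sum>i<k. z i) * ln (1 + (\<Sum>i<k. z i)) <= (\<Sum>i<k. z i * ln (1 + z i)) + ln (1 + c) * (\<Sum>i<k. z i)
   + (\<Sum>i<k. \<Sum>j\<in>{..<k} - {i}. z i * z j) / (1 + c)"
proof -
 let ?S = "\<Sum>i<k. z i"
 have "z i * ln (1 + ?S) <= z i * ln (1 + z i) + ln (1 + c) * z i + (\<Sum>j\<in>{..<k} - {i}. z i * z j) / (1 + c)" if i: "i < k" for i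
 proof -
  define wa where "wa = (\<Sum>j\<in>{..<k} - {i}. z j)"
  have S: "?S = z i + wa" unfolding wa_def using i by (subst sum.remove[of _ i]) auto
  have wa: "0 <= wa" unfolding wa_def by (intro sum_nonneg z)
  have "1 + ?S <= (1 + z i) * (1 + wa)" using z[of i] wa by (simp add: S algebra_simps)
  then have "ln (1 + ?S) <= ln ((1 + z i) * (1 + wa))" using z[of i] wa by (subst ln_le_cancel_iff) (auto simp: S intro!: mult_pos_pos add_pos_nonneg)
  also have "... = ln (1 + z i) + ln (1 + wa)" using z[of i] wa by (intro ln_mult_pos) auto
  also have "ln (1 + wa) = ln (1 + c) + ln ((1 + wa) / (1 + c))" using wa c by (subst ln_div) auto
  also have "ln ((1 + wa) / (1 + c)) <= (1 + wa) / (1 + c) - 1" using wa c by (intro ln_le_minus_one divide_pos_pos) auto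
  also have "(1 + wa) / (1 + c) - 1 <= wa / (1 + c)" using c by (simp add: field_simps)
  finally have "ln (1 + ?S) <= ln (1 + z i) + (ln (1 + c) + wa / (1 + c))" by simp
  then have "z i * ln (1 + ?S) <= z i * (ln (1 + z i) + (ln (1 + c) + wa / (1 + c)))" using z[of i] by (rule mult_left_mono)
  also have "... = z i * ln (1 + z i) + ln (1 + c) * z i + (z i * wa) / (1 + c)" by (simp add: algebra_simps)
  also have "z i * wa = (\<Sum>j\<in>{..<k} - {i}. z i * z j)" unfolding wa_def by (rule sum_distrib_left)
  finally show ?thesis .
 qed
 then have "(\<Sum>i<k. z i * ln (1 + ?S)) <= (\<Sum>i<k. z i * ln (1 + z i) + ln (1 + c) * z i + (\<Sum>j\<in>{..<k} - {i}. z i * z j) / (1 + c))"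
  by (intro sum_mono) auto
 then show ?thesis by (simp add: sum.distrib sum_distrib_left sum_distrib_right sum_divide_distrib)
qed

lemma LL_sum:
 fixes z :: "nat => ennreal"
 assumes c: "0 <= c"
 shows "LL (\<Sum>i<k. z i) <= (\<Sum>i<k. LL (z i)) + ennreal (ln (1 + c)) * (\<Sum>i<k. z i)
   + ennreal (1 / (1 + c)) * (\<Sum>i<k. \<Sum>j\<in>{..<k} - {i}. z i * z j)"
proof (cases "\<exists>i<k. z i = \<top>")
 case True
 then obtain i where "i < k" "z i = \<top>" by blast
 then have "\<top> <= (\<Sum>i<k. LL (z i))"
  using member_le_sum[of i "{..<k}" "\<lambda>i. LL (z i)"] by (simp add: LL_def)
 then have t: "(\<Sum>i<k. LL (z i)) = \<top>" by (simp only: top_unique)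
 show ?thesis unfolding t by simp
next
 case False
 define y where "y i = (if i < k then enn2real (z i) else 0)" for i
 have zy: "z i = ennreal (y i)" if "i < k" for i using False that by (auto simp: y_def less_top)
 have y: "0 <= y i" for i by (simp add: y_def)
 have S: "(\<Sum>i<k. z i) = ennreal (\<Sum>i<k. y i)" using y by (simp add: zy sum_ennreal)
 have L: "(\<Sum>i<k. LL (z i)) = ennreal (\<Sum>i<k. y i * ln (1 + y i))" using y by (simp add: zy sum_ennreal LL_ennreal)
 have D: "(\<Sum>i<k. \<Sum>j\<in>{..<k} - {i}. z i * z j) = ennreal (\<Sum>i<k. \<Sum>j\<in>{..<k} - {i}. y i * y j)"
  using y by (simp add: zy ennreal_mult'[symmetric] sum_ennreal sum_nonneg)
 have "LL (\<Sum>i<k. z i) = ennreal ((\<Sum>i<k. y i) * ln (1 + (\<Sum>i<k. y i)))" unfolding S by (rule LL_ennreal) (simp add: sum_nonneg y)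
 also have "... <= ennreal ((\<Sum>i<k. y i * ln (1 + y i)) + ln (1 + c) * (\<Sum>i<k. y i) + (\<Sum>i<k. \<Sum>j\<in>{..<k} - {i}. y i * y j) / (1 + c))"
  by (rule ennreal_leI[OF LL_sum_real[OF y c]])
 also have "... = (\<Sum>i<k. LL (z i)) + ennreal (ln (1 + c)) * (\<Sum>i<k. z i) + ennreal (1 / (1 + c)) * (\<Sum>i<k. \<Sum>j\<in>{..<k} - {i}. z i * z j)"
  unfolding S L D using c y by (simp add: ennreal_plus ennreal_mult'[symmetric] sum_nonneg)
 finally show ?thesis .
qed

text \<open>Population of the first \<open>n\<close> generations. The cut makes the moment estimate
  a genuine induction on \<open>n\<close> with start 0; a recursion for the full population would
  leave open whether the quantity is finite at all.\<close>

definition XL :: "nat => ('a option => ennreal) => real => 'a tree => ennreal" where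
 "XL n g t w = (\<Sum>j<n. XG j g t w)"

lemma XL_measurable:
 fixes h :: "'b => 'a::metric_space tree"
 assumes [measurable]: "g \<in> borel_measurable optB" and f: "f \<in> borel_measurable M" "h \<in> M \<rightarrow>\<^sub>M Omega_space"
 shows "(\<lambda>x. XL n g (f x) (h x)) \<in> borel_measurable M"
 unfolding XL_def using XG_measurable[OF assms] by measurable

lemma XL_Suc: "XL (Suc n) g t w = XG 0 g t w + ksum w t (XL n g)"
proof -
 have "XL (Suc n) g t w = XG 0 g t w + (\<Sum>j<n. XG (Suc j) g t w)"
  unfolding XL_def by (rule sum.lessThan_Suc_shift)
 also have "(\<Sum>j<n. XG (Suc j) g t w) = ksum w t (XL n g)"
  unfolding XG_Suc ksum_def XL_def by (subst nn_integral_sum[symmetric]) (auto intro!: nn_integral_cong)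
 finally show ?thesis .
qed

lemma XL_neg: "t < 0 ==> XL n g t w = 0" by (simp add: XL_def XG_neg)

lemma XL_le: "XL n g t w <= XE w t g"
 unfolding XL_def XE_XG by (rule sum_le_suminf) auto

context branching
begin

text \<open>The siblings are independent, so each product of two distinct terms has mean at most
  \<open>e * e\<close>. The first term keeps the moment of a single child with factor
  \<open>k\<close>; the second depends on means alone.\<close>

lemma LlogL_offspring:
 fixes Z :: "'a tree => ennreal"
 assumes Z[measurable]: "Z \<in> borel_measurable Omega_space" and r: "xi r = Some z" "0 <= r" and xi: "xi \<in> hpaths"
  and e: "(\<integral>\<^sup>+y. Z y \<partial>P z) <= ennreal e" "0 <= e"
 shows "(\<integral>\<^sup>+wa. LL (\<Sum>i<k. Z (wa i)) \<partial>subs_law (xi, ennreal r, k))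
   <= of_nat k * (\<integral>\<^sup>+y. LL (Z y) \<partial>P z) + ennreal (2 * (real k * e) * ln (1 + real k * e))"
proof -
 let ?M = "subs_law (xi, ennreal r, k)"
 \<comment> \<open>The bound for the mean of the sum, used as tangent point: both correction terms
   are then at most c ln (1 + c).\<close>
 define c where "c = real k * e"
 have c: "0 <= c" using e by (simp add: c_def)
 have Zc[measurable]: "(\<lambda>wa. Z (wa i)) \<in> borel_measurable ?M" for i
 proof -
  have "(\<lambda>wa. wa i) \<in> ?M \<rightarrow>\<^sub>M (Omega_space :: 'a tree measure)" by (simp cong: measurable_cong_sets)
  from measurable_compose[OF this Z] show ?thesis .
 qed
 note ch = child_Some[of xi r z _ k, OF r]
 have E1: "(\<integral>\<^sup>+wa. f (wa i) \<partial>?M) = (\<integral>\<^sup>+y. f y \<partial>P z)" if "i < k" "f \<in> borel_measurable Omega_space" for f i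
  using nn_integral_component[OF that(2), where i=i and d="(xi, ennreal r, k)"] ch[OF that(1)] by simp
 have E2: "(\<integral>\<^sup>+wa. Z (wa i) * Z (wa j) \<partial>?M) <= ennreal (e * e)" if ij: "i < k" "j < k" "j \<noteq> i" for i j
 proof -
  have "(\<integral>\<^sup>+wa. Z (wa i) * Z (wa j) \<partial>?M) = (\<integral>\<^sup>+wa. (\<integral>\<^sup>+y. Z ((wa(j := y)) i) * Z ((wa(j := y)) j) \<partial>child_law P (xi, ennreal r, k) j) \<partial>?M)"
   by (rule nn_integral_PiM_resample[OF child_prob]) measurable
  also have "... = (\<integral>\<^sup>+wa. Z (wa i) * (\<integral>\<^sup>+y. Z y \<partial>P z) \<partial>?M)"
   using ij ch[OF ij(2)] by (intro nn_integral_cong) (simp add: nn_integral_cmult)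
  also have "... = (\<integral>\<^sup>+y. Z y \<partial>P z) * (\<integral>\<^sup>+y. Z y \<partial>P z)"
   by (subst nn_integral_multc) (use E1[OF ij(1) Z] in auto)
  also have "... <= ennreal e * ennreal e" using e by (intro mult_mono) auto
  finally show ?thesis using e by (simp add: ennreal_mult)
 qed
 have "(\<integral>\<^sup>+wa. LL (\<Sum>i<k. Z (wa i)) \<partial>?M) <= (\<integral>\<^sup>+wa. (\<Sum>i<k. LL (Z (wa i))) + ennreal (ln (1 + c)) * (\<Sum>i<k. Z (wa i))
   + ennreal (1 / (1 + c)) * (\<Sum>i<k. \<Sum>j\<in>{..<k} - {i}. Z (wa i) * Z (wa j)) \<partial>?M)"
  by (intro nn_integral_mono LL_sum c)
 also have "... = (\<Sum>i<k. \<integral>\<^sup>+wa. LL (Z (wa i)) \<partial>?M) + ennreal (ln (1 + c)) * (\<Sum>i<k. \<integral>\<^sup>+wa. Z (wa i) \<partial>?M)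
   + ennreal (1 / (1 + c)) * (\<Sum>i<k. \<Sum>j\<in>{..<k} - {i}. \<integral>\<^sup>+wa. Z (wa i) * Z (wa j) \<partial>?M)"
  by (simp add: nn_integral_add nn_integral_cmult nn_integral_sum)
 also have "... <= of_nat k * (\<integral>\<^sup>+y. LL (Z y) \<partial>P z) + ennreal (ln (1 + c)) * ennreal c + ennreal (1 / (1 + c)) * ennreal (c * c)"
 proof (intro add_mono mult_left_mono)
  show "(\<Sum>i<k. \<integral>\<^sup>+wa. LL (Z (wa i)) \<partial>?M) <= of_nat k * (\<integral>\<^sup>+y. LL (Z y) \<partial>P z)"
   using E1[of _ "\<lambda>y. LL (Z y)"] by simp
  have "(\<Sum>i<k. \<integral>\<^sup>+wa. Z (wa i) \<partial>?M) <= (\<Sum>i<k. ennreal e)" using E1[OF _ Z] e(1) by (intro sum_mono) simp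
  also have "... = ennreal c" using e by (simp add: c_def ennreal_mult ennreal_of_nat_eq_real_of_nat)
  finally show "(\<Sum>i<k. \<integral>\<^sup>+wa. Z (wa i) \<partial>?M) <= ennreal c" .
  have "(\<Sum>i<k. \<Sum>j\<in>{..<k} - {i}. \<integral>\<^sup>+wa. Z (wa i) * Z (wa j) \<partial>?M) <= (\<Sum>i<k. \<Sum>j\<in>{..<k} - {i}. ennreal (e * e))"
   by (intro sum_mono E2) auto
  also have "... <= (\<Sum>i<k. \<Sum>j<k. ennreal (e * e))" by (intro sum_mono sum_mono2) auto
  also have "... = ennreal (\<Sum>i<k. \<Sum>j<k. e * e)" using e by (simp add: sum_ennreal sum_nonneg del: sum_constant)
  also have "(\<Sum>i<k. \<Sum>j<k. e * e) = c * c" by (simp add: c_def)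
  finally show "(\<Sum>i<k. \<Sum>j\<in>{..<k} - {i}. \<integral>\<^sup>+wa. Z (wa i) * Z (wa j) \<partial>?M) <= ennreal (c * c)" .
 qed auto
 also have "... = of_nat k * (\<integral>\<^sup>+y. LL (Z y) \<partial>P z) + ennreal (ln (1 + c) * c + (1 / (1 + c)) * (c * c))"
 proof -
  have "ennreal (ln (1 + c)) * ennreal c = ennreal (ln (1 + c) * c)" by (rule ennreal_mult[symmetric]) (use c in auto)
  moreover have "ennreal (1 / (1 + c)) * ennreal (c * c) = ennreal ((1 / (1 + c)) * (c * c))" by (rule ennreal_mult[symmetric]) (use c in auto)
  moreover have "ennreal (ln (1 + c) * c + (1 / (1 + c)) * (c * c)) = ennreal (ln (1 + c) * c) + ennreal ((1 / (1 + c)) * (c * c))"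
   by (rule ennreal_plus) (use c in auto)
  ultimately show ?thesis by (simp only: add.assoc)
 qed
 also have "... <= of_nat k * (\<integral>\<^sup>+y. LL (Z y) \<partial>P z) + ennreal (2 * c * ln (1 + c))"
 proof (intro add_left_mono ennreal_leI)
  have "ln (1 / (1 + c)) <= 1 / (1 + c) - 1" using c by (intro ln_le_minus_one) auto
  then have "c / (1 + c) <= ln (1 + c)" using c by (simp add: ln_div field_simps)
  then have "c * (c / (1 + c)) <= c * ln (1 + c)" using c by (rule mult_left_mono)
  then show "ln (1 + c) * c + (1 / (1 + c)) * (c * c) <= 2 * c * ln (1 + c)" by (simp add: field_simps)
 qed
 finally show ?thesis unfolding c_def .
qed

end

lemma ksum_before:
 fixes \<Psi> :: "real => 'a tree => ennreal"
 assumes neg: "\<And>s w. s < 0 ==> \<Psi> s w = 0" and t: "0 <= t" "ennreal t < \<tau>"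
 shows "ksum (graft (xi, \<tau>, n) wa) t \<Psi> = 0"
proof -
 have "\<Psi> (t - rtime (graft (xi, \<tau>, n) wa)) y = 0" if "okc (graft (xi, \<tau>, n) wa) i" for i y
 proof (rule neg)
  have "rlife (graft (xi, \<tau>, n) wa) = ennreal (rtime (graft (xi, \<tau>, n) wa))" by (rule okc_rtime[OF that])
  then have "\<tau> = ennreal (enn2real \<tau>)" by simp
  then have "t < enn2real \<tau>" using t by (metis ennreal_less_iff)
  then show "t - rtime (graft (xi, \<tau>, n) wa) < 0" by simp
 qed
 then show ?thesis unfolding ksum_def by (simp cong: if_cong)
qed

lemma ksum_at:
 assumes "xi r = Some z" "0 <= r"
 shows "ksum (graft (xi, ennreal r, k) wa) t \<Psi> = (\<Sum>i<k. \<Psi> (t - r) (wa i))"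
proof -
 have ok: "okc (graft (xi, ennreal r, k) wa) i \<longleftrightarrow> i < k" for i using assms by (simp add: okc_def)
 have rt: "rtime (graft (xi, ennreal r, k) wa) = r" using assms(2) by simp
 have "ksum (graft (xi, ennreal r, k) wa) t \<Psi> = (\<integral>\<^sup>+i. (if i < k then \<Psi> (t - r) (wa i) else 0) \<partial>count_space UNIV)"
  unfolding ksum_def ok rt graft_simps(1) ..
 also have "... = (\<Sum>i<k. if i < k then \<Psi> (t - r) (wa i) else 0)"
  by (rule nn_integral_count_space'[of "{..<k}"]) auto
 also have "... = (\<Sum>i<k. \<Psi> (t - r) (wa i))" by (rule sum.cong) auto
 finally show ?thesis .
qed

text \<open>Trades the logarithm that arises in the recursion for the truncated one of the moment
  hypothesis, at the cost of a constant.\<close>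

lemma logplus_bound:
 assumes "1 <= e" "0 <= y" shows "ln (1 + e * y) <= ln (2 * e) + logplus y"
proof (cases "y <= 1")
 case True
 have "e * y <= e * 1" using assms True by (intro mult_left_mono) auto
 then have "1 + e * y <= 2 * e" using assms by linarith
 moreover have "0 < 1 + e * y" using assms by (simp add: add_pos_nonneg)
 ultimately have "ln (1 + e * y) <= ln (2 * e)" using assms by (subst ln_le_cancel_iff) auto
 then show ?thesis by (simp add: logplus_def)
next
 case False
 have "1 * 1 <= e * y" using assms False by (intro mult_mono) auto
 then have "ln (1 + e * y) <= ln (2 * e * y)" using assms False by (subst ln_le_cancel_iff) (auto intro!: mult_pos_pos)
 also have "... = ln (2 * e) + ln y" using assms False by (subst ln_mult_pos) auto
 finally show ?thesis by (simp add: logplus_def)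
qed

context branching
begin

lemma oE_joint:
 assumes h: "(\<lambda>z. h (fst z) (snd z)) \<in> borel_measurable (borel \<Otimes>\<^sub>M borel)"
  and f: "f \<in> borel_measurable M" and o: "k \<in> M \<rightarrow>\<^sub>M optB"
 shows "(\<lambda>x. oE (h (f x)) (k x)) \<in> borel_measurable M"
proof -
 let ?c = "undefined :: 'a"
 have "(\<lambda>x. case k x of Some y => y | None => ?c) \<in> M \<rightarrow>\<^sub>M borel"
  by (rule measurable_compose[OF o the_measurable])
 from measurable_compose[OF measurable_Pair[OF f this] h]
 have [measurable]: "(\<lambda>x. h (f x) (case k x of Some y => y | None => ?c)) \<in> borel_measurable M" by simp
 note [measurable] = o
 have "(\<lambda>x. if k x = None then 0 else h (f x) (case k x of Some y => y | None => ?c)) \<in> borel_measurable M" by measurable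
 also have "(\<lambda>x. if k x = None then 0 else h (f x) (case k x of Some y => y | None => ?c)) = (\<lambda>x. oE (h (f x)) (k x))"
  by (auto simp: oE_def fun_eq_iff split: option.split)
 finally show ?thesis .
qed

text \<open>Joint measurability in time and starting point, so that the integral over the first
  branching time may be exchanged with phihat dm.\<close>

lemma QQ_joint:
 assumes h: "(\<lambda>z. h (fst z) (snd z)) \<in> borel_measurable (borel \<Otimes>\<^sub>M borel)"
 shows "(\<lambda>z. QQ (fst z) (h (fst z)) (snd z)) \<in> borel_measurable (borel \<Otimes>\<^sub>M borel)"
 unfolding QQ_def
proof (rule nn_integral_measurable_subprob_algebra2[where N=Omega_space])
 show "(\<lambda>x. P (snd x)) \<in> borel \<Otimes>\<^sub>M borel \<rightarrow>\<^sub>M subprob_algebra Omega_space"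
  by (rule measurable_prob_algebraD) measurable
 have "(\<lambda>z. XE (snd z) (fst (fst z)) (oE (h (fst (fst z))))) \<in> borel_measurable ((borel \<Otimes>\<^sub>M (borel :: 'a measure)) \<Otimes>\<^sub>M Omega_space)"
  unfolding XE_def
 proof (rule measurable_nn_integral_countable)
  fix u
  have p[measurable]: "(\<lambda>z. pos (snd z) (fst (fst z)) u) \<in> (borel \<Otimes>\<^sub>M (borel :: 'a measure)) \<Otimes>\<^sub>M Omega_space \<rightarrow>\<^sub>M (optB :: 'a option measure)"
   by (rule pos_measurable) measurable
  have [measurable]: "(\<lambda>z. oE (h (fst (fst z))) (pos (snd z) (fst (fst z)) u)) \<in> borel_measurable ((borel \<Otimes>\<^sub>M (borel :: 'a measure)) \<Otimes>\<^sub>M Omega_space)"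
   by (rule oE_joint[OF h _ p]) measurable
  show "(\<lambda>z. if pos (snd z) (fst (fst z)) u = None then 0 else oE (h (fst (fst z))) (pos (snd z) (fst (fst z)) u))
   \<in> borel_measurable ((borel \<Otimes>\<^sub>M (borel :: 'a measure)) \<Otimes>\<^sub>M Omega_space)" by measurable
 qed
 then show "(\<lambda>(z, w). XE w (fst z) (oE (h (fst z)))) \<in> borel_measurable ((borel \<Otimes>\<^sub>M (borel :: 'a measure)) \<Otimes>\<^sub>M Omega_space)"
  by (simp add: split_beta')
qed

definition aE :: "('a => ennreal) => nat => real => 'a => ennreal" where
 "aE f n t x = (\<integral>\<^sup>+w. LL (XL n (oE f) t w) \<partial>P x)"

lemma aE_joint:
 assumes [measurable]: "f \<in> borel_measurable borel"
 shows "(\<lambda>z. aE f n (t - fst z) (snd z)) \<in> borel_measurable (borel \<Otimes>\<^sub>M borel)"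
 unfolding aE_def
proof (rule nn_integral_measurable_subprob_algebra2[where N=Omega_space])
 show "(\<lambda>x. P (snd x)) \<in> borel \<Otimes>\<^sub>M borel \<rightarrow>\<^sub>M subprob_algebra Omega_space"
  by (rule measurable_prob_algebraD) measurable
 have [measurable]: "(\<lambda>z. XL n (oE f) (t - fst (fst z)) (snd z)) \<in> borel_measurable ((borel \<Otimes>\<^sub>M (borel :: 'a measure)) \<Otimes>\<^sub>M Omega_space)"
  by (rule XL_measurable) measurable
 show "(\<lambda>(z, w). LL (XL n (oE f) (t - fst z) w)) \<in> borel_measurable ((borel \<Otimes>\<^sub>M (borel :: 'a measure)) \<Otimes>\<^sub>M Omega_space)"
  unfolding split_beta' by measurable
qed

lemma aE_measurable[measurable]: "f \<in> borel_measurable borel ==> aE f n t \<in> borel_measurable borel"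
 using measurable_compose[OF measurable_Pair1' aE_joint[of f n t], of 0] by simp

text \<open>The correction term of \<open>LlogL_offspring\<close> averaged over the offspring law at
  \<open>z\<close>, when \<open>e z\<close> bounds the mean mass of a child born there.\<close>

definition bb :: "('a => real) => 'a => ennreal" where
 "bb e z = (\<Sum>k. ennreal (p k z) * ennreal (2 * (real k * e z) * ln (1 + real k * e z)))"

lemma bb_measurable[measurable]:
 assumes [measurable]: "e \<in> borel_measurable borel" shows "bb e \<in> borel_measurable borel"
 unfolding bb_def[abs_def] by measurable

text \<open>Decomposition at the first branching time. Both contributions are put under the mean
  semigroup \<open>QQ\<close>, to which the eigenmeasure can be applied.\<close>

lemma LlogL_recursion:
 assumes f[measurable]: "f \<in> borel_measurable borel" and em[measurable]: "e \<in> borel_measurable borel" and e0: "\<And>z. 0 <= e z"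
  and t: "0 <= t" "t <= T" and mean: "\<And>s z. 0 <= s ==> s <= T ==> QQ s f z <= ennreal (e z)"
 shows "aE f (Suc n) t x <= QQ t (\<lambda>z. LL (f z)) x
   + (\<integral>\<^sup>+r. QQ r (\<lambda>z. ennreal (KA * Kb) * aE f n (t - r) z + ennreal (\<beta> z) * bb e z) x * indicator {0..t} r \<partial>lborel)"
proof -
 define H where "H r z = ennreal (KA * Kb) * aE f n (t - r) z + ennreal (\<beta> z) * bb e z" for r z
 have Hj: "(\<lambda>z. H (fst z) (snd z)) \<in> borel_measurable (borel \<Otimes>\<^sub>M borel)"
  unfolding H_def using aE_joint[OF f] by measurable
 have Hm[measurable]: "H r \<in> borel_measurable borel" for r
  using measurable_compose[OF measurable_Pair1' Hj, of r] by simp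
 have Xm[measurable]: "(\<lambda>w. XL n (oE f) s w) \<in> borel_measurable Omega_space" for n s by (rule XL_measurable) measurable
 let ?F = "\<lambda>w. LL (XL (Suc n) (oE f) t w)"
 have mF: "?F \<in> borel_measurable Omega_space" by measurable
 have tm[measurable]: "(\<lambda>xi. xi t) \<in> path_space \<rightarrow>\<^sub>M (optB :: 'a option measure)" by (rule eval_measurable0[OF t(1)])
 have [measurable]: "(\<lambda>xi. Ib (bp xi) t) \<in> borel_measurable path_space" "(\<lambda>xi. Ib (ap xi) t) \<in> borel_measurable path_space"
  by (rule Ib_vp_measurable; measurable)+
 have XL0: "XL (Suc n) (oE f) t (graft (xi, \<tau>, k) wa) = oE f (xi t)" if "ennreal t < \<tau>" for xi \<tau> k wa
 proof -
  have "ksum (graft (xi, \<tau>, k) wa) t (XL n (oE f)) = 0" by (rule ksum_before[OF _ t(1) that]) (rule XL_neg)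
  then show ?thesis unfolding XL_Suc using that t(1) by (simp add: XG_0 pos_Nil)
 qed
 have XLr: "XL (Suc n) (oE f) t (graft (xi, ennreal r, k) wa) = (\<Sum>i<k. XL n (oE f) (t - r) (wa i))"
  if "xi r = Some z" "0 <= r" "r <= t" for xi r k wa z
  unfolding XL_Suc ksum_at[of xi r z, OF that(1,2)] using that by (simp add: XG_0 pos_Nil ennreal_less_iff)
 \<comment> \<open>The weight exp (- Ib) of the undisturbed root is enlarged to the Feynman-Kac
   weight; this is allowed because the accumulated birth rate is nonnegative.\<close>
 have RF: "R ?F xi (ennreal r) * ennreal (bp xi r * exp (- Ib (bp xi) r)) * indicator {0..t} r
   <= ennreal (exp (- Ib (bp xi) r + Ib (ap xi) r)) * oE (H r) (xi (max 0 r)) * indicator {0..t} r" if xi: "xi \<in> hpaths" for xi r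
 proof (cases "r \<in> {0..t}")
  case True
  then have r: "0 <= r" "r <= t" by auto
  interpret a: rate "ap xi" "KA * Kb" by (rule rate_ap[OF xi])
  interpret b: rate "bp xi" Kb by (rule rate_bp[OF xi])
  show ?thesis
  proof (cases "xi r")
   case None then show ?thesis using r by (simp add: vp_def)
  next
   case (Some z)
   have EZ: "(\<integral>\<^sup>+y. XL n (oE f) (t - r) y \<partial>P z) <= ennreal (e z)"
   proof -
    have "(\<integral>\<^sup>+y. XL n (oE f) (t - r) y \<partial>P z) <= QQ (t - r) f z" unfolding QQ_def by (intro nn_integral_mono XL_le)
    also have "... <= ennreal (e z)" by (rule mean) (use r t in auto)
    finally show ?thesis .
   qed
   have "R ?F xi (ennreal r) = (\<Sum>k. ennreal (p k z) * J ?F (xi, ennreal r, k))" by (rule R_Some[of xi r z, OF Some r(1)])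
   also have "... <= (\<Sum>k. ennreal (p k z) * (of_nat k * aE f n (t - r) z) + ennreal (p k z) * ennreal (2 * (real k * e z) * ln (1 + real k * e z)))"
   proof (rule suminf_le)
    fix k
    have "J ?F (xi, ennreal r, k) = (\<integral>\<^sup>+wa. LL (\<Sum>i<k. XL n (oE f) (t - r) (wa i)) \<partial>subs_law (xi, ennreal r, k))"
     unfolding J_def XLr[of xi r z, OF Some r] ..
    also have "... <= of_nat k * aE f n (t - r) z + ennreal (2 * (real k * e z) * ln (1 + real k * e z))"
     unfolding aE_def by (rule LlogL_offspring[of _ xi r z, OF _ Some r(1) xi EZ e0]) measurable
    finally have "ennreal (p k z) * J ?F (xi, ennreal r, k) <= ennreal (p k z) * (of_nat k * aE f n (t - r) z + ennreal (2 * (real k * e z) * ln (1 + real k * e z)))"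
     by (rule mult_left_mono) simp
    then show "ennreal (p k z) * J ?F (xi, ennreal r, k) <= ennreal (p k z) * (of_nat k * aE f n (t - r) z) + ennreal (p k z) * ennreal (2 * (real k * e z) * ln (1 + real k * e z))"
     by (simp only: distrib_left)
   qed auto
   also have "... = ennreal (meanoff p z) * aE f n (t - r) z + bb e z"
    unfolding bb_def suminf_offspring_mean[symmetric] by (rule suminf_add[symmetric]) auto
   finally have "R ?F xi (ennreal r) * ennreal (\<beta> z) <= (ennreal (meanoff p z) * aE f n (t - r) z + bb e z) * ennreal (\<beta> z)"
    by (rule mult_right_mono) simp
   also have "... = ennreal (meanoff p z * \<beta> z) * aE f n (t - r) z + ennreal (\<beta> z) * bb e z"
    using meanoff_nonneg[of z] \<beta>_nonneg[of z] by (simp add: distrib_left distrib_right ennreal_mult ac_simps)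
   also have "... <= H r z"
    unfolding H_def using \<beta>_nonneg \<beta>_le A_le meanoff_nonneg KA_nonneg
    by (intro add_right_mono mult_right_mono ennreal_leI mult_mono) auto
   finally have 1: "R ?F xi (ennreal r) * ennreal (\<beta> z) <= H r z" .
   have "R ?F xi (ennreal r) * ennreal (bp xi r * exp (- Ib (bp xi) r)) = (R ?F xi (ennreal r) * ennreal (\<beta> z)) * ennreal (exp (- Ib (bp xi) r))"
    using Some r \<beta>_nonneg[of z] by (simp add: vp_def ennreal_mult mult.assoc)
   also have "... <= H r z * ennreal (exp (- Ib (bp xi) r + Ib (ap xi) r))"
    using 1 a.Ib_nonneg[of r] by (intro mult_mono ennreal_leI) auto
   finally show ?thesis using True Some r by (simp add: mult.commute)
  qed
 qed simp
 interpret S: pair_sigma_finite "Yl x" lborel by (intro pair_sigma_finite.intro prob_Y sigma_finite_lborel)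
 have mj: "(\<lambda>(xi, r). ennreal (exp (- Ib (bp xi) r + Ib (ap xi) r)) * oE (H r) (xi (max 0 r)) * indicator {0..t} r) \<in> borel_measurable (Yl x \<Otimes>\<^sub>M lborel)"
 proof -
  have [measurable]: "(\<lambda>z. Ib (bp (fst z)) (snd z)) \<in> borel_measurable (path_space \<Otimes>\<^sub>M lborel)"
   "(\<lambda>z. Ib (ap (fst z)) (snd z)) \<in> borel_measurable (path_space \<Otimes>\<^sub>M lborel)"
   by (rule Ib_vp_measurable; measurable)+
  have e: "(\<lambda>z. fst z (max 0 (snd z))) \<in> path_space \<Otimes>\<^sub>M lborel \<rightarrow>\<^sub>M (optB :: 'a option measure)" by (rule eval_measurable) measurable
  have [measurable]: "(\<lambda>z. oE (H (snd z)) (fst z (max 0 (snd z)))) \<in> borel_measurable (path_space \<Otimes>\<^sub>M lborel)"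
   by (rule oE_joint[OF Hj _ e]) measurable
  have "(\<lambda>z. ennreal (exp (- Ib (bp (fst z)) (snd z) + Ib (ap (fst z)) (snd z))) * oE (H (snd z)) (fst z (max 0 (snd z))) * indicator {0..t} (snd z))
    \<in> borel_measurable (path_space \<Otimes>\<^sub>M lborel)" by measurable
  then show ?thesis by (simp add: split_beta' cong: measurable_cong_sets)
 qed
 have "aE f (Suc n) t x = (\<integral>\<^sup>+xi. (ennreal (exp (- Ib (bp xi) t)) * LL (oE f (xi t))
   + (\<integral>\<^sup>+r. R ?F xi (ennreal r) * ennreal (bp xi r * exp (- Ib (bp xi) r)) * indicator {0..t} r \<partial>lborel)) \<partial>Yl x)"
  unfolding aE_def by (rule root_decomposition[OF mF t(1), of "\<lambda>y. LL (oE f y)"]) (simp add: XL0)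
 also have "... <= (\<integral>\<^sup>+xi. (ennreal (exp (- Ib (bp xi) t + Ib (ap xi) t)) * oE (\<lambda>z. LL (f z)) (xi t)
   + (\<integral>\<^sup>+r. ennreal (exp (- Ib (bp xi) r + Ib (ap xi) r)) * oE (H r) (xi (max 0 r)) * indicator {0..t} r \<partial>lborel)) \<partial>Yl x)"
 proof (intro nn_integral_mono add_mono)
  fix xi assume "xi \<in> space (Yl x)" then have xi: "xi \<in> hpaths" by simp
  interpret a: rate "ap xi" "KA * Kb" by (rule rate_ap[OF xi])
  have "LL (oE f (xi t)) = oE (\<lambda>z. LL (f z)) (xi t)" by (cases "xi t") auto
  then show "ennreal (exp (- Ib (bp xi) t)) * LL (oE f (xi t)) <= ennreal (exp (- Ib (bp xi) t + Ib (ap xi) t)) * oE (\<lambda>z. LL (f z)) (xi t)"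
   using a.Ib_nonneg[of t] by (auto intro!: mult_right_mono ennreal_leI)
  show "R ?F xi (ennreal r) * ennreal (bp xi r * exp (- Ib (bp xi) r)) * indicator {0..t} r
   <= ennreal (exp (- Ib (bp xi) r + Ib (ap xi) r)) * oE (H r) (xi (max 0 r)) * indicator {0..t} r" for r by (rule RF[OF xi])
 qed
 also have "... = (\<integral>\<^sup>+xi. ennreal (exp (- Ib (bp xi) t + Ib (ap xi) t)) * oE (\<lambda>z. LL (f z)) (xi t) \<partial>Yl x)
   + (\<integral>\<^sup>+xi. \<integral>\<^sup>+r. ennreal (exp (- Ib (bp xi) r + Ib (ap xi) r)) * oE (H r) (xi (max 0 r)) * indicator {0..t} r \<partial>lborel \<partial>Yl x)"
  by (rule nn_integral_add) (use sigma_finite_measure.borel_measurable_nn_integral[OF sigma_finite_lborel mj] in auto)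
 also have "(\<integral>\<^sup>+xi. ennreal (exp (- Ib (bp xi) t + Ib (ap xi) t)) * oE (\<lambda>z. LL (f z)) (xi t) \<partial>Yl x) = QQ t (\<lambda>z. LL (f z)) x"
  by (rule QQ_path[symmetric]) (use t in auto)
 also have "(\<integral>\<^sup>+xi. \<integral>\<^sup>+r. ennreal (exp (- Ib (bp xi) r + Ib (ap xi) r)) * oE (H r) (xi (max 0 r)) * indicator {0..t} r \<partial>lborel \<partial>Yl x)
   = (\<integral>\<^sup>+r. \<integral>\<^sup>+xi. ennreal (exp (- Ib (bp xi) r + Ib (ap xi) r)) * oE (H r) (xi (max 0 r)) * indicator {0..t} r \<partial>Yl x \<partial>lborel)"
  by (rule S.Fubini'[OF mj, symmetric])
 also have "... = (\<integral>\<^sup>+r. QQ r (H r) x * indicator {0..t} r \<partial>lborel)"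
 proof (rule nn_integral_cong)
  fix r
  show "(\<integral>\<^sup>+xi. ennreal (exp (- Ib (bp xi) r + Ib (ap xi) r)) * oE (H r) (xi (max 0 r)) * indicator {0..t} r \<partial>Yl x) = QQ r (H r) x * indicator {0..t} r"
   using QQ_path[OF Hm, of r r x] by (cases "r \<in> {0..t}") (simp_all add: max_absorb2)
 qed
 finally show ?thesis unfolding H_def .
qed

end

context supercritical
begin

abbreviation e\<phi> :: "'a => ennreal" where "e\<phi> \<equiv> \<lambda>x. ennreal (\<phi> x)"

lemma mu_LL_\<phi>: "mu (\<lambda>z. LL (e\<phi> z)) < \<top>"
proof -
 obtain K where K: "0 < K" "\<And>x. \<phi> x <= K" using \<phi>_bounded by blast
 have "mu (\<lambda>z. LL (e\<phi> z)) <= mu (\<lambda>z. ennreal (ln (1 + K)) * e\<phi> z)"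
 proof (rule mu_mono)
  fix z
  have "\<phi> z * ln (1 + \<phi> z) <= \<phi> z * ln (1 + K)" using K(2)[of z] \<phi>_pos[of z] K(1) by (intro mult_left_mono) auto
  then show "LL (e\<phi> z) <= ennreal (ln (1 + K)) * e\<phi> z"
   using \<phi>_nonneg[of z] K(1) by (simp add: LL_ennreal ennreal_mult[symmetric] mult.commute ennreal_leI)
 qed
 also have "... = ennreal (ln (1 + K)) * 1" by (subst mu_cmult) (auto simp: mu_\<phi>)
 also have "... < \<top>" by simp
 finally show ?thesis .
qed

text \<open>Here the moment hypothesis on the offspring law enters. The constant part of the
  logarithm is paid by the bounded mean offspring number, and what remains is the logplus series
  over \<open>k\<close> at least 2.\<close>

lemma mu_bb:
 assumes e: "1 <= e"
 shows "mu (\<lambda>z. ennreal (\<beta> z) * bb (\<lambda>z. e * \<phi> z) z) < \<top>"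
proof -
 obtain K where K: "0 < K" "\<And>x. \<phi> x <= K" using \<phi>_bounded by blast
 define LS where "LS x = (\<Sum>k. if k \<ge> 2 then ennreal (real k * \<phi> x * logplus (real k * \<phi> x) * p k x) else 0)" for x
 have lpm[measurable]: "logplus \<in> borel_measurable borel" unfolding logplus_def[abs_def] by measurable
 have LSm[measurable]: "LS \<in> borel_measurable borel" unfolding LS_def by measurable
 define C1 where "C1 = 2 * e * (ln (1 + e * K) + ln (2 * e))"
 define C2 where "C2 = 2 * e"
 have C: "0 <= C1" "0 <= C2" using e K(1) by (auto simp: C1_def C2_def)
 have bbz: "bb (\<lambda>z. e * \<phi> z) z <= ennreal (C1 * \<phi> z * KA) + ennreal C2 * LS z" for z
 proof -
  let ?t = "\<lambda>k::nat. if k \<ge> 2 then ennreal (real k * \<phi> z * logplus (real k * \<phi> z) * p k z) else 0"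
  have "bb (\<lambda>z. e * \<phi> z) z <= (\<Sum>k. ennreal (C1 * \<phi> z) * ennreal (real k * p k z) + ennreal C2 * ?t k)"
   unfolding bb_def
  proof (rule suminf_le)
   fix k :: nat
   let ?y = "real k * \<phi> z"
   have y: "0 <= ?y" using \<phi>_nonneg by simp
   have lp: "0 <= logplus ?y" by (simp add: logplus_def)
   have ey: "real k * (e * \<phi> z) = e * ?y" by simp
   have ln0: "0 <= ln (1 + e * ?y)" using e y by simp
   \<comment> \<open>For \<open>k\<close> at most 1 the argument is bounded because \<phi> is, so
     the truncated logarithm is needed from 2 on only.\<close>
   have ln1: "ln (1 + e * ?y) <= (ln (1 + e * K) + ln (2 * e)) + (if k \<ge> 2 then logplus ?y else 0)"
   proof (cases "k \<ge> 2")
    case True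
    have "0 <= ln (1 + e * K)" using e K(1) by simp
    then show ?thesis using logplus_bound[OF e y] True by simp
   next
    case False
    then have "?y <= 1 * K" using K \<phi>_nonneg[of z] by (intro mult_mono) auto
    then have "e * ?y <= e * K" using e by (intro mult_left_mono) auto
    then have "ln (1 + e * ?y) <= ln (1 + e * K)" using e y by (subst ln_le_cancel_iff) (auto intro: add_pos_nonneg)
    moreover have "0 <= ln (2 * e)" using e by simp
    ultimately show ?thesis using False by simp
   qed
   have pk0: "0 <= p k z" by (rule p_nonneg)
   have c0: "0 <= p k z * (2 * (e * ?y))" using pk0 e y by simp
   have "p k z * (2 * (e * ?y) * ln (1 + e * ?y)) = (p k z * (2 * (e * ?y))) * ln (1 + e * ?y)" by simp
   also have "... <= (p k z * (2 * (e * ?y))) * ((ln (1 + e * K) + ln (2 * e)) + (if k \<ge> 2 then logplus ?y else 0))"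
    by (rule mult_left_mono[OF ln1 c0])
   also have "... = (C1 * \<phi> z) * (real k * p k z) + C2 * (if k \<ge> 2 then ?y * logplus ?y * p k z else 0)"
    by (simp add: C1_def C2_def algebra_simps)
   finally have "ennreal (p k z * (2 * (e * ?y) * ln (1 + e * ?y))) <= ennreal ((C1 * \<phi> z) * (real k * p k z) + C2 * (if k \<ge> 2 then ?y * logplus ?y * p k z else 0))"
    by (rule ennreal_leI)
   also have "... = ennreal ((C1 * \<phi> z) * (real k * p k z)) + ennreal (C2 * (if k \<ge> 2 then ?y * logplus ?y * p k z else 0))"
    by (rule ennreal_plus) (use C \<phi>_nonneg pk0 y lp in \<open>auto intro!: mult_nonneg_nonneg\<close>)
   also have "ennreal ((C1 * \<phi> z) * (real k * p k z)) = ennreal (C1 * \<phi> z) * ennreal (real k * p k z)"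
    by (rule ennreal_mult) (use C \<phi>_nonneg pk0 in auto)
   also have "ennreal (C2 * (if k \<ge> 2 then ?y * logplus ?y * p k z else 0)) = ennreal C2 * ?t k"
    using C by (simp add: ennreal_mult')
   also have "ennreal (p k z * (2 * (e * ?y) * ln (1 + e * ?y))) = ennreal (p k z) * ennreal (2 * (real k * (e * \<phi> z)) * ln (1 + real k * (e * \<phi> z)))"
    unfolding ey by (rule ennreal_mult) (use pk0 e y ln0 in auto)
   finally show "ennreal (p k z) * ennreal (2 * (real k * (e * \<phi> z)) * ln (1 + real k * (e * \<phi> z))) <= ennreal (C1 * \<phi> z) * ennreal (real k * p k z) + ennreal C2 * ?t k" .
  qed auto
  also have "... = (\<Sum>k. ennreal (C1 * \<phi> z) * ennreal (real k * p k z)) + (\<Sum>k. ennreal C2 * ?t k)"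
   by (rule suminf_add[symmetric]) auto
  also have "... = ennreal (C1 * \<phi> z) * ennreal (meanoff p z) + ennreal C2 * LS z"
  proof -
   have "(\<Sum>k. ennreal (real k * p k z)) = ennreal (meanoff p z)"
    unfolding meanoff_def by (rule suminf_ennreal2) (use A_summable p_nonneg in auto)
   then show ?thesis unfolding LS_def ennreal_suminf_cmult by (simp only:)
  qed
  also have "... <= ennreal (C1 * \<phi> z * KA) + ennreal C2 * LS z"
  proof (rule add_right_mono)
   have "ennreal (C1 * \<phi> z) * ennreal (meanoff p z) = ennreal (C1 * \<phi> z * meanoff p z)"
    by (rule ennreal_mult[symmetric]) (use C \<phi>_nonneg[of z] meanoff_nonneg[of z] in auto)
   also have "... <= ennreal (C1 * \<phi> z * KA)" by (intro ennreal_leI mult_left_mono A_le mult_nonneg_nonneg C \<phi>_nonneg)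
   finally show "ennreal (C1 * \<phi> z) * ennreal (meanoff p z) <= ennreal (C1 * \<phi> z * KA)" .
  qed
  finally show ?thesis .
 qed
 have "mu (\<lambda>z. ennreal (\<beta> z) * bb (\<lambda>z. e * \<phi> z) z) <= mu (\<lambda>z. ennreal (Kb * C1 * KA) * e\<phi> z + ennreal C2 * (ennreal (\<beta> z) * LS z))"
 proof (rule mu_mono)
  fix z
  have "ennreal (\<beta> z) * bb (\<lambda>z. e * \<phi> z) z <= ennreal (\<beta> z) * (ennreal (C1 * \<phi> z * KA) + ennreal C2 * LS z)" by (rule mult_left_mono[OF bbz]) simp
  also have "... = ennreal (\<beta> z) * ennreal (C1 * \<phi> z * KA) + ennreal C2 * (ennreal (\<beta> z) * LS z)" by (simp only: distrib_left mult.left_commute)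
  also have "... <= ennreal Kb * ennreal (C1 * \<phi> z * KA) + ennreal C2 * (ennreal (\<beta> z) * LS z)"
   by (intro add_right_mono mult_right_mono ennreal_leI \<beta>_le) simp
  also have "ennreal Kb * ennreal (C1 * \<phi> z * KA) = ennreal (Kb * C1 * KA) * e\<phi> z"
   using Kb_nonneg C KA_nonneg \<phi>_nonneg[of z] by (simp add: ennreal_mult[symmetric] ac_simps)
  finally show "ennreal (\<beta> z) * bb (\<lambda>z. e * \<phi> z) z <= ennreal (Kb * C1 * KA) * e\<phi> z + ennreal C2 * (ennreal (\<beta> z) * LS z)" .
 qed
 also have "... = ennreal (Kb * C1 * KA) * 1 + ennreal C2 * mu (\<lambda>z. ennreal (\<beta> z) * LS z)"
  by (subst mu_add; (subst mu_cmult)?; (subst mu_cmult)?; simp add: mu_\<phi>)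
 also have "mu (\<lambda>z. ennreal (\<beta> z) * LS z) = (\<integral>\<^sup>+x. ennreal (\<phi>h x * \<beta> x) * LS x \<partial>m)"
  unfolding mu_def using \<phi>h_nonneg \<beta>_nonneg by (intro nn_integral_cong) (simp add: ennreal_mult mult.assoc)
 also have "ennreal (Kb * C1 * KA) * 1 + ennreal C2 * (\<integral>\<^sup>+x. ennreal (\<phi>h x * \<beta> x) * LS x \<partial>m) < \<top>"
  using LlogL unfolding LS_def by (simp add: ennreal_mult_less_top)
 finally show ?thesis .
qed

text \<open>Under phihat dm the semigroup in the recursion becomes a factor at most exp (lam T),
  which leaves a scalar integral inequality in time with constants independent of the number of
  generations.\<close>

lemma mu_aE_bound:
 assumes T: "0 <= T"
 shows "\<exists>C. \<forall>n t. 0 <= t \<longrightarrow> t <= T \<longrightarrow> mu (aE e\<phi> n t) <= ennreal C"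
proof -
 define e where "e = exp (lam * T)"
 have e: "1 <= e" using T lam_pos by (simp add: e_def)
 define c where "c = e * (KA * Kb)"
 have c: "0 <= c" using e KA_nonneg Kb_nonneg by (simp add: c_def)
 define M where "M = mu (\<lambda>z. ennreal (\<beta> z) * bb (\<lambda>z. e * \<phi> z) z)"
 have "ennreal e * mu (\<lambda>z. LL (e\<phi> z)) + ennreal (e * T) * M < \<top>"
  using mu_LL_\<phi> mu_bb[OF e] by (simp add: M_def ennreal_mult_less_top)
 then obtain C0 where C0: "0 <= C0" "ennreal e * mu (\<lambda>z. LL (e\<phi> z)) + ennreal (e * T) * M = ennreal C0"
  by (cases "ennreal e * mu (\<lambda>z. LL (e\<phi> z)) + ennreal (e * T) * M") auto
 have mean: "QQ s e\<phi> z <= ennreal (e * \<phi> z)" if "0 <= s" "s <= T" for s z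
  unfolding QQ_\<phi>[OF that(1)] e_def using that lam_pos \<phi>_nonneg[of z] by (intro ennreal_leI mult_right_mono) auto
 have elt: "exp (lam * s) <= e" if "s <= T" for s unfolding e_def using that lam_pos by simp
 \<comment> \<open>The bound reproduces itself: \<open>C0\<close> collects the terms free of
   \<open>n\<close>, and \<open>C0\<close> plus the integral of c C0 exp (c (t - r)) over [0, t] is
   C0 exp (c t).\<close>
 have "mu (aE e\<phi> n t) <= ennreal (C0 * exp (c * t))" if "0 <= t" "t <= T" for n t
  using that
 proof (induction n arbitrary: t)
  case 0
  have "aE e\<phi> 0 t x = 0" for x by (simp add: aE_def XL_def)
  then show ?case by (simp add: mu_def)
 next
  case (Suc n)
  note t = Suc.prems
  define H where "H r z = ennreal (KA * Kb) * aE e\<phi> n (t - r) z + ennreal (\<beta> z) * bb (\<lambda>z. e * \<phi> z) z" for r z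
  have Hj: "(\<lambda>z. H (fst z) (snd z)) \<in> borel_measurable (borel \<Otimes>\<^sub>M borel)"
   unfolding H_def using aE_joint[of e\<phi> n t] by measurable
  have Hm[measurable]: "H r \<in> borel_measurable borel" for r
   using measurable_compose[OF measurable_Pair1' Hj, of r] by simp
  have Qj: "(\<lambda>z. QQ (fst z) (H (fst z)) (snd z)) \<in> borel_measurable (borel \<Otimes>\<^sub>M borel)" by (rule QQ_joint[OF Hj])
  interpret S: pair_sigma_finite m lborel by (intro pair_sigma_finite.intro m_sf sigma_finite_lborel)
  have Qj': "(\<lambda>(x, r). ennreal (\<phi>h x) * (QQ r (H r) x * indicator {0..t} r)) \<in> borel_measurable (m \<Otimes>\<^sub>M lborel)"
  proof -
   have "(\<lambda>z. (snd z, fst z)) \<in> m \<Otimes>\<^sub>M lborel \<rightarrow>\<^sub>M borel \<Otimes>\<^sub>M borel" by measurable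
   from measurable_compose[OF this Qj]
   have [measurable]: "(\<lambda>z. QQ (snd z) (H (snd z)) (fst z)) \<in> borel_measurable (m \<Otimes>\<^sub>M lborel)" by simp
   show ?thesis unfolding split_beta' by measurable
  qed
  have Qx: "(\<lambda>r. QQ r (H r) x * indicator {0..t} r) \<in> borel_measurable lborel" for x
  proof -
   have "(\<lambda>r. (r, x)) \<in> lborel \<rightarrow>\<^sub>M borel \<Otimes>\<^sub>M (borel :: 'a measure)" by measurable
   from measurable_compose[OF this Qj] show ?thesis by simp
  qed
  have "mu (aE e\<phi> (Suc n) t) <= mu (\<lambda>x. QQ t (\<lambda>z. LL (e\<phi> z)) x + (\<integral>\<^sup>+r. QQ r (H r) x * indicator {0..t} r \<partial>lborel))"
   unfolding H_def by (rule mu_mono, rule LlogL_recursion[where T=T]) (use t mean e \<phi>_nonneg in auto)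
  also have "... = mu (QQ t (\<lambda>z. LL (e\<phi> z))) + (\<integral>\<^sup>+x. ennreal (\<phi>h x) * (\<integral>\<^sup>+r. QQ r (H r) x * indicator {0..t} r \<partial>lborel) \<partial>m)"
  proof -
   have "(\<lambda>x. \<integral>\<^sup>+r. QQ r (H r) x * indicator {0..t} r \<partial>lborel) \<in> borel_measurable m"
   proof (rule sigma_finite_measure.borel_measurable_nn_integral[OF sigma_finite_lborel])
    have "(\<lambda>z. (snd z, fst z)) \<in> m \<Otimes>\<^sub>M lborel \<rightarrow>\<^sub>M borel \<Otimes>\<^sub>M borel" by measurable
    from measurable_compose[OF this Qj]
    have [measurable]: "(\<lambda>z. QQ (snd z) (H (snd z)) (fst z)) \<in> borel_measurable (m \<Otimes>\<^sub>M lborel)" by simp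
    show "(\<lambda>(x, r). QQ r (H r) x * indicator {0..t} r) \<in> borel_measurable (m \<Otimes>\<^sub>M lborel)" unfolding split_beta' by measurable
   qed
   then have [measurable]: "(\<lambda>x. \<integral>\<^sup>+r. QQ r (H r) x * indicator {0..t} r \<partial>lborel) \<in> borel_measurable borel" by (simp cong: measurable_cong_sets)
   show ?thesis unfolding mu_def by (subst nn_integral_add[symmetric]) (auto simp: distrib_left)
  qed
  finally have main: "mu (aE e\<phi> (Suc n) t) <= mu (QQ t (\<lambda>z. LL (e\<phi> z))) + (\<integral>\<^sup>+x. ennreal (\<phi>h x) * (\<integral>\<^sup>+r. QQ r (H r) x * indicator {0..t} r \<partial>lborel) \<partial>m)" .
  have "(\<integral>\<^sup>+x. ennreal (\<phi>h x) * (\<integral>\<^sup>+r. QQ r (H r) x * indicator {0..t} r \<partial>lborel) \<partial>m)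
    = (\<integral>\<^sup>+x. \<integral>\<^sup>+r. ennreal (\<phi>h x) * (QQ r (H r) x * indicator {0..t} r) \<partial>lborel \<partial>m)"
   by (intro nn_integral_cong nn_integral_cmult[symmetric] Qx)
  also have "... = (\<integral>\<^sup>+r. \<integral>\<^sup>+x. ennreal (\<phi>h x) * (QQ r (H r) x * indicator {0..t} r) \<partial>m \<partial>lborel)" by (rule S.Fubini'[OF Qj', symmetric])
  also have "... <= (\<integral>\<^sup>+r. (ennreal (c * (C0 * exp (c * (t - r)))) + ennreal e * M) * indicator {0..t} r \<partial>lborel)"
  proof (rule nn_integral_mono)
   fix r
   show "(\<integral>\<^sup>+x. ennreal (\<phi>h x) * (QQ r (H r) x * indicator {0..t} r) \<partial>m) <= (ennreal (c * (C0 * exp (c * (t - r)))) + ennreal e * M) * indicator {0..t} r"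
   proof (cases "r \<in> {0..t}")
    case True
    then have r: "0 <= r" "r <= t" by auto
    have "(\<integral>\<^sup>+x. ennreal (\<phi>h x) * (QQ r (H r) x * indicator {0..t} r) \<partial>m) = mu (QQ r (H r))" using True by (simp add: mu_def)
    also have "... = ennreal (exp (lam * r)) * mu (H r)" by (rule mu_QQ[OF r(1)]) measurable
    also have "mu (H r) = ennreal (KA * Kb) * mu (aE e\<phi> n (t - r)) + M"
     unfolding H_def M_def by (subst mu_add; (subst mu_cmult)?; simp)
    also have "ennreal (exp (lam * r)) * (ennreal (KA * Kb) * mu (aE e\<phi> n (t - r)) + M)
      <= ennreal e * (ennreal (KA * Kb) * ennreal (C0 * exp (c * (t - r))) + M)"
    proof (rule mult_mono)
     show "ennreal (exp (lam * r)) <= ennreal e" using elt[of r] r t by (intro ennreal_leI) auto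
     show "ennreal (KA * Kb) * mu (aE e\<phi> n (t - r)) + M <= ennreal (KA * Kb) * ennreal (C0 * exp (c * (t - r))) + M"
      by (intro add_right_mono mult_left_mono Suc.IH) (use r t in auto)
    qed auto
    also have "... = ennreal e * (ennreal (KA * Kb) * ennreal (C0 * exp (c * (t - r)))) + ennreal e * M" by (rule distrib_left)
    also have "ennreal e * (ennreal (KA * Kb) * ennreal (C0 * exp (c * (t - r)))) = ennreal (c * (C0 * exp (c * (t - r))))"
     using e KA_nonneg Kb_nonneg C0(1) by (simp add: c_def ennreal_mult[symmetric] mult.assoc)
    finally show ?thesis using True by simp
   qed simp
  qed
  also have "... = (\<integral>\<^sup>+r. ennreal (c * (C0 * exp (c * (t - r)))) * indicator {0..t} r \<partial>lborel) + (\<integral>\<^sup>+r. ennreal e * M * indicator {0..t} r \<partial>lborel)"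
   by (subst nn_integral_add[symmetric]) (auto simp: distrib_right)
  also have "(\<integral>\<^sup>+r. ennreal (c * (C0 * exp (c * (t - r)))) * indicator {0..t} r \<partial>lborel) = ennreal ((- (C0 * exp (c * (t - t)))) - (- (C0 * exp (c * (t - 0)))))"
  proof (rule nn_integral_FTC_Icc)
   fix r
   have "((\<lambda>a. - (C0 * exp (c * (t - a)))) has_real_derivative - (C0 * (exp (c * (t - r)) * (c * (0 - 1))))) (at r)"
    by (intro derivative_eq_intros refl | simp)+
   then show "((\<lambda>a. - (C0 * exp (c * (t - a)))) has_real_derivative c * (C0 * exp (c * (t - r)))) (at r)" by (simp add: ac_simps)
   show "0 <= c * (C0 * exp (c * (t - r)))" using c C0(1) by simp
  qed (use t in auto)
  finally have I: "(\<integral>\<^sup>+x. ennreal (\<phi>h x) * (\<integral>\<^sup>+r. QQ r (H r) x * indicator {0..t} r \<partial>lborel) \<partial>m)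
   <= ennreal ((- (C0 * exp (c * (t - t)))) - (- (C0 * exp (c * (t - 0))))) + (\<integral>\<^sup>+r. ennreal e * M * indicator {0..t} r \<partial>lborel)" .
  have "(\<integral>\<^sup>+r. ennreal e * M * indicator {0..t} r \<partial>lborel) = ennreal e * M * ennreal t"
   using t by (subst nn_integral_cmult_indicator) auto
  also have "... = ennreal (e * t) * M" using e t by (simp add: ennreal_mult mult_ac)
  also have "... <= ennreal (e * T) * M" using e t by (intro mult_right_mono ennreal_leI mult_left_mono) auto
  finally have I2: "(\<integral>\<^sup>+r. ennreal e * M * indicator {0..t} r \<partial>lborel) <= ennreal (e * T) * M" .
  have I3: "mu (QQ t (\<lambda>z. LL (e\<phi> z))) <= ennreal e * mu (\<lambda>z. LL (e\<phi> z))"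
   by (subst mu_QQ) (use t elt[of t] in \<open>auto intro!: mult_right_mono ennreal_leI\<close>)
  have "mu (aE e\<phi> (Suc n) t) <= ennreal e * mu (\<lambda>z. LL (e\<phi> z)) + (ennreal (- (C0 * exp (c * (t - t))) - - (C0 * exp (c * (t - 0)))) + ennreal (e * T) * M)"
   by (rule order_trans[OF main add_mono[OF I3 order_trans[OF I add_left_mono[OF I2]]]])
  also have "... = ennreal C0 + ennreal (C0 * exp (c * t) - C0)" unfolding C0(2)[symmetric] by (simp add: add_ac)
  also have "... = ennreal (C0 * exp (c * t))"
  proof -
   have "C0 * 1 <= C0 * exp (c * t)" using C0(1) c t by (intro mult_left_mono) auto
   then show ?thesis using C0(1) by (subst ennreal_plus[symmetric]) auto
  qed
  finally show ?case .
 qed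
 moreover have "C0 * exp (c * t) <= C0 * exp (c * T)" if "t <= T" for t using C0(1) c that by (intro mult_left_mono) (auto intro: mult_left_mono)
 ultimately show ?thesis by (intro exI[of _ "C0 * exp (c * T)"]) (meson ennreal_leI order_trans)
qed

text \<open>Almost every tree has finitely many particles at time \<open>T\<close>, so the truncated
  population is eventually the full one. Fatou's lemma is applied under \<open>P x\<close> and once
  more under phihat dm.\<close>

lemma LlogL_moment:
 assumes T: "0 <= T"
 shows "mu (\<lambda>x. \<integral>\<^sup>+w. LL (XE w T (oE e\<phi>)) \<partial>P x) < \<top>"
proof -
 obtain C where C: "\<And>n. mu (aE e\<phi> n T) <= ennreal C" using mu_aE_bound[OF T] T by blast
 have Xm[measurable]: "(\<lambda>w. XL n (oE e\<phi>) T w) \<in> borel_measurable Omega_space" for n by (rule XL_measurable) measurable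
 have "(\<integral>\<^sup>+w. LL (XE w T (oE e\<phi>)) \<partial>P x) <= liminf (\<lambda>n. aE e\<phi> n T x)" for x
 proof -
  have "AE w in P x. LL (XE w T (oE e\<phi>)) = liminf (\<lambda>n. LL (XL n (oE e\<phi>) T w))"
   using AE_Reg
  proof eventually_elim
   fix w assume "w \<in> Reg"
   then have fin: "finite (alive w T)" by (rule Reg_alive)
   obtain N where N: "\<And>u. u \<in> alive w T ==> length u < N"
    using finite_nat_set_iff_bounded[of "length ` alive w T"] fin by auto
   have XG0: "XG j (oE e\<phi>) T w = 0" if "N <= j" for j
   proof -
    have z: "(if length u = j \<and> pos w T u \<noteq> None then oE e\<phi> (pos w T u) else 0) = 0" for u
     using N[of u] that by (auto simp: alive_def)
    show ?thesis unfolding XG_def z by simp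
   qed
   have "XL n (oE e\<phi>) T w = XE w T (oE e\<phi>)" if "N <= n" for n
    unfolding XL_def XE_XG using XG0 that by (intro suminf_finite[symmetric]) auto
   then have "eventually (\<lambda>n. LL (XL n (oE e\<phi>) T w) = LL (XE w T (oE e\<phi>))) sequentially"
    unfolding eventually_sequentially by (intro exI[of _ N]) simp
   then have "(\<lambda>n. LL (XL n (oE e\<phi>) T w)) \<longlonglongrightarrow> LL (XE w T (oE e\<phi>))" by (rule tendsto_eventually)
   then show "LL (XE w T (oE e\<phi>)) = liminf (\<lambda>n. LL (XL n (oE e\<phi>) T w))"
    by (intro lim_imp_Liminf[symmetric]) simp_all
  qed
  then have "(\<integral>\<^sup>+w. LL (XE w T (oE e\<phi>)) \<partial>P x) = (\<integral>\<^sup>+w. liminf (\<lambda>n. LL (XL n (oE e\<phi>) T w)) \<partial>P x)" by (rule nn_integral_cong_AE)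
  also have "... <= liminf (\<lambda>n. aE e\<phi> n T x)" unfolding aE_def by (rule nn_integral_liminf) measurable
  finally show ?thesis .
 qed
 then have "mu (\<lambda>x. \<integral>\<^sup>+w. LL (XE w T (oE e\<phi>)) \<partial>P x) <= mu (\<lambda>x. liminf (\<lambda>n. aE e\<phi> n T x))" by (rule mu_mono)
 also have "... <= (\<integral>\<^sup>+x. liminf (\<lambda>n. ennreal (\<phi>h x) * aE e\<phi> n T x) \<partial>m)"
  unfolding mu_def
 proof (rule nn_integral_mono)
  fix x
  show "ennreal (\<phi>h x) * liminf (\<lambda>n. aE e\<phi> n T x) <= liminf (\<lambda>n. ennreal (\<phi>h x) * aE e\<phi> n T x)"
   unfolding liminf_SUP_INF SUP_mult_left_ennreal by (intro SUP_mono' INF_greatest mult_left_mono INF_lower) auto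
 qed
 also have "... <= liminf (\<lambda>n. mu (aE e\<phi> n T))" unfolding mu_def by (rule nn_integral_liminf) measurable
 also have "... <= ennreal C" by (rule Liminf_le) (auto simp: C)
 also have "... < \<top>" by simp
 finally show ?thesis .
qed

end

section \<open>The law of large numbers along lattice times\<close>

lemma LL_mono: "a <= b ==> LL a <= LL b"
proof (cases "b = \<top>")
 case False
 assume ab: "a <= b"
 then have a: "a \<noteq> \<top>" using False by (auto simp: top_unique)
 have "enn2real a <= enn2real b" using ab False by (intro enn2real_mono) (auto simp: less_top)
 moreover from this have "ln (1 + enn2real a) <= ln (1 + enn2real b)"
  by (subst ln_le_cancel_iff) (auto intro!: add_pos_nonneg)
 ultimately show ?thesis using a False unfolding LL_def by (auto intro!: ennreal_leI mult_mono)
qed (simp add: LL_def)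

lemma LL_scale:
 assumes "0 <= K" shows "LL (ennreal K * z) <= ennreal (K * ln (1 + K)) * z + ennreal K * LL z"
proof (cases "z = \<top>")
 case True
 show ?thesis
 proof (cases "K = 0")
  case False then show ?thesis using assms True by (simp add: LL_def ennreal_mult_top)
 qed simp
next
 case False
 then obtain y where y: "z = ennreal y" "0 <= y" by (cases z) auto
 have "(1 + K * y) <= (1 + K) * (1 + y)" using assms y by (simp add: algebra_simps)
 then have "ln (1 + K * y) <= ln ((1 + K) * (1 + y))" using assms y by (subst ln_le_cancel_iff) (auto intro!: add_pos_nonneg)
 also have "... = ln (1 + K) + ln (1 + y)" using assms y by (intro ln_mult_pos) auto
 finally have "(K * y) * ln (1 + K * y) <= (K * y) * (ln (1 + K) + ln (1 + y))" using assms y by (intro mult_left_mono) auto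
 also have "... = K * ln (1 + K) * y + K * (y * ln (1 + y))" by (simp add: algebra_simps)
 finally have "ennreal ((K * y) * ln (1 + K * y)) <= ennreal (K * ln (1 + K) * y + K * (y * ln (1 + y)))" by (rule ennreal_leI)
 also have "... = ennreal (K * ln (1 + K)) * ennreal y + ennreal K * ennreal (y * ln (1 + y))"
  using assms y by (simp add: ennreal_plus ennreal_mult)
 finally show ?thesis using assms y by (simp add: LL_ennreal ennreal_mult[symmetric])
qed

text \<open>A subtree begins where its particle is at the cut, so the conditional mean of a
  functional can itself be written as a functional of the subtree.\<close>

lemma subT_root: "pos w t u \<noteq> None ==> rpath (subT t u w) 0 = pos w t u"
proof (induction u arbitrary: w t)
 case Nil
 then have "0 <= t" "ennreal t < rlife w" by (auto simp: pos_Nil split: if_splits)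
 then show ?case by (simp add: subT_Nil_simps shiftp_def pos_Nil max_absorb2 del: subT.simps)
next
 case (Cons i u)
 then have "okc w i" "pos (sub w i) (t - rtime w) u \<noteq> None" by (auto simp: pos_Cons split: if_splits)
 then show ?case using Cons.IH by (simp add: pos_Cons del: not_None_eq)
qed

text \<open>Level \<open>exp (a n)\<close> is exceeded for at most \<open>ln (1 + g) / a\<close> positive integers \<open>n\<close>.\<close>
lemma truncation_count:
 assumes g: "0 <= (g::real)" and a: "0 < a"
 shows "(\<Sum>n. ennreal (if g <= exp (a * real (Suc n)) then 0 else g)) <= ennreal (1 / a) * LL (ennreal g)"
proof -
 define N where "N = nat \<lfloor>ln (1 + g) / a\<rfloor>"
 have ln0: "0 <= ln (1 + g) / a" using g a by simp
 have N: "real N <= ln (1 + g) / a" unfolding N_def using ln0 by (simp add: of_nat_nat)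
 have z: "g <= exp (a * real (Suc n))" if "N <= n" for n
 proof (rule ccontr)
  assume "\<not> g <= exp (a * real (Suc n))"
  then have "exp (a * real (Suc n)) < 1 + g" by simp
  then have "ln (exp (a * real (Suc n))) < ln (1 + g)" using g by (subst ln_less_cancel_iff) auto
  then have "real (Suc n) < ln (1 + g) / a" using a by (simp add: field_simps del: of_nat_Suc)
  then have "int (Suc n) <= \<lfloor>ln (1 + g) / a\<rfloor>" by (simp add: le_floor_iff)
  then have "Suc n <= N" unfolding N_def by linarith
  then show False using that by simp
 qed
 have "(\<Sum>n. ennreal (if g <= exp (a * real (Suc n)) then 0 else g)) = (\<Sum>n<N. ennreal (if g <= exp (a * real (Suc n)) then 0 else g))"
  by (rule suminf_finite) (use z in auto)
 also have "... <= (\<Sum>n<N. ennreal g)" by (intro sum_mono) auto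
 also have "... = ennreal (real N * g)" using g by (simp add: ennreal_mult ennreal_of_nat_eq_real_of_nat)
 also have "... <= ennreal ((ln (1 + g) / a) * g)" by (intro ennreal_leI mult_right_mono N g)
 also have "... = ennreal (1 / a) * LL (ennreal g)" using g a by (simp add: LL_ennreal ennreal_mult[symmetric] field_simps)
 finally show ?thesis .
qed

context branching
begin

lemma AE_root: "AE w in P x. rpath w 0 = Some x"
proof -
 have [measurable]: "(\<lambda>w. rpath w 0) \<in> Omega_space \<rightarrow>\<^sub>M (optB :: 'a option measure)"
  by (rule measurable_compose[OF r_measurable(1)[OF measurable_ident_sets[OF refl]] eval_measurable0]) simp
 have s: "{Some x} \<in> sets optB" by (simp add: sets_optB_iff vimage_def)
 let ?F = "\<lambda>w. indicator (- {Some x}) (rpath w 0) :: ennreal"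
 have mF: "?F \<in> borel_measurable Omega_space"
  by (rule measurable_compose[of "\<lambda>w. rpath w 0" _ optB]) (use s in \<open>auto intro!: borel_measurable_indicator sets.compl_sets[of _ optB, simplified, unfolded Compl_eq_Diff_UNIV[symmetric]]\<close>)
 have "(\<integral>\<^sup>+w. ?F w \<partial>P x) = (\<integral>\<^sup>+xi. indicator (- {Some x}) (xi 0) \<partial>Yl x)"
  unfolding nn_integral_P[OF mF]
 proof (rule nn_integral_cong)
  fix xi assume "xi \<in> space (Yl x)" then have xi: "xi \<in> hpaths" by simp
  have "R ?F xi \<tau> = indicator (- {Some x}) (xi 0)" for \<tau>
   unfolding R_def J_def using sets_off_at[OF xi] by (simp add: prob_space.emeasure_space_1 prob_subs_law)
  then show "(\<integral>\<^sup>+e. ennreal (exponential_density 1 e) * R ?F xi (tauf (bp xi) e) \<partial>lborel) = indicator (- {Some x}) (xi 0)"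
   by (simp add: nn_integral_multc expo_integral)
 qed
 also have "... = (\<integral>\<^sup>+xi. 0 \<partial>Yl x)" by (rule nn_integral_cong_AE) (use AE_start[of x] in \<open>auto elim!: eventually_mono\<close>)
 finally have "(\<integral>\<^sup>+w. ?F w \<partial>P x) = 0" by simp
 moreover have "?F \<in> borel_measurable (P x)" using mF by simp
 ultimately have "AE w in P x. ?F w = 0" by (simp add: nn_integral_0_iff_AE)
 then show ?thesis by (rule eventually_mono) (auto split: split_indicator_asm)
qed

lemma XE_finite_real:
 assumes "w \<in> Reg" shows "XE w t (oE (\<lambda>x. ennreal (f x))) < \<top>"
 unfolding XE_finite[OF Reg_alive[OF assms]] using Reg_alive[OF assms, of t]
 by (auto simp: oE_def less_top[symmetric] split: option.splits)

lemma Xf_enn2real: "w \<in> Reg ==> (\<And>x. 0 <= f x) ==> Xf w t f = enn2real (XE w t (oE (\<lambda>x. ennreal (f x))))"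
 using XE_Xf[OF Reg_alive, of w f t] unfolding oE_gD by (simp add: Xf_def sum_nonneg)

lemma SS_enn2real: "w \<in> Reg ==> (\<And>x. 0 <= G x) ==> SS w t G = enn2real (SE w t (\<lambda>w. ennreal (G w)))"
 using SE_SS[OF Reg_alive, of w G t] by (simp add: SS_def sum_nonneg)

definition cG :: "('a tree => real) => 'a => real" where
 "cG G y = enn2real (\<integral>\<^sup>+w. ennreal (G w) \<partial>P y)"

lemma cG_measurable[measurable]: "G \<in> borel_measurable Omega_space ==> cG G \<in> borel_measurable borel"
 unfolding cG_def[abs_def] by measurable

lemma cG_nonneg: "0 <= cG G y" by (simp add: cG_def)

end

context supercritical
begin

text \<open>After centring, the second moment is a sum of individual ones, each at most 2 L times
  the mean of \<open>G\<close>, and the eigenfunction equation sums them up. The elementary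
  inequality s <= \<eta> s^2 + 1/\<eta> turns this into a first-moment bound, with \<eta> left to be
  optimized.\<close>

lemma lln_centered_bound:
 assumes G[measurable]: "G \<in> borel_measurable Omega_space" and G0: "\<And>w. 0 <= G w" and GL: "\<And>w. G w <= L"
  and K: "0 <= K" "\<And>y. (\<integral>\<^sup>+w. ennreal (G w) \<partial>P y) <= ennreal (K * \<phi> y)" and t: "0 <= t" and \<eta>: "0 < \<eta>"
 shows "(\<integral>\<^sup>+w. ennreal \<bar>enn2real (SE w t (\<lambda>w. ennreal (G w))) - enn2real (XE w t (oE (\<lambda>y. ennreal (cG G y))))\<bar> \<partial>P x)
   <= ennreal (\<eta> * (2 * L * K * exp (lam * t) * \<phi> x) + 1 / \<eta>)"
proof -
 interpret Px: prob_space "P x" by (rule prob_P)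
 have L: "0 <= L" using G0[of undefined] GL[of undefined] by linarith
 have cGe: "(\<integral>\<^sup>+w. ennreal (G w) \<partial>P y) = ennreal (cG G y)" for y
  unfolding cG_def using le_less_trans[OF K(2)[of y] ennreal_less_top] by simp
 have cGL: "cG G y <= L" for y
 proof -
  have "(\<integral>\<^sup>+w. ennreal (G w) \<partial>P y) <= (\<integral>\<^sup>+w. ennreal L \<partial>P y)" by (intro nn_integral_mono ennreal_leI GL)
  then show ?thesis using prob_space.emeasure_space_1[OF prob_P, of y] L by (simp add: cGe ennreal_le_iff)
 qed
 \<comment> \<open>The conditional mean, read off the starting point of the subtree; it makes
   \<open>G - r\<close> a bounded functional with mean zero under every \<open>P y\<close>.\<close>
 define r where "r w = gD (cG G) (rpath w 0)" for w
 have r0: "0 <= r w" "r w <= L" for w using cG_nonneg cGL L by (auto simp: r_def gD_def split: option.split)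
 have [measurable]: "(\<lambda>w. rpath w 0) \<in> Omega_space \<rightarrow>\<^sub>M (optB :: 'a option measure)"
  by (rule measurable_compose[OF r_measurable(1)[OF measurable_ident_sets[OF refl]] eval_measurable0]) simp
 have rm[measurable]: "r \<in> borel_measurable Omega_space" unfolding r_def by measurable
 define g where "g w = G w - r w" for w
 have gm[measurable]: "g \<in> borel_measurable Omega_space" unfolding g_def by measurable
 have gL: "\<bar>g w\<bar> <= L" for w using G0[of w] GL[of w] r0[of w] by (auto simp: g_def abs_le_iff)
 have rE: "(\<integral>\<^sup>+w. ennreal (r w) \<partial>P y) = ennreal (cG G y)" for y
 proof -
  have "(\<integral>\<^sup>+w. ennreal (r w) \<partial>P y) = (\<integral>\<^sup>+w. ennreal (cG G y) \<partial>P y)"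
   by (rule nn_integral_cong_AE) (use AE_root[of y] in \<open>auto elim!: eventually_mono simp: r_def\<close>)
  then show ?thesis using prob_space.emeasure_space_1[OF prob_P, of y] by simp
 qed
 have g0: "(\<integral>\<^sup>+w. ennreal (g w) \<partial>P y) = (\<integral>\<^sup>+w. ennreal (- g w) \<partial>P y)" for y
 proof -
  have "ennreal (g w) + ennreal (r w) = ennreal (- g w) + ennreal (G w)" for w
   using G0[of w] r0[of w] unfolding g_def
   by (cases "r w <= G w") (simp_all add: ennreal_neg ennreal_plus[symmetric] del: ennreal_plus)
  then have "(\<integral>\<^sup>+w. ennreal (g w) + ennreal (r w) \<partial>P y) = (\<integral>\<^sup>+w. ennreal (- g w) + ennreal (G w) \<partial>P y)" by simp
  then have "(\<integral>\<^sup>+w. ennreal (g w) \<partial>P y) + ennreal (cG G y) = (\<integral>\<^sup>+w. ennreal (- g w) \<partial>P y) + ennreal (cG G y)"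
   by (subst (asm) (1 2) nn_integral_add) (auto simp: rE cGe)
  then show ?thesis by (simp add: add.commute[of _ "ennreal (cG G y)"])
 qed
 have g2: "(\<integral>\<^sup>+w. ennreal ((g w)\<^sup>2) \<partial>P y) <= ennreal (2 * L * K) * e\<phi> y" for y
 proof -
  have "(\<integral>\<^sup>+w. ennreal ((g w)\<^sup>2) \<partial>P y) <= (\<integral>\<^sup>+w. ennreal L * (ennreal (G w) + ennreal (r w)) \<partial>P y)"
  proof (rule nn_integral_mono)
   fix w
   have "(g w)\<^sup>2 = \<bar>g w\<bar> * \<bar>g w\<bar>" by (simp add: power2_eq_square)
   also have "... <= L * (G w + r w)" using gL[of w] G0[of w] r0[of w] L by (intro mult_mono) (auto simp: g_def)
   finally show "ennreal ((g w)\<^sup>2) <= ennreal L * (ennreal (G w) + ennreal (r w))"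
    using G0[of w] r0[of w] L by (simp add: ennreal_plus[symmetric] ennreal_mult[symmetric] ennreal_leI del: ennreal_plus)
  qed
  also have "... = ennreal L * (ennreal (cG G y) + ennreal (cG G y))"
   by (simp add: nn_integral_cmult nn_integral_add rE cGe)
  also have "... <= ennreal L * (ennreal (K * \<phi> y) + ennreal (K * \<phi> y))"
   using K(2)[of y] unfolding cGe by (intro mult_left_mono add_mono) auto
  also have "... = ennreal (2 * L * K) * e\<phi> y"
   using K(1) L \<phi>_nonneg[of y] by (simp add: ennreal_plus[symmetric] ennreal_mult[symmetric] del: ennreal_plus)
  finally show ?thesis .
 qed
 have S2: "(\<integral>\<^sup>+w. ennreal ((SS w t g)\<^sup>2) \<partial>P x) <= ennreal (2 * L * K * exp (lam * t) * \<phi> x)"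
 proof -
  have "(\<integral>\<^sup>+w. ennreal ((SS w t g)\<^sup>2) \<partial>P x) <= (\<integral>\<^sup>+w. SE w t (\<lambda>w. ennreal ((g w)\<^sup>2)) \<partial>P x)"
   by (rule second_moment[OF gm gL g0])
  also have "... = QQ t (\<lambda>y. \<integral>\<^sup>+w. ennreal ((g w)\<^sup>2) \<partial>P y) x" by (rule QQ_SE) measurable
  also have "... <= QQ t (\<lambda>y. ennreal (2 * L * K) * e\<phi> y) x" by (rule QQ_mono) (rule g2)
  also have "... = ennreal (2 * L * K) * ennreal (exp (lam * t) * \<phi> x)" by (subst QQ_cmult) (auto simp: QQ_\<phi>[OF t])
  also have "... = ennreal (2 * L * K * exp (lam * t) * \<phi> x)" using K(1) L \<phi>_nonneg[of x] by (simp add: ennreal_mult[symmetric] mult.assoc)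
  finally show ?thesis .
 qed
 have eq: "AE w in P x. enn2real (SE w t (\<lambda>w. ennreal (G w))) - enn2real (XE w t (oE (\<lambda>y. ennreal (cG G y)))) = SS w t g"
  using AE_Reg
 proof eventually_elim
  fix w assume r: "w \<in> Reg"
  have "SS w t g = (\<Sum>u\<in>alive w t. G (subT t u w) - gD (cG G) (pos w t u))"
   unfolding SS_def g_def r_def by (intro sum.cong refl) (simp add: subT_root alive_def del: not_None_eq)
  also have "... = SS w t G - Xf w t (cG G)" unfolding SS_def Xf_gD by (rule sum_subtractf)
  finally show "enn2real (SE w t (\<lambda>w. ennreal (G w))) - enn2real (XE w t (oE (\<lambda>y. ennreal (cG G y)))) = SS w t g"
   using SS_enn2real[OF r G0] Xf_enn2real[OF r cG_nonneg] by simp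
 qed
 let ?D = "\<lambda>w. enn2real (SE w t (\<lambda>w. ennreal (G w))) - enn2real (XE w t (oE (\<lambda>y. ennreal (cG G y))))"
 have Dm[measurable]: "?D \<in> borel_measurable Omega_space" by measurable
 have "(\<integral>\<^sup>+w. ennreal \<bar>?D w\<bar> \<partial>P x) <= (\<integral>\<^sup>+w. ennreal \<eta> * ennreal ((?D w)\<^sup>2) + ennreal (1 / \<eta>) \<partial>P x)"
 proof (rule nn_integral_mono)
  fix w
  let ?s = "\<bar>?D w\<bar>"
  have "2 * (\<eta> * ?s) <= (\<eta> * ?s)\<^sup>2 + 1" using sum_squares_bound[of "\<eta> * ?s" 1] by simp
  moreover have "0 <= \<eta> * ?s" using \<eta> by simp
  ultimately have "\<eta> * ?s <= \<eta> * (\<eta> * ?s\<^sup>2) + 1" by (simp add: power2_eq_square mult_ac)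
  then have "?s <= \<eta> * ?s\<^sup>2 + 1 / \<eta>" using \<eta> by (simp add: field_simps)
  then have "ennreal ?s <= ennreal (\<eta> * (?D w)\<^sup>2 + 1 / \<eta>)" by (intro ennreal_leI) simp
  also have "... = ennreal \<eta> * ennreal ((?D w)\<^sup>2) + ennreal (1 / \<eta>)" using \<eta> by (simp add: ennreal_plus ennreal_mult)
  finally show "ennreal ?s <= ennreal \<eta> * ennreal ((?D w)\<^sup>2) + ennreal (1 / \<eta>)" .
 qed
 also have "... = ennreal \<eta> * (\<integral>\<^sup>+w. ennreal ((?D w)\<^sup>2) \<partial>P x) + ennreal (1 / \<eta>)"
  using Px.emeasure_space_1 by (subst nn_integral_add) (auto simp: nn_integral_cmult)
 also have "(\<integral>\<^sup>+w. ennreal ((?D w)\<^sup>2) \<partial>P x) = (\<integral>\<^sup>+w. ennreal ((SS w t g)\<^sup>2) \<partial>P x)"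
  by (rule nn_integral_cong_AE) (use eq in \<open>auto elim!: eventually_mono\<close>)
 also have "ennreal \<eta> * (\<integral>\<^sup>+w. ennreal ((SS w t g)\<^sup>2) \<partial>P x) + ennreal (1 / \<eta>) <= ennreal \<eta> * ennreal (2 * L * K * exp (lam * t) * \<phi> x) + ennreal (1 / \<eta>)"
  by (intro add_right_mono mult_left_mono S2) simp
 also have "... = ennreal (\<eta> * (2 * L * K * exp (lam * t) * \<phi> x) + 1 / \<eta>)"
  using \<eta> L K(1) \<phi>_nonneg[of x] by (simp add: ennreal_plus ennreal_mult[symmetric])
 finally show ?thesis .
qed

text \<open>The centred sum, defined through \<open>enn2real\<close> so that it is measurable on all
  trees; on trees without explosion it is \<open>SS\<close> minus \<open>Xf\<close>.\<close>

definition Dv :: "('a tree => real) => real => 'a tree => real" where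
 "Dv G t w = enn2real (SE w t (\<lambda>w. ennreal (G w))) - enn2real (XE w t (oE (\<lambda>y. ennreal (cG G y))))"

lemma Dv_measurable[measurable]:
 assumes [measurable]: "G \<in> borel_measurable Omega_space" shows "Dv G t \<in> borel_measurable Omega_space"
 unfolding Dv_def[abs_def] by measurable

text \<open>Truncating at level \<open>exp (lam * t / 2)\<close> makes the fluctuations of the bounded part decay
 geometrically in mean, while the \<open>L log L\<close> moment makes the discarded parts summable.\<close>
lemma lln_step:
 assumes G[measurable]: "G \<in> borel_measurable Omega_space" and G0: "\<And>w. 0 <= G w"
  and K: "0 <= K" "\<And>y. (\<integral>\<^sup>+w. ennreal (G w) \<partial>P y) <= ennreal (K * \<phi> y)"
  and LG: "mu (\<lambda>y. \<integral>\<^sup>+w. LL (ennreal (G w)) \<partial>P y) < \<top>" and d: "0 < d"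
 shows "(\<Sum>n. \<integral>\<^sup>+w. ennreal (exp (- lam * (d * real (Suc n))) * \<bar>Dv G (d * real (Suc n)) w\<bar>) \<partial>P x) < \<top>"
proof -
 define t where "t n = d * real (Suc n)" for n
 have t: "0 <= t n" "d <= t n" for n using d by (auto simp: t_def)
 define L where "L n = exp (lam * d / 2 * real (Suc n))" for n
 have Lt: "L n = exp (lam * t n / 2)" for n by (simp add: L_def t_def)
 define G1 where "G1 n w = (if G w <= L n then G w else 0)" for n w
 define G2 where "G2 n w = (if G w <= L n then 0 else G w)" for n w
 have [measurable]: "G1 n \<in> borel_measurable Omega_space" "G2 n \<in> borel_measurable Omega_space" for n
  unfolding G1_def G2_def by measurable
 have G12: "0 <= G1 n w" "G1 n w <= L n" "0 <= G2 n w" "G w = G1 n w + G2 n w" for n w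
  using G0[of w] by (auto simp: G1_def G2_def L_def)
 have fin: "(\<integral>\<^sup>+w. ennreal (G' w) \<partial>P y) = ennreal (cG G' y)" if "\<And>w. G' w <= G w" for G' y
 proof -
  have "(\<integral>\<^sup>+w. ennreal (G' w) \<partial>P y) <= (\<integral>\<^sup>+w. ennreal (G w) \<partial>P y)" by (intro nn_integral_mono ennreal_leI that)
  also have "... < \<top>" using le_less_trans[OF K(2)[of y] ennreal_less_top] .
  finally show ?thesis by (simp add: cG_def)
 qed
 have G1le: "G1 n w <= G w" and G2le: "G2 n w <= G w" for n w using G0[of w] by (auto simp: G1_def G2_def)
 have c12: "cG G y = cG (G1 n) y + cG (G2 n) y" for n y
 proof -
  have "ennreal (cG G y) = (\<integral>\<^sup>+w. ennreal (G1 n w) + ennreal (G2 n w) \<partial>P y)"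
   using G12(1,3) unfolding fin[of G, OF order_refl, symmetric] by (subst G12(4)[of _ n]) (simp add: ennreal_plus)
  also have "... = ennreal (cG (G1 n) y) + ennreal (cG (G2 n) y)"
   by (subst nn_integral_add) (auto simp: fin[OF G1le] fin[OF G2le])
  finally show ?thesis by (simp add: ennreal_plus[symmetric] cG_nonneg del: ennreal_plus)
 qed
 obtain C where C: "0 < C" "\<And>t f x. d <= t ==> f \<in> borel_measurable borel ==> QQ t f x <= ennreal (C * exp (lam * t) * \<phi> x) * mu f"
  using QQ_upper[OF d] by blast
 define b where "b n = mu (\<lambda>y. ennreal (cG (G2 n) y))" for n
 have K1: "(\<integral>\<^sup>+w. ennreal (G1 n w) \<partial>P y) <= ennreal (K * \<phi> y)" for n y
  using order_trans[OF nn_integral_mono[OF ennreal_leI[OF G1le]] K(2)] .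
 \<comment> \<open>The sum over \<open>n\<close> is taken before integrating: a given tree is
   discarded at no more than 2 ln (1 + G) / (lam d) of the levels, so the sum is controlled by the L
   log L moment.\<close>
 have sb: "(\<Sum>n. b n) < \<top>"
 proof -
  have "(\<Sum>n. b n) = mu (\<lambda>y. \<Sum>n. ennreal (cG (G2 n) y))"
   unfolding b_def mu_def ennreal_suminf_cmult[symmetric] by (rule nn_integral_suminf[symmetric]) measurable
  also have "... <= mu (\<lambda>y. ennreal (1 / (lam * d / 2)) * (\<integral>\<^sup>+w. LL (ennreal (G w)) \<partial>P y))"
  proof (rule mu_mono)
   fix y
   have "(\<Sum>n. ennreal (cG (G2 n) y)) = (\<integral>\<^sup>+w. (\<Sum>n. ennreal (G2 n w)) \<partial>P y)"
    unfolding fin[OF G2le, symmetric] by (rule nn_integral_suminf[symmetric]) measurable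
   also have "... <= (\<integral>\<^sup>+w. ennreal (1 / (lam * d / 2)) * LL (ennreal (G w)) \<partial>P y)"
    unfolding G2_def L_def by (intro nn_integral_mono truncation_count G0) (use lam_pos d in simp)
   also have "... = ennreal (1 / (lam * d / 2)) * (\<integral>\<^sup>+w. LL (ennreal (G w)) \<partial>P y)" by (rule nn_integral_cmult) measurable
   finally show "(\<Sum>n. ennreal (cG (G2 n) y)) <= ennreal (1 / (lam * d / 2)) * (\<integral>\<^sup>+w. LL (ennreal (G w)) \<partial>P y)" .
  qed
  also have "... = ennreal (1 / (lam * d / 2)) * mu (\<lambda>y. \<integral>\<^sup>+w. LL (ennreal (G w)) \<partial>P y)" by (rule mu_cmult) measurable
  also have "... < \<top>" using LG by (simp add: ennreal_mult_less_top)
  finally show ?thesis .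
 qed
 define C' where "C' = 2 * K * \<phi> x + 1"
 have C': "0 <= C'" using K(1) \<phi>_nonneg[of x] by (simp add: C'_def)
 have tm: "(\<integral>\<^sup>+w. ennreal (exp (- lam * t n) * \<bar>Dv G (t n) w\<bar>) \<partial>P x)
   <= ennreal (C' * exp (- lam * t n / 4)) + ennreal (2 * C * \<phi> x) * b n" for n
 proof -
  let ?e = "exp (- lam * t n)"
  have AEb: "AE w in P x. \<bar>Dv G (t n) w\<bar> <= \<bar>Dv (G1 n) (t n) w\<bar> + enn2real (SE w (t n) (\<lambda>w. ennreal (G2 n w))) + enn2real (XE w (t n) (oE (\<lambda>y. ennreal (cG (G2 n) y))))"
   using AE_Reg
  proof eventually_elim
   fix w assume r: "w \<in> Reg"
   have s: "SS w (t n) G = SS w (t n) (G1 n) + SS w (t n) (G2 n)"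
    unfolding SS_def by (subst sum.distrib[symmetric]) (intro sum.cong refl G12(4))
   have c: "gD (cG G) y = gD (cG (G1 n)) y + gD (cG (G2 n)) y" for y using c12[of _ n] by (simp add: gD_def split: option.split)
   have x: "Xf w (t n) (cG G) = Xf w (t n) (cG (G1 n)) + Xf w (t n) (cG (G2 n))"
    unfolding Xf_gD c by (rule sum.distrib)
   have "0 <= SS w (t n) (G2 n)" "0 <= Xf w (t n) (cG (G2 n))"
    by (auto simp: SS_def Xf_def intro!: sum_nonneg G12 cG_nonneg)
   then have "\<bar>SS w (t n) G - Xf w (t n) (cG G)\<bar> <= \<bar>SS w (t n) (G1 n) - Xf w (t n) (cG (G1 n))\<bar> + SS w (t n) (G2 n) + Xf w (t n) (cG (G2 n))"
    unfolding s x by (auto simp: abs_le_iff)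
   then show "\<bar>Dv G (t n) w\<bar> <= \<bar>Dv (G1 n) (t n) w\<bar> + enn2real (SE w (t n) (\<lambda>w. ennreal (G2 n w))) + enn2real (XE w (t n) (oE (\<lambda>y. ennreal (cG (G2 n) y))))"
    unfolding Dv_def using SS_enn2real[OF r] Xf_enn2real[OF r] G0 G12 cG_nonneg by simp
  qed
  have e2: "ennreal (enn2real z) <= z" for z by (cases z) auto
  have "(\<integral>\<^sup>+w. ennreal \<bar>Dv G (t n) w\<bar> \<partial>P x) <= (\<integral>\<^sup>+w. ennreal \<bar>Dv (G1 n) (t n) w\<bar> + (SE w (t n) (\<lambda>w. ennreal (G2 n w)) + XE w (t n) (oE (\<lambda>y. ennreal (cG (G2 n) y)))) \<partial>P x)"
  proof (rule nn_integral_mono_AE, rule eventually_mono[OF AEb])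
   fix w assume le: "\<bar>Dv G (t n) w\<bar> <= \<bar>Dv (G1 n) (t n) w\<bar> + enn2real (SE w (t n) (\<lambda>w. ennreal (G2 n w))) + enn2real (XE w (t n) (oE (\<lambda>y. ennreal (cG (G2 n) y))))"
   have "ennreal \<bar>Dv G (t n) w\<bar> <= ennreal \<bar>Dv (G1 n) (t n) w\<bar> + (ennreal (enn2real (SE w (t n) (\<lambda>w. ennreal (G2 n w)))) + ennreal (enn2real (XE w (t n) (oE (\<lambda>y. ennreal (cG (G2 n) y))))))"
    using ennreal_leI[OF le] by (simp add: ennreal_plus add.assoc)
   also have "... <= ennreal \<bar>Dv (G1 n) (t n) w\<bar> + (SE w (t n) (\<lambda>w. ennreal (G2 n w)) + XE w (t n) (oE (\<lambda>y. ennreal (cG (G2 n) y))))"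
    by (intro add_left_mono add_mono e2)
   finally show "ennreal \<bar>Dv G (t n) w\<bar> <= ennreal \<bar>Dv (G1 n) (t n) w\<bar> + (SE w (t n) (\<lambda>w. ennreal (G2 n w)) + XE w (t n) (oE (\<lambda>y. ennreal (cG (G2 n) y))))" .
  qed
  also have "... = (\<integral>\<^sup>+w. ennreal \<bar>Dv (G1 n) (t n) w\<bar> \<partial>P x) + ((\<integral>\<^sup>+w. SE w (t n) (\<lambda>w. ennreal (G2 n w)) \<partial>P x) + (\<integral>\<^sup>+w. XE w (t n) (oE (\<lambda>y. ennreal (cG (G2 n) y))) \<partial>P x))"
   by (simp add: nn_integral_add)
  also have "(\<integral>\<^sup>+w. SE w (t n) (\<lambda>w. ennreal (G2 n w)) \<partial>P x) = QQ (t n) (\<lambda>y. ennreal (cG (G2 n) y)) x"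
   unfolding fin[OF G2le, symmetric] by (rule QQ_SE) measurable
  also have "(\<integral>\<^sup>+w. XE w (t n) (oE (\<lambda>y. ennreal (cG (G2 n) y))) \<partial>P x) = QQ (t n) (\<lambda>y. ennreal (cG (G2 n) y)) x"
   by (simp add: QQ_def)
  finally have 1: "(\<integral>\<^sup>+w. ennreal \<bar>Dv G (t n) w\<bar> \<partial>P x) <= (\<integral>\<^sup>+w. ennreal \<bar>Dv (G1 n) (t n) w\<bar> \<partial>P x)
    + (QQ (t n) (\<lambda>y. ennreal (cG (G2 n) y)) x + QQ (t n) (\<lambda>y. ennreal (cG (G2 n) y)) x)" .
  \<comment> \<open>Balances the two terms: the variance is of order exp (3/2 lam t), being the
    truncation level exp (lam t / 2) times the growth exp (lam t), so both terms are of order exp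
    (3/4 lam t), and exp (- lam t / 4) remains after normalization.\<close>
  let ?\<eta> = "exp (- 3 / 4 * (lam * t n))"
  have 2: "(\<integral>\<^sup>+w. ennreal \<bar>Dv (G1 n) (t n) w\<bar> \<partial>P x) <= ennreal (?\<eta> * (2 * L n * K * exp (lam * t n) * \<phi> x) + 1 / ?\<eta>)"
   unfolding Dv_def by (rule lln_centered_bound) (use G12 K K1 t in auto)
  have e3: "?\<eta> * (2 * L n * K * exp (lam * t n) * \<phi> x) + 1 / ?\<eta> = exp (lam * t n) * (C' * exp (- lam * t n / 4))"
  proof -
   define s where "s = lam * t n"
   have "exp (- 3 / 4 * s) * exp (s / 2) * exp s = exp (- 3 / 4 * s + s / 2 + s)" by (simp only: exp_add)
   also have "- 3 / 4 * s + s / 2 + s = s + - s / 4" by simp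
   also have "exp (s + - s / 4) = exp s * exp (- s / 4)" by (rule exp_add)
   finally have a: "?\<eta> * L n * exp (lam * t n) = exp (lam * t n) * exp (- lam * t n / 4)" by (simp add: Lt s_def)
   have "1 / exp (- 3 / 4 * s) = exp (- (- 3 / 4 * s))" by (simp only: exp_minus inverse_eq_divide)
   also have "- (- 3 / 4 * s) = s + - s / 4" by simp
   also have "exp (s + - s / 4) = exp s * exp (- s / 4)" by (rule exp_add)
   finally have b: "1 / ?\<eta> = exp (lam * t n) * exp (- lam * t n / 4)" by (simp add: s_def)
   have "?\<eta> * (2 * L n * K * exp (lam * t n) * \<phi> x) = 2 * K * \<phi> x * (?\<eta> * L n * exp (lam * t n))" by (simp only: mult_ac)
   then show ?thesis unfolding a b C'_def by (simp add: algebra_simps)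
  qed
  have 3: "QQ (t n) (\<lambda>y. ennreal (cG (G2 n) y)) x <= ennreal (C * exp (lam * t n) * \<phi> x) * b n"
   unfolding b_def by (rule C(2)) (use t in auto)
  have "(\<integral>\<^sup>+w. ennreal (?e * \<bar>Dv G (t n) w\<bar>) \<partial>P x) = ennreal ?e * (\<integral>\<^sup>+w. ennreal \<bar>Dv G (t n) w\<bar> \<partial>P x)"
   by (subst nn_integral_cmult[symmetric]) (auto simp: ennreal_mult)
  also have "... <= ennreal ?e * (ennreal (exp (lam * t n) * (C' * exp (- lam * t n / 4))) + (ennreal (C * exp (lam * t n) * \<phi> x) * b n + ennreal (C * exp (lam * t n) * \<phi> x) * b n))"
   using order_trans[OF 1 add_mono[OF 2[unfolded e3] add_mono[OF 3 3]]] by (rule mult_left_mono) simp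
  also have "... = ennreal ?e * ennreal (exp (lam * t n) * (C' * exp (- lam * t n / 4))) + (ennreal ?e * ennreal (2 * C * exp (lam * t n) * \<phi> x)) * b n"
  proof -
   have "ennreal (C * exp (lam * t n) * \<phi> x) * b n + ennreal (C * exp (lam * t n) * \<phi> x) * b n = (ennreal (C * exp (lam * t n) * \<phi> x) + ennreal (C * exp (lam * t n) * \<phi> x)) * b n"
    by (simp only: distrib_right)
   also have "ennreal (C * exp (lam * t n) * \<phi> x) + ennreal (C * exp (lam * t n) * \<phi> x) = ennreal (2 * C * exp (lam * t n) * \<phi> x)"
    using C(1) \<phi>_nonneg[of x] by (simp add: ennreal_plus[symmetric] del: ennreal_plus)
   finally show ?thesis by (simp only: distrib_left mult.assoc)
  qed
  also have "ennreal ?e * ennreal (exp (lam * t n) * (C' * exp (- lam * t n / 4))) = ennreal (C' * exp (- lam * t n / 4))"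
   using C' by (simp add: ennreal_mult[symmetric] mult.assoc[symmetric] exp_add[symmetric])
  also have "ennreal ?e * ennreal (2 * C * exp (lam * t n) * \<phi> x) = ennreal (2 * C * \<phi> x)"
  proof -
   have "ennreal ?e * ennreal (2 * C * exp (lam * t n) * \<phi> x) = ennreal (?e * (2 * C * exp (lam * t n) * \<phi> x))"
    using C(1) \<phi>_nonneg[of x] by (simp add: ennreal_mult[symmetric])
   also have "?e * (2 * C * exp (lam * t n) * \<phi> x) = (?e * exp (lam * t n)) * (2 * C * \<phi> x)" by (simp only: mult_ac)
   also have "?e * exp (lam * t n) = 1" by (simp add: exp_add[symmetric])
   finally show ?thesis by simp
  qed
  finally show ?thesis .
 qed
 have "(\<Sum>n. \<integral>\<^sup>+w. ennreal (exp (- lam * t n) * \<bar>Dv G (t n) w\<bar>) \<partial>P x) <= (\<Sum>n. ennreal (C' * exp (- lam * t n / 4)) + ennreal (2 * C * \<phi> x) * b n)"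
  by (intro suminf_le tm) auto
 also have "... = (\<Sum>n. ennreal (C' * exp (- lam * t n / 4))) + ennreal (2 * C * \<phi> x) * (\<Sum>n. b n)"
  by (simp add: suminf_add[symmetric] ennreal_suminf_cmult)
 also have "... < \<top>"
 proof -
  have e: "exp (- lam * t n / 4) = exp (- lam * d / 4) ^ Suc n" for n
   unfolding t_def by (subst exp_of_nat_mult[symmetric]) (simp add: field_simps del: of_nat_Suc)
  have "summable (\<lambda>n. exp (- lam * d / 4) ^ Suc n)"
   unfolding summable_Suc_iff using lam_pos d by (intro summable_geometric) simp
  then have "summable (\<lambda>n. C' * exp (- lam * t n / 4))" unfolding e by (rule summable_mult)
  then have "(\<Sum>n. ennreal (C' * exp (- lam * t n / 4))) = ennreal (\<Sum>n. C' * exp (- lam * t n / 4))"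
   by (rule suminf_ennreal2[rotated]) (use C' in simp)
  then show ?thesis using sb by (simp add: ennreal_mult_less_top)
 qed
 finally show ?thesis unfolding t_def .
qed

end

text \<open>A limit in two parameters: the delay \<open>k\<close> is fixed so large that the
  geometric term is small for all late \<open>n\<close>, and then \<open>n\<close> tends to infinity
  with \<open>k\<close> fixed.\<close>

lemma shifted_limit:
 fixes a wa :: "nat => real"
 assumes wa: "wa \<longlonglongrightarrow> M" and w0: "\<And>n. 0 <= wa n" and \<rho>: "0 <= \<rho>" "\<rho> < 1" and K: "0 <= K"
  and e: "\<And>k. e k \<longlonglongrightarrow> 0" and le: "\<And>n k. \<bar>a (n + c * k) - r * wa n\<bar> <= e k n + \<rho> ^ k * K * wa n"
 shows "a \<longlonglongrightarrow> r * M"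
proof (rule LIMSEQ_I)
 fix \<epsilon> :: real assume \<epsilon>: "0 < \<epsilon>"
 have M: "0 <= M" using wa w0 by (intro LIMSEQ_le_const) auto
 have "(\<lambda>k. \<rho> ^ k * K * (M + 1)) \<longlonglongrightarrow> 0 * K * (M + 1)" using \<rho> by (intro tendsto_intros LIMSEQ_power_zero) auto
 then have "eventually (\<lambda>k. \<rho> ^ k * K * (M + 1) < \<epsilon> / 3) sequentially" using \<epsilon> by (intro order_tendstoD(2)) auto
 then obtain k where k: "\<rho> ^ k * K * (M + 1) < \<epsilon> / 3" by (auto simp: eventually_sequentially)
 have "(\<lambda>n. r * wa n) \<longlonglongrightarrow> r * M" by (intro tendsto_intros wa)
 then obtain N1 where N1: "\<And>n. N1 <= n ==> \<bar>r * wa n - r * M\<bar> < \<epsilon> / 3" using LIMSEQ_D[of _ _ "\<epsilon> / 3"] \<epsilon> by (metis divide_pos_pos real_norm_def zero_less_numeral)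
 obtain N2 where N2: "\<And>n. N2 <= n ==> \<bar>e k n\<bar> < \<epsilon> / 3" using LIMSEQ_D[OF e, of "\<epsilon> / 3" k] \<epsilon> by auto
 obtain N3 where N3: "\<And>n. N3 <= n ==> wa n < M + 1" using order_tendstoD(2)[OF wa, of "M + 1"] by (auto simp: eventually_sequentially)
 show "\<exists>no. \<forall>n\<ge>no. norm (a n - r * M) < \<epsilon>"
 proof (intro exI[of _ "N1 + N2 + N3 + c * k"] allI impI)
  fix n assume n: "N1 + N2 + N3 + c * k <= n"
  define n' where "n' = n - c * k"
  have n': "n = n' + c * k" "N1 <= n'" "N2 <= n'" "N3 <= n'" using n by (auto simp: n'_def)
  have "\<rho> ^ k * K * wa n' <= \<rho> ^ k * K * (M + 1)" using N3[OF n'(4)] \<rho> K by (intro mult_left_mono) auto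
  then have "\<rho> ^ k * K * wa n' < \<epsilon> / 3" using k by linarith
  then show "norm (a n - r * M) < \<epsilon>" using le[of n' k] N1[OF n'(2)] N2[OF n'(3)] unfolding n'(1) real_norm_def by arith
 qed
qed

section \<open>Convergence of W and the law of large numbers along a fixed lattice\<close>

context supercritical
begin

lemma QQ_bounded_by_\<phi>:
 assumes t: "0 <= t" and K: "0 <= K" and h: "\<And>x. 0 <= h x \<and> h x <= K * \<phi> x"
 shows "QQ t (\<lambda>x. ennreal (h x)) x <= ennreal (K * exp (lam * t) * \<phi> x)"
proof -
 have "QQ t (\<lambda>x. ennreal (h x)) x <= QQ t (\<lambda>x. ennreal K * e\<phi> x) x"
  using h K by (intro QQ_mono) (simp add: ennreal_mult'[symmetric] ennreal_leI)
 also have "... = ennreal K * QQ t e\<phi> x" by (rule QQ_cmult) measurable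
 also have "... = ennreal (K * exp (lam * t) * \<phi> x)" using K by (simp add: QQ_\<phi> t ennreal_mult'[symmetric] mult.assoc)
 finally show ?thesis .
qed

definition W :: "'a tree => real => real" where
 "W w t = exp (- lam * t) * enn2real (XE w t (oE e\<phi>))"

lemma W_measurable[measurable]: "(\<lambda>w. W w t) \<in> borel_measurable Omega_space"
 unfolding W_def by measurable

lemma W_nonneg: "0 <= W w t" by (simp add: W_def)

lemma W_Xf: "w \<in> Reg ==> W w t = exp (- lam * t) * Xf w t \<phi>"
 unfolding W_def using Xf_enn2real[of w \<phi> t] \<phi>_nonneg by simp

lemma lln_AE:
 assumes G[measurable]: "G \<in> borel_measurable Omega_space" and G0: "\<And>w. 0 <= G w"
  and K: "0 <= K" "\<And>y. (\<integral>\<^sup>+w. ennreal (G w) \<partial>P y) <= ennreal (K * \<phi> y)"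
  and LG: "mu (\<lambda>y. \<integral>\<^sup>+w. LL (ennreal (G w)) \<partial>P y) < \<top>" and d: "0 < d"
 shows "AE w in P x. summable (\<lambda>n. exp (- lam * (d * real (Suc n))) * \<bar>SS w (d * real (Suc n)) G - Xf w (d * real (Suc n)) (cG G)\<bar>)"
proof -
 let ?a = "\<lambda>n w. exp (- lam * (d * real (Suc n))) * \<bar>Dv G (d * real (Suc n)) w\<bar>"
 have "(\<integral>\<^sup>+w. (\<Sum>n. ennreal (?a n w)) \<partial>P x) = (\<Sum>n. \<integral>\<^sup>+w. ennreal (?a n w) \<partial>P x)"
  by (rule nn_integral_suminf) measurable
 also have "... < \<top>" by (rule lln_step[OF G G0 K LG d])
 finally have f: "(\<integral>\<^sup>+w. (\<Sum>n. ennreal (?a n w)) \<partial>P x) \<noteq> \<infinity>" by simp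
 have "AE w in P x. (\<Sum>n. ennreal (?a n w)) \<noteq> \<infinity>" by (rule nn_integral_PInf_AE[OF _ f]) measurable
 with AE_Reg[of x] show ?thesis
 proof eventually_elim
  case (elim w)
  have "summable (\<lambda>n. ?a n w)" by (rule summable_suminf_not_top) (use elim(2) in auto)
  then show ?case unfolding Dv_def using SS_enn2real[OF elim(1), of G] Xf_enn2real[OF elim(1), of "cG G"] G0 cG_nonneg by simp
 qed
qed

text \<open>The functional <h, X_T> of a subtree. Summed over the particles alive at
  \<open>t\<close> it is <h, X_(t+T)>, so the law of large numbers compares the population with its
  conditional mean a time \<open>T\<close> earlier.\<close>

definition GT :: "real => ('a => real) => 'a tree => real" where
 "GT T h w = enn2real (XE w T (oE (\<lambda>x. ennreal (h x))))"

lemma GT_measurable[measurable]: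
 assumes [measurable]: "h \<in> borel_measurable borel" shows "GT T h \<in> borel_measurable Omega_space"
 unfolding GT_def[abs_def] by measurable

lemma GT_mean:
 assumes [measurable]: "h \<in> borel_measurable borel"
 shows "(\<integral>\<^sup>+w. ennreal (GT T h w) \<partial>P y) = QQ T (\<lambda>x. ennreal (h x)) y"
 unfolding QQ_def by (rule nn_integral_cong_AE, rule eventually_mono[OF AE_Reg]) (use XE_finite_real in \<open>auto simp: GT_def\<close>)

lemma GT_finite:
 assumes r: "w \<in> Reg" and t: "0 <= t" "0 <= T" and u: "u \<in> alive w t"
 shows "XE (subT t u w) T (oE (\<lambda>x. ennreal (h x))) < \<top>"
proof -
 have "SE w t (\<lambda>w'. XE w' T (oE (\<lambda>x. ennreal (h x)))) < \<top>"
  using XE_finite_real[OF r, of "t + T" h] XE_add[OF Reg_space[OF r] t] by simp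
 then show ?thesis using u Reg_alive[OF r, of t] unfolding SE_finite[OF Reg_alive[OF r]] by (simp add: less_top[symmetric])
qed

lemma GT_SS:
 assumes r: "w \<in> Reg" and h: "\<And>x. 0 <= h x" and t: "0 <= t" "0 <= T"
 shows "SS w t (GT T h) = Xf w (t + T) h"
proof -
 let ?h = "oE (\<lambda>x. ennreal (h x))"
 have "SE w t (\<lambda>w'. ennreal (GT T h w')) = SE w t (\<lambda>w'. XE w' T ?h)"
  unfolding SE_finite[OF Reg_alive[OF r]] GT_def by (intro sum.cong refl) (use GT_finite[OF r t] in auto)
 also have "... = XE w (t + T) ?h" using XE_add[OF Reg_space[OF r] t] by simp
 finally show ?thesis using SS_enn2real[OF r, of "GT T h" t] Xf_enn2real[OF r, of h "t + T"] h by (simp add: GT_def)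
qed

text \<open>The moment of <phi, X_T> is inherited by every functional dominated by a multiple of it;
  scaling costs just a term linear in the mean.\<close>

lemma LlogL_le:
 assumes T: "0 <= T" and K: "0 <= K"
  and G: "\<And>w. ennreal (G w) <= ennreal K * XE w T (oE e\<phi>)"
 shows "mu (\<lambda>y. \<integral>\<^sup>+w. LL (ennreal (G w)) \<partial>P y) < \<top>"
proof -
 let ?c = "ennreal (K * ln (1 + K))"
 have "mu (\<lambda>y. \<integral>\<^sup>+w. LL (ennreal (G w)) \<partial>P y) <= mu (\<lambda>y. \<integral>\<^sup>+w. ?c * XE w T (oE e\<phi>) + ennreal K * LL (XE w T (oE e\<phi>)) \<partial>P y)"
  by (intro mu_mono nn_integral_mono order_trans[OF LL_mono[OF G] LL_scale[OF K]])
 also have "... = mu (\<lambda>y. ?c * QQ T e\<phi> y + ennreal K * (\<integral>\<^sup>+w. LL (XE w T (oE e\<phi>)) \<partial>P y))"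
  unfolding QQ_def by (simp add: nn_integral_add nn_integral_cmult)
 also have "... = ?c * mu (QQ T e\<phi>) + ennreal K * mu (\<lambda>y. \<integral>\<^sup>+w. LL (XE w T (oE e\<phi>)) \<partial>P y)"
  by (simp add: mu_add mu_cmult)
 also have "QQ T e\<phi> = (\<lambda>y. ennreal (exp (lam * T)) * e\<phi> y)" by (simp add: fun_eq_iff QQ_\<phi> T ennreal_mult')
 also have "mu (\<lambda>y. ennreal (exp (lam * T)) * e\<phi> y) = ennreal (exp (lam * T))" by (subst mu_cmult) (auto simp: mu_\<phi>)
 finally show ?thesis using LlogL_moment[OF T] by (auto simp: ennreal_mult_less_top elim: le_less_trans)
qed

lemma lln_shift:
 assumes h[measurable]: "h \<in> borel_measurable borel" and K: "0 <= K" and hK: "\<And>x. 0 <= h x \<and> h x <= K * \<phi> x"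
  and d: "0 < d" and T: "0 <= T"
 shows "AE w in P x. summable (\<lambda>n. exp (- lam * (d * real (Suc n))) *
   \<bar>Xf w (d * real (Suc n) + T) h - Xf w (d * real (Suc n)) (\<lambda>y. enn2real (QQ T (\<lambda>x. ennreal (h x)) y))\<bar>)"
proof -
 have cG: "cG (GT T h) = (\<lambda>y. enn2real (QQ T (\<lambda>x. ennreal (h x)) y))" by (simp add: cG_def fun_eq_iff GT_mean)
 have XEle: "ennreal (GT T h w) <= ennreal K * XE w T (oE e\<phi>)" for w
 proof -
  have "ennreal (GT T h w) <= XE w T (oE (\<lambda>x. ennreal (h x)))" unfolding GT_def by (cases "XE w T (oE (\<lambda>x. ennreal (h x)))") auto
  also have "... <= XE w T (oE (\<lambda>x. ennreal K * e\<phi> x))" unfolding XE_def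
   using hK K by (intro nn_integral_mono) (auto simp: oE_def ennreal_mult'[symmetric] ennreal_leI split: option.split)
  finally show ?thesis unfolding XE_oE_cmult .
 qed
 have "AE w in P x. summable (\<lambda>n. exp (- lam * (d * real (Suc n))) * \<bar>SS w (d * real (Suc n)) (GT T h) - Xf w (d * real (Suc n)) (cG (GT T h))\<bar>)"
 proof (rule lln_AE)
  show "mu (\<lambda>y. \<integral>\<^sup>+w. LL (ennreal (GT T h w)) \<partial>P y) < \<top>" by (rule LlogL_le[OF T K XEle])
  show "(\<integral>\<^sup>+w. ennreal (GT T h w) \<partial>P y) <= ennreal (K * exp (lam * T) * \<phi> y)" for y
   unfolding GT_mean[OF h] by (rule QQ_bounded_by_\<phi>[OF T K hK])
 qed (use d K in \<open>auto simp: GT_def\<close>)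
 with AE_Reg[of x] show ?thesis
 proof eventually_elim
  case (elim w)
  have "SS w (d * real (Suc n)) (GT T h) = Xf w (d * real (Suc n) + T) h" for n
   by (rule GT_SS) (use elim d T hK in auto)
  then show ?case using elim(2) unfolding cG by simp
 qed
qed

lemma Xf_diff_le:
 assumes "\<And>y. \<bar>f y - g y\<bar> <= h y" shows "\<bar>Xf w t f - Xf w t g\<bar> <= Xf w t h"
 unfolding Xf_def sum_subtractf[symmetric] by (rule order_trans[OF sum_abs]) (intro sum_mono assms)

lemma Xf_cmult: "Xf w t (\<lambda>x. c * f x) = c * Xf w t f" by (simp add: Xf_def sum_distrib_left)

lemma Xf_mono: "(\<And>x. f x <= g x) ==> Xf w t f <= Xf w t g" by (auto simp: Xf_def intro!: sum_mono)

text \<open>\<phi> is an eigenfunction, so the conditional mean of W at \<open>t + d\<close> is W at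
  \<open>t\<close> and the centred sum is the increment. Summability in mean is used twice: for
  convergence along lattices and for the oscillation between lattice times.\<close>

lemma W_increments:
 assumes d: "0 < d"
 shows "(\<Sum>n. \<integral>\<^sup>+w. ennreal \<bar>W w (d * real (Suc n) + d) - W w (d * real (Suc n))\<bar> \<partial>P x) < \<top>"
proof -
 let ?t = "\<lambda>n. d * real (Suc n)"
 have "(\<Sum>n. \<integral>\<^sup>+w. ennreal (exp (- lam * ?t n) * \<bar>Dv (GT d \<phi>) (?t n) w\<bar>) \<partial>P x) < \<top>"
 proof (rule lln_step)
  show "mu (\<lambda>y. \<integral>\<^sup>+w. LL (ennreal (GT d \<phi> w)) \<partial>P y) < \<top>"
  proof (rule LlogL_le[of d 1])
   show "ennreal (GT d \<phi> w) <= ennreal 1 * XE w d (oE e\<phi>)" for w unfolding GT_def by (cases "XE w d (oE e\<phi>)") auto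
  qed (use d in auto)
  show "(\<integral>\<^sup>+w. ennreal (GT d \<phi> w) \<partial>P y) <= ennreal (exp (lam * d) * \<phi> y)" for y
   unfolding GT_mean[OF \<phi>_measurable] using d by (simp add: QQ_\<phi>)
 qed (use d in \<open>auto simp: GT_def\<close>)
 also have "(\<lambda>n. \<integral>\<^sup>+w. ennreal (exp (- lam * ?t n) * \<bar>Dv (GT d \<phi>) (?t n) w\<bar>) \<partial>P x) = (\<lambda>n. \<integral>\<^sup>+w. ennreal (exp (lam * d)) * ennreal \<bar>W w (?t n + d) - W w (?t n)\<bar> \<partial>P x)"
 proof (rule ext, rule nn_integral_cong_AE, rule eventually_mono[OF AE_Reg])
  fix w n assume r: "w \<in> Reg"
  have c: "cG (GT d \<phi>) = (\<lambda>y. exp (lam * d) * \<phi> y)" using \<phi>_nonneg d by (simp add: cG_def fun_eq_iff GT_mean QQ_\<phi>)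
  have "Dv (GT d \<phi>) (?t n) w = SS w (?t n) (GT d \<phi>) - Xf w (?t n) (cG (GT d \<phi>))"
   unfolding Dv_def using SS_enn2real[OF r, of "GT d \<phi>"] Xf_enn2real[OF r, of "cG (GT d \<phi>)"] cG_nonneg by (simp add: GT_def)
  also have "... = Xf w (?t n + d) \<phi> - exp (lam * d) * Xf w (?t n) \<phi>"
   unfolding c Xf_cmult by (subst GT_SS[OF r \<phi>_nonneg]) (use d in auto)
  finally have D: "Dv (GT d \<phi>) (?t n) w = Xf w (?t n + d) \<phi> - exp (lam * d) * Xf w (?t n) \<phi>" .
  have e: "exp (- lam * ?t n) = exp (lam * d) * exp (- lam * (?t n + d))" by (simp add: exp_add[symmetric] algebra_simps)
  have "exp (- lam * ?t n) * Dv (GT d \<phi>) (?t n) w = exp (- lam * ?t n) * Xf w (?t n + d) \<phi> - exp (lam * d) * (exp (- lam * ?t n) * Xf w (?t n) \<phi>)"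
   unfolding D by (simp only: right_diff_distrib mult_ac)
  also have "exp (- lam * ?t n) * Xf w (?t n + d) \<phi> = exp (lam * d) * W w (?t n + d)" unfolding W_Xf[OF r] e by (simp only: mult.assoc)
  finally have "\<bar>exp (- lam * ?t n) * Dv (GT d \<phi>) (?t n) w\<bar> = \<bar>exp (lam * d) * (W w (?t n + d) - W w (?t n))\<bar>"
   unfolding W_Xf[OF r] by (simp only: right_diff_distrib)
  then show "ennreal (exp (- lam * ?t n) * \<bar>Dv (GT d \<phi>) (?t n) w\<bar>) = ennreal (exp (lam * d)) * ennreal \<bar>W w (?t n + d) - W w (?t n)\<bar>"
   by (simp only: abs_mult abs_exp_cancel ennreal_mult'[OF abs_ge_zero] ennreal_mult''[OF abs_ge_zero])
 qed
 finally have "(\<Sum>n. ennreal (exp (lam * d)) * (\<integral>\<^sup>+w. ennreal \<bar>W w (?t n + d) - W w (?t n)\<bar> \<partial>P x)) < \<top>"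
  by (subst (asm) nn_integral_cmult) auto
 then show ?thesis by (auto simp: ennreal_suminf_cmult ennreal_mult_less_top)
qed

lemma W_lattice:
 assumes d: "0 < d" shows "AE w in P x. convergent (\<lambda>n. W w (d * real (Suc n)))"
proof -
 let ?t = "\<lambda>n. d * real (Suc n)"
 let ?a = "\<lambda>n w. \<bar>W w (?t n + d) - W w (?t n)\<bar>"
 have "(\<integral>\<^sup>+w. (\<Sum>n. ennreal (?a n w)) \<partial>P x) = (\<Sum>n. \<integral>\<^sup>+w. ennreal (?a n w) \<partial>P x)" by (rule nn_integral_suminf) measurable
 then have f: "(\<integral>\<^sup>+w. (\<Sum>n. ennreal (?a n w)) \<partial>P x) \<noteq> \<infinity>" using W_increments[OF d, of x] by simp
 have "AE w in P x. (\<Sum>n. ennreal (?a n w)) \<noteq> \<infinity>" by (rule nn_integral_PInf_AE[OF _ f]) measurable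
 then show ?thesis
 proof eventually_elim
  case (elim w)
  have s: "?t n + d = ?t (Suc n)" for n by (simp add: algebra_simps)
  have "summable (\<lambda>n. ?a n w)" by (rule summable_suminf_not_top) (use elim in auto)
  then have "summable (\<lambda>n. W w (?t (Suc n)) - W w (?t n))" unfolding s by (rule summable_rabs_cancel)
  then have "convergent (\<lambda>n. \<Sum>i<n. W w (?t (Suc i)) - W w (?t i))" by (simp add: summable_iff_convergent)
  then have "convergent (\<lambda>n. W w (?t n) - W w (?t 0))" unfolding sum_lessThan_telescope[of "\<lambda>n. W w (?t n)"] .
  then show ?case using convergent_add_const_iff[of "- W w (?t 0)" "\<lambda>n. W w (?t n)"] by simp
 qed
qed

text \<open>Two replacements: the sum of \<open>G\<close> by the population functional of its
  conditional mean, and that functional by its own conditional mean \<open>3 * d * real k\<close>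
  earlier, which the spectral gap compares with a multiple of W up to an error geometric in
  \<open>k\<close>.\<close>

lemma lattice_lln:
 assumes G[measurable]: "G \<in> borel_measurable Omega_space" and G0: "\<And>w. 0 <= G w"
  and K: "0 <= K" "\<And>y. (\<integral>\<^sup>+w. ennreal (G w) \<partial>P y) <= ennreal (K * \<phi> y)"
  and LG: "mu (\<lambda>y. \<integral>\<^sup>+w. LL (ennreal (G w)) \<partial>P y) < \<top>" and d: "0 < d"
 shows "AE w in P x. \<forall>M. (\<lambda>n. W w (d * real (Suc n))) \<longlonglongrightarrow> M \<longrightarrow>
  (\<lambda>n. exp (- lam * (d * real (Suc n))) * SS w (d * real (Suc n)) G) \<longlonglongrightarrow> enn2real (mu (\<lambda>y. ennreal (cG G y))) * M"
proof -
 define h where "h = cG G"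
 let ?t = "\<lambda>n. d * real (Suc n)"
 let ?Q = "\<lambda>k y. enn2real (QQ (3 * d * real k) (\<lambda>x. ennreal (h x)) y)"
 define r where "r = enn2real (mu (\<lambda>y. ennreal (h y)))"
 have hm[measurable]: "h \<in> borel_measurable borel" by (simp add: h_def)
 have hK: "0 <= h y \<and> h y <= K * \<phi> y" for y
 proof -
  have "ennreal (h y) <= ennreal (K * \<phi> y)" unfolding h_def cG_def using K(2)[of y] le_less_trans[OF K(2)[of y] ennreal_less_top] by simp
  then show ?thesis using K(1) \<phi>_nonneg[of y] by (simp add: ennreal_le_iff h_def cG_nonneg)
 qed
 obtain \<rho> where \<rho>: "0 <= \<rho>" "\<rho> < 1" and erg: "\<And>k y. \<bar>exp (- lam * (3 * d * real k)) * ?Q k y - r * \<phi> y\<bar> <= \<rho> ^ k * K * \<phi> y"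
  using ergodic[OF d] K(1) hK hm unfolding r_def by blast
 have a1: "AE w in P x. summable (\<lambda>n. exp (- lam * ?t n) * \<bar>SS w (?t n) G - Xf w (?t n) h\<bar>)"
  unfolding h_def by (rule lln_AE[OF G G0 K LG d])
 have a2: "AE w in P x. \<forall>k. summable (\<lambda>n. exp (- lam * ?t n) * \<bar>Xf w (?t n + 3 * d * real k) h - Xf w (?t n) (?Q k)\<bar>)"
  unfolding AE_all_countable by (intro allI lln_shift[OF hm K(1) hK d]) (use d in auto)
 from AE_Reg[of x] a1 a2 show ?thesis
 proof eventually_elim
  case (elim w)
  show ?case
  proof (intro allI impI)
   fix M assume wa: "(\<lambda>n. W w (?t n)) \<longlonglongrightarrow> M"
   let ?e = "\<lambda>k n. exp (- lam * (3 * d * real k)) * (exp (- lam * ?t n) * \<bar>Xf w (?t n + 3 * d * real k) h - Xf w (?t n) (?Q k)\<bar>)"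
   let ?a = "\<lambda>n. exp (- lam * ?t n) * Xf w (?t n) h"
   have "?a \<longlonglongrightarrow> r * M"
   \<comment> \<open>The shift is by \<open>3 * k\<close> lattice steps because one contraction step
     has length \<open>3 * d\<close>.\<close>
   proof (rule shifted_limit[OF wa W_nonneg \<rho> K(1), of ?e _ 3])
    show "?e k \<longlonglongrightarrow> 0" for k using elim(3) by (intro tendsto_mult_right_zero summable_LIMSEQ_zero) auto
    fix n k
    let ?T = "3 * d * real k"
    have s: "?t (n + 3 * k) = ?t n + ?T" by (simp add: algebra_simps)
    have ex: "exp (- lam * (?t n + ?T)) = exp (- lam * ?T) * exp (- lam * ?t n)" by (simp add: exp_add[symmetric] algebra_simps)
    have "\<bar>exp (- lam * ?T) * Xf w (?t n) (?Q k) - r * Xf w (?t n) \<phi>\<bar> <= \<rho> ^ k * K * Xf w (?t n) \<phi>"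
     unfolding Xf_cmult[symmetric] by (rule Xf_diff_le) (rule erg)
    then have "exp (- lam * ?t n) * \<bar>exp (- lam * ?T) * Xf w (?t n) (?Q k) - r * Xf w (?t n) \<phi>\<bar> <= exp (- lam * ?t n) * (\<rho> ^ k * K * Xf w (?t n) \<phi>)"
     by (rule mult_left_mono) simp
    also have "... = \<rho> ^ k * K * W w (?t n)" unfolding W_Xf[OF elim(1)] by (simp only: mult_ac)
    finally have 1: "\<bar>exp (- lam * ?t n) * (exp (- lam * ?T) * Xf w (?t n) (?Q k) - r * Xf w (?t n) \<phi>)\<bar> <= \<rho> ^ k * K * W w (?t n)"
     by (simp only: abs_mult abs_exp_cancel)
    have 2: "?e k n = \<bar>exp (- lam * ?T) * (exp (- lam * ?t n) * (Xf w (?t n + ?T) h - Xf w (?t n) (?Q k)))\<bar>"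
     by (simp only: abs_mult abs_exp_cancel)
    have "?a (n + 3 * k) - r * W w (?t n)
     = exp (- lam * ?T) * (exp (- lam * ?t n) * (Xf w (?t n + ?T) h - Xf w (?t n) (?Q k)))
      + exp (- lam * ?t n) * (exp (- lam * ?T) * Xf w (?t n) (?Q k) - r * Xf w (?t n) \<phi>)"
     unfolding s ex W_Xf[OF elim(1)] by (simp only: algebra_simps)
    then show "\<bar>?a (n + 3 * k) - r * W w (?t n)\<bar> <= ?e k n + \<rho> ^ k * K * W w (?t n)"
     using 1 unfolding 2 by (simp only: order_trans[OF abs_triangle_ineq] add_left_mono)
   qed
   moreover have "(\<lambda>n. exp (- lam * ?t n) * \<bar>SS w (?t n) G - Xf w (?t n) h\<bar>) \<longlonglongrightarrow> 0" using elim(2) by (rule summable_LIMSEQ_zero)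
   then have "(\<lambda>n. exp (- lam * ?t n) * (SS w (?t n) G - Xf w (?t n) h)) \<longlonglongrightarrow> 0"
    by (subst tendsto_rabs_zero_iff[symmetric]) (simp only: abs_mult abs_exp_cancel)
   ultimately have "(\<lambda>n. exp (- lam * ?t n) * (SS w (?t n) G - Xf w (?t n) h) + ?a n) \<longlonglongrightarrow> 0 + r * M" by (intro tendsto_add)
   then show "(\<lambda>n. exp (- lam * ?t n) * SS w (?t n) G) \<longlonglongrightarrow> enn2real (mu (\<lambda>y. ennreal (cG G y))) * M"
    unfolding r_def h_def by (simp add: algebra_simps)
  qed
 qed
qed

end

section \<open>Continuous time\<close>

context supercritical
begin

text \<open>An infimum over countably many times, hence measurable. Time 0 belongs to the index set,
  which bounds the functional by the value at the starting point.\<close>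

definition Imin :: "('a => real) => real => 'a tree => ennreal" where
 "Imin f d w = (INF s\<in>\<rat> \<inter> {0..d}. XE w s (oE (\<lambda>x. ennreal (f x))))"

lemma Imin_measurable[measurable]:
 assumes [measurable]: "f \<in> borel_measurable borel" shows "Imin f d \<in> borel_measurable Omega_space"
 unfolding Imin_def[abs_def] by (rule borel_measurable_INF) (auto intro: countable_subset[OF _ countable_rat])

lemma Imin_le: "s \<in> \<rat> ==> 0 <= s ==> s <= d ==> Imin f d w <= XE w s (oE (\<lambda>x. ennreal (f x)))"
 unfolding Imin_def by (rule INF_lower) auto

text \<open>Right continuity at time 0: on a short enough interval <f, X_s> stays above its initial
  value minus any tolerance.\<close>

lemma Imin_SUP:
 assumes r: "w \<in> Reg" and f: "continuous_on UNIV f" and f0: "\<And>x. 0 <= f x"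
 shows "XE w 0 (oE (\<lambda>x. ennreal (f x))) <= (SUP k. Imin f (1 / real (Suc k)) w)"
proof (rule ennreal_le_epsilon)
 have X: "XE w s (oE (\<lambda>x. ennreal (f x))) = ennreal (Xf w s f)" for s
  using XE_Xf[OF Reg_alive[OF r], of f s] f0 unfolding oE_gD by simp
 fix e :: real assume e: "0 < e"
 have "eventually (\<lambda>s. Xf w 0 f - e < Xf w s f) (at_right 0)"
  by (rule order_tendstoD(1)[OF Xf_right_cont[OF r f]]) (use e in simp)
 then obtain b where b: "0 < b" "\<And>s. 0 < s ==> s < b ==> Xf w 0 f - e < Xf w s f"
  by (auto simp: eventually_at_right_field)
 obtain k where k: "1 / real (Suc k) < b" using reals_Archimedean[OF b(1)] by (auto simp: inverse_eq_divide)
 have "ennreal (Xf w 0 f - e) <= Imin f (1 / real (Suc k)) w"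
  unfolding Imin_def X
 proof (rule INF_greatest)
  fix s assume "s \<in> \<rat> \<inter> {0..1 / real (Suc k)}"
  then show "ennreal (Xf w 0 f - e) <= ennreal (Xf w s f)"
   using b(2)[of s] k e by (cases "s = 0") (auto intro!: ennreal_leI)
 qed
 also have "... <= (SUP k. Imin f (1 / real (Suc k)) w)" by (rule SUP_upper) simp
 finally have "ennreal (Xf w 0 f - e) + ennreal e <= (SUP k. Imin f (1 / real (Suc k)) w) + ennreal e" by (rule add_right_mono)
 moreover have "ennreal (Xf w 0 f) <= ennreal (Xf w 0 f - e) + ennreal e"
 proof (cases "e <= Xf w 0 f")
  case True then show ?thesis using e by (simp add: ennreal_plus[symmetric] del: ennreal_plus)
 next
  case False then show ?thesis using e by (simp add: ennreal_neg ennreal_leI)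
 qed
 ultimately show "XE w 0 (oE (\<lambda>x. ennreal (f x))) <= (SUP k. Imin f (1 / real (Suc k)) w) + ennreal e"
  unfolding X by (rule order_trans[rotated])
qed

text \<open>Each particle alive at the last lattice time before \<open>t\<close> contributes at
  least its infimum over the following interval to <f, X_t>. As the spacing tends to 0 the means of
  these infima increase to \<open>f\<close>, so the constant in the bound tends to the right one by
  monotone convergence.\<close>

lemma lower_bound:
 assumes f: "continuous_on UNIV f" and f0: "\<And>x. 0 <= f x" and r: "0 <= r" and fr: "\<And>x. f x <= r * \<phi> x"
 shows "AE w in P x. \<forall>M. (\<lambda>n. W w (real (Suc n))) \<longlonglongrightarrow> M \<longrightarrow>
  (\<forall>\<epsilon>>0. \<exists>N. \<forall>t\<in>\<rat>. real N <= t \<longrightarrow> M * enn2real (mu (\<lambda>x. ennreal (f x))) - \<epsilon> <= exp (- lam * t) * Xf w t f)"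
proof -
 have fm[measurable]: "f \<in> borel_measurable borel" by (rule borel_measurable_continuous_onI[OF f])
 define d where "d k = 1 / real (Suc k)" for k
 have d: "0 < d k" "d k \<in> \<rat>" for k by (auto simp: d_def)
 define G where "G k w = enn2real (Imin f (d k) w)" for k w
 have Gm[measurable]: "G k \<in> borel_measurable Omega_space" for k unfolding G_def by measurable
 have I0: "Imin f (d k) w <= XE w 0 (oE (\<lambda>x. ennreal (f x)))" for k w by (rule Imin_le) (use d[of k] in auto)
 have GI: "ennreal (G k w) <= Imin f (d k) w" for k w unfolding G_def by (cases "Imin f (d k) w") auto
 have G0: "0 <= G k w" for k w by (simp add: G_def)
 have XEr: "XE w 0 (oE (\<lambda>x. ennreal (f x))) <= ennreal r * XE w 0 (oE e\<phi>)" for w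
 proof -
  have "XE w 0 (oE (\<lambda>x. ennreal (f x))) <= XE w 0 (oE (\<lambda>x. ennreal r * e\<phi> x))" unfolding XE_def
   using fr r by (intro nn_integral_mono) (auto simp: oE_def ennreal_mult'[symmetric] ennreal_leI split: option.split)
  then show ?thesis unfolding XE_oE_cmult .
 qed
 have mean0: "(\<integral>\<^sup>+w. XE w 0 (oE (\<lambda>x. ennreal (f x))) \<partial>P y) = ennreal (f y)" for y
  using QQ_0[of "\<lambda>x. ennreal (f x)" y] by (simp add: QQ_def)
 have Gf: "(\<integral>\<^sup>+w. ennreal (G k w) \<partial>P y) <= ennreal (f y)" for k y
  by (rule ord_le_eq_trans[OF nn_integral_mono mean0]) (rule order_trans[OF GI I0])
 have cGe: "ennreal (cG (G k) y) = (\<integral>\<^sup>+w. Imin f (d k) w \<partial>P y)" for k y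
 proof -
  have "ennreal (cG (G k) y) = (\<integral>\<^sup>+w. ennreal (G k w) \<partial>P y)"
   unfolding cG_def using le_less_trans[OF Gf[of y k] ennreal_less_top] by simp
  also have "... = (\<integral>\<^sup>+w. Imin f (d k) w \<partial>P y)"
  proof (rule nn_integral_cong_AE, rule eventually_mono[OF AE_Reg])
   fix w assume "w \<in> Reg"
   then have "Imin f (d k) w < \<top>" using le_less_trans[OF I0 XE_finite_real] by blast
   then show "ennreal (G k w) = Imin f (d k) w" by (simp add: G_def)
  qed
  finally show ?thesis .
 qed
 have dmono: "d k' <= d k" if "k <= k'" for k k' using that by (auto simp: d_def intro!: divide_left_mono)
 have inc: "incseq (\<lambda>k. Imin f (d k) w)" for w
  unfolding Imin_def by (intro monoI INF_superset_mono) ((force dest: dmono), simp)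
 have sup: "(SUP k. ennreal (cG (G k) y)) = ennreal (f y)" for y
 proof (rule antisym)
  show "(SUP k. ennreal (cG (G k) y)) <= ennreal (f y)"
   unfolding cGe by (intro SUP_least ord_le_eq_trans[OF nn_integral_mono mean0] I0)
  have "ennreal (f y) <= (\<integral>\<^sup>+w. (SUP k. Imin f (d k) w) \<partial>P y)"
   unfolding d_def
   by (rule ord_eq_le_trans[OF mean0[symmetric] nn_integral_mono_AE]) (rule eventually_mono[OF AE_Reg Imin_SUP[OF _ f f0]])
  also have "... = (SUP k. ennreal (cG (G k) y))" unfolding cGe
   by (rule nn_integral_monotone_convergence_SUP) (use inc in \<open>auto simp: incseq_def le_fun_def\<close>)
  finally show "ennreal (f y) <= (SUP k. ennreal (cG (G k) y))" .
 qed
 define \<nu> where "\<nu> k = enn2real (mu (\<lambda>y. ennreal (cG (G k) y)))" for k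
 have muf: "mu (\<lambda>x. ennreal (f x)) < \<top>"
 proof -
  have "mu (\<lambda>x. ennreal (f x)) <= mu (\<lambda>x. ennreal r * e\<phi> x)" by (intro mu_mono) (use fr r in \<open>simp add: ennreal_mult'[symmetric] ennreal_leI\<close>)
  also have "... < \<top>" by (subst mu_cmult) (auto simp: mu_\<phi>)
  finally show ?thesis .
 qed
 have incc: "incseq (\<lambda>k. ennreal (cG (G k) y))" for y unfolding cGe using inc by (intro monoI nn_integral_mono) (auto simp: incseq_def)
 have incm: "incseq (\<lambda>k. mu (\<lambda>y. ennreal (cG (G k) y)))" using incc by (intro monoI mu_mono) (auto simp: incseq_def)
 have "(SUP k. mu (\<lambda>y. ennreal (cG (G k) y))) = (\<integral>\<^sup>+y. (SUP k. ennreal (\<phi>h y) * ennreal (cG (G k) y)) \<partial>m)"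
  unfolding mu_def by (rule nn_integral_monotone_convergence_SUP[symmetric])
   (use incc in \<open>auto simp: incseq_def le_fun_def intro!: mult_left_mono\<close>)
 also have "... = mu (\<lambda>x. ennreal (f x))" unfolding mu_def sup[symmetric] by (simp add: SUP_mult_left_ennreal)
 finally have "(\<lambda>k. mu (\<lambda>y. ennreal (cG (G k) y))) \<longlonglongrightarrow> mu (\<lambda>x. ennreal (f x))" using LIMSEQ_SUP[OF incm] by simp
 then have \<nu>: "\<nu> \<longlonglongrightarrow> enn2real (mu (\<lambda>x. ennreal (f x)))" unfolding \<nu>_def[abs_def]
  by (intro tendsto_enn2real) (use muf in auto)
 have a1: "AE w in P x. \<forall>k M. (\<lambda>n. W w (d k * real (Suc n))) \<longlonglongrightarrow> M \<longrightarrow>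
   (\<lambda>n. exp (- lam * (d k * real (Suc n))) * SS w (d k * real (Suc n)) (G k)) \<longlonglongrightarrow> \<nu> k * M"
  unfolding AE_all_countable \<nu>_def
 proof (intro allI lattice_lln[OF Gm G0 r _ _ d(1)])
  fix k
  show "(\<integral>\<^sup>+w. ennreal (G k w) \<partial>P y) <= ennreal (r * \<phi> y)" for y using order_trans[OF Gf ennreal_leI[OF fr]] .
  show "mu (\<lambda>y. \<integral>\<^sup>+w. LL (ennreal (G k w)) \<partial>P y) < \<top>"
   by (rule LlogL_le[of 0, OF _ r]) (auto intro: order_trans[OF GI order_trans[OF I0 XEr]])
 qed
 have a2: "AE w in P x. \<forall>k. convergent (\<lambda>n. W w (d k * real (Suc n)))"
  unfolding AE_all_countable by (intro allI W_lattice d)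
 from AE_Reg[of x] a1 a2 show ?thesis
 proof eventually_elim
  case (elim w)
  show ?case
  proof (intro allI impI)
   fix M and \<epsilon> :: real assume M: "(\<lambda>n. W w (real (Suc n))) \<longlonglongrightarrow> M" and \<epsilon>: "0 < \<epsilon>"
   let ?\<nu> = "enn2real (mu (\<lambda>x. ennreal (f x)))"
   have "(\<lambda>k. exp (- lam * d k) * (\<nu> k * M)) \<longlonglongrightarrow> exp (- lam * 0) * (?\<nu> * M)"
    unfolding d_def by (intro tendsto_intros \<nu> LIMSEQ_Suc[OF lim_1_over_n])
   then have "eventually (\<lambda>k. M * ?\<nu> - \<epsilon> < exp (- lam * d k) * (\<nu> k * M)) sequentially"
    using \<epsilon> by (intro order_tendstoD(1)) (auto simp: mult.commute)
   then obtain k where k: "M * ?\<nu> - \<epsilon> < exp (- lam * d k) * (\<nu> k * M)" by (auto simp: eventually_sequentially)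
   let ?t = "\<lambda>n. d k * real (Suc n)"
   obtain L where L: "(\<lambda>n. W w (?t n)) \<longlonglongrightarrow> L" using elim(3) by (auto simp: convergent_def)
   \<comment> \<open>The lattice time with index \<open>idx n\<close> is the integer
     \<open>Suc n\<close>; hence the limit along this lattice is the limit \<open>M\<close> along
     the integers.\<close>
   define idx where "idx n = k + Suc k * n" for n
   have "strict_mono idx" by (auto simp: strict_mono_def idx_def intro!: add_less_le_mono)
   from LIMSEQ_subseq_LIMSEQ[OF L this] have "(\<lambda>n. W w (?t (idx n))) \<longlonglongrightarrow> L" by (simp add: o_def)
   moreover have "?t (idx n) = real (Suc n)" for n
   proof -
    have "real (Suc (idx n)) = real (Suc k) * real (Suc n)" by (simp add: idx_def algebra_simps)
    then show ?thesis by (simp add: d_def del: of_nat_Suc)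
   qed
   ultimately have "L = M" using LIMSEQ_unique M by auto
   then have "(\<lambda>n. exp (- lam * ?t n) * SS w (?t n) (G k)) \<longlonglongrightarrow> \<nu> k * M" using elim(2) L by blast
   then have "(\<lambda>n. exp (- lam * d k) * (exp (- lam * ?t n) * SS w (?t n) (G k))) \<longlonglongrightarrow> exp (- lam * d k) * (\<nu> k * M)" by (rule tendsto_mult_left)
   then have "eventually (\<lambda>n. M * ?\<nu> - \<epsilon> < exp (- lam * d k) * (exp (- lam * ?t n) * SS w (?t n) (G k))) sequentially"
    using k by (intro order_tendstoD(1))
   then obtain N0 where N0: "\<And>n. N0 <= n ==> M * ?\<nu> - \<epsilon> < exp (- lam * d k) * (exp (- lam * ?t n) * SS w (?t n) (G k))"
    by (auto simp: eventually_sequentially)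
   show "\<exists>N. \<forall>t\<in>\<rat>. real N <= t \<longrightarrow> M * ?\<nu> - \<epsilon> <= exp (- lam * t) * Xf w t f"
   proof (intro exI[of _ "N0 + 1"] ballI impI)
    fix t :: real assume t: "t \<in> \<rat>" "real (N0 + 1) <= t"
    have d1: "d k <= 1" by (simp add: d_def)
    \<comment> \<open>Lattice times are multiples by \<open>Suc n\<close>, so this is the index of
      the last one not after \<open>t\<close>.\<close>
    define n where "n = nat \<lfloor>t / d k\<rfloor> - 1"
    have "real (N0 + 1) <= t / d k" using t(2) d1 d(1)[of k] by (simp add: field_simps) (smt (verit) mult_left_le of_nat_0_le_iff)
    then have fl: "int (N0 + 1) <= \<lfloor>t / d k\<rfloor>" by (simp add: le_floor_iff)
    then have n: "N0 <= n" "real (Suc n) = of_int \<lfloor>t / d k\<rfloor>" unfolding n_def by linarith+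
    have "real (Suc n) <= t / d k" "t / d k < real (Suc n) + 1" unfolding n(2) by linarith+
    then have tn: "?t n <= t" "t <= ?t n + d k" using d(1)[of k] by (simp_all add: field_simps)
    \<comment> \<open>Rational because \<open>t\<close> and the spacing are, so the infimum over
      rational times covers it.\<close>
    define s where "s = t - ?t n"
    have s: "s \<in> \<rat>" "0 <= s" "s <= d k" "t = ?t n + s" using tn t(1) d(2)[of k] by (auto simp: s_def)
    have tn0: "0 <= ?t n" using d(1)[of k] by simp
    have "SS w (?t n) (G k) <= SS w (?t n) (GT s f)"
     unfolding SS_def
    proof (rule sum_mono)
     fix u assume "u \<in> alive w (?t n)"
     from GT_finite[OF elim(1) tn0 s(2) this] show "G k (subT (?t n) u w) <= GT s f (subT (?t n) u w)"
      unfolding G_def GT_def by (intro enn2real_mono Imin_le s)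
    qed
    also have "... = Xf w t f" unfolding s(4) by (rule GT_SS[OF elim(1) f0 tn0 s(2)])
    finally have X: "SS w (?t n) (G k) <= Xf w t f" .
    have "M * ?\<nu> - \<epsilon> <= exp (- lam * d k) * (exp (- lam * ?t n) * SS w (?t n) (G k))" using N0[OF n(1)] by simp
    also have "... = exp (- lam * (?t n + d k)) * SS w (?t n) (G k)" by (simp add: exp_add[symmetric] algebra_simps)
    also have "... <= exp (- lam * t) * Xf w t f"
     using X tn(2) lam_pos by (intro mult_mono) (auto simp: SS_def G0 intro!: sum_nonneg mult_left_mono)
    finally show "M * ?\<nu> - \<epsilon> <= exp (- lam * t) * Xf w t f" .
   qed
  qed
 qed
qed

text \<open>Doob's maximal argument, one-sided: on the event that \<open>W\<close> first exceeds \<open>W w a + \<epsilon>\<close> at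
 time \<open>s\<close>, replace \<open>W w s\<close> by \<open>W w b\<close> in the mean; only the increment over \<open>[a, b]\<close> remains.\<close>
lemma maximal_finite:
 assumes S: "finite S" "\<And>s. s \<in> S ==> a <= s \<and> s <= b" and a: "0 <= a" and \<epsilon>: "0 < \<epsilon>"
 shows "ennreal \<epsilon> * emeasure (P x) {w\<in>space Omega_space. \<exists>s\<in>S. W w a + \<epsilon> < W w s} <= (\<integral>\<^sup>+w. ennreal \<bar>W w b - W w a\<bar> \<partial>P x)"
proof -
 define Q where "Q s w \<longleftrightarrow> W w a + \<epsilon> < W w s \<and> (\<forall>s'\<in>S. s' < s \<longrightarrow> W w s' <= W w a + \<epsilon>)" for s w
 define A where "A s = {w\<in>space Omega_space. Q s w}" for s
 have lt: "Measurable.pred Omega_space (\<lambda>w. W w a + \<epsilon> < W w t)" for t by measurable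
 have Qm[measurable]: "Measurable.pred Omega_space (Q s)" for s
 proof -
  have "Q s = (\<lambda>w. W w a + \<epsilon> < W w s \<and> (\<forall>s'\<in>{s'\<in>S. s' < s}. \<not> W w a + \<epsilon> < W w s'))" by (auto simp: Q_def fun_eq_iff)
  moreover have "Measurable.pred Omega_space (\<lambda>w. \<forall>s'\<in>{s'\<in>S. s' < s}. \<not> W w a + \<epsilon> < W w s')"
   by (rule pred_intros_finite(3)) (use S(1) lt in \<open>auto intro: pred_intros_logic\<close>)
  ultimately show ?thesis using pred_intros_logic(3)[OF lt] by simp
 qed
 have Am[measurable]: "A s \<in> sets Omega_space" for s unfolding A_def by measurable
 have AmP[measurable]: "A s \<in> sets (P x)" for s by simp
 have un: "{w\<in>space Omega_space. \<exists>s\<in>S. W w a + \<epsilon> < W w s} = (\<Union>s\<in>S. A s)"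
 proof (intro set_eqI iffI)
  fix w assume "w \<in> {w\<in>space Omega_space. \<exists>s\<in>S. W w a + \<epsilon> < W w s}"
  then have wa: "w \<in> space Omega_space" "{s\<in>S. W w a + \<epsilon> < W w s} \<noteq> {}" by auto
  let ?s = "Min {s\<in>S. W w a + \<epsilon> < W w s}"
  have "?s \<in> {s\<in>S. W w a + \<epsilon> < W w s}" by (rule Min_in) (use S(1) wa in auto)
  moreover have "W w s' <= W w a + \<epsilon>" if "s' \<in> S" "s' < ?s" for s'
  proof (rule ccontr)
   assume "\<not> ?thesis" then have "?s <= s'" using that(1) S(1) by (intro Min_le) auto
   then show False using that(2) by simp
  qed
  ultimately show "w \<in> (\<Union>s\<in>S. A s)" using wa(1) by (auto simp: A_def Q_def)
 qed (auto simp: A_def Q_def)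
 have disj: "disjoint_family_on A S"
 proof -
  have "\<not> (Q s w \<and> Q s' w)" if "s \<in> S" "s' \<in> S" "s < s'" for s s' w
   using that by (auto simp: Q_def not_less[symmetric])
  then show ?thesis unfolding disjoint_family_on_def A_def by (auto simp: neq_iff)
 qed
 have We: "AE w in P x. ennreal (W w t) = ennreal (exp (- lam * t)) * XE w t (oE e\<phi>)" for t
  by (rule eventually_mono[OF AE_Reg]) (use XE_finite_real[of _ t \<phi>] in \<open>simp add: W_def ennreal_mult'\<close>)
 have step: "ennreal \<epsilon> * emeasure (P x) (A s) <= (\<integral>\<^sup>+w. indicator (A s) w * ennreal \<bar>W w b - W w a\<bar> \<partial>P x)" if s: "s \<in> S" for s
 proof -
  have sab: "a <= s" "s <= b" "0 <= b - s" "0 <= s" using S(2)[OF s] a by auto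
  let ?H = "\<lambda>w. if Q s w then 1 else 0 :: ennreal"
  have HA: "?H w = indicator (A s) w" if "w \<in> space (P x)" for w using that by (simp add: A_def indicator_def)
  \<comment> \<open>The event depends on W up to time \<open>s\<close> alone, which killing at
    \<open>s\<close> does not change; its indicator may thus serve as the past factor in the
    branching property.\<close>
  have inv: "?H (killT s u w) = ?H w" if "pos w s u \<noteq> None" for w u
  proof -
   have "W (killT s u w) r = W w r" if "r <= s" for r unfolding W_def XE_killT[OF \<open>pos w s u \<noteq> None\<close> that] ..
   then show ?thesis using sab by (auto simp: Q_def)
  qed
  have SEb: "AE w in P x. XE w b (oE e\<phi>) = SE w s (\<lambda>w'. XE w' (b - s) (oE e\<phi>))"
   by (rule eventually_mono[OF AE_Reg]) (use XE_add[OF Reg_space sab(4,3)] in simp)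
  have gP: "gP (\<lambda>w'. XE w' (b - s) (oE e\<phi>)) = oE (\<lambda>y. ennreal (exp (lam * (b - s))) * e\<phi> y)"
   unfolding gP_oE QQ_def[symmetric] using QQ_\<phi>[OF sab(3)] by (simp add: ennreal_mult')
  have "(\<integral>\<^sup>+w. ?H w * ennreal (W w b) \<partial>P x) = (\<integral>\<^sup>+w. ennreal (exp (- lam * b)) * (?H w * SE w s (\<lambda>w'. XE w' (b - s) (oE e\<phi>))) \<partial>P x)"
   by (rule nn_integral_cong_AE) (use We[of b] SEb in \<open>eventually_elim, simp add: ac_simps\<close>)
  also have "... = ennreal (exp (- lam * b)) * (\<integral>\<^sup>+w. ?H w * SE w s (\<lambda>w'. XE w' (b - s) (oE e\<phi>)) \<partial>P x)"
   by (rule nn_integral_cmult) measurable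
  also have "(\<integral>\<^sup>+w. ?H w * SE w s (\<lambda>w'. XE w' (b - s) (oE e\<phi>)) \<partial>P x) = (\<integral>\<^sup>+w. ?H w * XE w s (gP (\<lambda>w'. XE w' (b - s) (oE e\<phi>))) \<partial>P x)"
   by (rule nn_integral_SE[OF _ _ inv]) measurable
  also have "ennreal (exp (- lam * b)) * ... = (\<integral>\<^sup>+w. ennreal (exp (- lam * b)) * (?H w * XE w s (gP (\<lambda>w'. XE w' (b - s) (oE e\<phi>)))) \<partial>P x)"
   by (rule nn_integral_cmult[symmetric]) (simp add: gP)
  also have "... = (\<integral>\<^sup>+w. ?H w * ennreal (W w s) \<partial>P x)"
  proof (rule nn_integral_cong_AE, rule eventually_mono[OF We[of s]])
   fix w assume wa: "ennreal (W w s) = ennreal (exp (- lam * s)) * XE w s (oE e\<phi>)"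
   have "ennreal (exp (- lam * b)) * (?H w * (ennreal (exp (lam * (b - s))) * XE w s (oE e\<phi>)))
     = ?H w * ((ennreal (exp (- lam * b)) * ennreal (exp (lam * (b - s)))) * XE w s (oE e\<phi>))" by (simp only: mult_ac)
   also have "ennreal (exp (- lam * b)) * ennreal (exp (lam * (b - s))) = ennreal (exp (- lam * s))"
    by (simp add: ennreal_mult'[symmetric] exp_add[symmetric] algebra_simps)
   finally show "ennreal (exp (- lam * b)) * (?H w * XE w s (gP (\<lambda>w'. XE w' (b - s) (oE e\<phi>)))) = ?H w * ennreal (W w s)"
    unfolding gP XE_oE_cmult wa .
  qed
  \<comment> \<open>The martingale identity on the event that \<open>s\<close> is the first
    exceedance.\<close>
  finally have eq: "(\<integral>\<^sup>+w. ?H w * ennreal (W w b) \<partial>P x) = (\<integral>\<^sup>+w. ?H w * ennreal (W w s) \<partial>P x)" .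
  let ?wa = "\<integral>\<^sup>+w. ?H w * ennreal (W w a) \<partial>P x"
  have "?wa <= (\<integral>\<^sup>+w. ennreal (exp (- lam * a)) * XE w a (oE e\<phi>) \<partial>P x)"
   by (rule nn_integral_mono_AE, rule eventually_mono[OF We[of a]]) auto
  also have "... = ennreal (exp (- lam * a)) * QQ a e\<phi> x" unfolding QQ_def by (rule nn_integral_cmult) measurable
  also have "... < \<top>" using a by (simp add: QQ_\<phi> ennreal_mult_less_top)
  \<comment> \<open>The term with W at \<open>a\<close> is added to both sides instead of being
    subtracted; it can be cancelled since it is finite.\<close>
  finally have fin: "?wa < \<top>" .
  have "ennreal \<epsilon> * emeasure (P x) (A s) = ennreal \<epsilon> * (\<integral>\<^sup>+w. indicator (A s) w \<partial>P x)" by simp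
  also have "... = ennreal \<epsilon> * (\<integral>\<^sup>+w. ?H w \<partial>P x)" by (intro arg_cong2[where f="(*)"] refl nn_integral_cong) (rule HA[symmetric])
  also have "... = (\<integral>\<^sup>+w. ennreal \<epsilon> * ?H w \<partial>P x)" by (rule nn_integral_cmult[symmetric]) measurable
  finally have "ennreal \<epsilon> * emeasure (P x) (A s) + ?wa = (\<integral>\<^sup>+w. ennreal \<epsilon> * ?H w + ?H w * ennreal (W w a) \<partial>P x)"
   by (subst nn_integral_add) auto
  also have "... <= (\<integral>\<^sup>+w. ?H w * ennreal (W w s) \<partial>P x)"
   using \<epsilon> W_nonneg by (intro nn_integral_mono) (auto simp: Q_def ennreal_plus[symmetric] intro!: ennreal_leI simp del: ennreal_plus)
  also have "... <= (\<integral>\<^sup>+w. ?H w * ennreal \<bar>W w b - W w a\<bar> + ?H w * ennreal (W w a) \<partial>P x)"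
   unfolding eq[symmetric] using W_nonneg
   by (intro nn_integral_mono) (auto simp: ennreal_plus[symmetric] intro!: ennreal_leI simp del: ennreal_plus)
  also have "... = (\<integral>\<^sup>+w. ?H w * ennreal \<bar>W w b - W w a\<bar> \<partial>P x) + ?wa"
   by (rule nn_integral_add) measurable
  also have "(\<integral>\<^sup>+w. ?H w * ennreal \<bar>W w b - W w a\<bar> \<partial>P x) = (\<integral>\<^sup>+w. indicator (A s) w * ennreal \<bar>W w b - W w a\<bar> \<partial>P x)"
   by (intro nn_integral_cong arg_cong2[where f="(*)"] refl HA)
  finally show ?thesis using fin by (auto simp: add.commute[of _ ?wa])
 qed
 have "ennreal \<epsilon> * emeasure (P x) (\<Union>s\<in>S. A s) = (\<Sum>s\<in>S. ennreal \<epsilon> * emeasure (P x) (A s))"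
  by (subst sum_emeasure[symmetric]) (use S(1) disj in \<open>auto simp: sum_distrib_left\<close>)
 also have "... <= (\<Sum>s\<in>S. \<integral>\<^sup>+w. indicator (A s) w * ennreal \<bar>W w b - W w a\<bar> \<partial>P x)" by (intro sum_mono step)
 also have "... = (\<integral>\<^sup>+w. (\<Sum>s\<in>S. indicator (A s) w) * ennreal \<bar>W w b - W w a\<bar> \<partial>P x)"
  by (subst nn_integral_sum[symmetric]) (auto simp: sum_distrib_right)
 also have "... = (\<integral>\<^sup>+w. indicator (\<Union>s\<in>S. A s) w * ennreal \<bar>W w b - W w a\<bar> \<partial>P x)"
  by (simp add: indicator_UN_disjoint[OF S(1) disj])
 also have "... <= (\<integral>\<^sup>+w. ennreal \<bar>W w b - W w a\<bar> \<partial>P x)" by (intro nn_integral_mono) (auto simp: indicator_def)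
 finally show ?thesis unfolding un .
qed

lemma maximal_rational:
 assumes ab: "0 <= a" "a \<in> \<rat>" "a <= b" and \<epsilon>: "0 < \<epsilon>"
 shows "{w\<in>space Omega_space. \<exists>s\<in>\<rat> \<inter> {a..b}. W w a + \<epsilon> < W w s} \<in> sets Omega_space"
  and "ennreal \<epsilon> * emeasure (P x) {w\<in>space Omega_space. \<exists>s\<in>\<rat> \<inter> {a..b}. W w a + \<epsilon> < W w s} <= (\<integral>\<^sup>+w. ennreal \<bar>W w b - W w a\<bar> \<partial>P x)"
proof -
 let ?Q = "\<rat> \<inter> {a..b}"
 have c: "countable ?Q" by (rule countable_subset[OF _ countable_rat]) auto
 have ne: "?Q \<noteq> {}" using ab by auto
 define S where "S n = from_nat_into ?Q ` {..<n}" for n :: nat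
 have SQ: "S n \<subseteq> ?Q" for n unfolding S_def using from_nat_into[OF ne] by blast
 have US: "(\<Union>n. S n) = ?Q"
 proof
  show "?Q \<subseteq> (\<Union>n. S n)"
  proof
   fix s assume "s \<in> ?Q"
   then obtain n where "from_nat_into ?Q n = s" using from_nat_into_surj[OF c] by blast
   then have "s \<in> S (Suc n)" by (auto simp: S_def)
   then show "s \<in> (\<Union>n. S n)" by blast
  qed
 qed (use SQ in blast)
 let ?B = "\<lambda>S. {w\<in>space Omega_space. \<exists>s\<in>S. W w a + \<epsilon> < W w s}"
 have m: "?B (S n) \<in> sets Omega_space" for n
 proof -
  have "finite (S n)" by (simp add: S_def)
  then show ?thesis by measurable
 qed
 have B: "?B ?Q = (\<Union>n. ?B (S n))" unfolding US[symmetric] by blast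
 show "?B ?Q \<in> sets Omega_space" unfolding B using m by blast
 have inc: "incseq (\<lambda>n. ?B (S n))" by (intro monoI) (auto simp: S_def)
 have "emeasure (P x) (?B ?Q) = (SUP n. emeasure (P x) (?B (S n)))"
  unfolding B by (rule SUP_emeasure_incseq[symmetric]) (use m inc in auto)
 then have "ennreal \<epsilon> * emeasure (P x) (?B ?Q) = (SUP n. ennreal \<epsilon> * emeasure (P x) (?B (S n)))" by (simp add: SUP_mult_left_ennreal)
 also have "... <= (\<integral>\<^sup>+w. ennreal \<bar>W w b - W w a\<bar> \<partial>P x)"
 proof (rule SUP_least)
  fix n
  show "ennreal \<epsilon> * emeasure (P x) (?B (S n)) <= (\<integral>\<^sup>+w. ennreal \<bar>W w b - W w a\<bar> \<partial>P x)"
   by (rule maximal_finite[OF _ _ ab(1) \<epsilon>]) (use SQ[of n] in \<open>auto simp: S_def\<close>)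
 qed
 finally show "ennreal \<epsilon> * emeasure (P x) (?B ?Q) <= (\<integral>\<^sup>+w. ennreal \<bar>W w b - W w a\<bar> \<partial>P x)" .
qed

lemma upper_bound:
 "AE w in P x. \<forall>M. (\<lambda>n. W w (real (Suc n))) \<longlonglongrightarrow> M \<longrightarrow> (\<forall>\<epsilon>>0. \<exists>N. \<forall>t\<in>\<rat>. real N <= t \<longrightarrow> W w t <= M + \<epsilon>)"
proof -
 interpret Px: prob_space "P x" by (rule prob_P)
 let ?t = "\<lambda>n. 1 * real (Suc n)"
 have sW: "(\<Sum>n. \<integral>\<^sup>+w. ennreal \<bar>W w (?t n + 1) - W w (?t n)\<bar> \<partial>P x) < \<top>" by (rule W_increments) simp
 \<comment> \<open>A rise by more than \<open>1 / real (Suc j)\<close> during the unit interval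
   after time \<open>n + 1\<close>. Summable increments make the probabilities summable, so almost
   surely only finitely many such rises occur.\<close>
 define B where "B j n = {w\<in>space Omega_space. \<exists>s\<in>\<rat> \<inter> {?t n..?t n + 1}. W w (?t n) + 1 / real (Suc j) < W w s}" for j n
 have Bm: "B j n \<in> sets (P x)" for j n unfolding B_def sets_P by (rule maximal_rational(1)) auto
 have sB: "(\<Sum>n. emeasure (P x) (B j n)) < \<top>" for j
 proof -
  have "ennreal (1 / real (Suc j)) * (\<Sum>n. emeasure (P x) (B j n)) <= (\<Sum>n. \<integral>\<^sup>+w. ennreal \<bar>W w (?t n + 1) - W w (?t n)\<bar> \<partial>P x)"
   unfolding ennreal_suminf_cmult[symmetric] B_def by (intro suminf_le maximal_rational(2)) auto
  then have "ennreal (1 / real (Suc j)) * (\<Sum>n. emeasure (P x) (B j n)) < \<top>" using sW by (rule le_less_trans)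
  then show ?thesis by (auto simp: ennreal_mult_less_top)
 qed
 have "AE w in P x. \<forall>j. eventually (\<lambda>n. w \<in> space (P x) - B j n) sequentially"
  unfolding AE_all_countable
 proof
  fix j
  have "summable (\<lambda>n. measure (P x) (B j n))"
   by (rule summable_suminf_not_top) (use sB[of j] in \<open>auto simp: Px.emeasure_eq_measure\<close>)
  moreover have "emeasure (P x) (B j n) < \<infinity>" for n by (simp add: Px.emeasure_eq_measure)
  ultimately show "AE w in P x. eventually (\<lambda>n. w \<in> space (P x) - B j n) sequentially"
   by (intro borel_cantelli_AE1 Bm)
 qed
 then show ?thesis
 proof (rule eventually_mono, intro allI impI)
  fix w M and \<epsilon> :: real
  assume ev: "\<forall>j. eventually (\<lambda>n. w \<in> space (P x) - B j n) sequentially" and M: "(\<lambda>n. W w (real (Suc n))) \<longlonglongrightarrow> M" and \<epsilon>: "0 < \<epsilon>"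
  obtain j where j: "1 / real (Suc j) < \<epsilon> / 2" using reals_Archimedean[of "\<epsilon> / 2"] \<epsilon> by (auto simp: inverse_eq_divide)
  have "eventually (\<lambda>n. W w (real (Suc n)) < M + \<epsilon> / 2) sequentially" by (rule order_tendstoD(2)[OF M]) (use \<epsilon> in simp)
  with ev[THEN spec, of j] have "eventually (\<lambda>n. w \<in> space (P x) - B j n \<and> W w (real (Suc n)) < M + \<epsilon> / 2) sequentially"
   by eventually_elim simp
  then obtain N where N: "\<And>n. N <= n ==> w \<in> space (P x) - B j n \<and> W w (real (Suc n)) < M + \<epsilon> / 2" by (auto simp: eventually_sequentially)
  show "\<exists>N. \<forall>t\<in>\<rat>. real N <= t \<longrightarrow> W w t <= M + \<epsilon>"
  proof (intro exI[of _ "Suc N"] ballI impI)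
   fix t :: real assume t: "t \<in> \<rat>" "real (Suc N) <= t"
   define n where "n = nat \<lfloor>t\<rfloor> - 1"
   have "int (Suc N) <= \<lfloor>t\<rfloor>" using t(2) by (simp add: le_floor_iff)
   then have n: "N <= n" "real (Suc n) = of_int \<lfloor>t\<rfloor>" unfolding n_def by linarith+
   have "t \<in> \<rat> \<inter> {?t n..?t n + 1}" using t(1) n(2) by (simp del: of_nat_Suc)
   then have "\<not> W w (?t n) + 1 / real (Suc j) < W w t" using N[OF n(1)] by (auto simp: B_def simp del: of_nat_Suc)
   then show "W w t <= M + \<epsilon>" using N[OF n(1)] j by simp
  qed
 qed
qed

end

section \<open>The almost sure limit\<close>

text \<open>A finite maximum of tents with rational height, centre \<open>c i\<close> and radius
  1/n. The index type is countable, and appending lists takes the maximum, so suprema over the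
  family can be reached along an increasing sequence.\<close>

fun hat :: "(nat => 'a::metric_space) => (nat \<times> nat \<times> rat) list => 'a => real" where
 "hat c [] x = 0"
| "hat c ((i, n, r) # l) x = max (\<bar>of_rat r\<bar> * max 0 (1 - real n * dist x (c i))) (hat c l x)"

lemma hat_nonneg: "0 <= hat c l x"
 by (induction l) (auto simp: le_max_iff_disj)

lemma hat_continuous: "continuous_on UNIV (hat c l)"
proof (induction l)
 case (Cons a l)
 obtain i n r where a: "a = (i, n, r)" by (cases a)
 show ?case unfolding a hat.simps[abs_def] using Cons by (intro continuous_intros)
qed simp

lemma hat_bounded: "\<exists>b\<ge>0. \<forall>x. hat c l x <= b"
proof (induction l)
 case (Cons a l)
 obtain i n r where a: "a = (i, n, r)" by (cases a)
 obtain b where b: "b \<ge> 0" "\<And>x. hat c l x <= b" using Cons by auto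
 have "\<bar>of_rat r\<bar> * max 0 (1 - real n * dist x (c i)) <= \<bar>of_rat r\<bar> * 1" for x by (rule mult_left_mono) auto
 then show ?case unfolding a hat.simps
  using b by (intro exI[of _ "max \<bar>of_rat r\<bar> b"] conjI allI max.mono) (simp_all add: le_max_iff_disj)
qed auto

lemma hat_append: "hat c (l @ l') x = max (hat c l x) (hat c l' x)"
 by (induction l) (auto simp: hat_nonneg max.assoc max_absorb2)

lemma hat_concat_le: "(\<And>l. l \<in> set ls ==> hat c l x <= b) ==> 0 <= b ==> hat c (concat ls) x <= b"
 by (induction ls) (auto simp: hat_append)

lemma hat_concat_ge: "l \<in> set ls ==> hat c l x <= hat c (concat ls) x"
 by (induction ls) (auto simp: hat_append le_max_iff_disj)

text \<open>Near a continuity point \<open>F\<close> exceeds any rational height below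
  \<open>F x\<close>. A steep tent of such a height with centre close to \<open>x\<close> lies below
  \<open>F\<close> everywhere, since \<open>F\<close> is nonnegative off its support.\<close>

lemma hat_approx:
 assumes dense: "\<And>U. open U ==> U \<noteq> {} ==> \<exists>i. c i \<in> U"
  and F0: "\<And>x. 0 <= F x" and F: "isCont F x" and e: "0 < e"
 shows "\<exists>l. (\<forall>y. hat c l y <= F y) \<and> F x - e <= hat c l x"
proof (cases "F x <= e")
 case True then show ?thesis using F0 by (intro exI[of _ "[]"]) auto
next
 case False
 obtain r where r: "F x - e / 2 < of_rat r" "of_rat r < F x" using of_rat_dense[of "F x - e / 2" "F x"] e by auto
 have r0: "0 < (of_rat r :: real)" using r False e by linarith
 have "eventually (\<lambda>y. of_rat r < F y) (at x)" using F r(2) by (intro order_tendstoD(1)) (auto simp: isCont_def)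
 then obtain \<delta> where \<delta>: "0 < \<delta>" "\<And>y. dist y x < \<delta> ==> of_rat r < F y"
  using r(2) unfolding eventually_at by (metis dist_self UNIV_I)
 obtain n :: nat where n: "0 < n" "1 / real n < \<delta> / 2" using \<delta>(1) by (metis half_gt_zero nat_approx_posE of_nat_0_less_iff zero_less_Suc)
 \<comment> \<open>The first bound keeps the support of the tent within distance \<delta> of
   \<open>x\<close>; the second limits the loss of height at \<open>x\<close>, whose slope is
   \<open>real n * of_rat r\<close>, to e/2.\<close>
 define \<eta> where "\<eta> = min (\<delta> / 2) (e / 2 / (real n * of_rat r))"
 have \<eta>: "0 < \<eta>" using \<delta> e n r0 by (simp add: \<eta>_def)
 obtain i where i: "c i \<in> ball x \<eta>" using dense[of "ball x \<eta>"] \<eta> by auto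
 let ?l = "[(i, n, r)]"
 show ?thesis
 proof (intro exI[of _ ?l] conjI allI)
  fix y
  show "hat c ?l y <= F y"
  proof (cases "dist y x < \<delta>")
   case True
   have "of_rat r * max 0 (1 - real n * dist y (c i)) <= of_rat r * (1::real)" using r0 by (intro mult_left_mono) auto
   then have "of_rat r * max 0 (1 - real n * dist y (c i)) <= F y" using \<delta>(2)[OF True] by simp
   then show ?thesis using F0[of y] r0 by simp
  next
   case False
   have "dist y x <= dist y (c i) + dist (c i) x" by (rule dist_triangle)
   moreover have "dist (c i) x < \<delta> / 2" using i by (simp add: \<eta>_def dist_commute)
   ultimately have "1 / real n < dist y (c i)" using False n(2) by linarith
   then have "1 - real n * dist y (c i) <= 0" using n(1) by (simp add: field_simps)
   then show ?thesis using F0[of y] r0 by (simp add: max_absorb1)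
  qed
 next
  have "dist x (c i) <= e / 2 / (real n * of_rat r)" using i by (simp add: \<eta>_def)
  then have "of_rat r * (real n * dist x (c i)) <= e / 2" using n(1) r0 by (simp add: field_simps)
  then have "F x - e <= of_rat r * (1 - real n * dist x (c i))" using r(1) by (simp add: algebra_simps)
  also have "... <= of_rat r * max 0 (1 - real n * dist x (c i))" using r0 by (intro mult_left_mono) auto
  finally show "F x - e <= hat c ?l x" using r0 by (simp add: le_max_iff_disj)
 qed
qed

text \<open>Bounds at rational times extend to all times because population functionals of
  continuous functions are right continuous.\<close>

lemma rational_to_right_limit:
 fixes g :: "real => real"
 assumes g: "(g \<longlongrightarrow> L) (at_right t)" and le: "\<And>s. s \<in> \<rat> ==> t <= s ==> b <= g s"
 shows "b <= L"
proof (rule ccontr)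
 assume "\<not> b <= L"
 then have "eventually (\<lambda>s. g s < b) (at_right t)" by (intro order_tendstoD(2)[OF g]) simp
 then obtain t' where t': "t < t'" "\<And>s. t < s ==> s < t' ==> g s < b" by (auto simp: eventually_at_right_field)
 obtain s where "s \<in> \<rat>" "t < s" "s < t'" using Rats_dense_in_real[OF t'(1)] by auto
 then show False using t'(2)[of s] le[of s] by simp
qed

section \<open>The almost sure event and the limit for general test functions\<close>

context supercritical
begin

definition cc :: "nat => 'a" where
 "cc = (SOME c. \<forall>U. open U \<longrightarrow> U \<noteq> {} \<longrightarrow> (\<exists>i. c i \<in> U))"

lemma cc: "open U ==> U \<noteq> {} ==> \<exists>i. cc i \<in> U"
proof -
 obtain D :: "'a set" where D: "countable D" "\<And>X. open X ==> X \<noteq> {} ==> \<exists>d\<in>D. d \<in> X" using countable_dense_exists by blast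
 have "D \<noteq> {}" using D(2)[of UNIV] by auto
 then have "\<exists>c. \<forall>U. open U \<longrightarrow> U \<noteq> {} \<longrightarrow> (\<exists>i. (c :: nat => 'a) i \<in> U)"
  using D(2) from_nat_into_surj[OF D(1)] by (intro exI[of _ "from_nat_into D"]) metis
 from someI_ex[OF this] show "open U ==> U \<noteq> {} ==> \<exists>i. cc i \<in> U" unfolding cc_def by blast
qed

definition nu :: "('a => real) => real" where "nu f = enn2real (mu (\<lambda>x. ennreal (f x)))"

text \<open>Phrased through the tree alone, so that the same event works for every starting point,
  and with countable quantifiers, so that it is measurable: rational times, tolerances 1/(j+1), tent
  lists. The Cauchy condition gives convergence in a measurable form.\<close>

definition good :: "'a tree set" where
 "good = {w\<in>space Omega_space. w \<in> Reg \<and> Cauchy (\<lambda>n. W w (real (Suc n)))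
   \<and> (\<forall>j l. \<exists>N. \<forall>r. real N <= of_rat r \<longrightarrow> lim (\<lambda>n. W w (real (Suc n))) * nu (\<lambda>x. \<phi> x * hat cc l x) - 1 / real (Suc j)
      <= exp (- lam * of_rat r) * enn2real (XE w (of_rat r) (oE (\<lambda>x. ennreal (\<phi> x * hat cc l x)))))
   \<and> (\<forall>j. \<exists>N. \<forall>r. real N <= of_rat r \<longrightarrow> W w (of_rat r) <= lim (\<lambda>n. W w (real (Suc n))) + 1 / real (Suc j))}"

lemma hat_measurable[measurable]: "hat cc l \<in> borel_measurable borel"
 by (rule borel_measurable_continuous_onI[OF hat_continuous])

lemma good_sets: "good \<in> sets Omega_space"
proof -
 have [measurable]: "(\<lambda>w. XE w t (oE (\<lambda>x. ennreal (\<phi> x * hat cc l x)))) \<in> borel_measurable Omega_space" for t l by measurable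
 have 1: "{w\<in>space Omega_space. Cauchy (\<lambda>n. W w (real (Suc n)))} \<in> sets Omega_space" by (rule sets_Collect_Cauchy) measurable
 have 2: "{w\<in>space Omega_space. \<forall>j l. \<exists>N. \<forall>r. real N <= of_rat r \<longrightarrow> lim (\<lambda>n. W w (real (Suc n))) * nu (\<lambda>x. \<phi> x * hat cc l x) - 1 / real (Suc j)
      <= exp (- lam * of_rat r) * enn2real (XE w (of_rat r) (oE (\<lambda>x. ennreal (\<phi> x * hat cc l x))))} \<in> sets Omega_space"
  by (intro sets.sets_Collect_countable_All sets.sets_Collect_countable_Ex sets.sets_Collect_imp sets.sets_Collect_const borel_measurable_le) measurable
 have 3: "{w\<in>space Omega_space. \<forall>j. \<exists>N. \<forall>r. real N <= of_rat r \<longrightarrow> W w (of_rat r) <= lim (\<lambda>n. W w (real (Suc n))) + 1 / real (Suc j)} \<in> sets Omega_space"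
  by (intro sets.sets_Collect_countable_All sets.sets_Collect_countable_Ex sets.sets_Collect_imp sets.sets_Collect_const borel_measurable_le) measurable
 have 4: "{w\<in>space Omega_space. w \<in> Reg} \<in> sets Omega_space" by measurable
 show ?thesis unfolding good_def by (intro sets.sets_Collect_conj 1 2 3 4)
qed

lemma \<phi>_hat_nonneg: "0 <= \<phi> x * hat cc l x" by (simp add: \<phi>_nonneg hat_nonneg)

lemma good_prob: "emeasure (P x) good = 1"
proof -
 interpret Px: prob_space "P x" by (rule prob_P)
 let ?f = "\<lambda>l x. \<phi> x * hat cc l x"
 have lb: "AE w in P x. \<forall>l M. (\<lambda>n. W w (real (Suc n))) \<longlonglongrightarrow> M \<longrightarrow>
  (\<forall>\<epsilon>>0. \<exists>N. \<forall>t\<in>\<rat>. real N <= t \<longrightarrow> M * enn2real (mu (\<lambda>x. ennreal (?f l x))) - \<epsilon> <= exp (- lam * t) * Xf w t (?f l))"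
  unfolding AE_all_countable
 proof
  fix l
  obtain b where b: "0 <= b" "\<And>x. hat cc l x <= b" using hat_bounded by metis
  show "AE w in P x. \<forall>M. (\<lambda>n. W w (real (Suc n))) \<longlonglongrightarrow> M \<longrightarrow>
   (\<forall>\<epsilon>>0. \<exists>N. \<forall>t\<in>\<rat>. real N <= t \<longrightarrow> M * enn2real (mu (\<lambda>x. ennreal (?f l x))) - \<epsilon> <= exp (- lam * t) * Xf w t (?f l))"
  proof (rule lower_bound[of _ b])
   show "continuous_on UNIV (?f l)" by (intro continuous_intros \<phi>_cont hat_continuous)
   show "?f l x <= b * \<phi> x" for x using mult_left_mono[OF b(2)[of x] \<phi>_nonneg[of x]] by (simp add: mult.commute)
  qed (use b \<phi>_hat_nonneg in auto)
 qed
 have "AE w in P x. convergent (\<lambda>n. W w (1 * real (Suc n)))" by (rule W_lattice) simp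
 with AE_Reg[of x] lb upper_bound[of x] have "AE w in P x. w \<in> good"
 proof eventually_elim
  case (elim w)
  define M where "M = lim (\<lambda>n. W w (real (Suc n)))"
  have M: "(\<lambda>n. W w (real (Suc n))) \<longlonglongrightarrow> M" using elim(4) by (simp add: M_def convergent_LIMSEQ_iff)
  have X: "Xf w t (?f l) = enn2real (XE w t (oE (\<lambda>x. ennreal (?f l x))))" for t l
   by (rule Xf_enn2real[OF elim(1) \<phi>_hat_nonneg])
  have 1: "\<exists>N. \<forall>r. real N <= of_rat r \<longrightarrow> M * nu (?f l) - 1 / real (Suc j) <= exp (- lam * of_rat r) * enn2real (XE w (of_rat r) (oE (\<lambda>x. ennreal (?f l x))))" for j l
  proof -
   have "\<exists>N. \<forall>t\<in>\<rat>. real N <= t \<longrightarrow> M * enn2real (mu (\<lambda>x. ennreal (?f l x))) - 1 / real (Suc j) <= exp (- lam * t) * Xf w t (?f l)"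
    using elim(2)[rule_format, OF M, of "1 / real (Suc j)" l] by simp
   then show ?thesis unfolding X nu_def using Rats_of_rat by blast
  qed
  have 2: "\<exists>N. \<forall>r. real N <= of_rat r \<longrightarrow> W w (of_rat r) <= M + 1 / real (Suc j)" for j
  proof -
   have "\<exists>N. \<forall>t\<in>\<rat>. real N <= t \<longrightarrow> W w t <= M + 1 / real (Suc j)" using elim(3)[rule_format, OF M, of "1 / real (Suc j)"] by simp
   then show ?thesis using Rats_of_rat by blast
  qed
  show ?case unfolding good_def mem_Collect_eq M_def[symmetric]
   by (intro conjI allI elim(1) Reg_space LIMSEQ_imp_Cauchy[OF M] 1 2)
 qed
 then show ?thesis using good_sets by (intro Px.emeasure_eq_1_AE) auto
qed

lemma mu_\<phi>_multiple: "0 <= B ==> mu (\<lambda>x. ennreal (B * \<phi> x)) = ennreal B"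
 using mu_cmult[of e\<phi> "ennreal B"] by (simp add: mu_\<phi> ennreal_mult')

text \<open>Dividing by \<phi> turns the function into a bounded nonnegative \<open>F\<close> which
  is continuous almost everywhere. Continuous tent maxima below \<open>F\<close> increase to it at
  its continuity points, so their integrals exhaust that of \<open>F\<close>, and each of them has
  the lower bound on the event.\<close>

lemma good_lower:
 assumes w: "w \<in> good" and M: "M = lim (\<lambda>n. W w (real (Suc n)))"
  and g[measurable]: "g \<in> borel_measurable borel" and B: "\<And>x. \<bar>g x\<bar> <= B * \<phi> x"
  and cont: "emeasure m {x. \<not> isCont g x} = 0" and \<epsilon>: "0 < \<epsilon>"
 shows "eventually (\<lambda>t. M * nu (\<lambda>x. B * \<phi> x + g x) - \<epsilon> <= exp (- lam * t) * Xf w t (\<lambda>x. B * \<phi> x + g x)) at_top"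
proof -
 have r: "w \<in> Reg" using w by (simp add: good_def)
 have "0 <= B * \<phi> undefined" using order_trans[OF abs_ge_zero B] .
 then have B0: "0 <= B" using \<phi>_pos[of undefined] by (simp add: zero_le_mult_iff)
 define F where "F x = B + g x / \<phi> x" for x
 have Fm[measurable]: "F \<in> borel_measurable borel" unfolding F_def by measurable
 have F0: "0 <= F x" for x
 proof -
  have "- g x <= B * \<phi> x" using B[of x] by linarith
  then have "- B <= g x / \<phi> x" using \<phi>_pos[of x] by (simp add: field_simps)
  then show ?thesis by (simp add: F_def)
 qed
 have \<phi>F: "\<phi> x * F x = B * \<phi> x + g x" for x using \<phi>_pos[of x] by (simp add: F_def field_simps)
 have F2: "F x <= 2 * B" for x
 proof -
  have "g x / \<phi> x <= B" using B[of x] \<phi>_pos[of x] by (simp add: field_simps)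
  then show ?thesis by (simp add: F_def)
 qed
 have M0: "0 <= M"
 proof -
  have "Cauchy (\<lambda>n. W w (real (Suc n)))" using w by (simp add: good_def)
  then have "(\<lambda>n. W w (real (Suc n))) \<longlonglongrightarrow> M" by (simp add: M Cauchy_convergent_iff convergent_LIMSEQ_iff)
  then show ?thesis by (rule LIMSEQ_le_const) (use W_nonneg in auto)
 qed
 define Adm where "Adm = {l. \<forall>x. hat cc l x <= F x}"
 have Adm: "[] \<in> Adm" using F0 by (simp add: Adm_def)
 have cA: "countable Adm" by simp
 \<comment> \<open>Concatenating the first \<open>n\<close> admissible lists gives the running
   maximum of their tents: increasing in \<open>n\<close> and still below \<open>F\<close>.\<close>
 define L where "L n = concat (map (from_nat_into Adm) [0..<n])" for n
 have LA: "hat cc (L n) x <= F x" for n x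
 proof -
  have "hat cc l x <= F x" if "l \<in> Adm" for l using that by (simp add: Adm_def)
  moreover have "from_nat_into Adm n \<in> Adm" for n using Adm by (intro from_nat_into) auto
  ultimately show ?thesis unfolding L_def using F0 by (intro hat_concat_le) auto
 qed
 have Linc: "hat cc (L n) x <= hat cc (L (Suc n)) x" for n x by (simp add: L_def hat_append)
 have Lsup: "ennreal (\<phi> x * F x) <= (SUP n. ennreal (\<phi> x * hat cc (L n) x))" if x: "isCont g x" for x
 proof (rule ennreal_le_epsilon)
  fix e :: real assume e: "0 < e"
  have "isCont F x" unfolding F_def
   using x \<phi>_cont \<phi>_pos[of x] by (intro continuous_intros) (auto simp: continuous_on_eq_continuous_at)
  from hat_approx[OF cc F0 this, of "e / \<phi> x"] obtain l where l: "l \<in> Adm" "F x - e / \<phi> x <= hat cc l x"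
   using e \<phi>_pos[of x] by (auto simp: Adm_def)
  obtain n where n: "from_nat_into Adm n = l" using from_nat_into_surj[OF cA l(1)] by blast
  have "hat cc l x <= hat cc (L (Suc n)) x" unfolding L_def by (rule hat_concat_ge) (use n in auto)
  then have "\<phi> x * (F x - e / \<phi> x) <= \<phi> x * hat cc (L (Suc n)) x" using l(2) \<phi>_nonneg[of x] by (intro mult_left_mono) auto
  then have "\<phi> x * F x <= \<phi> x * hat cc (L (Suc n)) x + e" using \<phi>_pos[of x] by (simp add: right_diff_distrib)
  then have "ennreal (\<phi> x * F x) <= ennreal (\<phi> x * hat cc (L (Suc n)) x) + ennreal e"
   using e \<phi>_hat_nonneg by (simp add: ennreal_plus[symmetric] ennreal_leI del: ennreal_plus)
  also have "... <= (SUP n. ennreal (\<phi> x * hat cc (L n) x)) + ennreal e" by (intro add_right_mono SUP_upper) simp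
  finally show "ennreal (\<phi> x * F x) <= (SUP n. ennreal (\<phi> x * hat cc (L n) x)) + ennreal e" .
 qed
 have "AE x in m. isCont g x"
 proof (rule AE_I[OF _ cont])
  have "{x. \<not> isCont g x} = - {x. isCont g x}" by auto
  then show "{x. \<not> isCont g x} \<in> sets m" using isCont_borel[of g] by (simp add: sets.compl_sets[of _ borel, simplified] Compl_eq_Diff_UNIV)
 qed auto
 then have "mu (\<lambda>x. ennreal (\<phi> x * F x)) <= (\<integral>\<^sup>+x. (SUP n. ennreal (\<phi>h x) * ennreal (\<phi> x * hat cc (L n) x)) \<partial>m)"
  unfolding mu_def SUP_mult_left_ennreal[symmetric]
  by (intro nn_integral_mono_AE) (auto elim!: eventually_mono intro!: mult_left_mono Lsup)
 also have "... = (SUP n. mu (\<lambda>x. ennreal (\<phi> x * hat cc (L n) x)))"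
  unfolding mu_def
 proof (rule nn_integral_monotone_convergence_SUP)
  show "incseq (\<lambda>n x. ennreal (\<phi>h x) * ennreal (\<phi> x * hat cc (L n) x))"
   by (intro incseq_SucI le_funI mult_left_mono ennreal_leI Linc \<phi>_nonneg) auto
 qed measurable
 finally have sup: "mu (\<lambda>x. ennreal (\<phi> x * F x)) <= (SUP n. mu (\<lambda>x. ennreal (\<phi> x * hat cc (L n) x)))" .
 have fin: "mu (\<lambda>x. ennreal (h x)) = ennreal (nu h)" if "\<And>x. h x <= \<phi> x * F x" for h
 proof -
  have "mu (\<lambda>x. ennreal (h x)) <= mu (\<lambda>x. ennreal (2 * B * \<phi> x))"
   using order_trans[OF that mult_left_mono[OF F2 \<phi>_nonneg]] by (intro mu_mono ennreal_leI) (simp add: mult.commute)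
  also have "... < \<top>" using mu_\<phi>_multiple[of "2 * B"] B0 by simp
  finally show ?thesis by (simp add: nu_def)
 qed
 have nu0: "0 <= nu h" for h by (simp add: nu_def)
 \<comment> \<open>The error in the integral is later multiplied by \<open>M\<close>; dividing by
   \<open>M + 1\<close> also covers the case in which \<open>M\<close> is 0.\<close>
 define \<epsilon>' where "\<epsilon>' = \<epsilon> / 2 / (M + 1)"
 have \<epsilon>': "0 < \<epsilon>'" "M * \<epsilon>' <= \<epsilon> / 2" using \<epsilon> M0 by (auto simp: \<epsilon>'_def field_simps)
 have "\<exists>n. nu (\<lambda>x. \<phi> x * F x) - \<epsilon>' <= nu (\<lambda>x. \<phi> x * hat cc (L n) x)"
 proof (rule ccontr)
  assume neg: "\<not> ?thesis"
  from neg have "mu (\<lambda>x. ennreal (\<phi> x * hat cc (L n) x)) <= ennreal (nu (\<lambda>x. \<phi> x * F x) - \<epsilon>')" for n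
   using fin[of "\<lambda>x. \<phi> x * hat cc (L n) x"] mult_left_mono[OF LA \<phi>_nonneg] by (simp add: not_le less_imp_le ennreal_leI)
  then have "ennreal (nu (\<lambda>x. \<phi> x * F x)) <= ennreal (nu (\<lambda>x. \<phi> x * F x) - \<epsilon>')"
   using order_trans[OF sup SUP_least] fin[of "\<lambda>x. \<phi> x * F x"] by simp
  \<comment> \<open>\<open>ennreal\<close> maps negative numbers to 0, so the sign has to be known
    before the inequality can be read in the reals.\<close>
  moreover have "0 <= nu (\<lambda>x. \<phi> x * F x) - \<epsilon>'"
  proof -
   have "nu (\<lambda>x. \<phi> x * hat cc (L 0) x) < nu (\<lambda>x. \<phi> x * F x) - \<epsilon>'" using neg by (auto simp: not_le)
   then show ?thesis using nu0[of "\<lambda>x. \<phi> x * hat cc (L 0) x"] by linarith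
  qed
  ultimately show False using \<epsilon>' by (simp add: ennreal_le_iff)
 qed
 then obtain n where n: "nu (\<lambda>x. \<phi> x * F x) - \<epsilon>' <= nu (\<lambda>x. \<phi> x * hat cc (L n) x)" by blast
 let ?h = "\<lambda>x. \<phi> x * hat cc (L n) x"
 obtain j where j: "1 / real (Suc j) < \<epsilon> / 2" using reals_Archimedean[of "\<epsilon> / 2"] \<epsilon> by (auto simp: inverse_eq_divide)
 obtain N where N: "\<And>r. real N <= of_rat r ==> M * nu ?h - 1 / real (Suc j) <= exp (- lam * of_rat r) * enn2real (XE w (of_rat r) (oE (\<lambda>x. ennreal (?h x))))"
  using w unfolding good_def mem_Collect_eq M[symmetric] by blast
 show ?thesis
  unfolding eventually_at_top_linorder
 proof (intro exI[of _ "real N"] allI impI)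
  fix t assume t: "real N <= t"
  have "M * nu ?h - 1 / real (Suc j) <= exp (- lam * t) * Xf w t ?h"
  proof (rule rational_to_right_limit)
   show "((\<lambda>s. exp (- lam * s) * Xf w s ?h) \<longlongrightarrow> exp (- lam * t) * Xf w t ?h) (at_right t)"
    by (intro tendsto_intros Xf_right_cont[OF r] continuous_intros \<phi>_cont hat_continuous)
   fix s :: real assume s: "s \<in> \<rat>" "t <= s"
   then obtain q where q: "s = of_rat q" by (auto elim: Rats_cases)
   show "M * nu ?h - 1 / real (Suc j) <= exp (- lam * s) * Xf w s ?h"
    using N[of q] s t unfolding q by (simp add: Xf_enn2real[OF r \<phi>_hat_nonneg])
  qed
  also have "... <= exp (- lam * t) * Xf w t (\<lambda>x. B * \<phi> x + g x)"
   unfolding \<phi>F[symmetric] by (intro mult_left_mono Xf_mono LA \<phi>_nonneg) auto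
  finally have 1: "M * nu ?h - 1 / real (Suc j) <= exp (- lam * t) * Xf w t (\<lambda>x. B * \<phi> x + g x)" .
  have "M * (nu (\<lambda>x. \<phi> x * F x) - \<epsilon>') <= M * nu ?h" by (rule mult_left_mono[OF n M0])
  then show "M * nu (\<lambda>x. B * \<phi> x + g x) - \<epsilon> <= exp (- lam * t) * Xf w t (\<lambda>x. B * \<phi> x + g x)"
   using 1 j \<epsilon>'(2) unfolding \<phi>F right_diff_distrib by linarith
 qed
qed

lemma good_limit:
 assumes w: "w \<in> good" and M: "M = lim (\<lambda>n. W w (real (Suc n)))"
 shows "((\<lambda>t. exp (- lam * t) * Xf w t \<phi>) \<longlongrightarrow> M) at_top"
proof -
 have r: "w \<in> Reg" using w by (simp add: good_def)
 have nu1: "nu \<phi> = 1" by (simp add: nu_def mu_\<phi>)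
 show ?thesis
  unfolding tendsto_iff
 proof (intro allI impI)
  fix e :: real assume e: "0 < e"
  have lo: "eventually (\<lambda>t. M * nu (\<lambda>x. 1 * \<phi> x + 0) - e / 2 <= exp (- lam * t) * Xf w t (\<lambda>x. 1 * \<phi> x + 0)) at_top"
   by (rule good_lower[OF w M]) (use e \<phi>_nonneg in auto)
  obtain j where j: "1 / real (Suc j) < e / 2" using reals_Archimedean[of "e / 2"] e by (auto simp: inverse_eq_divide)
  obtain N where N: "\<And>r. real N <= of_rat r ==> W w (of_rat r) <= M + 1 / real (Suc j)"
   using w unfolding good_def mem_Collect_eq M[symmetric] by blast
  have up: "exp (- lam * t) * Xf w t \<phi> <= M + 1 / real (Suc j)" if t: "real N <= t" for t
  proof -
   have "- (M + 1 / real (Suc j)) <= - (exp (- lam * t) * Xf w t \<phi>)"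
   proof (rule rational_to_right_limit)
    show "((\<lambda>s. - (exp (- lam * s) * Xf w s \<phi>)) \<longlongrightarrow> - (exp (- lam * t) * Xf w t \<phi>)) (at_right t)"
     by (intro tendsto_intros Xf_right_cont[OF r \<phi>_cont])
    fix s :: real assume s: "s \<in> \<rat>" "t <= s"
    then obtain q where q: "s = of_rat q" by (auto elim: Rats_cases)
    show "- (M + 1 / real (Suc j)) <= - (exp (- lam * s) * Xf w s \<phi>)"
     using N[of q] s t unfolding W_Xf[OF r] q by simp
   qed
   then show ?thesis by simp
  qed
  from lo eventually_ge_at_top[of "real N"]
  show "eventually (\<lambda>t. dist (exp (- lam * t) * Xf w t \<phi>) M < e) at_top"
  proof eventually_elim
   case (elim t)
   then show ?case using up[of t] j e nu1 by (simp add: dist_real_def abs_less_iff)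
  qed
 qed
qed

lemma integrable_\<phi>h_dominated:
 assumes [measurable]: "f \<in> borel_measurable borel" and B: "\<And>x. \<bar>f x\<bar> <= B * \<phi> x"
 shows "integrable m (\<lambda>x. \<phi>h x * f x)" "nu (\<lambda>x. B * \<phi> x + f x) = B + (\<integral>x. \<phi>h x * f x \<partial>m)"
proof -
 have i\<phi>: "integrable m (\<lambda>x. \<phi> x * \<phi>h x)" using \<phi>\<phi>h_norm not_integrable_integral_eq by fastforce
 show i: "integrable m (\<lambda>x. \<phi>h x * f x)"
 proof (rule Bochner_Integration.integrable_bound[of _ "\<lambda>x. B * (\<phi> x * \<phi>h x)"])
  have "\<bar>\<phi>h x * f x\<bar> <= \<bar>B * (\<phi> x * \<phi>h x)\<bar>" for x
  proof -
   have "\<bar>\<phi>h x * f x\<bar> = \<phi>h x * \<bar>f x\<bar>" using \<phi>h_nonneg[of x] by (simp add: abs_mult)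
   also have "... <= \<phi>h x * (B * \<phi> x)" by (rule mult_left_mono[OF B \<phi>h_nonneg])
   also have "... = B * (\<phi> x * \<phi>h x)" by (simp only: mult_ac)
   finally show ?thesis by linarith
  qed
  then show "AE x in m. norm (\<phi>h x * f x) <= norm (B * (\<phi> x * \<phi>h x))" by simp
 qed (use i\<phi> in auto)
 have "mu (\<lambda>x. ennreal (B * \<phi> x + f x)) = (\<integral>\<^sup>+x. ennreal (B * (\<phi> x * \<phi>h x) + \<phi>h x * f x) \<partial>m)"
  unfolding mu_def
 proof (intro nn_integral_cong)
  fix x
  have "0 <= B * \<phi> x + f x" using B[of x] by linarith
  then show "ennreal (\<phi>h x) * ennreal (B * \<phi> x + f x) = ennreal (B * (\<phi> x * \<phi>h x) + \<phi>h x * f x)"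
   using \<phi>h_nonneg[of x] by (simp add: ennreal_mult'[symmetric] algebra_simps)
 qed
 also have "... = ennreal (\<integral>x. B * (\<phi> x * \<phi>h x) + \<phi>h x * f x \<partial>m)"
 proof (rule nn_integral_eq_integral)
  have "0 <= B * (\<phi> x * \<phi>h x) + \<phi>h x * f x" for x
  proof -
   have "0 <= \<phi>h x * (B * \<phi> x + f x)" using B[of x] \<phi>h_nonneg[of x] by (intro mult_nonneg_nonneg) linarith+
   then show ?thesis by (simp add: algebra_simps)
  qed
  then show "AE x in m. 0 <= B * (\<phi> x * \<phi>h x) + \<phi>h x * f x" by simp
 qed (use i i\<phi> in auto)
 finally have e: "mu (\<lambda>x. ennreal (B * \<phi> x + f x)) = ennreal (\<integral>x. B * (\<phi> x * \<phi>h x) + \<phi>h x * f x \<partial>m)" .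
 have "(\<integral>x. B * (\<phi> x * \<phi>h x) + \<phi>h x * f x \<partial>m) = B + (\<integral>x. \<phi>h x * f x \<partial>m)"
  using i i\<phi> \<phi>\<phi>h_norm by simp
 moreover have "0 <= (\<integral>x. B * (\<phi> x * \<phi>h x) + \<phi>h x * f x \<partial>m)"
 proof (rule Bochner_Integration.integral_nonneg)
  fix x
  have "0 <= \<phi>h x * (B * \<phi> x + f x)" using B[of x] \<phi>h_nonneg[of x] by (intro mult_nonneg_nonneg) linarith+
  then show "0 <= B * (\<phi> x * \<phi>h x) + \<phi>h x * f x" by (simp add: algebra_simps)
 qed
 ultimately show "nu (\<lambda>x. B * \<phi> x + f x) = B + (\<integral>x. \<phi>h x * f x \<partial>m)" unfolding nu_def e by simp
qed

lemma Xf_add: "Xf w t (\<lambda>x. f x + g x) = Xf w t f + Xf w t g" by (simp add: Xf_def sum.distrib)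

text \<open>The two lower bounds share the term B W, which converges by itself. Its cancellation
  leaves a lower bound from \<open>B * \<phi> + f\<close> and an upper bound from
  \<open>B * \<phi> - f\<close>.\<close>

lemma good_converges:
 assumes w: "w \<in> good" and M: "M = lim (\<lambda>n. W w (real (Suc n)))"
  and f[measurable]: "f \<in> borel_measurable borel" and B: "\<And>x. \<bar>f x\<bar> <= B * \<phi> x"
  and cont: "emeasure m {x. \<not> isCont f x} = 0"
 shows "((\<lambda>t. exp (- lam * t) * Xf w t f) \<longlongrightarrow> M * (\<integral>x. \<phi>h x * f x \<partial>m)) at_top"
proof -
 define I where "I = (\<integral>x. \<phi>h x * f x \<partial>m)"
 have nI: "nu (\<lambda>x. B * \<phi> x + f x) = B + I" "nu (\<lambda>x. B * \<phi> x + - f x) = B - I"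
  using integrable_\<phi>h_dominated(2)[of f B] integrable_\<phi>h_dominated(2)[of "\<lambda>x. - f x" B] B by (simp_all add: I_def)
 have c': "emeasure m {x. \<not> isCont (\<lambda>x. - f x) x} = 0"
 proof -
  have "isCont (\<lambda>x. - f x) x \<longleftrightarrow> isCont f x" for x
   using isCont_minus[of x f] isCont_minus[of x "\<lambda>x. - f x"] by auto
  then show ?thesis using cont by simp
 qed
 have W: "((\<lambda>t. B * (exp (- lam * t) * Xf w t \<phi>)) \<longlongrightarrow> B * M) at_top" by (intro tendsto_intros good_limit[OF w M])
 have X: "exp (- lam * t) * Xf w t (\<lambda>x. B * \<phi> x + g x) = B * (exp (- lam * t) * Xf w t \<phi>) + exp (- lam * t) * Xf w t g" for t g
  by (simp add: Xf_add Xf_cmult algebra_simps)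
 have Xm: "Xf w t (\<lambda>x. - f x) = - Xf w t f" for t by (simp add: Xf_def sum_negf)
 show ?thesis
  unfolding tendsto_iff I_def[symmetric]
 proof (intro allI impI)
  fix e :: real assume e: "0 < e"
  have 1: "eventually (\<lambda>t. M * nu (\<lambda>x. B * \<phi> x + f x) - e / 2 <= exp (- lam * t) * Xf w t (\<lambda>x. B * \<phi> x + f x)) at_top"
   by (rule good_lower[OF w M f B cont]) (use e in simp)
  have 2: "eventually (\<lambda>t. M * nu (\<lambda>x. B * \<phi> x + - f x) - e / 2 <= exp (- lam * t) * Xf w t (\<lambda>x. B * \<phi> x + - f x)) at_top"
   by (rule good_lower[OF w M _ _ c']) (use e B in auto)
  have 3: "eventually (\<lambda>t. dist (B * (exp (- lam * t) * Xf w t \<phi>)) (B * M) < e / 2) at_top"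
   using tendstoD[OF W, of "e / 2"] e by simp
  from 1 2 3 show "eventually (\<lambda>t. dist (exp (- lam * t) * Xf w t f) (M * I) < e) at_top"
  proof eventually_elim
   case (elim t)
   have a: "M * (B + I) = B * M + M * I" "M * (B - I) = B * M - M * I" by (simp_all add: algebra_simps)
   show ?case using elim unfolding nI X Xm a dist_real_def abs_less_iff by linarith
  qed
 qed
qed

end

theorem theorem3p6:
  fixes m :: "'a::{metric_space, second_countable_topology} measure"
    and Yl :: "'a \<Rightarrow> 'a path measure"
    and \<beta> :: "'a \<Rightarrow> real"
    and p :: "nat \<Rightarrow> 'a \<Rightarrow> real"
    and pk :: "real \<Rightarrow> 'a \<Rightarrow> 'a \<Rightarrow> real"
    and q :: "real \<Rightarrow> 'a \<Rightarrow> 'a \<Rightarrow> real"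
    and lam1 :: real
    and \<phi> \<phi>h :: "'a \<Rightarrow> real"
    and P :: "'a \<Rightarrow> 'a tree measure"
  assumes E_lc: "locally_compact_space (euclidean :: 'a topology)"
    and m_sets: "sets m = sets borel"
    and m_sf: "sigma_finite_measure m"
    and m_supp: "\<forall>U. open U \<and> U \<noteq> {} \<longrightarrow> emeasure m U > 0"
    and Y_hunt: "hunt_process Yl"
    and \<beta>_meas: "\<beta> \<in> borel_measurable borel"
    and \<beta>_nonneg: "\<forall>x. \<beta> x \<ge> 0"
    and \<beta>_bdd: "bounded (range \<beta>)"
    and \<beta>_pos: "emeasure m {x. \<beta> x > 0} > 0"
    and p_meas: "\<forall>n. p n \<in> borel_measurable borel"
    and p_nonneg: "\<forall>n x. p n x \<ge> 0"
    and p_sum: "\<forall>x. (\<lambda>n. p n x) sums 1"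
    and A_summable: "\<forall>x. summable (\<lambda>n. real n * p n x)"
    and A_bdd: "bounded (range (meanoff p))"
    and H1_cont: "\<forall>t>0. continuous_on UNIV (\<lambda>(x, y). pk t x y)"
    and H1_pos: "\<forall>t>0. \<forall>x y. pk t x y > 0"
    and H1_kernel: "\<forall>t>0. \<forall>f x. f \<in> borel_measurable borel \<and> (\<forall>y. f y \<ge> 0) \<longrightarrow>
                      Psg Yl t f x = (\<integral>\<^sup>+y. ennreal (pk t x y * f y) \<partial>m)"
    and H1_bdd: "\<forall>t>0. \<exists>c. \<forall>x y. pk t x y \<le> c"
    and q_cont: "\<forall>t>0. continuous_on UNIV (\<lambda>(x, y). q t x y)"
    and q_pos: "\<forall>t>0. \<forall>x y. q t x y > 0"
    and q_kernel: "\<forall>t>0. \<forall>f x. f \<in> borel_measurable borel \<and> (\<forall>y. f y \<ge> 0) \<longrightarrow>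
                      FKsg Yl (\<lambda>y. (1 - meanoff p y) * \<beta> y) t f x
                        = (\<integral>\<^sup>+y. ennreal (q t x y * f y) \<partial>m)"
    and \<phi>_cont: "continuous_on UNIV \<phi>" and \<phi>_pos: "\<forall>x. \<phi> x > 0"
    and \<phi>h_cont: "continuous_on UNIV \<phi>h" and \<phi>h_pos: "\<forall>x. \<phi>h x > 0"
    and \<phi>_L2: "integrable m (\<lambda>x. (\<phi> x)\<^sup>2)"
    and \<phi>h_L2: "integrable m (\<lambda>x. (\<phi>h x)\<^sup>2)"
    and \<phi>_norm: "(\<integral>x. (\<phi> x)\<^sup>2 \<partial>m) = 1"
    and \<phi>\<phi>h_norm: "(\<integral>x. \<phi> x * \<phi>h x \<partial>m) = 1"
    and \<phi>_eig: "\<forall>t>0. \<forall>x. FKsg Yl (\<lambda>y. (1 - meanoff p y) * \<beta> y) t \<phi> x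
                          = ennreal (exp (lam1 * t) * \<phi> x)"
    and \<phi>h_eig: "\<forall>t>0. \<forall>x. (\<integral>\<^sup>+y. ennreal (q t y x * \<phi>h y) \<partial>m)
                          = ennreal (exp (lam1 * t) * \<phi>h x)"
    and H2: "\<forall>t>0. \<exists>c. \<forall>x y. q t x y \<le> c * \<phi> x * \<phi>h y"
    and lam1_pos: "lam1 > 0"
    and LlogL: "(\<integral>\<^sup>+x. ennreal (\<phi>h x * \<beta> x)
                   * (\<Sum>k. if k \<ge> 2 then ennreal (real k * \<phi> x * logplus (real k * \<phi> x) * p k x)
                          else 0) \<partial>m) < \<top>"
    and X_law: "branching_law Yl \<beta> p P"
  shows "\<exists>\<Omega>0 \<in> sets Omega_space. (\<forall>x. emeasure (P x) \<Omega>0 = 1) \<and>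
           (\<forall>\<omega>\<in>\<Omega>0. \<exists>M. ((\<lambda>t. exp (- lam1 * t) * Xf \<omega> t \<phi>) \<longlongrightarrow> M) at_top \<and>
              (\<forall>f. f \<in> borel_measurable borel \<and> bounded (range f)
                    \<and> compact (closure {x. f x \<noteq> 0})
                    \<and> emeasure m {x. \<not> isCont f x} = 0 \<longrightarrow>
                 ((\<lambda>t. exp (- lam1 * t) * Xf \<omega> t f) \<longlongrightarrow> M * (\<integral>x. \<phi>h x * f x \<partial>m)) at_top))"
proof -
  obtain Kb where Kb: "\<And>x. \<bar>\<beta> x\<bar> \<le> Kb" using \<beta>_bdd by (auto simp: bounded_iff)
  obtain KA where KA: "\<And>x. \<bar>meanoff p x\<bar> \<le> KA" using A_bdd by (auto simp: bounded_iff)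
  interpret S: supercritical Yl \<beta> p P Kb KA m q lam1 \<phi> \<phi>h
    by unfold_locales
      (rule Y_hunt m_sets sigma_finite_measure.sigma_finite_countable[OF m_sf] \<beta>_meas X_law LlogL \<phi>_cont \<phi>h_cont \<phi>\<phi>h_norm lam1_pos abs_le_D1[OF Kb] abs_le_D1[OF KA]
         \<beta>_nonneg[rule_format] p_meas[rule_format] p_nonneg[rule_format] p_sum[rule_format] A_summable[rule_format]
         q_cont[rule_format] q_pos[rule_format]
         q_kernel[rule_format] \<phi>_pos[rule_format] \<phi>h_pos[rule_format] \<phi>_eig[rule_format] \<phi>h_eig[rule_format] H2[rule_format];
       (blast)?)+
  show ?thesis
  proof (intro bexI[of _ S.good] conjI allI ballI S.good_prob S.good_sets)
    fix \<omega> assume \<omega>: "\<omega> \<in> S.good"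
    let ?M = "lim (\<lambda>n. S.W \<omega> (real (Suc n)))"
    show "\<exists>M. ((\<lambda>t. exp (- lam1 * t) * Xf \<omega> t \<phi>) \<longlongrightarrow> M) at_top \<and>
              (\<forall>f. f \<in> borel_measurable borel \<and> bounded (range f) \<and> compact (closure {x. f x \<noteq> 0})
                    \<and> emeasure m {x. \<not> isCont f x} = 0 \<longrightarrow>
                 ((\<lambda>t. exp (- lam1 * t) * Xf \<omega> t f) \<longlongrightarrow> M * (\<integral>x. \<phi>h x * f x \<partial>m)) at_top)"
    proof (intro exI[of _ ?M] conjI allI impI S.good_limit[OF \<omega> refl])
      fix f :: "'a \<Rightarrow> real"
      assume f: "f \<in> borel_measurable borel \<and> bounded (range f) \<and> compact (closure {x. f x \<noteq> 0})
                    \<and> emeasure m {x. \<not> isCont f x} = 0"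
      then obtain b where b: "\<And>x. \<bar>f x\<bar> \<le> b" by (auto simp: bounded_iff)
      let ?K = "closure {x. f x \<noteq> 0}"
      \<comment> \<open>On the compact support the continuous positive \<phi> has a positive
        minimum, so a bounded \<open>f\<close> is dominated by a multiple of \<phi>.\<close>
      have "\<exists>B. \<forall>x. \<bar>f x\<bar> \<le> B * \<phi> x"
      proof (cases "?K = {}")
        case True then show ?thesis by (intro exI[of _ 0]) auto
      next
        case False
        then obtain x0 where x0: "\<And>x. x \<in> ?K \<Longrightarrow> \<phi> x0 \<le> \<phi> x"
          using continuous_attains_inf[of ?K \<phi>] f continuous_on_subset[OF \<phi>_cont] by blast
        have "\<bar>f x\<bar> \<le> b / \<phi> x0 * \<phi> x" for x
        proof (cases "f x = 0")
          case True
          then show ?thesis using b[of x] S.\<phi>_nonneg[of x] S.\<phi>_nonneg[of x0] by simp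
        next
          case False
          then have "x \<in> {x. f x \<noteq> 0}" by simp
          then have "\<phi> x0 \<le> \<phi> x" by (rule x0[OF subsetD[OF closure_subset]])
          then have "b * \<phi> x0 \<le> b * \<phi> x" using order_trans[OF abs_ge_zero b] by (rule mult_left_mono)
          then have "b \<le> b / \<phi> x0 * \<phi> x" using S.\<phi>_pos[of x0] by (simp add: field_simps)
          then show ?thesis using b[of x] by linarith
        qed
        then show ?thesis by blast
      qed
      then obtain B where B: "\<And>x. \<bar>f x\<bar> \<le> B * \<phi> x" by blast
      show "((\<lambda>t. exp (- lam1 * t) * Xf \<omega> t f) \<longlongrightarrow> ?M * (\<integral>x. \<phi>h x * f x \<partial>m)) at_top"
        by (rule S.good_converges[OF \<omega> refl _ B]) (use f in auto)
    qed
  qed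
qed

end
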